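(* Suppose $H$ is a finitely generated group and $\phi:H\to H$ is a monomorphism such that $\phi(H)$ has finite index in $H$. Then the ascending HNN extension $H\ast_{\phi}$ is semistable at $\infty$.
   Context: For a group $H$ and monomorphism $\phi:H\to H$, the ascending HNN extension $H\ast_\phi$ is the group with presentation $\langle t,H : t^{-1}ht=\phi(h)\text{ for all }h\in H\rangle$. A ray in a space is a proper map from $[0,\infty)$ (proper: preimages of compact sets are compact). Two rays $r,s$ in a locally finite connected CW-complex $K$ converge to the same end if for each compact $C\subset K$ there is $N$ such that $r([N,\infty))$ and $s([N,\infty))$ lie in the same path component of $K-C$. $K$ is semistable at $\infty$ if any two rays in $K$ converging to the same end are properly homotopic. For a finitely generated group $G$ with finite generating set $S$, $\Gamma(G,S)$ is the Cayley graph (edges labeled $s$ from $g$ to $gs$), and for a finite set $P$ of $S$-relations of $G$ (words in $S^{\pm1}$ representing $1$), $\Gamma_{(G,S)}(P)$ is the 2-complex obtained from $\Gamma(G,S)$ by attaching, at each vertex $v$ and for each relation in $P$, a 2-cell along the edge path loop at $v$ labeled by that relation. $G$ is semistable at $\infty$ if for some finite generating set $S$ and some finite set $P$ of $S$-relations, $\Gamma_{(G,S)}(P)$ is semistable at $\infty$. *)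

theory Defs
  imports "HOL-Analysis.Analysis" "HOL-Algebra.Generated_Groups"
begin

section \<open>Words and group presentations\<close>

text \<open>The letter \<open>(x, True)\<close> stands for \<open>x\<close>, and \<open>(x, False)\<close> for the formal inverse of \<open>x\<close>.\<close>

type_synonym 'x word = "('x \<times> bool) list"

definition words :: "'x set \<Rightarrow> 'x word set"
  where "words X = lists (X \<times> UNIV)"

text \<open>The defining relations of a presentation are given as equations \<open>u = v\<close>, that is,
  as a set \<open>R\<close> of pairs of words.\<close>

inductive pres_eq :: "'x set \<Rightarrow> ('x word \<times> 'x word) set \<Rightarrow> 'x word \<Rightarrow> 'x word \<Rightarrow> bool"
  for X :: "'x set" and R :: "('x word \<times> 'x word) set"
  where
    pres_refl: "u \<in> words X \<Longrightarrow> pres_eq X R u u"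
  | pres_sym: "pres_eq X R u v \<Longrightarrow> pres_eq X R v u"
  | pres_trans: "pres_eq X R u v \<Longrightarrow> pres_eq X R v w \<Longrightarrow> pres_eq X R u w"
  | pres_context: "pres_eq X R u v \<Longrightarrow> p \<in> words X \<Longrightarrow> q \<in> words X \<Longrightarrow>
      pres_eq X R (p @ u @ q) (p @ v @ q)"
  | pres_cancel: "x \<in> X \<Longrightarrow> pres_eq X R [(x, b), (x, \<not> b)] []"
  | pres_relation: "(u, v) \<in> R \<Longrightarrow> u \<in> words X \<Longrightarrow> v \<in> words X \<Longrightarrow> pres_eq X R u v"

definition pres_rel :: "'x set \<Rightarrow> ('x word \<times> 'x word) set \<Rightarrow> ('x word \<times> 'x word) set"
  where "pres_rel X R = {(u, v). pres_eq X R u v}"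

definition presented_group :: "'x set \<Rightarrow> ('x word \<times> 'x word) set \<Rightarrow> 'x word set monoid"
  where "presented_group X R =
    \<lparr>carrier = words X // pres_rel X R,
     monoid.mult = (\<lambda>A B. \<Union>u\<in>A. \<Union>v\<in>B. pres_rel X R `` {u @ v}),
     one = pres_rel X R `` {[]}\<rparr>"

lemma words_simps [simp]:
  "[] \<in> words X"
  "l # u \<in> words X \<longleftrightarrow> fst l \<in> X \<and> u \<in> words X"
  "u @ v \<in> words X \<longleftrightarrow> u \<in> words X \<and> v \<in> words X"
  by (auto simp: words_def mem_Times_iff)

lemma pres_eq_words: "pres_eq X R u v \<Longrightarrow> u \<in> words X \<and> v \<in> words X"
  by (induction rule: pres_eq.induct) auto

lemma pres_eq_append:
  assumes "pres_eq X R u u'" "pres_eq X R v v'"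
  shows "pres_eq X R (u @ v) (u' @ v')"
proof (rule pres_trans)
  show "pres_eq X R (u @ v) (u' @ v)"
    using pres_context[OF assms(1), of "[]" v] pres_eq_words[OF assms(2)] by simp
  show "pres_eq X R (u' @ v) (u' @ v')"
    using pres_context[OF assms(2), of u' "[]"] pres_eq_words[OF assms(1)] by simp
qed

lemma equiv_pres_rel: "equiv (words X) (pres_rel X R)"
proof (rule equivI)
  show "pres_rel X R \<subseteq> words X \<times> words X"
    using pres_eq_words by (fastforce simp: pres_rel_def)
  show "refl_on (words X) (pres_rel X R)"
    by (simp add: refl_on_def pres_rel_def pres_refl)
  show "sym (pres_rel X R)"
    unfolding sym_def pres_rel_def using pres_sym by fast
  show "trans (pres_rel X R)"
    unfolding trans_def pres_rel_def using pres_trans by fast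
qed

lemma presented_group_carrier_iff:
  "A \<in> carrier (presented_group X R) \<longleftrightarrow> (\<exists>u\<in>words X. A = pres_rel X R `` {u})"
  by (auto simp: presented_group_def quotient_def)

lemma presented_group_one: "\<one>\<^bsub>presented_group X R\<^esub> = pres_rel X R `` {[]}"
  by (simp add: presented_group_def)

lemma pres_class_eq_iff:
  "u \<in> words X \<Longrightarrow> v \<in> words X \<Longrightarrow>
    pres_rel X R `` {u} = pres_rel X R `` {v} \<longleftrightarrow> pres_eq X R u v"
  using eq_equiv_class_iff[OF equiv_pres_rel, of u X v R] by (simp add: pres_rel_def)

lemma presented_group_mult:
  assumes "u \<in> words X" "v \<in> words X"
  shows "pres_rel X R `` {u} \<otimes>\<^bsub>presented_group X R\<^esub> pres_rel X R `` {v} = pres_rel X R `` {u @ v}"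
proof -
  have "pres_rel X R `` {u' @ v'} = pres_rel X R `` {u @ v}"
    if "pres_eq X R u u'" "pres_eq X R v v'" for u' v'
    using pres_eq_append[OF that] pres_eq_words[OF that(1)] pres_eq_words[OF that(2)]
    by (subst pres_class_eq_iff) (simp_all add: pres_sym)
  then have "pres_rel X R `` {u' @ v'} = pres_rel X R `` {u @ v}"
    if "u' \<in> pres_rel X R `` {u}" "v' \<in> pres_rel X R `` {v}" for u' v'
    using that by (simp add: pres_rel_def)
  moreover have "u \<in> pres_rel X R `` {u}" "v \<in> pres_rel X R `` {v}"
    using assms by (simp_all add: pres_rel_def pres_refl)
  ultimately show ?thesis
    unfolding presented_group_def monoid.simps by blast
qed

lemma pres_eq_inverse:
  "u \<in> words X \<Longrightarrow> pres_eq X R (rev (map (\<lambda>(x, b). (x, \<not> b)) u) @ u) [] \<and>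
    rev (map (\<lambda>(x, b). (x, \<not> b)) u) \<in> words X"
proof (induction u)
  case Nil
  then show ?case by (auto intro: pres_refl)
next
  case (Cons l u)
  obtain x b where l: "l = (x, b)" by (cases l)
  let ?i = "rev (map (\<lambda>(x, b). (x, \<not> b)) u)"
  from Cons l have x: "x \<in> X" and u: "u \<in> words X" by auto
  with Cons have "pres_eq X R (?i @ u) []" and i: "?i \<in> words X" by auto
  moreover have "pres_eq X R (?i @ [(x, \<not> b), (x, b)] @ u) (?i @ [] @ u)"
    using pres_context[OF pres_cancel[OF x, of R "\<not> b"] i u] by simp
  ultimately show ?case using l x i pres_trans by auto
qed

lemma group_presented_group: "group (presented_group X R)"
proof (rule groupI)
  let ?G = "presented_group X R" and ?c = "\<lambda>u. pres_rel X R `` {u}"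
  have carrier: "carrier ?G = ?c ` words X"
    using presented_group_carrier_iff by blast
  note simps = carrier presented_group_one presented_group_mult
  show "\<one>\<^bsub>?G\<^esub> \<in> carrier ?G"
    by (simp add: simps)
  show "A \<otimes>\<^bsub>?G\<^esub> B \<in> carrier ?G" if "A \<in> carrier ?G" "B \<in> carrier ?G" for A B
    using that by (auto simp: simps)
  show "A \<otimes>\<^bsub>?G\<^esub> B \<otimes>\<^bsub>?G\<^esub> C = A \<otimes>\<^bsub>?G\<^esub> (B \<otimes>\<^bsub>?G\<^esub> C)"
    if "A \<in> carrier ?G" "B \<in> carrier ?G" "C \<in> carrier ?G" for A B C
    using that by (auto simp: simps)
  show "\<one>\<^bsub>?G\<^esub> \<otimes>\<^bsub>?G\<^esub> A = A" if "A \<in> carrier ?G" for A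
    using that by (auto simp: simps)
  show "\<exists>B\<in>carrier ?G. B \<otimes>\<^bsub>?G\<^esub> A = \<one>\<^bsub>?G\<^esub>" if "A \<in> carrier ?G" for A
  proof -
    from that obtain u where u: "u \<in> words X" "A = ?c u"
      by (auto simp: carrier)
    let ?i = "rev (map (\<lambda>(x, b). (x, \<not> b)) u)"
    have i: "pres_eq X R (?i @ u) []" "?i \<in> words X"
      using pres_eq_inverse[OF u(1)] by auto
    have "?c ?i \<otimes>\<^bsub>?G\<^esub> A = ?c (?i @ u)"
      unfolding u(2) by (rule presented_group_mult[OF i(2) u(1)])
    also have "\<dots> = \<one>\<^bsub>?G\<^esub>"
      using i u(1) by (simp add: presented_group_one pres_class_eq_iff)
    finally show ?thesis
      using i(2) unfolding carrier by blast
  qed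
qed


section \<open>Ascending HNN extensions\<close>

datatype 'a hnn_gen = Stable | Base 'a

text \<open>The group \<open>H\<close> enters the presentation through its multiplication table.
  The second family of relations is \<open>t\<^sup>-\<^sup>1 h t = \<phi>(h)\<close>.\<close>

definition hnn_relations ::
    "('a, 'b) monoid_scheme \<Rightarrow> ('a \<Rightarrow> 'a) \<Rightarrow> ('a hnn_gen word \<times> 'a hnn_gen word) set"
  where "hnn_relations H \<phi> =
    {([(Base h, True), (Base k, True)], [(Base (h \<otimes>\<^bsub>H\<^esub> k), True)]) | h k.
        h \<in> carrier H \<and> k \<in> carrier H} \<union>
    {([(Stable, False), (Base h, True), (Stable, True)], [(Base (\<phi> h), True)]) | h.
        h \<in> carrier H}"

definition ascending_HNN ::
    "('a, 'b) monoid_scheme \<Rightarrow> ('a \<Rightarrow> 'a) \<Rightarrow> 'a hnn_gen word set monoid"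
  where "ascending_HNN H \<phi> =
    presented_group (insert Stable (Base ` carrier H)) (hnn_relations H \<phi>)"


lemma group_ascending_HNN: "group (ascending_HNN H \<phi>)"
  by (simp add: ascending_HNN_def group_presented_group)


section \<open>Semistability at infinity of a space\<close>

text \<open>The library's \<^const>\<open>proper_map\<close> asks for closed maps with compact fibres;
  here a proper map is a continuous map under which preimages of compact sets are compact.\<close>

definition proper_continuous_map :: "'a topology \<Rightarrow> 'b topology \<Rightarrow> ('a \<Rightarrow> 'b) \<Rightarrow> bool"
  where "proper_continuous_map X Y f \<longleftrightarrow> continuous_map X Y f \<and>
    (\<forall>C. compactin Y C \<longrightarrow> compactin X {x \<in> topspace X. f x \<in> C})"

definition is_ray :: "'a topology \<Rightarrow> (real \<Rightarrow> 'a) \<Rightarrow> bool"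
  where "is_ray K r \<longleftrightarrow> proper_continuous_map (top_of_set {0..}) K r"

definition converge_to_same_end :: "'a topology \<Rightarrow> (real \<Rightarrow> 'a) \<Rightarrow> (real \<Rightarrow> 'a) \<Rightarrow> bool"
  where "converge_to_same_end K r s \<longleftrightarrow>
    (\<forall>C. compactin K C \<longrightarrow>
      (\<exists>N\<ge>0. \<exists>Q \<in> path_components_of (subtopology K (topspace K - C)).
        r ` {N..} \<subseteq> Q \<and> s ` {N..} \<subseteq> Q))"

definition properly_homotopic :: "'a topology \<Rightarrow> (real \<Rightarrow> 'a) \<Rightarrow> (real \<Rightarrow> 'a) \<Rightarrow> bool"
  where "properly_homotopic K r s \<longleftrightarrow>
    (\<exists>F. proper_continuous_map
          (prod_topology (top_of_set {0..}) (top_of_set {0..1::real})) K F \<and>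
        (\<forall>x\<ge>0. F (x, 0) = r x) \<and> (\<forall>x\<ge>0. F (x, 1) = s x))"

definition semistable_space :: "'a topology \<Rightarrow> bool"
  where "semistable_space K \<longleftrightarrow>
    (\<forall>r s. is_ray K r \<and> is_ray K s \<and> converge_to_same_end K r s \<longrightarrow> properly_homotopic K r s)"


section \<open>Cayley 2-complexes\<close>

definition letter_val :: "('a, 'b) monoid_scheme \<Rightarrow> 'a \<times> bool \<Rightarrow> 'a"
  where "letter_val G l = (if snd l then fst l else inv\<^bsub>G\<^esub> (fst l))"

fun word_val :: "('a, 'b) monoid_scheme \<Rightarrow> 'a word \<Rightarrow> 'a"
  where
    "word_val G [] = \<one>\<^bsub>G\<^esub>"
  | "word_val G (l # w) = letter_val G l \<otimes>\<^bsub>G\<^esub> word_val G w"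

text \<open>The points of the complex, sorted by the open cell that contains them:
  \<open>EdgePoint g s u\<close> with \<open>0 < u < 1\<close> lies on the edge labelled \<open>s\<close> from \<open>g\<close> to \<open>g s\<close>, and
  \<open>CellPoint g w z\<close> with \<open>|z| < 1\<close> lies in the 2-cell attached at \<open>g\<close> along the relation \<open>w\<close>.\<close>

datatype 'a cayley_point = Vertex 'a | EdgePoint 'a 'a real | CellPoint 'a "'a word" complex

definition edge_map :: "('a, 'b) monoid_scheme \<Rightarrow> 'a \<Rightarrow> 'a \<Rightarrow> real \<Rightarrow> 'a cayley_point"
  where "edge_map G g s u =
    (if u \<le> 0 then Vertex g else if u \<ge> 1 then Vertex (g \<otimes>\<^bsub>G\<^esub> s) else EdgePoint g s u)"

text \<open>The edge path that starts at \<open>g\<close> and is labelled by a word, parametrised by \<open>[0, n]\<close>,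
  where \<open>n\<close> is the length of the word.\<close>

fun edge_path :: "('a, 'b) monoid_scheme \<Rightarrow> 'a \<Rightarrow> 'a word \<Rightarrow> real \<Rightarrow> 'a cayley_point"
  where
    "edge_path G g [] u = Vertex g"
  | "edge_path G g ((s, b) # w) u =
      (if u \<le> 1
       then if b then edge_map G g s u else edge_map G (g \<otimes>\<^bsub>G\<^esub> inv\<^bsub>G\<^esub> s) s (1 - u)
       else edge_path G (g \<otimes>\<^bsub>G\<^esub> letter_val G (s, b)) w (u - 1))"

text \<open>The characteristic map of a 2-cell, defined on the closed unit disc.\<close>

definition cell_map :: "('a, 'b) monoid_scheme \<Rightarrow> 'a \<Rightarrow> 'a word \<Rightarrow> complex \<Rightarrow> 'a cayley_point"
  where "cell_map G g w z =
    (if norm z < 1 then CellPoint g w z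
     else edge_path G g w (real (length w) * (Arg2pi z / (2 * pi))))"

definition cayley_points ::
    "('a, 'b) monoid_scheme \<Rightarrow> 'a set \<Rightarrow> 'a word set \<Rightarrow> 'a cayley_point set"
  where "cayley_points G S P = Vertex ` carrier G \<union>
    {EdgePoint g s u | g s u. g \<in> carrier G \<and> s \<in> S \<and> 0 < u \<and> u < 1} \<union>
    {CellPoint g w z | g w z. g \<in> carrier G \<and> w \<in> P \<and> norm z < 1}"

text \<open>The quotient topology of the disjoint union of all vertices, closed edges and closed
  discs: a set is open if its preimages under all characteristic maps are open.\<close>

definition cayley_open ::
    "('a, 'b) monoid_scheme \<Rightarrow> 'a set \<Rightarrow> 'a word set \<Rightarrow> 'a cayley_point set \<Rightarrow> bool"
  where "cayley_open G S P U \<longleftrightarrow> U \<subseteq> cayley_points G S P \<and>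
    (\<forall>g \<in> carrier G. \<forall>s \<in> S.
      openin (top_of_set {0..1}) {u \<in> {0..1}. edge_map G g s u \<in> U}) \<and>
    (\<forall>g \<in> carrier G. \<forall>w \<in> P.
      openin (top_of_set (cball 0 1)) {z \<in> cball 0 1. cell_map G g w z \<in> U})"

definition cayley_complex ::
    "('a, 'b) monoid_scheme \<Rightarrow> 'a set \<Rightarrow> 'a word set \<Rightarrow> 'a cayley_point topology"
  where "cayley_complex G S P = topology (cayley_open G S P)"

lemma openin_preimage_Int:
  assumes "openin T {x \<in> A. f x \<in> U}" "openin T {x \<in> A. f x \<in> V}"
  shows "openin T {x \<in> A. f x \<in> U \<inter> V}"
proof -
  have "{x \<in> A. f x \<in> U \<inter> V} = {x \<in> A. f x \<in> U} \<inter> {x \<in> A. f x \<in> V}" by blast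
  then show ?thesis using openin_Int[OF assms] by argo
qed

lemma openin_preimage_Union:
  assumes "\<And>U. U \<in> \<U> \<Longrightarrow> openin T {x \<in> A. f x \<in> U}"
  shows "openin T {x \<in> A. f x \<in> \<Union>\<U>}"
proof -
  have "{x \<in> A. f x \<in> \<Union>\<U>} = \<Union>((\<lambda>U. {x \<in> A. f x \<in> U}) ` \<U>)" by blast
  moreover have "openin T (\<Union>((\<lambda>U. {x \<in> A. f x \<in> U}) ` \<U>))"
    by (rule openin_Union) (use assms in blast)
  ultimately show ?thesis by argo
qed

lemma istopology_cayley_open: "istopology (cayley_open G S P)"
  unfolding istopology_def
proof (intro conjI allI impI)
  fix U V assume "cayley_open G S P U" "cayley_open G S P V"
  then show "cayley_open G S P (U \<inter> V)"
    unfolding cayley_open_def by (intro conjI ballI openin_preimage_Int) blast+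
next
  fix \<U> assume "\<forall>U\<in>\<U>. cayley_open G S P U"
  then show "cayley_open G S P (\<Union>\<U>)"
    unfolding cayley_open_def by (intro conjI ballI openin_preimage_Union) blast+
qed

lemma openin_cayley_complex: "openin (cayley_complex G S P) = cayley_open G S P"
  by (simp add: cayley_complex_def istopology_cayley_open topology_inverse')

lemma edge_map_in_points:
  assumes "group G" "g \<in> carrier G" "s \<in> S" "S \<subseteq> carrier G"
  shows "edge_map G g s u \<in> cayley_points G S P"
proof -
  interpret group G by fact
  show ?thesis using assms by (auto simp: edge_map_def cayley_points_def)
qed

lemma edge_path_in_points:
  assumes "group G" "S \<subseteq> carrier G" "g \<in> carrier G" "w \<in> words S"
  shows "edge_path G g w u \<in> cayley_points G S P"
  using assms(3,4)
proof (induction w arbitrary: g u)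
  case Nil
  then show ?case by (auto simp: cayley_points_def)
next
  case (Cons l w)
  interpret group G by fact
  obtain s b where l: "l = (s, b)" by (cases l)
  have "s \<in> S" "s \<in> carrier G" using Cons.prems l assms(2) by auto
  then show ?case using Cons l assms
    by (auto simp: letter_val_def intro!: edge_map_in_points)
qed

lemma topspace_cayley_complex:
  assumes "group G" "S \<subseteq> carrier G" "P \<subseteq> words S"
  shows "topspace (cayley_complex G S P) = cayley_points G S P"
proof -
  have cell: "cell_map G g w z \<in> cayley_points G S P" if "g \<in> carrier G" "w \<in> P" for g w z
  proof (cases "norm z < 1")
    case True
    then show ?thesis using that by (auto simp: cell_map_def cayley_points_def)
  next
    case False
    have "w \<in> words S" using that assms(3) by blast
    with False show ?thesis
      unfolding cell_map_def by (simp add: edge_path_in_points assms(1,2) that(1))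
  qed
  have full: "openin (top_of_set A) {x \<in> A. f x \<in> B}" if "\<And>x. x \<in> A \<Longrightarrow> f x \<in> B" for A B f
  proof -
    have "{x \<in> A. f x \<in> B} = A" using that by blast
    then show ?thesis by simp
  qed
  have "cayley_open G S P (cayley_points G S P)"
    unfolding cayley_open_def
    by (intro conjI ballI full subset_refl cell edge_map_in_points assms)
  then show ?thesis
    unfolding topspace_def openin_cayley_complex by (auto simp: cayley_open_def)
qed


section \<open>Groups that are semistable at infinity\<close>

definition generates :: "('a, 'b) monoid_scheme \<Rightarrow> 'a set \<Rightarrow> bool"
  where "generates G S \<longleftrightarrow> S \<subseteq> carrier G \<and> generate G S = carrier G"

definition finitely_generated :: "('a, 'b) monoid_scheme \<Rightarrow> bool"
  where "finitely_generated G \<longleftrightarrow> (\<exists>S. finite S \<and> generates G S)"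

definition semistable_group :: "('a, 'b) monoid_scheme \<Rightarrow> bool"
  where "semistable_group G \<longleftrightarrow>
    (\<exists>S P. finite S \<and> generates G S \<and>
      finite P \<and> P \<subseteq> {w \<in> words S. word_val G w = \<one>\<^bsub>G\<^esub>} \<and>
      semistable_space (cayley_complex G S P))"

end

theory Submission
  imports Defs
begin

text \<open>
Let \<open>G\<close> be the extension, \<open>H\<close> the image of the base group, \<open>t\<close> the stable letter and \<open>lev\<close> the exponent sum of
\<open>t\<close>, which is additive on \<open>G\<close>. The generators are \<open>t\<close> and finitely many nontrivial elements that generate \<open>H\<close>.

The relations say how \<open>tau = t\<close> or \<open>tau = t\<^sup>-\<^sup>1\<close> moves past a letter of \<open>H\<close>. For either choice finitely many corrections
\<open>c \<in> H\<close> suffice to move every \<open>h \<in> H\<close> to some \<open>h c\<^sup>-\<^sup>1\<close> that \<open>tau\<close> conjugates into \<open>H\<close>: none in the direction of \<open>\<phi>\<close>,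
and a transversal of \<open>\<phi>(H)\<close> in the other one. Reading a word over \<open>H\<close> with the current correction as a state, one relation
for each letter, writes a word over \<open>H\<close> one level away. So finitely many relations fill, at bounded distance, the strip between
an edge ray of \<open>H\<close>-letters and an edge ray one level up or down (\<open>push_ladder\<close>).

\<^emph>\<open>Infinite H.\<close> Every vertex \<open>v\<close> lies on a geodesic line inside \<open>v H\<close>, and one of its two halves stays out of any ball
from which \<open>v\<close> is far (\<open>avoiding_rays\<close>). Attach this half \<open>\<gamma> v\<close> to \<open>v\<close>. Any two rays of \<open>H\<close>-letters at the same vertex \<open>g\<close>
are properly homotopic: pushing either of them again and again, away from level \<open>0\<close>, fills a quadrant between it and
the line of powers of \<open>t\<close> at \<open>g\<close> (\<open>far_ladder\<close>). The filling is proper because only the first \<open>n\<close> pushes can reach a vertex of level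
\<open>\<plusminus>n\<close>. So the rays \<open>\<gamma> v\<close> and \<open>\<gamma> (v l)\<close> at adjacent vertices span a ladder that meets a given vertex only if \<open>v\<close> or
\<open>v l\<close> is in a finite set. An arbitrary ray \<open>r\<close> follows an edge path; the ladders over the edges of this path form a grid in a
quadrant, which is a proper homotopy from \<open>r\<close> to the column over a fixed vertex (\<open>ray_homotopic_column\<close>).
Hence all rays are properly homotopic.

\<^emph>\<open>Finite H.\<close> Then \<open>t\<close> normalises \<open>H\<close> and the level has finite fibres, so the sign of the level separates two ends. For the
rays that converge to one of them the columns are the lines \<open>v t\<^sup>k\<close> or \<open>v t\<^sup>-\<^sup>k\<close>, and the same sweep applies inside a set of
vertices whose level is bounded on one side.

The topological input is that the complex is Hausdorff, that compact sets meet only cells over finitely many vertices, and that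
paths are homotopic to edge paths through the vertices of the cells they meet. The latter rests on contractions of vertex stars and open cells that keep
every point in its closed cell.
\<close>

section \<open>Homotopies of paths\<close>

lemma continuous_map_compose_on:
  assumes "continuous_map (top_of_set T) X f" "continuous_on S g" "\<And>x. x \<in> S \<Longrightarrow> g x \<in> T"
  shows "continuous_map (top_of_set S) X (\<lambda>x. f (g x))"
proof -
  have "continuous_map (top_of_set S) (top_of_set T) g"
    using assms(2,3) by (auto simp: continuous_map_in_subtopology)
  from continuous_map_compose[OF this assms(1)] show ?thesis by (simp add: o_def)
qed

lemma continuous_map_cases_closed:
  assumes A: "closed A" and B: "closed B" and S: "S \<subseteq> A \<union> B"
    and f: "continuous_map (top_of_set (S \<inter> A)) X f"
    and g: "continuous_map (top_of_set (S \<inter> B)) X g"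
    and eq: "\<And>x. x \<in> S \<Longrightarrow> x \<in> A \<Longrightarrow> x \<in> B \<Longrightarrow> f x = g x"
    and h: "\<And>x. x \<in> S \<Longrightarrow> x \<in> A \<Longrightarrow> h x = f x" "\<And>x. x \<in> S \<Longrightarrow> x \<in> B \<Longrightarrow> h x = g x"
  shows "continuous_map (top_of_set S) X h"
proof -
  let ?T = "\<lambda>i. if i then S \<inter> A else S \<inter> B"
  show ?thesis
  proof (rule pasting_lemma_closed[of "UNIV :: bool set" _ ?T X "\<lambda>i. if i then f else g"])
    show "closedin (top_of_set S) (?T i)" for i
      using A B by (auto simp: closedin_closed)
    show "continuous_map (subtopology (top_of_set S) (?T i)) X (if i then f else g)" for i
    proof -
      have "S \<inter> ?T i = ?T i" by auto
      then have "subtopology (top_of_set S) (?T i) = top_of_set (?T i)" 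
        by (simp only: subtopology_subtopology)
      then show ?thesis using f g by auto
    qed
    show "\<exists>j. j \<in> UNIV \<and> x \<in> ?T j \<and> h x = (if j then f else g) x" if "x \<in> topspace (top_of_set S)" for x
    proof (cases "x \<in> A")
      case True then show ?thesis using that h by (intro exI[of _ True]) auto
    next
      case False then show ?thesis using that h S by (intro exI[of _ False]) auto
    qed
  qed (use eq in auto)
qed

abbreviation unit_square :: "(real \<times> real) set" where
  "unit_square \<equiv> {0..1} \<times> {0..1}"

text \<open>The first coordinate of the square is the time of the homotopy, the second the parameter of the paths.\<close>

definition path_homotopic :: "'a topology \<Rightarrow> (real \<Rightarrow> 'a) \<Rightarrow> (real \<Rightarrow> 'a) \<Rightarrow> bool" where
  "path_homotopic X p q \<longleftrightarrow>
    (\<exists>h. continuous_map (top_of_set unit_square) X h \<and>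
      (\<forall>x\<in>{0..1}. h (0, x) = p x \<and> h (1, x) = q x) \<and>
      (\<forall>t\<in>{0..1}. h (t, 0) = p 0 \<and> h (t, 1) = p 1))"

definition path_join :: "(real \<Rightarrow> 'a) \<Rightarrow> (real \<Rightarrow> 'a) \<Rightarrow> real \<Rightarrow> 'a" where
  "path_join p q x = (if x \<le> 1/2 then p (2 * x) else q (2 * x - 1))"

lemma path_join_second_half:
  assumes "1/2 \<le> y" "p 1 = q 0" shows "path_join p q y = q (2 * y - 1)"
proof (cases "y = 1/2")
  case True
  show ?thesis unfolding True path_join_def using assms(2) by simp
qed (use assms in \<open>auto simp: path_join_def\<close>)

definition path_reverse :: "(real \<Rightarrow> 'a) \<Rightarrow> real \<Rightarrow> 'a" where
  "path_reverse p x = p (1 - x)"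

lemma path_join_ends [simp]: "path_join p q 0 = p 0" "path_join p q 1 = q 1"
  and path_reverse_ends [simp]: "path_reverse p 0 = p 1" "path_reverse p 1 = p 0"
  by (auto simp: path_join_def path_reverse_def)

lemma path_homotopic_ends:
  assumes "path_homotopic X p q" shows "p 0 = q 0" "p 1 = q 1"
  using assms unfolding path_homotopic_def by (metis atLeastAtMost_iff order_refl zero_le_one)+

lemma path_homotopic_pathin:
  assumes "path_homotopic X p q" shows "pathin X p" "pathin X q"
proof -
  obtain h where h: "continuous_map (top_of_set unit_square) X h"
    "\<forall>x\<in>{0..1}. h (0, x) = p x \<and> h (1, x) = q x"
    using assms unfolding path_homotopic_def by blast
  have "continuous_map (top_of_set {0..1}) X (\<lambda>x. h (c, x))" if "c \<in> {0..1}" for c :: real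
    by (rule continuous_map_compose_on[OF h(1)]) (use that in \<open>auto intro!: continuous_intros\<close>)
  note * = this
  show "pathin X p"
    unfolding pathin_def by (rule continuous_map_eq[OF *[of 0]]) (use h(2) in auto)
  show "pathin X q"
    unfolding pathin_def by (rule continuous_map_eq[OF *[of 1]]) (use h(2) in auto)
qed

lemma path_homotopic_cong:
  assumes "path_homotopic X p q" "\<And>x. 0 \<le> x \<Longrightarrow> x \<le> 1 \<Longrightarrow> p x = p' x" "\<And>x. 0 \<le> x \<Longrightarrow> x \<le> 1 \<Longrightarrow> q x = q' x"
  shows "path_homotopic X p' q'"
  using assms unfolding path_homotopic_def by simp

text \<open>The straight-line homotopy in a convex parameter domain. The laws of the path groupoid follow from it, as both sides
  of each law are one map composed with two reparametrisations.\<close>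

lemma path_homotopic_factor:
  fixes \<alpha> \<beta> :: "real \<Rightarrow> 'b::real_normed_vector"
  assumes D: "convex D" and f: "continuous_map (top_of_set D) X f"
    and \<alpha>: "continuous_on {0..1} \<alpha>" "\<And>x. x \<in> {0..1} \<Longrightarrow> \<alpha> x \<in> D"
    and \<beta>: "continuous_on {0..1} \<beta>" "\<And>x. x \<in> {0..1} \<Longrightarrow> \<beta> x \<in> D"
    and ends: "\<alpha> 0 = \<beta> 0" "\<alpha> 1 = \<beta> 1"
  shows "path_homotopic X (\<lambda>x. f (\<alpha> x)) (\<lambda>x. f (\<beta> x))"
proof -
  let ?h = "\<lambda>z. (1 - fst z) *\<^sub>R \<alpha> (snd z) + fst z *\<^sub>R \<beta> (snd z)"
  have "continuous_map (top_of_set unit_square) X (\<lambda>z. f (?h z))"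
  proof (rule continuous_map_compose_on[OF f])
    show "continuous_on ({0..1} \<times> {0..1}) ?h"
      by (intro continuous_intros continuous_on_compose2[OF \<alpha>(1)] continuous_on_compose2[OF \<beta>(1)]) auto
    show "?h z \<in> D" if "z \<in> unit_square" for z
      using that \<alpha>(2) \<beta>(2) D by (intro convexD) (auto simp: mem_Times_iff)
  qed
  then show ?thesis
    unfolding path_homotopic_def
    by (intro exI[of _ "\<lambda>z. f (?h z)"])
       (use ends in \<open>auto simp: algebra_simps simp flip: scaleR_add_left\<close>)
qed

lemma path_homotopic_refl: "pathin X p \<Longrightarrow> path_homotopic X p p"
  unfolding pathin_def
  by (rule path_homotopic_factor[of "{0..1}" X p "\<lambda>x. x" "\<lambda>x. x"]) (auto intro: continuous_intros)

lemma path_homotopic_sym: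
  assumes "path_homotopic X p q" shows "path_homotopic X q p"
proof -
  obtain h where h: "continuous_map (top_of_set unit_square) X h"
    "\<forall>x\<in>{0..1}. h (0, x) = p x \<and> h (1, x) = q x" "\<forall>t\<in>{0..1}. h (t, 0) = p 0 \<and> h (t, 1) = p 1"
    using assms unfolding path_homotopic_def by blast
  have "continuous_map (top_of_set unit_square) X (\<lambda>z. h (1 - fst z, snd z))"
    by (rule continuous_map_compose_on[OF h(1)]) (auto intro!: continuous_intros)
  then show ?thesis
    unfolding path_homotopic_def using h(2,3) path_homotopic_ends[OF assms]
    by (intro exI[of _ "\<lambda>z. h (1 - fst z, snd z)"]) auto
qed

lemma path_homotopic_trans [trans]:
  assumes pq: "path_homotopic X p q" and qr: "path_homotopic X q r" shows "path_homotopic X p r"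
proof -
  obtain h where h: "continuous_map (top_of_set unit_square) X h"
    "\<forall>x\<in>{0..1}. h (0, x) = p x \<and> h (1, x) = q x" "\<forall>t\<in>{0..1}. h (t, 0) = p 0 \<and> h (t, 1) = p 1"
    using pq unfolding path_homotopic_def by blast
  obtain k where k: "continuous_map (top_of_set unit_square) X k"
    "\<forall>x\<in>{0..1}. k (0, x) = q x \<and> k (1, x) = r x" "\<forall>t\<in>{0..1}. k (t, 0) = q 0 \<and> k (t, 1) = q 1"
    using qr unfolding path_homotopic_def by blast
  let ?m = "\<lambda>z. if fst z \<le> 1/2 then h (2 * fst z, snd z) else k (2 * fst z - 1, snd z)"
  have "continuous_map (top_of_set unit_square) X ?m"
  proof (rule continuous_map_cases_closed[of "{z. fst z \<le> 1/2}" "{z. fst z \<ge> 1/2}" _ X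
        "\<lambda>z. h (2 * fst z, snd z)" "\<lambda>z. k (2 * fst z - 1, snd z)"])
    show "closed {z::real\<times>real. fst z \<le> 1/2}" "closed {z::real\<times>real. fst z \<ge> 1/2}"
      by (intro closed_Collect_le continuous_intros)+
    show "continuous_map (top_of_set ({0..1} \<times> {0..1} \<inter> {z. fst z \<le> 1/2})) X (\<lambda>z. h (2 * fst z, snd z))"
      by (rule continuous_map_compose_on[OF h(1)]) (auto intro!: continuous_intros)
    show "continuous_map (top_of_set ({0..1} \<times> {0..1} \<inter> {z. fst z \<ge> 1/2})) X (\<lambda>z. k (2 * fst z - 1, snd z))"
      by (rule continuous_map_compose_on[OF k(1)]) (auto intro!: continuous_intros)
    have eq: "h (2 * fst z, snd z) = k (2 * fst z - 1, snd z)" if "z \<in> unit_square" "fst z = 1/2" for z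
      unfolding that(2) using that(1) h(2) k(2) by (cases z) auto
    then show "h (2 * fst z, snd z) = k (2 * fst z - 1, snd z)" if "z \<in> unit_square" 
      "z \<in> {z. fst z \<le> 1/2}" "z \<in> {z. fst z \<ge> 1/2}" for z
      using that by auto
    show "?m z = k (2 * fst z - 1, snd z)" if "z \<in> unit_square" "z \<in> {z. fst z \<ge> 1/2}" for z
      using that eq[of z] by auto
  qed auto
  moreover have "?m (0, x) = p x \<and> ?m (1, x) = r x" if "x \<in> {0..1}" for x
    using h(2) k(2) that by simp
  moreover have "?m (t, 0) = p 0 \<and> ?m (t, 1) = p 1" if "t \<in> {0..1}" for t
    using h(3) k(3) that path_homotopic_ends[OF pq] by simp
  ultimately show ?thesis
    unfolding path_homotopic_def by blast
qed

lemma pathin_join: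
  assumes "pathin X p" "pathin X q" "p 1 = q 0" shows "pathin X (path_join p q)"
  unfolding pathin_def
proof (rule continuous_map_cases_closed[of "{..1/2}" "{1/2..}" _ X "\<lambda>x. p (2 * x)" "\<lambda>x. q (2 * x - 1)"])
  show "continuous_map (top_of_set ({0..1} \<inter> {..1/2})) X (\<lambda>x. p (2 * x))"
    by (rule continuous_map_compose_on[OF assms(1)[unfolded pathin_def]]) (auto intro!: continuous_intros)
  show "continuous_map (top_of_set ({0..1} \<inter> {1/2..})) X (\<lambda>x. q (2 * x - 1))"
    by (rule continuous_map_compose_on[OF assms(2)[unfolded pathin_def]]) (auto intro!: continuous_intros)
  have e: "p (2 * x) = q (2 * x - 1)" if "x = 1/2" for x unfolding that using assms(3) by simp
  show "p (2 * x) = q (2 * x - 1)" if "x \<in> {..1/2}" "x \<in> {1/2..}" for x using that by (intro e) auto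
  show "path_join p q x = q (2 * x - 1)" if "x \<in> {1/2..}" for x
    using that e[of x] by (auto simp: path_join_def)
qed (auto simp: path_join_def)

lemma pathin_reverse: "pathin X p \<Longrightarrow> pathin X (path_reverse p)"
  unfolding pathin_def path_reverse_def
  by (erule continuous_map_compose_on) (auto intro!: continuous_intros)

lemma path_homotopic_join:
  assumes p: "path_homotopic X p p'" and q: "path_homotopic X q q'" and j: "p 1 = q 0"
  shows "path_homotopic X (path_join p q) (path_join p' q')"
proof -
  obtain h where h: "continuous_map (top_of_set unit_square) X h"
    "\<forall>x\<in>{0..1}. h (0, x) = p x \<and> h (1, x) = p' x" "\<forall>t\<in>{0..1}. h (t, 0) = p 0 \<and> h (t, 1) = p 1"
    using p unfolding path_homotopic_def by blast
  obtain k where k: "continuous_map (top_of_set unit_square) X k"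
    "\<forall>x\<in>{0..1}. k (0, x) = q x \<and> k (1, x) = q' x" "\<forall>t\<in>{0..1}. k (t, 0) = q 0 \<and> k (t, 1) = q 1"
    using q unfolding path_homotopic_def by blast
  let ?m = "\<lambda>z. if snd z \<le> 1/2 then h (fst z, 2 * snd z) else k (fst z, 2 * snd z - 1)"
  have "continuous_map (top_of_set unit_square) X ?m"
  proof (rule continuous_map_cases_closed[of "{z. snd z \<le> 1/2}" "{z. snd z \<ge> 1/2}" _ X
        "\<lambda>z. h (fst z, 2 * snd z)" "\<lambda>z. k (fst z, 2 * snd z - 1)"])
    show "closed {z::real\<times>real. snd z \<le> 1/2}" "closed {z::real\<times>real. snd z \<ge> 1/2}"
      by (intro closed_Collect_le continuous_intros)+
    show "continuous_map (top_of_set ({0..1} \<times> {0..1} \<inter> {z. snd z \<le> 1/2})) X (\<lambda>z. h (fst z, 2 * snd z))"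
      by (rule continuous_map_compose_on[OF h(1)]) (auto intro!: continuous_intros)
    show "continuous_map (top_of_set ({0..1} \<times> {0..1} \<inter> {z. snd z \<ge> 1/2})) X (\<lambda>z. k (fst z, 2 * snd z - 1))"
      by (rule continuous_map_compose_on[OF k(1)]) (auto intro!: continuous_intros)
    have eq: "h (fst z, 2 * snd z) = k (fst z, 2 * snd z - 1)" if "z \<in> unit_square" "snd z = 1/2" for z
      unfolding that(2) using that(1) h(3) k(3) j by (cases z) auto
    then show "h (fst z, 2 * snd z) = k (fst z, 2 * snd z - 1)" if "z \<in> unit_square" 
      "z \<in> {z. snd z \<le> 1/2}" "z \<in> {z. snd z \<ge> 1/2}" for z
      using that by auto
    show "?m z = k (fst z, 2 * snd z - 1)" if "z \<in> unit_square" "z \<in> {z. snd z \<ge> 1/2}" for z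
      using that eq[of z] by auto
  qed auto
  moreover have "?m (0, x) = path_join p q x \<and> ?m (1, x) = path_join p' q' x" if "x \<in> {0..1}" for x
    using h(2) k(2) that by (simp add: path_join_def)
  moreover have "?m (t, 0) = path_join p q 0 \<and> ?m (t, 1) = path_join p q 1" if "t \<in> {0..1}" for t
    using h(3) k(3) that by simp
  ultimately show ?thesis
    unfolding path_homotopic_def by blast
qed

lemma path_homotopic_assoc:
  assumes "pathin X p" "pathin X q" "pathin X r" "p 1 = q 0" "q 1 = r 0"
  shows "path_homotopic X (path_join (path_join p q) r) (path_join p (path_join q r))"
proof -
  let ?f = "path_join p (path_join q r)"
  let ?g = "\<lambda>x::real. if x \<le> 1/4 then 2 * x else if x \<le> 1/2 then x + 1/4 else (x + 1)/2"
  have "pathin X (path_join q r)" using assms by (intro pathin_join)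
  then have f: "continuous_map (top_of_set {0..1}) X ?f"
    using pathin_join[of X p "path_join q r"] assms by (simp add: pathin_def)
  have g: "?g = (\<lambda>x. min (2 * x) (min (x + 1/4) ((x + 1) / 2)))"
    by (auto simp: fun_eq_iff min_def field_simps)
  have "path_homotopic X (\<lambda>x. ?f (?g x)) (\<lambda>x. ?f x)"
  proof (rule path_homotopic_factor[OF _ f])
    show "continuous_on {0..1} ?g" unfolding g by (intro continuous_intros) auto
  qed auto
  moreover have eq: "?f (?g x) = path_join (path_join p q) r x" for x
  proof -
    consider "x \<le> 1/4" | "1/4 < x" "x \<le> 1/2" | "1/2 < x" by linarith
    then show ?thesis
    proof cases
      case 2
      then have "2 * (x + 1/4) - 1 = 2 * x - 1/2" by simp
      with 2 show ?thesis by (simp add: path_join_def)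
    next
      case 3
      define y where "y = (x + 1) / 2"
      have y: "2 * (2 * y - 1) - 1 = 2 * x - 1" "\<not> y \<le> 1/2" "\<not> 2 * y - 1 \<le> 1/2" "?g x = y"
        using 3 by (auto simp: y_def field_simps)
      have f: "?f y = r (2 * (2 * y - 1) - 1)" using y(2,3) by (simp only: path_join_def if_False)
      have "path_join (path_join p q) r x = r (2 * x - 1)" using 3 by (simp add: path_join_def)
      then show ?thesis by (simp only: y(1,4) f)
    qed (simp add: path_join_def)
  qed
  ultimately show ?thesis by (simp only: eq)
qed

lemma path_homotopic_const_left:
  assumes "pathin X p" shows "path_homotopic X (path_join (\<lambda>_. p 0) p) p"
proof -
  have "path_homotopic X (\<lambda>x. p (max 0 (2 * x - 1))) (\<lambda>x. p x)"
    by (rule path_homotopic_factor[OF _ assms[unfolded pathin_def]]) (auto intro!: continuous_intros)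
  then show ?thesis
    by (rule path_homotopic_cong) (auto simp: path_join_def max_def intro!: arg_cong[of _ _ p])
qed

lemma path_homotopic_const_right:
  assumes "pathin X p" shows "path_homotopic X (path_join p (\<lambda>_. p 1)) p"
proof -
  have "path_homotopic X (\<lambda>x. p (min 1 (2 * x))) (\<lambda>x. p x)"
    by (rule path_homotopic_factor[OF _ assms[unfolded pathin_def]]) (auto intro!: continuous_intros)
  then show ?thesis
    by (rule path_homotopic_cong) (auto simp: path_join_def min_def intro!: arg_cong[of _ _ p])
qed

lemma path_homotopic_reverse_left:
  assumes "pathin X p" shows "path_homotopic X (path_join (path_reverse p) p) (\<lambda>_. p 1)"
proof -
  have "path_homotopic X (\<lambda>x. p (\<bar>2 * x - 1\<bar>)) (\<lambda>x. p 1)"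
    by (rule path_homotopic_factor[OF _ assms[unfolded pathin_def]]) (auto intro!: continuous_intros)
  then show ?thesis
    by (rule path_homotopic_cong) (auto simp: path_join_def path_reverse_def field_simps)
qed

lemma path_homotopic_subtopology_mono:
  assumes "path_homotopic (subtopology X A) p q" "A \<subseteq> B"
  shows "path_homotopic (subtopology X B) p q"
proof -
  have "continuous_map (top_of_set unit_square) (subtopology X A) h \<Longrightarrow>
     continuous_map (top_of_set unit_square) (subtopology X B) h" for h :: "real \<times> real \<Rightarrow> 'a"
    using assms(2) by (auto simp: continuous_map_in_subtopology)
  then show ?thesis using assms(1) unfolding path_homotopic_def by blast
qed

text \<open>A homotopy rel endpoints has its left and right sides collapsed to points; the map below
  blows them up to diagonal corners of the square.\<close>

lemma square_of_path_homotopic: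
  assumes hom: "path_homotopic X (path_join a b') (path_join b a')"
    and ends: "a 1 = b' 0" "b 1 = a' 0"
  obtains f where "continuous_map (top_of_set unit_square) X f"
    "\<And>x. x \<in> {0..1} \<Longrightarrow> f (x, 0) = a x" "\<And>x. x \<in> {0..1} \<Longrightarrow> f (1, x) = b' x"
    "\<And>x. x \<in> {0..1} \<Longrightarrow> f (0, x) = b x" "\<And>x. x \<in> {0..1} \<Longrightarrow> f (x, 1) = a' x"
proof -
  let ?I = "{0..1::real} \<times> {0..1::real}"
  obtain h where h: "continuous_map (top_of_set ?I) X h"
    "\<forall>x\<in>{0..1}. h (0, x) = path_join a b' x \<and> h (1, x) = path_join b a' x" "\<forall>t\<in>{0..1}. h (t, 0) = a 0 \<and> h (t, 1) = b' 1"
    using hom unfolding path_homotopic_def path_join_ends by blast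
  define m where "m s = min s (1 - s)" for s :: real
  define \<Psi> where "\<Psi> z = (snd z + (1 - 2 * fst z) * m (snd z), snd z - (1 - 2 * fst z) * m (snd z))" for z :: "real \<times> real"
  have m: "0 \<le> m s" "m s \<le> s" "m s \<le> 1 - s" if "s \<in> {0..1}" for s using that by (auto simp: m_def)
  have into: "\<Psi> z \<in> ?I" if "z \<in> ?I" for z
  proof -
    from that obtain t s where z: "z = (t, s)" and t: "t \<in> {0..1}" and s: "s \<in> {0..1}" by auto
    have "\<bar>(1 - 2 * t) * m s\<bar> \<le> 1 * m s"
      unfolding abs_mult using t m[OF s] by (intro mult_mono) auto
    then show ?thesis using m[OF s] by (auto simp: z \<Psi>_def)
  qed
  have onto: "\<exists>z\<in>?I. \<Psi> z = w" if "w \<in> ?I" for w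
  proof -
    from that obtain x y where w: "w = (x, y)" and x: "x \<in> {0..1}" and y: "y \<in> {0..1}" by auto
    define s where "s = (x + y) / 2"
    have s: "s \<in> {0..1}" using x y by (auto simp: s_def)
    show ?thesis
    proof (cases "m s = 0")
      case True
      then have "x = s" "y = s" using x y by (auto simp: m_def s_def min_def split: if_splits)
      then have "\<Psi> (0, s) = w" by (simp add: \<Psi>_def True w)
      then show ?thesis using s by (intro bexI[of _ "(0, s)"]) auto
    next
      case False
      then have pos: "m s > 0" using m[OF s] by auto
      define u where "u = (x - s) / m s"
      define t where "t = (1 - u) / 2"
      have "\<bar>x - s\<bar> \<le> m s" using x y by (auto simp: m_def s_def min_def abs_if field_simps)
      then have "u \<le> 1" "-1 \<le> u" using pos by (auto simp: u_def field_simps)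
      then have t: "t \<in> {0..1}" by (auto simp: t_def)
      have "1 - 2 * t = u" by (simp add: t_def field_simps)
      then have "(1 - 2 * t) * m s = x - s" using pos by (simp add: u_def)
      then have "\<Psi> (t, s) = w" by (simp add: \<Psi>_def w s_def)
      then show ?thesis using s t by (intro bexI[of _ "(t, s)"]) auto
    qed
  qed
  have cont: "continuous_on ?I \<Psi>"
    unfolding \<Psi>_def m_def by (intro continuous_intros)
  have comp: "compact_space (top_of_set ?I)"
    by (simp add: compact_space_subtopology compactin_euclidean_iff compact_Times)
  have haus: "Hausdorff_space (top_of_set ?I)"
    by (simp add: Hausdorff_space_subtopology)
  have img: "\<Psi> ` ?I = ?I"
  proof (intro equalityI subsetI)
    show "w \<in> \<Psi> ` ?I" if w: "w \<in> ?I" for w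
      using onto[OF w] by (elim bexE) (rule image_eqI, rule sym)
    show "w \<in> ?I" if "w \<in> \<Psi> ` ?I" for w
      using that by (elim imageE) (simp only: into)
  qed
  have cm: "continuous_map (top_of_set ?I) (top_of_set ?I) \<Psi>"
    using cont into by (simp only: continuous_map_in_subtopology continuous_map_iff_continuous topspace_euclidean_subtopology Pi_iff) simp
  have quot: "quotient_map (top_of_set ?I) (top_of_set ?I) \<Psi>"
  proof (rule T1_Spaces.continuous_imp_quotient_map[OF _ comp haus])
    show "continuous_map (top_of_set ?I) (top_of_set ?I) \<Psi>"
      by (rule cm)
    show "\<Psi> ` topspace (top_of_set ?I) = topspace (top_of_set ?I)"
      using img by simp
  qed
  have fib: "h z = h z'" if zz: "z \<in> ?I" "z' \<in> ?I" "\<Psi> z = \<Psi> z'" for z z'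
  proof -
    from zz obtain t s t' s' where z: "z = (t, s)" "z' = (t', s')"
      and r: "t \<in> {0..1}" "s \<in> {0..1}" "t' \<in> {0..1}" "s' \<in> {0..1}" by auto
    have ab: "s + (1 - 2 * t) * m s = s' + (1 - 2 * t') * m s'" "s - (1 - 2 * t) * m s = s' - (1 - 2 * t') * m s'"
      using zz(3) by (simp_all only: z \<Psi>_def fst_conv snd_conv prod.inject)
    then have e1: "s = s'" by linarith
    have e2: "(1 - 2 * t) * m s = (1 - 2 * t') * m s"
      using ab(1) unfolding e1 by linarith
    show ?thesis
    proof (cases "m s = 0")
      case True
      then have "s = 0 \<or> s = 1" by (auto simp: m_def min_def split: if_splits)
      then show ?thesis using h(3) r e1 z by auto
    next
      case False
      then show ?thesis using e1 e2 z by simp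
    qed
  qed
  have fib': "\<And>x y. x \<in> topspace (top_of_set ?I) \<Longrightarrow> y \<in> topspace (top_of_set ?I) \<Longrightarrow> \<Psi> x = \<Psi> y \<Longrightarrow> h x = h y"
    by (rule fib) (simp_all only: topspace_euclidean_subtopology)
  obtain f where f: "continuous_map (top_of_set ?I) X f"
      and f': "\<And>z. z \<in> topspace (top_of_set ?I) \<Longrightarrow> f (\<Psi> z) = h z"
    by (rule quotient_map_lift_exists[OF quot h(1)], erule (2) fib', rule that, assumption, blast)
  have f'': "f (\<Psi> z) = h z" if "z \<in> ?I" for z
    using f' that by (simp only: topspace_euclidean_subtopology)
  show thesis
  proof (rule that[OF f])
    fix x :: real assume x: "x \<in> {0..1}"
    have "\<Psi> (0, x / 2) = (x, 0)" "\<Psi> (1, x / 2) = (0, x)" 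
      "\<Psi> (0, (1 + x) / 2) = (1, x)" "\<Psi> (1, (1 + x) / 2) = (x, 1)"
      using x by (auto simp: \<Psi>_def m_def min_def field_simps)
    with f''[of "(0, x/2)"] f''[of "(1, x/2)"] f''[of "(0, (1+x)/2)"] f''[of "(1, (1+x)/2)"] 
    have "f (x, 0) = h (0, x / 2)" "f (0, x) = h (1, x / 2)" "f (1, x) = h (0, (1 + x) / 2)" "f (x, 1) = h (1, (1 + x) / 2)"
      using x by auto
    moreover have "path_join p q ((1 + x) / 2) = q x" if pq: "p 1 = q 0" for p q :: "real \<Rightarrow> 'a"
    proof -
      have hx: "2 * ((1 + x) / 2) - 1 = x" "1/2 \<le> (1 + x) / 2" using x by (simp_all add: field_simps)
      from path_join_second_half[of "(1 + x) / 2" p q, OF hx(2) pq] show ?thesis by (simp only: hx(1))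
    qed
    moreover have "path_join p q (x / 2) = p x" for p q :: "real \<Rightarrow> 'a"
      using x by (simp add: path_join_def)
    moreover have "(1 + x) / 2 \<in> {0..1}" "x / 2 \<in> {0..1}" using x by auto
    ultimately show "f (x, 0) = a x" "f (1, x) = b' x" "f (0, x) = b x" "f (x, 1) = a' x" using ends h(2) by simp_all
  qed
qed

section \<open>Proper homotopies of rays\<close>

abbreviation half_strip :: "(real \<times> real) set" where
  "half_strip \<equiv> {0..} \<times> {0..1}"

abbreviation quadrant :: "(real \<times> real) set" where
  "quadrant \<equiv> {0..} \<times> {0..}"

text \<open>Compact sets of a Hausdorff space are closed, so their preimages in a closed set of a Heine-Borel space are compact
  once they are bounded.\<close>

lemma proper_continuous_map_iff_bounded:
  fixes f :: "'b::heine_borel \<Rightarrow> 'a"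
  assumes X: "Hausdorff_space X" and D: "closed D"
  shows "proper_continuous_map (top_of_set D) X f \<longleftrightarrow>
    continuous_map (top_of_set D) X f \<and> (\<forall>C. compactin X C \<longrightarrow> bounded {z \<in> D. f z \<in> C})"
proof -
  have "compactin (top_of_set D) {z \<in> D. f z \<in> C} \<longleftrightarrow> bounded {z \<in> D. f z \<in> C}"
    if f: "continuous_map (top_of_set D) X f" and C: "compactin X C" for C
  proof -
    have "closedin (top_of_set D) {z \<in> topspace (top_of_set D). f z \<in> C}"
      using f compactin_imp_closedin[OF X C] by (rule closedin_continuous_map_preimage)
    then have "closed {z \<in> D. f z \<in> C}" using D by (simp add: closedin_closed_trans)
    then show ?thesis
      by (auto simp: compactin_subtopology compactin_euclidean_iff compact_eq_bounded_closed)
  qed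
  then show ?thesis unfolding proper_continuous_map_def by auto
qed

lemma bounded_strip_iff:
  "bounded {z \<in> half_strip. P z} \<longleftrightarrow> (\<exists>N::real. \<forall>x\<ge>0. \<forall>t\<in>{0..1}. P (x, t) \<longrightarrow> x \<le> N)"
proof
  assume "bounded {z \<in> half_strip. P z}"
  then obtain B where "\<And>z. z \<in> {z \<in> half_strip. P z} \<Longrightarrow> norm z \<le> B"
    unfolding bounded_iff by blast
  then have "\<bar>x\<bar> \<le> B" if "x \<ge> 0" "t \<in> {0..1}" "P (x, t)" for x t :: real
    using that norm_fst_le[of x t] by (smt (verit) SigmaI atLeast_iff mem_Collect_eq norm_fst_le real_norm_def)
  then show "\<exists>N. \<forall>x\<ge>0. \<forall>t\<in>{0..1}. P (x, t) \<longrightarrow> x \<le> N" by (metis abs_of_nonneg)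
next
  assume "\<exists>N. \<forall>x\<ge>0. \<forall>t\<in>{0..1}. P (x, t) \<longrightarrow> x \<le> N"
  then obtain N where "\<forall>x\<ge>0. \<forall>t\<in>{0..1}. P (x, t) \<longrightarrow> x \<le> N" by blast
  then have "{z \<in> half_strip. P z} \<subseteq> {0..N} \<times> {0..1}" by auto
  then show "bounded {z \<in> half_strip. P z}"
    by (rule bounded_subset[rotated]) (simp add: bounded_Times)
qed

lemma proper_strip_iff:
  assumes "Hausdorff_space X"
  shows "proper_continuous_map (prod_topology (top_of_set {0..}) (top_of_set {0..1::real})) X F \<longleftrightarrow>
    continuous_map (top_of_set half_strip) X F \<and>
    (\<forall>C. compactin X C \<longrightarrow> (\<exists>N::real. \<forall>x\<ge>0. \<forall>t\<in>{0..1}. F (x, t) \<in> C \<longrightarrow> x \<le> N))"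
proof -
  have "closed half_strip" by (intro closed_Times) auto
  from proper_continuous_map_iff_bounded[OF assms this, of F] show ?thesis
    by (simp only: prod_topology_subtopology_eu bounded_strip_iff)
qed

lemma is_ray_iff:
  assumes "Hausdorff_space X"
  shows "is_ray X r \<longleftrightarrow> continuous_map (top_of_set {0..}) X r \<and>
    (\<forall>C. compactin X C \<longrightarrow> (\<exists>N::real. \<forall>x\<ge>0. r x \<in> C \<longrightarrow> x \<le> N))"
proof -
  have "bounded {x \<in> {0..}. P x} \<longleftrightarrow> (\<exists>N::real. \<forall>x\<ge>0. P x \<longrightarrow> x \<le> N)" for P
  proof
    assume "bounded {x \<in> {0..}. P x}"
    then show "\<exists>N::real. \<forall>x\<ge>0. P x \<longrightarrow> x \<le> N" unfolding bounded_iff by (fastforce simp: abs_le_iff)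
  next
    assume "\<exists>N::real. \<forall>x\<ge>0. P x \<longrightarrow> x \<le> N"
    then show "bounded {x \<in> {0..}. P x}" unfolding bounded_iff by (metis (mono_tags, lifting) abs_of_nonneg atLeast_iff mem_Collect_eq real_norm_def)
  qed
  with proper_continuous_map_iff_bounded[OF assms, of "{0..}" r] show ?thesis
    unfolding is_ray_def by simp
qed

lemma properly_homotopic_iff:
  assumes "Hausdorff_space X"
  shows "properly_homotopic X r s \<longleftrightarrow>
    (\<exists>F. continuous_map (top_of_set half_strip) X F \<and>
      (\<forall>C. compactin X C \<longrightarrow> (\<exists>N::real. \<forall>x\<ge>0. \<forall>t\<in>{0..1}. F (x, t) \<in> C \<longrightarrow> x \<le> N)) \<and>
      (\<forall>x\<ge>0. F (x, 0) = r x) \<and> (\<forall>x\<ge>0. F (x, 1) = s x))"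
  by (simp only: properly_homotopic_def proper_strip_iff[OF assms] conj_assoc)

lemma properly_homotopic_cong:
  assumes "properly_homotopic X r s" "\<And>x. x \<ge> 0 \<Longrightarrow> r x = r' x" "\<And>x. x \<ge> 0 \<Longrightarrow> s x = s' x"
  shows "properly_homotopic X r' s'"
  using assms unfolding properly_homotopic_def by simp

lemma properly_homotopic_sym:
  assumes X: "Hausdorff_space X" and rs: "properly_homotopic X r s"
  shows "properly_homotopic X s r"
proof -
  obtain F where F: "continuous_map (top_of_set half_strip) X F"
    "\<forall>C. compactin X C \<longrightarrow> (\<exists>N::real. \<forall>x\<ge>0. \<forall>t\<in>{0..1}. F (x, t) \<in> C \<longrightarrow> x \<le> N)"
    "\<forall>x\<ge>0. F (x, 0) = r x" "\<forall>x\<ge>0. F (x, 1) = s x"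
    using rs unfolding properly_homotopic_iff[OF X] by (elim exE conjE) (rule that)
  have "continuous_map (top_of_set half_strip) X (\<lambda>z. F (fst z, 1 - snd z))"
    by (rule continuous_map_compose_on[OF F(1)]) (auto intro!: continuous_intros)
  moreover have "\<exists>N::real. \<forall>x\<ge>0. \<forall>t\<in>{0..1}. F (fst (x, t), 1 - snd (x, t)) \<in> C \<longrightarrow> x \<le> N" if "compactin X C" for C
  proof -
    obtain N where "\<forall>x\<ge>0. \<forall>t\<in>{0..1}. F (x, t) \<in> C \<longrightarrow> x \<le> N" using F(2) \<open>compactin X C\<close> by blast
    then show ?thesis by (intro exI[of _ N]) auto
  qed
  ultimately show ?thesis
    unfolding properly_homotopic_iff[OF X] using F(3,4)
    by (intro exI[of _ "\<lambda>z. F (fst z, 1 - snd z)"]) simp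
qed

lemma properly_homotopic_trans:
  assumes X: "Hausdorff_space X" and rs: "properly_homotopic X r s" and st: "properly_homotopic X s u"
  shows "properly_homotopic X r u"
proof -
  obtain F where F: "continuous_map (top_of_set half_strip) X F"
    "\<forall>C. compactin X C \<longrightarrow> (\<exists>N::real. \<forall>x\<ge>0. \<forall>t\<in>{0..1}. F (x, t) \<in> C \<longrightarrow> x \<le> N)"
    "\<forall>x\<ge>0. F (x, 0) = r x" "\<forall>x\<ge>0. F (x, 1) = s x"
    using rs unfolding properly_homotopic_iff[OF X] by (elim exE conjE) (rule that)
  obtain E where E: "continuous_map (top_of_set half_strip) X E"
    "\<forall>C. compactin X C \<longrightarrow> (\<exists>N::real. \<forall>x\<ge>0. \<forall>t\<in>{0..1}. E (x, t) \<in> C \<longrightarrow> x \<le> N)"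
    "\<forall>x\<ge>0. E (x, 0) = s x" "\<forall>x\<ge>0. E (x, 1) = u x"
    using st unfolding properly_homotopic_iff[OF X] by (elim exE conjE) (rule that)
  let ?m = "\<lambda>z. if snd z \<le> 1/2 then F (fst z, 2 * snd z) else E (fst z, 2 * snd z - 1)"
  have "continuous_map (top_of_set half_strip) X ?m"
  proof (rule continuous_map_cases_closed[of "{z. snd z \<le> 1/2}" "{z. snd z \<ge> 1/2}" _ X
        "\<lambda>z. F (fst z, 2 * snd z)" "\<lambda>z. E (fst z, 2 * snd z - 1)"])
    show "closed {z::real\<times>real. snd z \<le> 1/2}" "closed {z::real\<times>real. snd z \<ge> 1/2}"
      by (intro closed_Collect_le continuous_intros)+
    show "continuous_map (top_of_set (half_strip \<inter> {z. snd z \<le> 1/2})) X (\<lambda>z. F (fst z, 2 * snd z))"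
      by (rule continuous_map_compose_on[OF F(1)]) (auto intro!: continuous_intros)
    show "continuous_map (top_of_set (half_strip \<inter> {z. snd z \<ge> 1/2})) X (\<lambda>z. E (fst z, 2 * snd z - 1))"
      by (rule continuous_map_compose_on[OF E(1)]) (auto intro!: continuous_intros)
    have eq: "F (fst z, 2 * snd z) = E (fst z, 2 * snd z - 1)" if "z \<in> half_strip" "snd z = 1/2" for z
      unfolding that(2) using that(1) F(4) E(3) by (cases z) auto
    then show "F (fst z, 2 * snd z) = E (fst z, 2 * snd z - 1)" if "z \<in> half_strip" 
      "z \<in> {z. snd z \<le> 1/2}" "z \<in> {z. snd z \<ge> 1/2}" for z
      using that by auto
    show "?m z = E (fst z, 2 * snd z - 1)" if "z \<in> half_strip" "z \<in> {z. snd z \<ge> 1/2}" for z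
      using that eq[of z] by auto
  qed auto
  moreover have "\<exists>N::real. \<forall>x\<ge>0. \<forall>t\<in>{0..1}. ?m (x, t) \<in> C \<longrightarrow> x \<le> N" if C: "compactin X C" for C
  proof -
    obtain N where N: "\<And>x t. x \<ge> 0 \<Longrightarrow> t \<in> {0..1} \<Longrightarrow> F (x, t) \<in> C \<Longrightarrow> x \<le> N" using F(2) C by blast
    obtain M where M: "\<And>x t. x \<ge> 0 \<Longrightarrow> t \<in> {0..1} \<Longrightarrow> E (x, t) \<in> C \<Longrightarrow> x \<le> M" using E(2) C by blast
    have "x \<le> max N M" if "x \<ge> 0" "t \<in> {0..1}" "?m (x, t) \<in> C" for x t
    proof (cases "t \<le> 1/2")
      case True then show ?thesis using that N[of x "2 * t"] by auto
    next
      case False then show ?thesis using that M[of x "2 * t - 1"] by auto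
    qed
    then show ?thesis by blast
  qed
  moreover have "\<forall>x\<ge>0. ?m (x, 0) = r x" "\<forall>x\<ge>0. ?m (x, 1) = u x"
    using F(3) E(4) by simp_all
  ultimately show ?thesis
    unfolding properly_homotopic_iff[OF X] by (intro exI[of _ ?m] conjI) blast+
qed

lemma properly_homotopic_shift:
  assumes X: "Hausdorff_space X" and r: "is_ray X r" and c: "c \<ge> 0"
  shows "properly_homotopic X r (\<lambda>x. r (x + c))"
proof -
  have r': "continuous_map (top_of_set {0..}) X r"
    and p: "\<And>C. compactin X C \<Longrightarrow> \<exists>N. \<forall>x\<ge>0. r x \<in> C \<longrightarrow> x \<le> N"
    using r by (auto simp: is_ray_iff[OF X])
  let ?F = "\<lambda>z. r (fst z + snd z * c)"
  have "continuous_map (top_of_set half_strip) X ?F"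
    by (rule continuous_map_compose_on[OF r']) (use c in \<open>auto intro!: continuous_intros\<close>)
  moreover have "\<exists>N::real. \<forall>x\<ge>0. \<forall>t\<in>{0..1}. ?F (x, t) \<in> C \<longrightarrow> x \<le> N" if C: "compactin X C" for C
  proof -
    obtain N where N: "\<And>x. x \<ge> 0 \<Longrightarrow> r x \<in> C \<Longrightarrow> x \<le> N" using p[OF C] by blast
    have "x \<le> N" if "x \<ge> 0" "t \<in> {0..1}" "?F (x, t) \<in> C" for x t
    proof -
      have "t * c \<ge> 0" using that c by auto
      then show ?thesis using N[of "x + t * c"] that by auto
    qed
    then show ?thesis by blast
  qed
  moreover have "\<forall>x\<ge>0. ?F (x, 0) = r x" "\<forall>x\<ge>0. ?F (x, 1) = r (x + c)" by simp_all
  ultimately show ?thesis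
    unfolding properly_homotopic_iff[OF X] by (intro exI[of _ ?F] conjI) blast+
qed

text \<open>The segments from \<open>(x, 0)\<close> to \<open>(0, x)\<close> sweep out the quadrant and leave every bounded set as
  \<open>x\<close> grows.\<close>

lemma properly_homotopic_quadrant:
  fixes F :: "real \<times> real \<Rightarrow> 'a"
  assumes X: "Hausdorff_space X" and F: "continuous_map (top_of_set quadrant) X F"
    and p: "\<And>C. compactin X C \<Longrightarrow> \<exists>N. \<forall>x\<ge>0. \<forall>y\<ge>0. F (x, y) \<in> C \<longrightarrow> x \<le> N \<and> y \<le> N"
  shows "is_ray X (\<lambda>x. F (x, 0))" "properly_homotopic X (\<lambda>x. F (x, 0)) (\<lambda>y. F (0, y))"
proof -
  have "continuous_map (top_of_set {0..}) X (\<lambda>x. F (x, 0))"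
    by (rule continuous_map_compose_on[OF F]) (auto intro!: continuous_intros)
  then show "is_ray X (\<lambda>x. F (x, 0))"
    unfolding is_ray_iff[OF X] using p by (metis order_refl)
  let ?F = "\<lambda>z. F ((1 - snd z) * fst z, snd z * fst z)"
  have "continuous_map (top_of_set half_strip) X ?F"
    by (rule continuous_map_compose_on[OF F]) (auto intro!: continuous_intros)
  moreover have "\<exists>N::real. \<forall>x\<ge>0. \<forall>t\<in>{0..1}. ?F (x, t) \<in> C \<longrightarrow> x \<le> N" if C: "compactin X C" for C
  proof -
    obtain N where N: "\<And>x y. x \<ge> 0 \<Longrightarrow> y \<ge> 0 \<Longrightarrow> F (x, y) \<in> C \<Longrightarrow> x \<le> N \<and> y \<le> N" using p[OF C] by blast
    have "x \<le> 2 * N" if "x \<ge> 0" "t \<in> {0..1}" "?F (x, t) \<in> C" for x t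
    proof -
      have "0 \<le> (1 - t) * x" "0 \<le> t * x" using that by auto
      with N[of "(1 - t) * x" "t * x"] that have "(1 - t) * x \<le> N" "t * x \<le> N" by auto
      then show ?thesis by (simp add: algebra_simps)
    qed
    then show ?thesis by blast
  qed
  moreover have "\<forall>x\<ge>0. ?F (x, 0) = F (x, 0)" "\<forall>x\<ge>0. ?F (x, 1) = F (0, x)" by simp_all
  ultimately show "properly_homotopic X (\<lambda>x. F (x, 0)) (\<lambda>y. F (0, y))"
    unfolding properly_homotopic_iff[OF X] by (intro exI[of _ ?F] conjI) blast+
qed

lemma unit_cell_floor:
  assumes "real i \<le> x" "x \<le> real i + 1"
  shows "nat \<lfloor>x\<rfloor> = i \<and> frac x = x - real i \<or> x = real i + 1 \<and> nat \<lfloor>x\<rfloor> = Suc i \<and> frac x = 0"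
proof (cases "x = real i + 1")
  case True
  then have "x = of_int (int (Suc i))" by simp
  then have "\<lfloor>x\<rfloor> = int (Suc i)" by (metis floor_of_int)
  then show ?thesis using True by (simp add: frac_def)
next
  case False
  then have "\<lfloor>x\<rfloor> = int i" using assms by (intro floor_unique) auto
  then show ?thesis by (simp add: frac_def)
qed

text \<open>Each homotopy fills a unit cell of the quadrant, with \<open>a\<close> along the horizontal and \<open>b\<close> along
  the vertical edges. The fillings agree on common edges and glue to a map that is proper since only finitely many cells
  meet a compact set.\<close>

theorem grid_properly_homotopic:
  assumes X: "Hausdorff_space X"
    and hom: "\<And>i j. path_homotopic (subtopology X (A i j))
        (path_join (a i j) (b (Suc i) j)) (path_join (b i j) (a i (Suc j)))"
    and e: "\<And>i j. a i j 1 = b (Suc i) j 0" "\<And>i j. b i j 1 = a i (Suc j) 0"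
    and fin: "\<And>C. compactin X C \<Longrightarrow> finite {(i, j). A i j \<inter> C \<noteq> {}}"
  shows "is_ray X (\<lambda>x. a (nat \<lfloor>x\<rfloor>) 0 (frac x))"
    "properly_homotopic X (\<lambda>x. a (nat \<lfloor>x\<rfloor>) 0 (frac x)) (\<lambda>y. b 0 (nat \<lfloor>y\<rfloor>) (frac y))"
proof -
  have "\<exists>f. continuous_map (top_of_set unit_square) (subtopology X (A i j)) f \<and>
    (\<forall>x\<in>{0..1}. f (x, 0) = a i j x \<and> f (1, x) = b (Suc i) j x \<and> f (0, x) = b i j x \<and> f (x, 1) = a i (Suc j) x)" for i j
    by (rule square_of_path_homotopic[OF hom[of i j] e]) blast
  then obtain f where f: "\<And>i j. continuous_map (top_of_set unit_square) (subtopology X (A i j)) (f i j)"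
    and f': "\<And>i j x. x \<in> {0..1} \<Longrightarrow> f i j (x, 0) = a i j x \<and> f i j (1, x) = b (Suc i) j x \<and>
        f i j (0, x) = b i j x \<and> f i j (x, 1) = a i (Suc j) x" by metis
  define F where "F z = f (nat \<lfloor>fst z\<rfloor>) (nat \<lfloor>snd z\<rfloor>) (frac (fst z), frac (snd z))" for z :: "real \<times> real"
  define T where "T ij = {real (fst ij)..real (fst ij) + 1} \<times> {real (snd ij)..real (snd ij) + 1}" for ij :: "nat \<times> nat"
  define g where "g ij z = f (fst ij) (snd ij) (fst z - real (fst ij), snd z - real (snd ij))" for ij :: "nat \<times> nat" and z
  have gF: "g ij z = F z" if z: "z \<in> T ij" for ij z
  proof -
    obtain i j where ij: "ij = (i, j)" by (cases ij)
    obtain x y where xy: "z = (x, y)" by (cases z)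
    have x: "real i \<le> x" "x \<le> real i + 1" and y: "real j \<le> y" "y \<le> real j + 1"
      using z by (auto simp: T_def ij xy)
    have r: "x - real i \<in> {0..1}" "y - real j \<in> {0..1}" "0 \<in> {0..1::real}" "1 \<in> {0..1::real}" using x y by auto
    have g: "g ij z = f i j (x - real i, y - real j)" by (simp add: g_def ij xy)
    have "f i j (x - real i, y - real j) = f (nat \<lfloor>x\<rfloor>) (nat \<lfloor>y\<rfloor>) (frac x, frac y)"
      using unit_cell_floor[OF x] unit_cell_floor[OF y]
    proof (elim disjE conjE)
      assume "x = real i + 1" and x': "nat \<lfloor>x\<rfloor> = Suc i" "frac x = 0" and y': "nat \<lfloor>y\<rfloor> = j" "frac y = y - real j"
      then have "x - real i = 1" by simp
      then show ?thesis unfolding x' y' using f'[OF r(2), of i j] f'[OF r(2), of "Suc i" j] by simp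
    next
      assume "y = real j + 1" and x': "nat \<lfloor>x\<rfloor> = i" "frac x = x - real i" and y': "nat \<lfloor>y\<rfloor> = Suc j" "frac y = 0"
      then have "y - real j = 1" by simp
      then show ?thesis unfolding x' y' using f'[OF r(1), of i j] f'[OF r(1), of i "Suc j"] by simp
    next
      assume "x = real i + 1" "y = real j + 1" and x': "nat \<lfloor>x\<rfloor> = Suc i" "frac x = 0" and y': "nat \<lfloor>y\<rfloor> = Suc j" "frac y = 0"
      then have 1: "x - real i = 1" "y - real j = 1" by simp_all
      have "f i j (1, 1) = b (Suc i) j 1" using f'[OF r(4), of i j] by simp
      also have "\<dots> = a (Suc i) (Suc j) 0" by (rule e)
      also have "\<dots> = f (Suc i) (Suc j) (0, 0)" using f'[OF r(3), of "Suc i" "Suc j"] by simp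
      finally show ?thesis unfolding x' y' 1 .
    qed simp
    then show ?thesis unfolding g by (simp add: F_def xy)
  qed
  have cover: "\<exists>ij. z \<in> T ij" if "z \<in> quadrant" for z
    using that by (intro exI[of _ "(nat \<lfloor>fst z\<rfloor>, nat \<lfloor>snd z\<rfloor>)"]) (auto simp: T_def; linarith)
  have Tsub: "T ij \<subseteq> quadrant" for ij by (auto simp: T_def)
  have gA: "g ij z \<in> A (fst ij) (snd ij)" if "z \<in> T ij" for ij z
  proof -
    have "(fst z - real (fst ij), snd z - real (snd ij)) \<in> unit_square" using that by (auto simp: T_def)
    then show ?thesis
      using f[of "fst ij" "snd ij"] unfolding g_def by (auto simp: continuous_map_def Pi_iff)
  qed
  have cont: "continuous_map (top_of_set quadrant) X F"
  proof (rule pasting_lemma_locally_finite[of _ UNIV T X g])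
    fix z :: "real \<times> real" assume z: "z \<in> topspace (top_of_set quadrant)"
    let ?V = "quadrant \<inter> ({..<fst z + 1} \<times> {..<snd z + 1})"
    have "openin (top_of_set quadrant) ?V"
      by (rule openin_open_Int) (auto intro: open_Times)
    moreover have "z \<in> ?V" using z by auto
    moreover have "{ij \<in> UNIV. T ij \<inter> ?V \<noteq> {}} \<subseteq> {..nat \<lceil>fst z + 1\<rceil>} \<times> {..nat \<lceil>snd z + 1\<rceil>}"
      by (auto simp: T_def; linarith)
    then have "finite {ij \<in> UNIV. T ij \<inter> ?V \<noteq> {}}" by (rule finite_subset) auto
    ultimately show "\<exists>V. openin (top_of_set quadrant) V \<and> z \<in> V \<and> finite {ij \<in> UNIV. T ij \<inter> V \<noteq> {}}"
      by blast
  next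
    fix ij :: "nat \<times> nat"
    have "closed (T ij)" unfolding T_def by (intro closed_Times) auto
    then show "closedin (top_of_set quadrant) (T ij)" using Tsub closed_subset by blast
    have "continuous_map (top_of_set (T ij)) (subtopology X (A (fst ij) (snd ij))) (g ij)"
      unfolding g_def by (rule continuous_map_compose_on[OF f]) (auto simp: T_def intro!: continuous_intros)
    moreover have "quadrant \<inter> T ij = T ij" using Tsub by blast
    ultimately show "continuous_map (subtopology (top_of_set quadrant) (T ij)) X (g ij)"
      by (simp add: subtopology_subtopology continuous_map_in_subtopology)
  next
    show "g i z = g j z" if "z \<in> topspace (top_of_set quadrant) \<inter> T i \<inter> T j" for i j z
      using that gF[of z i] gF[of z j] by auto
    show "\<exists>j. j \<in> UNIV \<and> z \<in> T j \<and> F z = g j z" if "z \<in> topspace (top_of_set quadrant)" for z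
    proof -
      have "z \<in> quadrant" using that by (simp only: topspace_euclidean_subtopology)
      from cover[OF this] obtain ij where "z \<in> T ij" by (elim exE)
      with gF[OF this] show ?thesis by (intro exI[of _ ij]) auto
    qed
  qed
  have bd: "\<exists>N. \<forall>x\<ge>0. \<forall>y\<ge>0. F (x, y) \<in> C \<longrightarrow> x \<le> N \<and> y \<le> N" if C: "compactin X C" for C
  proof -
    let ?S = "{(i, j). A i j \<inter> C \<noteq> {}}"
    have "finite (fst ` ?S \<union> snd ` ?S)" using fin[OF C] by blast
    then obtain N where N: "\<And>n. n \<in> fst ` ?S \<union> snd ` ?S \<Longrightarrow> n \<le> N" by (meson finite_nat_set_iff_bounded_le)
    have "x \<le> real N + 1 \<and> y \<le> real N + 1" if "x \<ge> 0" "y \<ge> 0" "F (x, y) \<in> C" for x y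
    proof -
      obtain ij where ij: "(x, y) \<in> T ij" using cover[of "(x, y)"] \<open>x \<ge> 0\<close> \<open>y \<ge> 0\<close> by auto
      then have "F (x, y) \<in> A (fst ij) (snd ij)" using gA[OF ij] gF[OF ij] by simp
      then have S: "(fst ij, snd ij) \<in> ?S" using \<open>F (x, y) \<in> C\<close> by auto
      have "fst ij \<in> fst ` ?S" "snd ij \<in> snd ` ?S"
        using imageI[OF S, of fst] imageI[OF S, of snd] by simp_all
      then have "fst ij \<le> N" "snd ij \<le> N" using N by blast+
      then show ?thesis using ij by (auto simp: T_def)
    qed
    then show ?thesis by blast
  qed
  have eq: "F (x, 0) = a (nat \<lfloor>x\<rfloor>) 0 (frac x)" "F (0, x) = b 0 (nat \<lfloor>x\<rfloor>) (frac x)" for x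
    using f'[of "frac x" "nat \<lfloor>x\<rfloor>" 0] f'[of "frac x" 0 "nat \<lfloor>x\<rfloor>"] frac_lt_1[of x] frac_ge_0[of x]
    by (simp_all add: F_def)
  from properly_homotopic_quadrant[OF X cont bd] show "is_ray X (\<lambda>x. a (nat \<lfloor>x\<rfloor>) 0 (frac x))"
    "properly_homotopic X (\<lambda>x. a (nat \<lfloor>x\<rfloor>) 0 (frac x)) (\<lambda>y. b 0 (nat \<lfloor>y\<rfloor>) (frac y))"
    by (simp_all only: eq)
qed

section \<open>Continuity on the Cayley complex\<close>

definition inv_word :: "'x word \<Rightarrow> 'x word" where
  "inv_word w = rev (map (\<lambda>(x, b). (x, \<not> b)) w)"

lemma inv_word_simps [simp]: "inv_word [] = []" "inv_word (l # w) = inv_word w @ [(fst l, \<not> snd l)]"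
  "inv_word (u @ v) = inv_word v @ inv_word u" "length (inv_word w) = length w"
  by (simp_all add: inv_word_def case_prod_beta)

lemma inv_word_inv_word [simp]: "inv_word (inv_word w) = w"
  by (induction w) auto

lemma inv_word_words [simp]: "inv_word w \<in> words X \<longleftrightarrow> w \<in> words X"
  by (induction w) auto

fun path_verts :: "('a, 'b) monoid_scheme \<Rightarrow> 'a \<Rightarrow> 'a word \<Rightarrow> 'a set" where
  "path_verts G g [] = {g}"
| "path_verts G g (l # w) = insert g (path_verts G (g \<otimes>\<^bsub>G\<^esub> letter_val G l) w)"

lemma start_in_path_verts [simp]: "g \<in> path_verts G g w"
  by (cases w) auto

lemma finite_path_verts [simp]: "finite (path_verts G g w)"
  by (induction w arbitrary: g) auto

fun base :: "'a cayley_point \<Rightarrow> 'a" where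
  "base (Vertex g) = g"
| "base (EdgePoint g s u) = g"
| "base (CellPoint g w z) = g"

text \<open>A graph function, extended over every 2-cell by coning it off to a prescribed value at the centre.\<close>

fun cone_extension :: "('a, 'b) monoid_scheme \<Rightarrow> ('a \<Rightarrow> real) \<Rightarrow> ('a cayley_point \<Rightarrow> real) \<Rightarrow> 'a cayley_point \<Rightarrow> real" where
  "cone_extension G c q (CellPoint g w z) =
     (1 - norm z) * c g + norm z * q (edge_path G g w (real (length w) * (Arg2pi z / (2 * pi))))"
| "cone_extension G c q y = q y"

text \<open>The angle is measured in full turns, so that the boundary of a cell becomes its attaching edge path, up to scale. As
  this map is a quotient map, continuity on the disc can be tested on the square.\<close>

definition polar :: "real \<times> real \<Rightarrow> complex" where
  "polar z = of_real (fst z) * cis (2 * pi * snd z)"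

lemma polar_in_cball: "z \<in> unit_square \<Longrightarrow> polar z \<in> cball 0 1"
  by (auto simp: polar_def norm_mult)

lemma continuous_on_polar: "continuous_on A polar"
  unfolding polar_def by (intro continuous_intros)

lemma Arg2pi_polar: "0 < \<rho> \<Longrightarrow> 0 \<le> x \<Longrightarrow> x < 1 \<Longrightarrow> Arg2pi (polar (\<rho>, x)) = 2 * pi * x"
  by (intro Arg2pi_unique[of \<rho>]) (auto simp: polar_def cis_conv_exp)

lemma polar_1: "polar (\<rho>, 1) = polar (\<rho>, 0)"
  by (simp add: polar_def)

lemma norm_polar: "0 \<le> \<rho> \<Longrightarrow> norm (polar (\<rho>, x)) = \<rho>"
  by (simp add: polar_def norm_mult)

lemma quotient_map_polar: "quotient_map (top_of_set unit_square) (top_of_set (cball 0 1)) polar"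
proof (rule T1_Spaces.continuous_imp_quotient_map)
  show "continuous_map (top_of_set unit_square) (top_of_set (cball 0 1)) polar"
    using polar_in_cball continuous_on_polar by (auto simp: continuous_map_in_subtopology)
  show "compact_space (top_of_set unit_square)"
    by (simp add: compact_space_subtopology compactin_euclidean_iff compact_Times)
  show "Hausdorff_space (top_of_set (cball (0::complex) 1))"
    by (simp add: Hausdorff_space_subtopology)
  have "z \<in> polar ` unit_square" if "z \<in> cball 0 1" for z
  proof (rule image_eqI)
    have "cmod z * cis (Arg2pi z) = z" using Arg2pi_eq[of z] by (simp add: cis_conv_exp)
    then show "z = polar (norm z, Arg2pi z / (2 * pi))" by (simp add: polar_def)
    show "(norm z, Arg2pi z / (2 * pi)) \<in> unit_square"
      using that Arg2pi_ge_0[of z] Arg2pi_lt_2pi[of z] by auto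
  qed
  then show "polar ` topspace (top_of_set unit_square) = topspace (top_of_set (cball 0 1))"
    using polar_in_cball by (auto simp del: mem_cball)
qed

text \<open>The tube lemma for the compact factor \<open>J\<close>.\<close>

lemma tube_openin:
  assumes J: "compact J" and h: "continuous_map (top_of_set (A \<times> J)) Y h" and W: "openin Y W"
  shows "openin (top_of_set A) {a \<in> A. \<forall>t\<in>J. h (a, t) \<in> W}"
proof -
  have "closed_map (prod_topology (top_of_set A) (top_of_set J)) (top_of_set A) fst"
    by (rule Abstract_Topological_Spaces.closed_map_fst) (use J in \<open>simp add: compact_space_subtopology\<close>)
  moreover have "closedin (top_of_set (A \<times> J)) {p \<in> topspace (top_of_set (A \<times> J)). h p \<in> topspace Y - W}"
    by (rule closedin_continuous_map_preimage[OF h]) (use W in blast)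
  ultimately have "closedin (top_of_set A) (fst ` {p \<in> A \<times> J. h p \<in> topspace Y - W})"
    by (simp add: closed_map_def)
  then have "openin (top_of_set A) (A - fst ` {p \<in> A \<times> J. h p \<in> topspace Y - W})"
    using openin_diff[OF openin_topspace[of "top_of_set A"]] by simp
  moreover have "h p \<in> topspace Y" if "p \<in> A \<times> J" for p
    using h that by (auto simp: continuous_map_def Pi_iff)
  then have "A - fst ` {p \<in> A \<times> J. h p \<in> topspace Y - W} = {a \<in> A. \<forall>t\<in>J. h (a, t) \<in> W}"
    by force
  ultimately show ?thesis by simp
qed

text \<open>The generators are nontrivial, so the two ends of an edge differ; the contractions of vertex stars depend on this.\<close>

locale cayley = group G for G :: "('a, 'b) monoid_scheme" (structure) +
  fixes S :: "'a set" and P :: "'a word set"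
  assumes finite_S: "finite S" and S_carrier: "S \<subseteq> carrier G" and one_notin_S: "\<one> \<notin> S" and S_nonempty: "S \<noteq> {}"
    and finite_P: "finite P" and P_words: "P \<subseteq> words S" and P_nonempty: "[] \<notin> P"
    and P_val: "\<And>w. w \<in> P \<Longrightarrow> word_val G w = \<one>"
begin

abbreviation K :: "'a cayley_point topology" where "K \<equiv> cayley_complex G S P"
abbreviation lval :: "'a \<times> bool \<Rightarrow> 'a" where "lval \<equiv> letter_val G"
abbreviation val :: "'a word \<Rightarrow> 'a" where "val \<equiv> word_val G"
abbreviation pverts :: "'a \<Rightarrow> 'a word \<Rightarrow> 'a set" where "pverts \<equiv> path_verts G"

lemma lval_closed [simp]: "fst l \<in> S \<Longrightarrow> lval l \<in> carrier G"
  using S_carrier by (auto simp: letter_val_def)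

lemma val_closed [simp]: "w \<in> words S \<Longrightarrow> val w \<in> carrier G"
  by (induction w) auto

lemma val_append [simp]: "u \<in> words S \<Longrightarrow> v \<in> words S \<Longrightarrow> val (u @ v) = val u \<otimes> val v"
  by (induction u) (auto simp: m_assoc)

lemma lval_flip: "fst l \<in> S \<Longrightarrow> lval (fst l, \<not> snd l) = inv (lval l)"
  using S_carrier by (auto simp: letter_val_def)

lemma val_inv_word [simp]: "w \<in> words S \<Longrightarrow> val (inv_word w) = inv (val w)"
proof (induction w)
  case (Cons l w)
  then have "val (inv_word (l # w)) = inv (val w) \<otimes> inv (lval l)"
    using lval_flip[of l] by (simp add: m_assoc)
  then show ?case using Cons.prems by (simp add: inv_mult_group)
qed simp

lemma path_verts_carrier: "g \<in> carrier G \<Longrightarrow> w \<in> words S \<Longrightarrow> pverts g w \<subseteq> carrier G"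
  by (induction w arbitrary: g) auto

lemma end_in_path_verts [simp]: "g \<in> carrier G \<Longrightarrow> w \<in> words S \<Longrightarrow> g \<otimes> val w \<in> pverts g w"
  by (induction w arbitrary: g) (auto simp flip: m_assoc)

lemma path_verts_append:
  "g \<in> carrier G \<Longrightarrow> u \<in> words S \<Longrightarrow> v \<in> words S \<Longrightarrow> pverts g (u @ v) = pverts g u \<union> pverts (g \<otimes> val u) v"
  by (induction u arbitrary: g) (auto simp: m_assoc)

lemma path_verts_inv_word:
  "g \<in> carrier G \<Longrightarrow> w \<in> words S \<Longrightarrow> pverts (g \<otimes> val w) (inv_word w) = pverts g w"
proof (induction w arbitrary: g)
  case (Cons l w)
  let ?h = "g \<otimes> lval l"
  have l: "fst l \<in> S" and w: "w \<in> words S" and h: "?h \<in> carrier G" using Cons.prems by auto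
  have "pverts (g \<otimes> val (l # w)) (inv_word (l # w)) =
      pverts (?h \<otimes> val w) (inv_word w) \<union> pverts (?h \<otimes> val w \<otimes> val (inv_word w)) [(fst l, \<not> snd l)]"
    using l w h Cons.prems(1) by (simp add: path_verts_append m_assoc)
  also have "?h \<otimes> val w \<otimes> val (inv_word w) = ?h" using h w by (simp add: m_assoc)
  also have "pverts ?h [(fst l, \<not> snd l)] = {?h, g}"
    using l Cons.prems(1) by (simp add: lval_flip m_assoc)
  finally show ?case using Cons.IH[OF h w] by auto
qed simp

lemma topspace_K: "topspace K = cayley_points G S P"
  by (rule topspace_cayley_complex[OF is_group S_carrier P_words])

lemma edge_map_points [simp]: "g \<in> carrier G \<Longrightarrow> s \<in> S \<Longrightarrow> edge_map G g s u \<in> cayley_points G S P"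
  by (rule edge_map_in_points[OF is_group _ _ S_carrier])

lemma edge_map_ends [simp]: "edge_map G g s 0 = Vertex g" "edge_map G g s 1 = Vertex (g \<otimes> s)"
  by (auto simp: edge_map_def)

lemma edge_map_clamp: "edge_map G g s u = edge_map G g s (max 0 (min 1 u))"
  by (auto simp: edge_map_def max_def min_def)

lemma edge_path_start [simp]:
  assumes "g \<in> carrier G" "w \<in> words S" "u \<le> 0" shows "edge_path G g w u = Vertex g"
proof (cases w)
  case (Cons l v)
  then obtain s b where "w = (s, b) # v" "s \<in> carrier G" using assms S_carrier by (cases l) auto
  then show ?thesis using assms by (auto simp: edge_map_def m_assoc)
qed simp

lemma edge_path_end [simp]:
  "g \<in> carrier G \<Longrightarrow> w \<in> words S \<Longrightarrow> u \<ge> real (length w) \<Longrightarrow> edge_path G g w u = Vertex (g \<otimes> val w)"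
proof (induction w arbitrary: g u)
  case (Cons l w)
  then obtain s b where l: "l = (s, b)" "s \<in> S" "s \<in> carrier G" using S_carrier by (cases l) auto
  show ?case
  proof (cases "u \<le> 1")
    case True
    have "1 + real (length w) \<le> u" using Cons.prems by simp
    with True have "real (length w) \<le> 0" "u \<ge> 1" by linarith+
    then have "w = []" "u = 1" using True by auto
    then show ?thesis using Cons.prems l by (auto simp: letter_val_def)
  next
    case False
    then show ?thesis using Cons l by (auto simp: m_assoc)
  qed
qed simp

lemma edge_path_append:
  assumes "g \<in> carrier G" "v \<in> words S" "w \<in> words S"
  shows "edge_path G g (v @ w) u =
    (if u \<le> real (length v) then edge_path G g v u else edge_path G (g \<otimes> val v) w (u - real (length v)))"
  using assms
proof (induction v arbitrary: g u)
  case Nil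
  then show ?case by auto
next
  case (Cons l v)
  then obtain s b where l: "l = (s, b)" "s \<in> S" using S_carrier by (cases l) auto
  then show ?case
    using Cons.IH[of "g \<otimes> lval l" "u - 1"] Cons.prems by (auto simp: m_assoc diff_diff_eq)
qed

lemma continuous_map_edge_map: "g \<in> carrier G \<Longrightarrow> s \<in> S \<Longrightarrow> continuous_map (top_of_set {0..1}) K (edge_map G g s)"
  unfolding continuous_map_def topspace_K openin_cayley_complex
  by (auto simp: cayley_open_def)

lemma cell_map_points:
  assumes "g \<in> carrier G" "w \<in> P" shows "cell_map G g w z \<in> cayley_points G S P"
proof (cases "norm z < 1")
  case True
  then show ?thesis using assms by (auto simp: cell_map_def cayley_points_def)
next
  case False
  have "w \<in> words S" using assms P_words by blast
  with False show ?thesis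
    unfolding cell_map_def by (simp add: edge_path_in_points is_group S_carrier assms(1))
qed

lemma continuous_map_cell_map:
  assumes "g \<in> carrier G" "w \<in> P" shows "continuous_map (top_of_set (cball 0 1)) K (cell_map G g w)"
  unfolding continuous_map_def topspace_K openin_cayley_complex
  using cell_map_points[OF assms] assms by (auto simp: cayley_open_def)

definition pcell :: "'a \<Rightarrow> 'a word \<Rightarrow> real \<times> real \<Rightarrow> 'a cayley_point" where
  "pcell g w z = cell_map G g w (polar z)"

lemma edge_path_Arg2pi:
  assumes "g \<in> carrier G" "w \<in> P" "0 < \<rho>" "0 \<le> x" "x \<le> 1"
  shows "edge_path G g w (real (length w) * (Arg2pi (polar (\<rho>, x)) / (2 * pi))) = edge_path G g w (real (length w) * x)"
proof (cases "x = 1")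
  case True
  have "Arg2pi (polar (\<rho>, 1)) = 0" using Arg2pi_polar[of \<rho> 0] assms by (simp add: polar_1)
  then show ?thesis using assms P_words P_val[of w] True by auto
next
  case False
  then show ?thesis using Arg2pi_polar[of \<rho> x] assms by simp
qed

lemma pcell_inner: "0 \<le> \<rho> \<Longrightarrow> \<rho> < 1 \<Longrightarrow> pcell g w (\<rho>, x) = CellPoint g w (polar (\<rho>, x))"
  by (simp add: pcell_def cell_map_def norm_polar)

lemma pcell_boundary:
  assumes "g \<in> carrier G" "w \<in> P" "0 \<le> x" "x \<le> 1"
  shows "pcell g w (1, x) = edge_path G g w (real (length w) * x)"
  using edge_path_Arg2pi[OF assms(1,2) zero_less_one assms(3,4)] by (simp add: pcell_def cell_map_def norm_polar)

lemma continuous_map_pcell: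
  assumes "g \<in> carrier G" "w \<in> P" shows "continuous_map (top_of_set unit_square) K (pcell g w)"
  unfolding pcell_def
  by (rule continuous_map_compose_on[OF continuous_map_cell_map[OF assms] continuous_on_polar polar_in_cball])

lemma openin_K_iff:
  "openin K U \<longleftrightarrow> U \<subseteq> cayley_points G S P \<and>
    (\<forall>g \<in> carrier G. \<forall>s \<in> S. openin (top_of_set {0..1}) {u \<in> {0..1}. edge_map G g s u \<in> U}) \<and>
    (\<forall>g \<in> carrier G. \<forall>w \<in> P. openin (top_of_set unit_square) {z \<in> unit_square. pcell g w z \<in> U})"
proof -
  have "openin (top_of_set (cball 0 1)) {z \<in> cball 0 1. cell_map G g w z \<in> U} \<longleftrightarrow>
      openin (top_of_set unit_square) {z \<in> unit_square. pcell g w z \<in> U}" for g w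
  proof -
    let ?U = "{z \<in> cball 0 1. cell_map G g w z \<in> U}"
    have q: "\<And>U. U \<subseteq> topspace (top_of_set (cball 0 1)) \<Longrightarrow>
        openin (top_of_set unit_square) {x \<in> topspace (top_of_set unit_square). polar x \<in> U} =
        openin (top_of_set (cball 0 1)) U"
      using quotient_map_polar unfolding quotient_map_def by blast
    have "openin (top_of_set unit_square) {x \<in> topspace (top_of_set unit_square). polar x \<in> ?U} \<longleftrightarrow>
       openin (top_of_set (cball 0 1)) ?U"
      by (rule q) auto
    moreover have "{x \<in> topspace (top_of_set unit_square). polar x \<in> ?U} = {z \<in> unit_square. pcell g w z \<in> U}"
      using polar_in_cball by (auto simp: pcell_def simp del: mem_cball)
    ultimately show ?thesis by simp
  qed
  then show ?thesis unfolding openin_cayley_complex cayley_open_def by simp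
qed

lemma closedin_K_I:
  assumes "C \<subseteq> cayley_points G S P"
    "\<And>g s. g \<in> carrier G \<Longrightarrow> s \<in> S \<Longrightarrow> closedin (top_of_set {0..1}) {u \<in> {0..1}. edge_map G g s u \<in> C}"
    "\<And>g w. g \<in> carrier G \<Longrightarrow> w \<in> P \<Longrightarrow> closedin (top_of_set unit_square) {z \<in> unit_square. pcell g w z \<in> C}"
  shows "closedin K C"
proof -
  have *: "openin (top_of_set A) {x \<in> A. f x \<in> cayley_points G S P - C}"
    if "closedin (top_of_set A) {x \<in> A. f x \<in> C}" "\<And>x. x \<in> A \<Longrightarrow> f x \<in> cayley_points G S P" for A :: "'c::topological_space set" and f
  proof -
    have "{x \<in> A. f x \<in> cayley_points G S P - C} = A - {x \<in> A. f x \<in> C}" using that(2) by blast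
    then show ?thesis using that(1) by (simp add: closedin_def)
  qed
  have "openin K (cayley_points G S P - C)"
    unfolding openin_K_iff
  proof (intro conjI ballI)
    fix g s assume "g \<in> carrier G" "s \<in> S"
    then show "openin (top_of_set {0..1}) {u \<in> {0..1}. edge_map G g s u \<in> cayley_points G S P - C}"
      by (intro * assms(2) edge_map_points)
  next
    fix g w assume "g \<in> carrier G" "w \<in> P"
    then show "openin (top_of_set unit_square) {z \<in> unit_square. pcell g w z \<in> cayley_points G S P - C}"
      by (intro * assms(3)) (simp_all add: pcell_def cell_map_points)
  qed auto
  then show ?thesis using assms(1) by (simp add: closedin_def topspace_K)
qed

lemma K_point_cases:
  assumes "y \<in> cayley_points G S P"
  obtains g s u where "g \<in> carrier G" "s \<in> S" "u \<in> {0..1}" "y = edge_map G g s u"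
  | g w z where "g \<in> carrier G" "w \<in> P" "z \<in> unit_square" "y = pcell g w z"
proof -
  consider g where "g \<in> carrier G" "y = Vertex g"
    | g s u where "g \<in> carrier G" "s \<in> S" "0 < u" "u < 1" "y = EdgePoint g s u"
    | g w z where "g \<in> carrier G" "w \<in> P" "norm z < 1" "y = CellPoint g w z"
    using assms unfolding cayley_points_def by blast
  then show thesis
  proof cases
    case 1
    obtain s where "s \<in> S" using S_nonempty by blast
    then show ?thesis using 1 by (intro that(1)[of g s 0]) auto
  next
    case 2
    then show ?thesis by (intro that(1)[of g s u]) (auto simp: edge_map_def)
  next
    case 3
    have "z \<in> topspace (top_of_set (cball 0 1))" using 3 by simp
    then have "z \<in> polar ` topspace (top_of_set unit_square)"
      by (simp only: quotient_imp_surjective_map[OF quotient_map_polar])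
    then obtain z' where z': "z' \<in> topspace (top_of_set unit_square)" "z = polar z'" by (elim imageE)
    have "y = pcell g w z'" using 3 z'(2) by (simp add: pcell_def cell_map_def)
    with 3 z'(1) show ?thesis
      by (intro that(2)[of g w z']) (simp_all only: topspace_euclidean_subtopology)
  qed
qed

lemma continuous_map_from_K:
  assumes e: "\<And>g s. g \<in> carrier G \<Longrightarrow> s \<in> S \<Longrightarrow> continuous_map (top_of_set {0..1}) Y (\<lambda>u. f (edge_map G g s u))"
    and c: "\<And>g w. g \<in> carrier G \<Longrightarrow> w \<in> P \<Longrightarrow> continuous_map (top_of_set unit_square) Y (\<lambda>z. f (pcell g w z))"
  shows "continuous_map K Y f"
  unfolding continuous_map_def topspace_K
proof (intro conjI allI impI)
  show "f \<in> cayley_points G S P \<rightarrow> topspace Y"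
  proof
    fix y assume "y \<in> cayley_points G S P"
    then show "f y \<in> topspace Y"
    proof (cases rule: K_point_cases)
      case (1 g s u)
      with e[OF 1(1,2)] show ?thesis by (auto simp: continuous_map_def Pi_iff)
    next
      case (2 g w z)
      with c[OF 2(1,2)] show ?thesis unfolding continuous_map_def topspace_euclidean_subtopology Pi_iff by blast
    qed
  qed
  fix W assume W: "openin Y W"
  show "openin K {y \<in> cayley_points G S P. f y \<in> W}"
    unfolding openin_K_iff
  proof (intro conjI ballI)
    fix g s assume gs: "g \<in> carrier G" "s \<in> S"
    have "openin (top_of_set {0..1}) {u \<in> topspace (top_of_set {0..1}). f (edge_map G g s u) \<in> W}"
      by (rule openin_continuous_map_preimage[OF e[OF gs] W])
    then show "openin (top_of_set {0..1}) {u \<in> {0..1}. edge_map G g s u \<in> {y \<in> cayley_points G S P. f y \<in> W}}"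
      using gs by simp
  next
    fix g w assume gw: "g \<in> carrier G" "w \<in> P"
    have "openin (top_of_set unit_square) {u \<in> topspace (top_of_set unit_square). f (pcell g w u) \<in> W}"
      by (rule openin_continuous_map_preimage[OF c[OF gw] W])
    then show "openin (top_of_set unit_square) {u \<in> unit_square. pcell g w u \<in> {y \<in> cayley_points G S P. f y \<in> W}}"
      using cell_map_points[OF gw] by (simp add: pcell_def)
  qed auto
qed

text \<open>A map out of an open part of the complex times the unit interval is continuous as soon as it is so on
  every cell; compactness of the interval is what makes the product with a quotient topology harmless.\<close>

lemma continuous_map_homotopy_from_K:
  assumes U: "openin K U"
    and e: "\<And>g s. g \<in> carrier G \<Longrightarrow> s \<in> S \<Longrightarrow>
      continuous_map (top_of_set ({u \<in> {0..1}. edge_map G g s u \<in> U} \<times> {0..1})) Y (\<lambda>z. H (edge_map G g s (fst z), snd z))"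
    and c: "\<And>g w. g \<in> carrier G \<Longrightarrow> w \<in> P \<Longrightarrow>
      continuous_map (top_of_set ({z \<in> unit_square. pcell g w z \<in> U} \<times> {0..1})) Y (\<lambda>z. H (pcell g w (fst z), snd z))"
  shows "continuous_map (prod_topology (subtopology K U) (top_of_set {0..1::real})) Y H"
  unfolding continuous_map_eq_topcontinuous_at
proof
  have Usub: "U \<subseteq> cayley_points G S P" using openin_subset[OF U] by (simp add: topspace_K)
  have track: "continuous_map (top_of_set {0..1}) Y (\<lambda>t. H (y, t))" if y: "y \<in> U" for y
  proof -
    have "y \<in> cayley_points G S P" using y Usub by blast
    then show ?thesis
    proof (cases rule: K_point_cases)
      case (1 g s u)
      have "continuous_map (top_of_set {0..1}) Y (\<lambda>t. H (edge_map G g s (fst (u, t)), snd (u, t)))"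
        by (rule continuous_map_compose_on[OF e[OF 1(1,2)]]) (use 1 y in \<open>auto intro!: continuous_intros\<close>)
      then show ?thesis using 1 by simp
    next
      case (2 g w z)
      have "continuous_map (top_of_set {0..1}) Y (\<lambda>t. H (pcell g w (fst (z, t)), snd (z, t)))"
        by (rule continuous_map_compose_on[OF c[OF 2(1,2)]]) (use 2 y in \<open>auto intro!: continuous_intros\<close>)
      then show ?thesis using 2 by simp
    qed
  qed
  have top: "topspace (prod_topology (subtopology K U) (top_of_set {0..1::real})) = U \<times> {0..1}"
    using Usub by (auto simp: topspace_K)
  have into: "H (y, t) \<in> topspace Y" if "y \<in> U" "t \<in> {0..1}" for y t
    using track[OF that(1)] that(2) by (auto simp: continuous_map_def Pi_iff)
  fix p assume "p \<in> topspace (prod_topology (subtopology K U) (top_of_set {0..1::real}))"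
  then obtain y0 t0 where p: "p = (y0, t0)" and y0: "y0 \<in> U" and t0: "t0 \<in> {0..1}"
    unfolding top by blast
  have nbhd: "\<exists>N. openin (prod_topology (subtopology K U) (top_of_set {0..1::real})) N \<and> p \<in> N \<and> (\<forall>q\<in>N. H q \<in> W)"
    if W: "openin Y W" "H p \<in> W" for W
  proof -
    have "openin (top_of_set {0..1}) {t \<in> topspace (top_of_set {0..1}). H (y0, t) \<in> W}"
      by (rule openin_continuous_map_preimage[OF track[OF y0] W(1)])
    then obtain T where T: "open T" "{t \<in> {0..1}. H (y0, t) \<in> W} = {0..1} \<inter> T"
      by (auto simp: openin_open)
    have "t0 \<in> T" using T(2) W(2) t0 p by auto
    then obtain d where d: "d > 0" "cball t0 d \<subseteq> T" using T(1) open_contains_cball by blast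
    define J where "J = cball t0 d \<inter> {0..1}"
    have J: "compact J" "J \<subseteq> {0..1}" by (auto simp: J_def compact_Int)
    define N where "N = {y \<in> U. \<forall>t\<in>J. H (y, t) \<in> W}"
    have *: "openin (top_of_set D) {x \<in> D. f x \<in> N}"
      if o: "openin (top_of_set D) {x \<in> D. f x \<in> U}"
        and h: "continuous_map (top_of_set ({x \<in> D. f x \<in> U} \<times> {0..1})) Y (\<lambda>z. H (f (fst z), snd z))"
      for D :: "'d::topological_space set" and f
    proof -
      have "continuous_map (top_of_set ({x \<in> D. f x \<in> U} \<times> J)) Y (\<lambda>z. H (f (fst z), snd z))"
        by (rule continuous_map_compose_on[OF h, of _ "\<lambda>z. z", simplified]) (use J in auto)
      from tube_openin[OF J(1) this W(1)]
      have "openin (top_of_set {x \<in> D. f x \<in> U}) {x \<in> {x \<in> D. f x \<in> U}. \<forall>t\<in>J. H (f x, t) \<in> W}" by simp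
      from openin_trans[OF this o] show ?thesis by (simp add: N_def conj_assoc)
    qed
    have "openin K N"
      unfolding openin_K_iff
    proof (intro conjI ballI)
      show "N \<subseteq> cayley_points G S P" using Usub by (auto simp: N_def)
    next
      fix g s assume gs: "g \<in> carrier G" "s \<in> S"
      then have "openin (top_of_set {0..1}) {u \<in> {0..1}. edge_map G g s u \<in> U}"
        using U unfolding openin_K_iff by blast
      then show "openin (top_of_set {0..1}) {u \<in> {0..1}. edge_map G g s u \<in> N}"
        by (rule *) (rule e[OF gs])
    next
      fix g w assume gw: "g \<in> carrier G" "w \<in> P"
      then have "openin (top_of_set unit_square) {z \<in> unit_square. pcell g w z \<in> U}"
        using U unfolding openin_K_iff by blast
      then show "openin (top_of_set unit_square) {z \<in> unit_square. pcell g w z \<in> N}"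
        by (rule *) (rule c[OF gw])
    qed
    then have "openin (subtopology K U) N"
      using U by (auto simp: openin_open_subtopology N_def)
    moreover have "openin (top_of_set {0..1}) (ball t0 d \<inter> {0..1})"
      by (subst Int_commute) (rule openin_open_Int, rule open_ball)
    ultimately have "openin (prod_topology (subtopology K U) (top_of_set {0..1::real})) (N \<times> (ball t0 d \<inter> {0..1}))"
      by (simp add: openin_prod_Times_iff)
    moreover have "y0 \<in> N" using y0 d(2) T(2) by (auto simp: N_def J_def)
    moreover have "H q \<in> W" if "q \<in> N \<times> (ball t0 d \<inter> {0..1})" for q
      using that by (auto simp: N_def J_def)
    ultimately show ?thesis
      using t0 d(1) p by (intro exI[of _ "N \<times> (ball t0 d \<inter> {0..1})"]) auto
  qed
  show "topcontinuous_at (prod_topology (subtopology K U) (top_of_set {0..1::real})) Y H p"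
    unfolding topcontinuous_at_def top using y0 t0 p into nbhd by auto
qed

section \<open>Separation and compactness\<close>

lemma edge_path_continuous_gen:
  assumes q: "\<And>g s. g \<in> carrier G \<Longrightarrow> s \<in> S \<Longrightarrow> continuous_map (top_of_set {0..1}) Y (\<lambda>u. q (edge_map G g s u))"
    and g: "g \<in> carrier G" and w: "w \<in> words S"
  shows "continuous_map euclideanreal Y (\<lambda>u. q (edge_path G g w u))"
  using g w
proof (induction w arbitrary: g)
  case Nil
  obtain s where "s \<in> S" using S_nonempty by blast
  from q[OF Nil(1) this] have "q (edge_map G g s 0) \<in> topspace Y"
    unfolding continuous_map_def topspace_euclidean_subtopology Pi_iff by force
  then show ?case by (simp add: continuous_map_const)
next
  case (Cons l w)
  then obtain s b where l: "l = (s, b)" and s: "s \<in> S" "s \<in> carrier G" and w: "w \<in> words S" using S_carrier by (cases l) auto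
  let ?h = "g \<otimes> lval l"
  have h: "?h \<in> carrier G" using Cons.prems l s by simp
  let ?f = "\<lambda>u. q (if b then edge_map G g s u else edge_map G (g \<otimes> inv s) s (1 - u))"
  have "continuous_map (top_of_set UNIV) Y (\<lambda>u. q (edge_path G g (l # w) u))"
  proof (rule continuous_map_cases_closed[of "{..1}" "{1..}" UNIV Y ?f "\<lambda>u. q (edge_path G ?h w (u - 1))"])
    have clamp: "continuous_map (top_of_set (UNIV \<inter> {..1})) Y (\<lambda>u. q (edge_map G g s (\<alpha> u)))"
      if "g \<in> carrier G" "continuous_on UNIV \<alpha>" for g and \<alpha> :: "real \<Rightarrow> real"
    proof -
      have "continuous_map (top_of_set (UNIV \<inter> {..1})) Y (\<lambda>u. q (edge_map G g s (max 0 (min 1 (\<alpha> u)))))"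
        by (rule continuous_map_compose_on[OF q[OF that(1) s(1)]])
           (auto intro!: continuous_intros continuous_on_subset[OF that(2)])
      then show ?thesis by (simp only: edge_map_clamp[symmetric])
    qed
    show "continuous_map (top_of_set (UNIV \<inter> {..1})) Y ?f"
    proof (cases b)
      case True
      then show ?thesis using clamp[of g "\<lambda>u. u"] Cons.prems by (simp add: continuous_on_id)
    next
      case False
      have "continuous_on UNIV (\<lambda>u::real. 1 - u)" by (intro continuous_intros)
      then show ?thesis using clamp[of "g \<otimes> inv s" "\<lambda>u. 1 - u"] Cons.prems s False by simp
    qed
    have IH: "continuous_map (top_of_set UNIV) Y (\<lambda>u. q (edge_path G ?h w u))"
      using Cons.IH[OF h w] by simp
    show "continuous_map (top_of_set (UNIV \<inter> {1..})) Y (\<lambda>u. q (edge_path G ?h w (u - 1)))"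
      by (rule continuous_map_compose_on[OF IH]) (auto intro!: continuous_intros)
    have eq: "?f u = q (edge_path G ?h w (u - 1))" if "u = 1" for u
      unfolding that using h w Cons.prems(1) l s by (simp add: letter_val_def m_assoc)
    then show "?f u = q (edge_path G ?h w (u - 1))" if "u \<in> {..1}" "u \<in> {1..}" for u using that by (intro eq) auto
    show "q (edge_path G g (l # w) u) = ?f u" if "u \<in> {..1}" for u using that by (simp add: l)
    show "q (edge_path G g (l # w) u) = q (edge_path G ?h w (u - 1))" if "u \<in> {1..}" for u
    proof (cases "u = 1")
      case True
      have "q (edge_path G g (l # w) u) = ?f u" unfolding True by (simp add: l)
      also have "\<dots> = q (edge_path G ?h w (u - 1))" by (rule eq[OF True])
      finally show ?thesis .
    qed (use that in \<open>simp add: l\<close>)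
  qed auto
  then show ?case by simp
qed

lemma continuous_map_edge_path:
  "g \<in> carrier G \<Longrightarrow> w \<in> words S \<Longrightarrow> continuous_map euclideanreal K (edge_path G g w)"
  using edge_path_continuous_gen[of K "\<lambda>y. y"] continuous_map_edge_map by blast

text \<open>On the graph the cone extension of \<open>q\<close> is \<open>q\<close> itself.\<close>

lemma cone_extension_edge_path:
  "cone_extension G c q (edge_path G g w u) = q (edge_path G g w u)"
proof -
  have m: "cone_extension G c q (edge_map G g s u) = q (edge_map G g s u)" for g s u
    by (simp add: edge_map_def)
  show ?thesis
  proof (induction w arbitrary: g u)
    case (Cons l w)
    then show ?case by (cases l) (simp add: m)
  qed simp
qed

lemma cone_extension_pcell:
  assumes "g \<in> carrier G" "w \<in> P" "0 \<le> \<rho>" "\<rho> \<le> 1" "0 \<le> x" "x \<le> 1"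
  shows "cone_extension G c q (pcell g w (\<rho>, x)) = (1 - \<rho>) * c g + \<rho> * q (edge_path G g w (real (length w) * x))"
proof -
  consider "\<rho> = 0" | "0 < \<rho>" "\<rho> < 1" | "\<rho> = 1" using assms by linarith
  then show ?thesis
  proof cases
    case 1
    then show ?thesis by (simp add: pcell_inner) (simp add: polar_def)
  next
    case 2
    have "edge_path G g w (real (length w) * (Arg2pi (polar (\<rho>, x)) / (2 * pi))) = edge_path G g w (real (length w) * x)"
      using 2 assms by (intro edge_path_Arg2pi) auto
    moreover have "norm (polar (\<rho>, x)) = \<rho>" using 2 by (simp add: norm_polar)
    ultimately show ?thesis using 2 by (simp only: pcell_inner less_imp_le cone_extension.simps)
  next
    case 3
    then show ?thesis using assms by (simp add: pcell_boundary cone_extension_edge_path)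
  qed
qed

lemma continuous_map_cone_extension:
  assumes q: "\<And>g s. g \<in> carrier G \<Longrightarrow> s \<in> S \<Longrightarrow> continuous_on {0..1} (\<lambda>u. q (edge_map G g s u))"
  shows "continuous_map K euclideanreal (cone_extension G c q)"
proof (rule continuous_map_from_K)
  fix g s assume gs: "g \<in> carrier G" "s \<in> S"
  have "cone_extension G c q (edge_map G g s u) = q (edge_map G g s u)" for u by (simp add: edge_map_def)
  then show "continuous_map (top_of_set {0..1}) euclideanreal (\<lambda>u. cone_extension G c q (edge_map G g s u))"
    using q[OF gs] by simp
next
  fix g w assume gw: "g \<in> carrier G" "w \<in> P"
  have w: "w \<in> words S" using gw P_words by blast
  have "continuous_map euclideanreal euclideanreal (\<lambda>u. q (edge_path G g w u))"
    by (rule edge_path_continuous_gen[OF _ gw(1) w]) (simp add: q)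
  then have *: "continuous_on UNIV (\<lambda>u. q (edge_path G g w u))" by simp
  have "continuous_on unit_square (\<lambda>z. (1 - fst z) * c g + fst z * q (edge_path G g w (real (length w) * snd z)))"
    by (intro continuous_intros continuous_on_compose2[OF *]) auto
  then have "continuous_on unit_square (\<lambda>z. cone_extension G c q (pcell g w z))"
    by (rule continuous_on_eq) (use cone_extension_pcell[OF gw] in auto)
  then show "continuous_map (top_of_set unit_square) euclideanreal (\<lambda>z. cone_extension G c q (pcell g w z))"
    by simp
qed

text \<open>A bump function supported in the interior of a 2-cell.\<close>

lemma separate_cell_point:
  assumes "y = CellPoint g0 w0 z0" "norm z0 < 1" "y' \<noteq> y"
  shows "\<exists>f. continuous_map K euclideanreal f \<and> f y \<noteq> (f y' :: real)"
proof -
  define f where "f y = (case y of CellPoint g w z \<Rightarrow> if g = g0 \<and> w = w0 then max 0 (1 - norm z0 - norm (z - z0)) else 0 | _ \<Rightarrow> 0)" for y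
  have f0: "f (edge_map G g s u) = 0" for g s u by (simp add: f_def edge_map_def)
  have f1: "f (edge_path G g w u) = 0" for g w u
  proof (induction w arbitrary: g u)
    case (Cons l w)
    then show ?case by (cases l) (simp add: f0)
  qed (simp add: f_def)
  have "continuous_map K euclideanreal f"
  proof (rule continuous_map_from_K)
    fix g w assume gw: "g \<in> carrier G" "w \<in> P"
    have eq: "f (pcell g w z) = (if g = g0 \<and> w = w0 then max 0 (1 - norm z0 - norm (polar z - z0)) else 0)"
      if "z \<in> unit_square" for z
    proof (cases "fst z = 1")
      case True
      then have "pcell g w z = edge_path G g w (real (length w) * snd z)"
        using pcell_boundary[OF gw, of "snd z"] that by (cases z) auto
      moreover have "norm (polar z) = 1" using norm_polar[of 1 "snd z"] True by (cases z) auto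
      then have "1 - norm z0 - norm (polar z - z0) \<le> 0" using norm_triangle_ineq2[of "polar z" z0] by linarith
      ultimately show ?thesis by (simp add: f1)
    next
      case False
      then show ?thesis using pcell_inner[of "fst z" g w "snd z"] that by (cases z) (auto simp: f_def)
    qed
    have "continuous_on unit_square (\<lambda>z. if g = g0 \<and> w = w0 then max 0 (1 - norm z0 - norm (polar z - z0)) else 0)"
      by (cases "g = g0 \<and> w = w0") (auto intro!: continuous_intros continuous_on_polar)
    then have "continuous_on unit_square (\<lambda>z. f (pcell g w z))"
      by (rule continuous_on_eq) (simp only: eq)
    then show "continuous_map (top_of_set unit_square) euclideanreal (\<lambda>z. f (pcell g w z))" by simp
  qed (simp add: f0)
  moreover have "f y' \<noteq> f y"
  proof (cases y')
    case (CellPoint g w z)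
    then show ?thesis using assms(1,2,3) by (auto simp: f_def max_def)
  qed (use assms in \<open>auto simp: f_def\<close>)
  ultimately show ?thesis by (intro exI[of _ f]) auto
qed

text \<open>A vertex and an interior point of an edge have a tent function on the graph, which extends over the 2-cells. So
  continuous real functions separate points, which gives the Hausdorff property without a description of neighbourhoods.\<close>

lemma separate_points:
  assumes "y \<in> cayley_points G S P" "y' \<in> cayley_points G S P" "y \<noteq> y'"
  shows "\<exists>f. continuous_map K euclideanreal f \<and> f y \<noteq> (f y' :: real)"
proof -
  have vert: ?thesis if "y = Vertex a" "y' = Vertex a'" for a a'
  proof -
    define q where "q y = (case y of Vertex g \<Rightarrow> if g = a then 1 else 0 
      | EdgePoint g s u \<Rightarrow> (1 - u) * (if g = a then 1 else 0) + u * (if g \<otimes> s = a then 1 else 0) | _ \<Rightarrow> 0)" for y :: "'a cayley_point"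
    have eq: "q (edge_map G g s u) = (1 - u) * (if g = a then 1 else 0) + u * (if g \<otimes> s = a then 1 else 0)" 
      if "u \<in> {0..1}" for g s u using that by (auto simp: q_def edge_map_def)
    have "continuous_on {0..1} (\<lambda>u. q (edge_map G g s u))" for g s
      by (rule continuous_on_eq[of _ "\<lambda>u. (1 - u) * (if g = a then 1 else 0) + u * (if g \<otimes> s = a then 1 else 0)"])
         (auto intro!: continuous_intros simp: eq)
    then have "continuous_map K euclideanreal (cone_extension G (\<lambda>_. 0) q)"
      by (intro continuous_map_cone_extension)
    moreover have "cone_extension G (\<lambda>_. 0) q y \<noteq> cone_extension G (\<lambda>_. 0) q y'"
      using that assms(3) by (auto simp: q_def)
    ultimately show ?thesis by blast
  qed
  have edge: "\<exists>f. continuous_map K euclideanreal f \<and> f z \<noteq> (f z' :: real)"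
    if z: "z = EdgePoint a t v" "0 < v" "v < 1" and z': "z' \<noteq> z" "\<And>g w c. z' \<noteq> CellPoint g w c" for z z' a t v
  proof -
    define q where "q y = (case y of EdgePoint g s u \<Rightarrow> if g = a \<and> s = t then max 0 (min v (1 - v) - \<bar>u - v\<bar>) else 0 | _ \<Rightarrow> 0)" 
      for y :: "'a cayley_point"
    have eq: "q (edge_map G g s u) = (if g = a \<and> s = t then max 0 (min v (1 - v) - \<bar>u - v\<bar>) else 0)" 
      if "u \<in> {0..1}" for g s u using that by (auto simp: q_def edge_map_def max_def)
    have "continuous_on {0..1} (\<lambda>u. q (edge_map G g s u))" for g s
      by (rule continuous_on_eq[of _ "\<lambda>u. if g = a \<and> s = t then max 0 (min v (1 - v) - \<bar>u - v\<bar>) else 0"])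
         (cases "g = a \<and> s = t"; auto intro!: continuous_intros simp: eq)+
    then have "continuous_map K euclideanreal (cone_extension G (\<lambda>_. 0) q)"
      by (intro continuous_map_cone_extension)
    moreover have "cone_extension G (\<lambda>_. 0) q z \<noteq> cone_extension G (\<lambda>_. 0) q z'"
    proof (cases z')
      case (EdgePoint g s u)
      then show ?thesis using z z'(1) by (auto simp: q_def max_def min_def)
    qed (use z z'(2) in \<open>auto simp: q_def\<close>)
    ultimately show ?thesis by blast
  qed
  have edge_in: "0 < v \<and> v < 1" if "EdgePoint a t v \<in> cayley_points G S P" for a t v
    using that by (auto simp: cayley_points_def)
  have cell_in: "norm z < 1" if "CellPoint g w z \<in> cayley_points G S P" for g w z
    using that by (auto simp: cayley_points_def)
  show ?thesis
  proof (cases y)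
    case (CellPoint g w z)
    then show ?thesis using separate_cell_point[OF CellPoint cell_in] assms by auto
  next
    case y: (EdgePoint a t v)
    show ?thesis
    proof (cases y')
      case (CellPoint g w z)
      have "y \<noteq> y'" by fact
      then show ?thesis using separate_cell_point[OF CellPoint cell_in[of g w z]] assms CellPoint by metis
    qed (use edge[OF y, of y'] edge_in y assms in auto)
  next
    case y: (Vertex a)
    show ?thesis
    proof (cases y')
      case (CellPoint g w z)
      have "y \<noteq> y'" by fact
      then show ?thesis using separate_cell_point[OF CellPoint cell_in[of g w z]] assms CellPoint by metis
    next
      case y': (EdgePoint a t v)
      have "\<exists>f. continuous_map K euclideanreal f \<and> f y' \<noteq> (f y :: real)"
        using edge[OF y', of y] edge_in[of a t v] y y' assms by auto
      then show ?thesis by metis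
    qed (use vert y in auto)
  qed
qed

lemma Hausdorff_K: "Hausdorff_space K"
  unfolding Hausdorff_space_def
proof (intro allI impI, elim conjE)
  fix x y assume "x \<in> topspace K" "y \<in> topspace K" "x \<noteq> y"
  then obtain f :: "_ \<Rightarrow> real" where f: "continuous_map K euclideanreal f" "f x \<noteq> f y"
    using separate_points[of x y] by (auto simp: topspace_K)
  obtain U V where UV: "open U" "open V" "f x \<in> U" "f y \<in> V" "U \<inter> V = {}"
    using hausdorff[OF f(2)] by blast
  have "openin K {z \<in> topspace K. f z \<in> U}" "openin K {z \<in> topspace K. f z \<in> V}"
    using f(1) UV(1,2) by (auto intro: openin_continuous_map_preimage)
  then show "\<exists>U V. openin K U \<and> openin K V \<and> x \<in> U \<and> y \<in> V \<and> disjnt U V"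
    using UV \<open>x \<in> topspace K\<close> \<open>y \<in> topspace K\<close>
    by (intro exI[of _ "{z \<in> topspace K. f z \<in> U}"] exI[of _ "{z \<in> topspace K. f z \<in> V}"]) (auto simp: disjnt_def)
qed

lemma base_edge_map: "base (edge_map G g s u) \<in> {g, g \<otimes> s}"
  by (simp add: edge_map_def)

text \<open>The vertices of the closed cell that contains \<open>y\<close> in its interior.\<close>

definition cell_verts :: "'a cayley_point \<Rightarrow> 'a set" where
  "cell_verts y = (case y of Vertex g \<Rightarrow> {g} | EdgePoint g s u \<Rightarrow> {g, g \<otimes> s} | CellPoint g w z \<Rightarrow> pverts g w)"

lemma base_in_cell_verts: "base y \<in> cell_verts y"
  by (cases y) (auto simp: cell_verts_def)

lemma cell_verts_edge_map: "cell_verts (edge_map G g s u) \<subseteq> {g, g \<otimes> s}"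
  by (simp add: edge_map_def cell_verts_def)

lemma cell_verts_edge_path:
  "g \<in> carrier G \<Longrightarrow> w \<in> words S \<Longrightarrow> cell_verts (edge_path G g w u) \<subseteq> pverts g w"
proof (induction w arbitrary: g u)
  case Nil
  then show ?case by (simp add: cell_verts_def)
next
  case (Cons l w)
  then obtain s b where l: "l = (s, b)" "s \<in> S" "s \<in> carrier G" using S_carrier by (cases l) auto
  have m: "{g, g \<otimes> lval l} \<subseteq> pverts g (l # w)" by simp
  have "cell_verts (edge_map G g s u) \<subseteq> {g, g \<otimes> s}" "cell_verts (edge_map G (g \<otimes> inv s) s (1 - u)) \<subseteq> {g \<otimes> inv s, g}"
    using cell_verts_edge_map[of g s u] cell_verts_edge_map[of "g \<otimes> inv s" s "1 - u"] l Cons.prems by (auto simp: m_assoc)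
  moreover have "cell_verts (edge_path G (g \<otimes> lval l) w (u - 1)) \<subseteq> pverts (g \<otimes> lval l) w"
    using Cons l by (intro Cons.IH) auto
  ultimately show ?case using m l by (cases b) (auto simp: letter_val_def)
qed

lemma cell_verts_cell_map:
  assumes "g \<in> carrier G" "w \<in> P" shows "cell_verts (cell_map G g w z) \<subseteq> pverts g w"
proof (cases "norm z < 1")
  case False
  then show ?thesis using assms P_words by (auto simp: cell_map_def dest: subsetD[OF cell_verts_edge_path])
qed (simp add: cell_map_def cell_verts_def)

text \<open>The full subcomplex spanned by \<open>V\<close>. All fillings are controlled by the vertices they may touch.\<close>

definition full :: "'a set \<Rightarrow> 'a cayley_point set" where
  "full V = {y \<in> cayley_points G S P. cell_verts y \<subseteq> V}"

lemma full_mono: "V \<subseteq> W \<Longrightarrow> full V \<subseteq> full W"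
  by (auto simp: full_def)

lemma edge_path_full:
  "g \<in> carrier G \<Longrightarrow> w \<in> words S \<Longrightarrow> pverts g w \<subseteq> V \<Longrightarrow> edge_path G g w u \<in> full V"
  using cell_verts_edge_path[of g w u] edge_path_in_points[OF is_group S_carrier, of g w u P]
  by (auto simp: full_def)

lemma cell_map_full: "g \<in> carrier G \<Longrightarrow> w \<in> P \<Longrightarrow> pverts g w \<subseteq> V \<Longrightarrow> cell_map G g w z \<in> full V"
  using cell_verts_cell_map[of g w z] cell_map_points[of g w z] by (auto simp: full_def)

lemma edge_map_full: "g \<in> carrier G \<Longrightarrow> s \<in> S \<Longrightarrow> {g, g \<otimes> s} \<subseteq> V \<Longrightarrow> edge_map G g s u \<in> full V"
  using cell_verts_edge_map[of g s u] by (auto simp: full_def)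

text \<open>Choosing one point over each base vertex gives a closed discrete set, since every closed cell
  contains points over finitely many vertices only.\<close>

lemma compactin_finite_base:
  assumes C: "compactin K C" shows "finite (base ` C)"
proof (rule ccontr)
  assume inf: "infinite (base ` C)"
  define D where "D = (\<lambda>g. SOME y. y \<in> C \<and> base y = g) ` base ` C"
  have D: "y \<in> C \<and> base y = g" if "g \<in> base ` C" "y = (SOME y. y \<in> C \<and> base y = g)" for y g
    unfolding that(2) by (rule someI_ex) (use that(1) in blast)
  have DC: "D \<subseteq> C" and inj: "inj_on base D" and img: "base ` D = base ` C"
    unfolding D_def inj_on_def using D by (auto simp: image_iff)
  have "infinite D" using inf img by (metis finite_imageI)
  have CK: "C \<subseteq> cayley_points G S P" using compactin_subset_topspace[OF C] by (simp add: topspace_K)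
  have closed: "closedin K D'" if D': "D' \<subseteq> D" for D'
  proof (rule closedin_K_I)
    show "D' \<subseteq> cayley_points G S P" using D' DC CK by blast
    have fin: "closedin K (D' \<inter> {y. base y \<in> F})" if F: "finite F" for F
    proof -
      have "finite (D' \<inter> {y. base y \<in> F})"
        by (rule inj_on_finite[of base _ F]) (use inj D' F in \<open>auto intro: inj_on_subset\<close>)
      then show ?thesis
        by (rule closedin_Hausdorff_finite[OF Hausdorff_K, rotated]) (use D' DC CK in \<open>auto simp: topspace_K\<close>)
    qed
    show "closedin (top_of_set {0..1}) {u \<in> {0..1}. edge_map G g s u \<in> D'}" if gs: "g \<in> carrier G" "s \<in> S" for g s
    proof -
      have "closedin (top_of_set {0..1}) {u \<in> topspace (top_of_set {0..1}). edge_map G g s u \<in> D' \<inter> {y. base y \<in> {g, g \<otimes> s}}}"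
        by (rule closedin_continuous_map_preimage[OF continuous_map_edge_map[OF gs] fin]) simp
      moreover have "{u \<in> topspace (top_of_set {0..1}). edge_map G g s u \<in> D' \<inter> {y. base y \<in> {g, g \<otimes> s}}} = {u \<in> {0..1}. edge_map G g s u \<in> D'}"
        using base_edge_map[of g s] by auto
      ultimately show ?thesis by simp
    qed
    show "closedin (top_of_set unit_square) {z \<in> unit_square. pcell g w z \<in> D'}" if gw: "g \<in> carrier G" "w \<in> P" for g w
    proof -
      have "closedin (top_of_set unit_square) {u \<in> topspace (top_of_set unit_square). pcell g w u \<in> D' \<inter> {y. base y \<in> pverts g w}}"
        by (rule closedin_continuous_map_preimage[OF continuous_map_pcell[OF gw] fin]) simp
      moreover have "base (pcell g w z) \<in> pverts g w" for z
        using cell_verts_cell_map[OF gw] base_in_cell_verts by (auto simp: pcell_def)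
      then have "{u \<in> topspace (top_of_set unit_square). pcell g w u \<in> D' \<inter> {y. base y \<in> pverts g w}} = {z \<in> unit_square. pcell g w z \<in> D'}"
        by (simp only: topspace_euclidean_subtopology Int_iff mem_Collect_eq simp_thms)
      ultimately show ?thesis by (simp only:)
    qed
  qed
  obtain x where x: "x \<in> C" "x \<in> K derived_set_of D"
    using compactin_imp_Bolzano_Weierstrass[OF C, of D] \<open>infinite D\<close> DC by blast
  have o: "openin K (topspace K - (D - {x}))" using closed[of "D - {x}"] by (simp add: closedin_def)
  have m: "x \<in> topspace K - (D - {x})" using x(1) CK topspace_K by auto
  have "\<forall>T. x \<in> T \<and> openin K T \<longrightarrow> (\<exists>y. y \<noteq> x \<and> y \<in> D \<and> y \<in> T)"
    using x(2) by (simp add: derived_set_of_def)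
  from this[rule_format, OF conjI[OF m o]] show False by auto
qed

text \<open>All points over a finite set of vertices lie in a finite, hence compact, subcomplex.\<close>

lemma compactin_over_finite:
  assumes F: "finite F" "F \<subseteq> carrier G"
  obtains C where "compactin K C" "{y \<in> cayley_points G S P. base y \<in> F} \<subseteq> C"
proof -
  define C where "C = (\<Union>(g, s)\<in>F \<times> S. edge_map G g s ` {0..1}) \<union> (\<Union>(g, w)\<in>F \<times> P. cell_map G g w ` cball 0 1)"
  have e: "compactin K (edge_map G g s ` {0..1})" if "(g, s) \<in> F \<times> S" for g s
    using that F(2) by (intro image_compactin[OF _ continuous_map_edge_map]) (auto simp: compactin_subtopology)
  have c: "compactin K (cell_map G g w ` cball 0 1)" if "(g, w) \<in> F \<times> P" for g w
    using that F(2) by (intro image_compactin[OF _ continuous_map_cell_map]) (auto simp: compactin_subtopology)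
  have "compactin K C"
    unfolding C_def using F(1) finite_S finite_P e c
    by (intro compactin_Un compactin_Union) (auto split: prod.splits)
  moreover have "y \<in> C" if "y \<in> cayley_points G S P" "base y \<in> F" for y
  proof -
    obtain s0 where s0: "s0 \<in> S" using S_nonempty by blast
    show ?thesis
    proof (cases y)
      case (Vertex g)
      then have "y = edge_map G g s0 0" "g \<in> F" "0 \<in> {0..1::real}" using that by auto
      then have "y \<in> edge_map G g s0 ` {0..1}" by (intro image_eqI[of _ _ "0::real"])
      then show ?thesis unfolding C_def using s0 \<open>g \<in> F\<close> by (intro UnI1 UN_I[of "(g, s0)"]) auto
    next
      case (EdgePoint g s u)
      then have "y = edge_map G g s u" "g \<in> F" "s \<in> S" "u \<in> {0..1}" using that by (auto simp: cayley_points_def edge_map_def)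
      then show ?thesis unfolding C_def by (intro UnI1 UN_I[of "(g, s)"]) auto
    next
      case (CellPoint g w z)
      then have "y = cell_map G g w z" "g \<in> F" "w \<in> P" "z \<in> cball 0 1" using that by (auto simp: cayley_points_def cell_map_def)
      then show ?thesis unfolding C_def by (intro UnI2 UN_I[of "(g, w)"]) auto
    qed
  qed
  ultimately show thesis by (intro that[of C]) auto
qed

section \<open>Homotopies of edge paths\<close>

definition epath :: "'a \<Rightarrow> 'a word \<Rightarrow> real \<Rightarrow> 'a cayley_point" where
  "epath g w x = edge_path G g w (real (length w) * x)"

abbreviation KV :: "'a set \<Rightarrow> 'a cayley_point topology" where
  "KV V \<equiv> subtopology K (full V)"

lemma epath_ends [simp]:
  assumes "g \<in> carrier G" "w \<in> words S"
  shows "epath g w 0 = Vertex g" "epath g w 1 = Vertex (g \<otimes> val w)"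
  using assms by (simp_all add: epath_def)

lemma epath_Nil [simp]: "epath g [] x = Vertex g"
  by (simp add: epath_def)

lemma pathin_KV:
  assumes "pathin K p" "\<And>x. 0 \<le> x \<Longrightarrow> x \<le> 1 \<Longrightarrow> p x \<in> full V" shows "pathin (KV V) p"
  using assms unfolding pathin_def by (auto simp: continuous_map_in_subtopology)

lemma pathin_epath:
  assumes "g \<in> carrier G" "w \<in> words S" "pverts g w \<subseteq> V" shows "pathin (KV V) (epath g w)"
proof (rule pathin_KV)
  have "continuous_map (top_of_set UNIV) K (edge_path G g w)"
    using continuous_map_edge_path[OF assms(1,2)] by simp
  then show "pathin K (epath g w)"
    unfolding pathin_def epath_def by (rule continuous_map_compose_on) (auto intro!: continuous_intros)
  show "epath g w x \<in> full V" for x unfolding epath_def by (rule edge_path_full[OF assms])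
qed

lemma continuous_map_edge_path_full:
  assumes "g \<in> carrier G" "w \<in> words S" "pverts g w \<subseteq> V"
  shows "continuous_map (top_of_set A) (KV V) (edge_path G g w)"
proof -
  have "continuous_map (top_of_set UNIV) K (edge_path G g w)"
    using continuous_map_edge_path[OF assms(1,2)] by simp
  then have "continuous_map (top_of_set A) K (\<lambda>x. edge_path G g w x)"
    by (rule continuous_map_compose_on) (auto intro!: continuous_intros)
  then show ?thesis using edge_path_full[OF assms] by (auto simp: continuous_map_in_subtopology)
qed

lemma epath_append:
  assumes g: "g \<in> carrier G" and u: "u \<in> words S" "pverts g u \<subseteq> V" and v: "v \<in> words S" "pverts (g \<otimes> val u) v \<subseteq> V"
  shows "path_homotopic (KV V) (epath g (u @ v)) (path_join (epath g u) (epath (g \<otimes> val u) v))"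
proof -
  let ?n = "real (length u)" and ?m = "real (length v)"
  let ?f = "edge_path G g (u @ v)"
  let ?\<beta> = "\<lambda>x. ?n * min (2 * x) 1 + ?m * max 0 (2 * x - 1)"
  have "path_homotopic (KV V) (\<lambda>x. ?f ((?n + ?m) * x)) (\<lambda>x. ?f (?\<beta> x))"
    by (rule path_homotopic_factor[of UNIV])
       (use assms in \<open>auto intro!: continuous_intros continuous_map_edge_path_full[of _ _ _ UNIV, simplified] simp: path_verts_append\<close>)
  then show ?thesis
  proof (rule path_homotopic_cong)
    show "?f ((?n + ?m) * x) = epath g (u @ v) x" for x by (simp add: epath_def)
    fix x :: real assume x: "0 \<le> x" "x \<le> 1"
    show "?f (?\<beta> x) = path_join (epath g u) (epath (g \<otimes> val u) v) x"
    proof (cases "x \<le> 1/2")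
      case True
      then have \<beta>: "?\<beta> x = ?n * (2 * x)" by simp
      have "?n * (2 * x) \<le> ?n * 1" using True by (intro mult_left_mono) auto
      then have "?f (?n * (2 * x)) = edge_path G g u (?n * (2 * x))" using assms by (simp add: edge_path_append)
      then show ?thesis using True unfolding \<beta> by (simp add: path_join_def epath_def)
    next
      case False
      then have \<beta>: "?\<beta> x = ?n + ?m * (2 * x - 1)" by simp
      have "?f (?n + ?m * (2 * x - 1)) = edge_path G (g \<otimes> val u) v (?m * (2 * x - 1))"
      proof (cases "v = []")
        case True
        then show ?thesis using assms by simp
      next
        case v': False
        then have "0 < ?m * (2 * x - 1)" using False by simp
        then show ?thesis using assms by (simp add: edge_path_append)
      qed
      then show ?thesis using False unfolding \<beta> by (simp add: path_join_def epath_def)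
    qed
  qed
qed

text \<open>Two edge paths from \<open>g\<close> that are homotopic rel endpoints inside the full subcomplex on \<open>V\<close>.\<close>

definition ehom :: "'a set \<Rightarrow> 'a \<Rightarrow> 'a word \<Rightarrow> 'a word \<Rightarrow> bool" where
  "ehom V g u v \<longleftrightarrow> g \<in> carrier G \<and> u \<in> words S \<and> v \<in> words S \<and> pverts g u \<subseteq> V \<and> pverts g v \<subseteq> V \<and>
     path_homotopic (KV V) (epath g u) (epath g v)"

lemma ehomD:
  assumes "ehom V g u v"
  shows "g \<in> carrier G" "u \<in> words S" "v \<in> words S" "pverts g u \<subseteq> V" "pverts g v \<subseteq> V"
    "path_homotopic (KV V) (epath g u) (epath g v)"
  using assms by (auto simp: ehom_def)

lemma ehom_val: assumes "ehom V g u v" shows "val u = val v"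
proof -
  have "g \<otimes> val u = g \<otimes> val v"
    using path_homotopic_ends(2)[OF ehomD(6)[OF assms]] ehomD(1-3)[OF assms] by simp
  then show ?thesis using ehomD(1-3)[OF assms] by simp
qed

lemma ehom_refl: "g \<in> carrier G \<Longrightarrow> u \<in> words S \<Longrightarrow> pverts g u \<subseteq> V \<Longrightarrow> ehom V g u u"
  by (simp add: ehom_def path_homotopic_refl pathin_epath)

lemma ehom_sym: "ehom V g u v \<Longrightarrow> ehom V g v u"
  by (auto simp: ehom_def path_homotopic_sym)

lemma ehom_trans [trans]: "ehom V g u v \<Longrightarrow> ehom V g v w \<Longrightarrow> ehom V g u w"
  unfolding ehom_def using path_homotopic_trans by blast

lemma ehom_mono: "ehom V g u v \<Longrightarrow> V \<subseteq> W \<Longrightarrow> ehom W g u v"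
  unfolding ehom_def using path_homotopic_subtopology_mono full_mono by (meson order_trans)

lemma ehom_append:
  assumes u: "ehom V g u u'" and v: "ehom V (g \<otimes> val u) v v'"
  shows "ehom V g (u @ v) (u' @ v')"
proof -
  note U = ehomD[OF u] and W = ehomD[OF v]
  have e: "val u' = val u" using ehom_val[OF u] by simp
  have "path_homotopic (KV V) (epath g (u @ v)) (path_join (epath g u) (epath (g \<otimes> val u) v))"
    using U W by (intro epath_append)
  also have "path_homotopic (KV V) \<dots> (path_join (epath g u') (epath (g \<otimes> val u') v'))"
    using U W e by (intro path_homotopic_join) auto
  also have "path_homotopic (KV V) \<dots> (epath g (u' @ v'))"
    using U W e by (intro path_homotopic_sym[OF epath_append]) auto
  finally show ?thesis using U W e by (simp add: ehom_def path_verts_append)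
qed

text \<open>A backtrack along one edge retracts to its start.\<close>

lemma ehom_cancel_letter:
  assumes g: "g \<in> carrier G" and l: "fst l \<in> S" and V: "{g, g \<otimes> lval l} \<subseteq> V"
  shows "ehom V g [l, (fst l, \<not> snd l)] []"
proof -
  obtain s b where sb: "l = (s, b)" by (cases l)
  have s: "s \<in> S" "s \<in> carrier G" using l sb S_carrier by auto
  let ?f = "edge_path G g [l]"
  have "path_homotopic (KV V) (\<lambda>x. ?f (1 - \<bar>2 * x - 1\<bar>)) (\<lambda>x. ?f 0)"
    by (rule path_homotopic_factor[of UNIV])
       (use assms in \<open>auto intro!: continuous_intros continuous_map_edge_path_full[of _ _ _ UNIV, simplified]\<close>)
  then have "path_homotopic (KV V) (epath g [l, (fst l, \<not> snd l)]) (epath g [])"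
  proof (rule path_homotopic_cong)
    show "?f 0 = epath g [] x" for x using g l by simp
    show "?f (1 - \<bar>2 * x - 1\<bar>) = epath g [l, (fst l, \<not> snd l)] x" if "0 \<le> x" "x \<le> 1" for x
      using that s g unfolding epath_def sb by (auto simp: letter_val_def m_assoc)
  qed
  then show ?thesis using assms S_carrier by (auto simp: ehom_def lval_flip m_assoc)
qed

lemma ehom_cancel:
  assumes "g \<in> carrier G" "w \<in> words S" "pverts g w \<subseteq> V"
  shows "ehom V g (w @ inv_word w) []"
  using assms
proof (induction w arbitrary: g)
  case Nil
  then show ?case by (simp add: ehom_refl)
next
  case (Cons l w)
  let ?h = "g \<otimes> lval l" and ?l = "(fst l, \<not> snd l)"
  have l: "fst l \<in> S" and w: "w \<in> words S" and h: "?h \<in> carrier G" and V: "pverts ?h w \<subseteq> V" "g \<in> V" "?h \<in> V"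
    using Cons.prems by (auto dest: subsetD[OF _ start_in_path_verts])
  have hl: "?h \<otimes> lval ?l = g" using l Cons.prems(1) by (simp add: lval_flip m_assoc)
  have "ehom V g ([l] @ ((w @ inv_word w) @ [?l])) ([l] @ ([] @ [?l]))"
    using Cons.IH[OF h w V(1)] h w l V Cons.prems(1) hl
    by (intro ehom_append ehom_refl) (auto simp: m_assoc)
  also have "ehom V g ([l] @ ([] @ [?l])) []"
    using ehom_cancel_letter[OF Cons.prems(1) l, of V] V by simp
  finally show ?case by simp
qed

lemma ehom_cancel':
  assumes "g \<in> carrier G" "w \<in> words S" "pverts g (inv_word w) \<subseteq> V"
  shows "ehom V g (inv_word w @ w) []"
  using ehom_cancel[of g "inv_word w" V] assms by simp

lemma ehom_relator:
  assumes g: "g \<in> carrier G" and w: "w \<in> P" and V: "pverts g w \<subseteq> V"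
  shows "ehom V g w []"
proof -
  have f: "continuous_map (top_of_set (cball 0 1)) (KV V) (cell_map G g w)"
    using continuous_map_cell_map[OF g w] cell_map_full[OF g w V] by (auto simp: continuous_map_in_subtopology)
  have "path_homotopic (KV V) (\<lambda>x. cell_map G g w (polar (1, x))) (\<lambda>x. cell_map G g w (polar (1, 0)))"
    by (rule path_homotopic_factor[OF _ f])
       (auto simp: norm_polar polar_1 intro!: continuous_on_compose2[OF continuous_on_polar[of UNIV]] continuous_intros)
  then have "path_homotopic (KV V) (epath g w) (epath g [])"
  proof (rule path_homotopic_cong)
    show "cell_map G g w (polar (1, x)) = epath g w x" if "0 \<le> x" "x \<le> 1" for x
      using pcell_boundary[OF g w that] by (simp add: pcell_def epath_def)
    show "cell_map G g w (polar (1, 0)) = epath g [] x" for x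
      using pcell_boundary[OF g w, of 0] g w P_words by (auto simp: pcell_def)
  qed
  then show ?thesis using assms P_words by (auto simp: ehom_def dest: subsetD[OF _ start_in_path_verts])
qed

text \<open>If \<open>u v\<^sup>-\<^sup>1\<close> is a relator, its 2-cell slides \<open>u\<close> over to \<open>v\<close>.\<close>

lemma ehom_of_relator:
  assumes g: "g \<in> carrier G" and u: "u \<in> words S" "pverts g u \<subseteq> V" and v: "v \<in> words S" "pverts g v \<subseteq> V"
    and P: "u @ inv_word v \<in> P"
  shows "ehom V g u v"
proof -
  have "val u \<otimes> inv (val v) = \<one>" using P_val[OF P] u v by simp
  then have e: "val u = val v" using u v by (metis inv_closed inv_inv inv_equality val_closed)
  have V: "pverts (g \<otimes> val u) (inv_word v) \<subseteq> V" using path_verts_inv_word[of g v] g v e by simp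
  have c: "g \<otimes> val u \<in> carrier G" using g u by simp
  have "ehom V g (u @ []) (u @ (inv_word v @ v))"
    using ehom_append[OF ehom_refl[OF g u] ehom_sym[OF ehom_cancel'[OF c v(1) V]]] .
  then have "ehom V g u ((u @ inv_word v) @ v)" by simp
  also have "ehom V g \<dots> ([] @ v)"
    using g u v V e by (intro ehom_append ehom_relator[OF _ P] ehom_refl) (auto simp: path_verts_append m_assoc r_inv)
  finally show ?thesis by simp
qed

end

section \<open>Contractible stars\<close>

lemma continuous_on_locally_constant:
  fixes f :: "'b::metric_space \<Rightarrow> real"
  assumes "\<And>x. x \<in> A \<Longrightarrow> \<exists>d>0. \<forall>y\<in>A. dist y x < d \<longrightarrow> f y = f x"
  shows "continuous_on A f"
  unfolding continuous_on_iff using assms by (metis dist_self)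

lemma words_take [simp]: "w \<in> words X \<Longrightarrow> take k w \<in> words X"
  and words_drop [simp]: "w \<in> words X \<Longrightarrow> drop k w \<in> words X"
  using words_simps(3)[of "take k w" "drop k w" X] by simp_all

lemma continuous_on_path_join:
  fixes p q :: "real \<Rightarrow> 'b::topological_space"
  assumes "continuous_on {0..1} p" "continuous_on {0..1} q" "p 1 = q 0"
  shows "continuous_on {0..1} (path_join p q)"
  using pathin_join[of euclidean p q] assms by (simp add: pathin_def)

context cayley begin

lemma edge_map_KV:
  assumes "g \<in> carrier G" "s \<in> S" "{g, g \<otimes> s} \<subseteq> V"
  shows "continuous_map (top_of_set {0..1}) (KV V) (edge_map G g s)"
  using continuous_map_edge_map[OF assms(1,2)] edge_map_full[OF assms] by (auto simp: continuous_map_in_subtopology)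

lemma cell_map_KV:
  assumes "g \<in> carrier G" "w \<in> P" "pverts g w \<subseteq> V"
  shows "continuous_map (top_of_set (cball 0 1)) (KV V) (cell_map G g w)"
  using continuous_map_cell_map[OF assms(1,2)] cell_map_full[OF assms] by (auto simp: continuous_map_in_subtopology)

text \<open>A path inside the closed cell of \<open>y\<close> from \<open>y\<close> to its base vertex, by which arbitrary points
  are compared with vertices.\<close>

definition base_path :: "'a cayley_point \<Rightarrow> real \<Rightarrow> 'a cayley_point" where
  "base_path y x = (case y of Vertex g \<Rightarrow> Vertex g
     | EdgePoint g s u \<Rightarrow> edge_map G g s ((1 - x) * u)
     | CellPoint g w z \<Rightarrow> cell_map G g w ((1 - x) *\<^sub>R z + x *\<^sub>R 1))"

lemma cell_map_1:
  assumes "g \<in> carrier G" "w \<in> P" shows "cell_map G g w 1 = Vertex g"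
proof -
  have "polar (1, 0) = 1" by (simp add: polar_def)
  then show ?thesis
    using pcell_boundary[OF assms, of 0] assms P_words by (auto simp: pcell_def)
qed

lemma point_cases:
  assumes "y \<in> cayley_points G S P"
  obtains g where "y = Vertex g" "g \<in> carrier G"
  | g s u where "y = EdgePoint g s u" "g \<in> carrier G" "s \<in> S" "0 < u" "u < 1"
  | g w z where "y = CellPoint g w z" "g \<in> carrier G" "w \<in> P" "norm z < 1"
  using assms unfolding cayley_points_def by blast

lemma base_path_ends:
  assumes "y \<in> cayley_points G S P"
  shows "base_path y 0 = y" "base_path y 1 = Vertex (base y)"
proof -
  show "base_path y 0 = y" using assms
    by (cases rule: point_cases) (simp_all add: base_path_def edge_map_def cell_map_def)
  show "base_path y 1 = Vertex (base y)" using assms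
    by (cases rule: point_cases) (simp_all add: base_path_def cell_map_1)
qed

lemma base_path_cell:
  assumes "norm z < 1" "0 \<le> x" "x \<le> 1" shows "(1 - x) *\<^sub>R z + x *\<^sub>R (1::complex) \<in> cball 0 1"
  using convexD[OF convex_cball, of z 0 1 1 "1 - x" x] assms by auto

lemma pathin_base_path:
  assumes y: "y \<in> cayley_points G S P" and V: "cell_verts y \<subseteq> V"
  shows "pathin (KV V) (base_path y)"
  using y
proof (cases rule: point_cases)
  case (1 g)
  then show ?thesis using y V by (simp add: base_path_def[abs_def] pathin_def continuous_map_const full_def topspace_K)
next
  case (2 g s u)
  have "(1 - x) * u \<in> {0..1}" if "x \<in> {0..1}" for x
    using that 2 mult_mono[of "1 - x" 1 u 1] by auto
  then show ?thesis
    using 2 V unfolding pathin_def base_path_def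
    by (auto intro!: continuous_map_compose_on[OF edge_map_KV] continuous_intros simp: cell_verts_def)
next
  case (3 g w z)
  then show ?thesis
    using V base_path_cell unfolding pathin_def base_path_def
    by (auto intro!: continuous_map_compose_on[OF cell_map_KV] continuous_intros simp: cell_verts_def simp del: mem_cball)
qed

text \<open>Contractible open sets whose contraction moves every point inside its closed cell, to a common vertex.\<close>

definition contracts :: "'a cayley_point set \<Rightarrow> 'a \<Rightarrow> ('a cayley_point \<times> real \<Rightarrow> 'a cayley_point) \<Rightarrow> bool" where
  "contracts U g H \<longleftrightarrow> openin K U \<and>
    continuous_map (prod_topology (subtopology K U) (top_of_set {0..1})) K H \<and>
    (\<forall>y\<in>U. H (y, 0) = y \<and> H (y, 1) = Vertex g \<and> (\<forall>t\<in>{0..1}. H (y, t) \<in> full (cell_verts y)) \<and>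
      (\<exists>u\<in>words S. pverts (base y) u \<subseteq> cell_verts y \<and>
        path_homotopic (KV (cell_verts y)) (\<lambda>t. H (y, t)) (path_join (base_path y) (epath (base y) u))))"

lemma base_path_const_right:
  assumes "y \<in> cayley_points G S P"
  shows "path_homotopic (KV (cell_verts y)) (base_path y) (path_join (base_path y) (epath (base y) []))"
proof -
  have "path_homotopic (KV (cell_verts y)) (path_join (base_path y) (\<lambda>_. base_path y 1)) (base_path y)"
    by (rule path_homotopic_const_right[OF pathin_base_path[OF assms order_refl]])
  then show ?thesis by (simp add: base_path_ends[OF assms] epath_def[abs_def] path_homotopic_sym)
qed

text \<open>The straight segments to the boundary point \<open>1\<close> of the disc are the base paths themselves.\<close>

lemma contracts_open_cell:
  assumes a: "a \<in> carrier G" and w: "w \<in> P"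
  shows "contracts {CellPoint a w z | z. norm z < 1} a (\<lambda>(y, t). base_path y t)"
    (is "contracts ?U a ?H")
proof -
  have edge: "edge_map G g s u \<notin> ?U" for g s u by (simp add: edge_map_def)
  have path: "edge_path G g v u \<notin> ?U" for g v u
  proof (induction v arbitrary: g u)
    case (Cons l v)
    then show ?case using edge by (cases l) (auto simp del: edge_map_def)
  qed simp
  have cell: "pcell g v z \<in> ?U \<longleftrightarrow> g = a \<and> v = w \<and> fst z < 1" if "g \<in> carrier G" "v \<in> P" "z \<in> unit_square" for g v z
  proof (cases "fst z < 1")
    case True
    then show ?thesis using that pcell_inner[of "fst z" g v "snd z"] norm_polar[of "fst z" "snd z"] by (cases z) auto
  next
    case False
    then have "pcell g v z = edge_path G g v (real (length v) * snd z)"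
      using that pcell_boundary[of g v "snd z"] by (cases z) auto
    then show ?thesis using path False by auto
  qed
  have pt: "y \<in> cayley_points G S P" "base y = a" if "y \<in> ?U" for y
    using that a w by (auto simp: cayley_points_def)
  have U: "openin K ?U"
    unfolding openin_K_iff
  proof (intro conjI ballI)
    show "?U \<subseteq> cayley_points G S P" using pt by blast
    show "openin (top_of_set {0..1}) {u \<in> {0..1}. edge_map G g s u \<in> ?U}" for g s
    proof -
      have "{u \<in> {0..1}. edge_map G g s u \<in> ?U} = {}" using edge by blast
      then show ?thesis by (simp only: openin_empty)
    qed
    show "openin (top_of_set unit_square) {z \<in> unit_square. pcell g v z \<in> ?U}" if "g \<in> carrier G" "v \<in> P" for g v
    proof -
      have "{z \<in> unit_square. pcell g v z \<in> ?U} = unit_square \<inter> (if g = a \<and> v = w then {z. fst z < 1} else {})"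
        using cell[OF that] by auto
      moreover have "open {z :: real \<times> real. fst z < 1}" by (intro open_Collect_less continuous_intros)
      ultimately show ?thesis by (auto intro: openin_open_Int)
    qed
  qed
  have "continuous_map (prod_topology (subtopology K ?U) (top_of_set {0..1})) K ?H"
  proof (rule continuous_map_homotopy_from_K[OF U])
    show "continuous_map (top_of_set ({u \<in> {0..1}. edge_map G g s u \<in> ?U} \<times> {0..1})) K (\<lambda>z. ?H (edge_map G g s (fst z), snd z))" for g s
    proof -
      have "{u \<in> {0..1}. edge_map G g s u \<in> ?U} = {}" using edge by blast
      then show ?thesis by (simp only:) simp
    qed
    fix g v assume gv: "g \<in> carrier G" "v \<in> P"
    show "continuous_map (top_of_set ({z \<in> unit_square. pcell g v z \<in> ?U} \<times> {0..1})) K (\<lambda>z. ?H (pcell g v (fst z), snd z))"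
    proof (cases "g = a \<and> v = w")
      case True
      let ?A = "{z \<in> unit_square. pcell g v z \<in> ?U} \<times> {0..1::real}"
      have in1: "norm (polar (fst z)) < 1" "pcell g v (fst z) = CellPoint a w (polar (fst z))" "0 \<le> snd z" "snd z \<le> 1"
        if z: "z \<in> ?A" for z
      proof -
        obtain \<rho> x t where z': "z = ((\<rho>, x), t)" by (metis surj_pair)
        have zz: "(\<rho>, x) \<in> unit_square" "pcell g v (\<rho>, x) \<in> ?U" "0 \<le> t" "t \<le> 1"
          using z unfolding z' by simp_all
        then have "0 \<le> \<rho>" "\<rho> < 1" using cell[OF gv zz(1)] by (simp_all only: fst_conv) simp
        then show "norm (polar (fst z)) < 1" "pcell g v (fst z) = CellPoint a w (polar (fst z))" "0 \<le> snd z" "snd z \<le> 1"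
          using pcell_inner[of \<rho> g v x] norm_polar[of \<rho> x] True zz(3,4) by (simp_all only: z' fst_conv snd_conv)
      qed
      have "continuous_map (top_of_set ?A) K (\<lambda>z. cell_map G a w ((1 - snd z) *\<^sub>R polar (fst z) + snd z *\<^sub>R 1))"
      proof (rule continuous_map_compose_on[OF continuous_map_cell_map[OF a w]])
        show "continuous_on ?A (\<lambda>z. (1 - snd z) *\<^sub>R polar (fst z) + snd z *\<^sub>R 1)"
          by (intro continuous_intros continuous_on_compose2[OF continuous_on_polar[of UNIV]]) auto
        show "(1 - snd z) *\<^sub>R polar (fst z) + snd z *\<^sub>R 1 \<in> cball 0 1" if "z \<in> ?A" for z
          by (rule base_path_cell[OF in1(1,3,4)[OF that]])
      qed
      then show ?thesis
      proof (rule continuous_map_eq)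
        show "cell_map G a w ((1 - snd z) *\<^sub>R polar (fst z) + snd z *\<^sub>R 1) = ?H (pcell g v (fst z), snd z)"
          if "z \<in> topspace (top_of_set ?A)" for z
        proof -
          have "z \<in> ?A" using that by (simp only: topspace_euclidean_subtopology)
          from in1(2)[OF this] show ?thesis by (simp add: base_path_def)
        qed
      qed
    next
      case False
      then have e: "{z \<in> unit_square. pcell g v z \<in> ?U} = {}" using cell[OF gv] by blast
      show ?thesis unfolding e by simp
    qed
  qed
  moreover have "?H (y, t) \<in> full (cell_verts y)" if yU: "y \<in> ?U" and "t \<in> {0..1}" for y t
  proof -
    obtain z where y: "y = CellPoint a w z" using yU by blast
    show ?thesis unfolding y by (simp add: base_path_def cell_verts_def cell_map_full a w)
  qed
  moreover have "\<exists>u\<in>words S. pverts (base y) u \<subseteq> cell_verts y \<and>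
      path_homotopic (KV (cell_verts y)) (\<lambda>t. ?H (y, t)) (path_join (base_path y) (epath (base y) u))" if "y \<in> ?U" for y
    using base_path_const_right[OF pt(1)[OF that]] base_in_cell_verts[of y] by (intro bexI[of _ "[]"]) auto
  ultimately show ?thesis
    unfolding contracts_def using U base_path_ends pt by (auto simp del: mem_Collect_eq)
qed

fun tent_graph :: "'a \<Rightarrow> 'a cayley_point \<Rightarrow> real" where
  "tent_graph g (Vertex a) = (if a = g then 1 else 0)"
| "tent_graph g (EdgePoint a s u) = (1 - u) * (if a = g then 1 else 0) + u * (if a \<otimes> s = g then 1 else 0)"
| "tent_graph g (CellPoint a w z) = 0"

text \<open>Equal to \<open>1\<close> at \<open>g\<close>, \<open>0\<close> at all other vertices and at the centres of 2-cells,
  and linear in between.\<close>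

definition tent :: "'a \<Rightarrow> 'a cayley_point \<Rightarrow> real" where
  "tent g = cone_extension G (\<lambda>_. 0) (tent_graph g)"

definition star :: "'a \<Rightarrow> 'a cayley_point set" where
  "star g = {y \<in> cayley_points G S P. tent g y > 0}"

lemma tent_graph_edge_map:
  "0 \<le> u \<Longrightarrow> u \<le> 1 \<Longrightarrow> tent_graph g (edge_map G a s u) = (1 - u) * (if a = g then 1 else 0) + u * (if a \<otimes> s = g then 1 else 0)"
  by (auto simp: edge_map_def)

lemma continuous_map_tent: "continuous_map K euclideanreal (tent g)"
  unfolding tent_def
proof (rule continuous_map_cone_extension)
  show "continuous_on {0..1} (\<lambda>u. tent_graph g (edge_map G a s u))" for a s
    by (rule continuous_on_eq[of _ "\<lambda>u. (1 - u) * (if a = g then 1 else 0) + u * (if a \<otimes> s = g then 1 else 0)"])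
       (auto intro!: continuous_intros simp: tent_graph_edge_map)
qed

lemma openin_star: "openin K (star g)"
proof -
  have "openin K {y \<in> topspace K. tent g y \<in> {0<..}}"
    by (rule openin_continuous_map_preimage[OF continuous_map_tent]) simp
  then show ?thesis by (simp add: star_def topspace_K)
qed

lemma tent_edge_map: "tent g (edge_map G a s u) = tent_graph g (edge_map G a s u)"
  by (simp add: tent_def edge_map_def)

lemma mult_gen_neq: "c \<in> carrier G \<Longrightarrow> s \<in> S \<Longrightarrow> c \<otimes> s \<noteq> c"
proof
  assume c: "c \<in> carrier G" "s \<in> S" "c \<otimes> s = c"
  then have "s \<in> carrier G" using S_carrier by blast
  then have "s = inv c \<otimes> (c \<otimes> s)" using c(1) by (simp only: m_assoc[symmetric] inv_closed l_inv l_one)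
  then have "s = \<one>" using c by simp
  then show False using c(2) one_notin_S by simp
qed

text \<open>The position \<open>\<xi>\<close> on the edge path \<open>w\<close> from \<open>a\<close> is less than one edge away from a visit of \<open>g\<close> at time \<open>k\<close>.\<close>

definition near :: "'a \<Rightarrow> 'a \<Rightarrow> 'a word \<Rightarrow> real \<Rightarrow> nat \<Rightarrow> bool" where
  "near g a w \<xi> k \<longleftrightarrow> k \<le> length w \<and> \<bar>\<xi> - real k\<bar> < 1 \<and> a \<otimes> val (take k w) = g"

lemma near_unique_less:
  assumes "near g a w \<xi> k" "near g a w \<xi> k'" "a \<in> carrier G" "w \<in> words S" shows "\<not> k < k'"
proof
  assume "k < k'"
  then have k': "k' = Suc k" "k < length w" using assms(1,2) by (auto simp: near_def)
  have "(w ! k) \<in> set w" using k'(2) by simp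
  then have l: "fst (w ! k) \<in> S" using assms(4) by (auto simp: words_def lists_eq_set mem_Times_iff)
  have "a \<otimes> val (take k w) = a \<otimes> (val (take k w) \<otimes> lval (w ! k))"
    using assms k' l by (auto simp: near_def take_Suc_conv_app_nth)
  then have "lval (w ! k) = \<one>" using assms l by (simp add: m_assoc[symmetric])
  then have "fst (w ! k) = \<one>" using l S_carrier by (auto simp: letter_val_def split: if_splits)
  then show False using l one_notin_S by simp
qed

text \<open>Consecutive vertices of an edge path differ, so two visits of \<open>g\<close> are at least two edges apart and no
  position is less than one edge away from both.\<close>

lemma near_unique:
  assumes "near g a w \<xi> k" "near g a w \<xi> k'" "a \<in> carrier G" "w \<in> words S" shows "k = k'"
  using near_unique_less[OF assms] near_unique_less[OF assms(2,1,3,4)] by simp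

lemma edge_path_Cons_ge:
  assumes "a \<in> carrier G" "l # w \<in> words S" "1 \<le> \<xi>"
  shows "edge_path G a (l # w) \<xi> = edge_path G (a \<otimes> lval l) w (\<xi> - 1)"
proof (cases "\<xi> = 1")
  case True
  have "edge_path G a ([l] @ w) 1 = edge_path G a [l] 1" using assms by (subst edge_path_append) auto
  then show ?thesis using assms True by simp
next
  case False
  have "edge_path G a ([l] @ w) \<xi> = edge_path G (a \<otimes> lval l) w (\<xi> - 1)"
    using assms False by (subst edge_path_append) auto
  then show ?thesis by simp
qed

lemma near_if_tent_pos:
  "a \<in> carrier G \<Longrightarrow> w \<in> words S \<Longrightarrow> 0 \<le> \<xi> \<Longrightarrow> \<xi> \<le> real (length w) \<Longrightarrow> tent_graph g (edge_path G a w \<xi>) > 0 \<Longrightarrow>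
    \<exists>k. near g a w \<xi> k"
proof (induction w arbitrary: a \<xi>)
  case Nil
  then show ?case by (intro exI[of _ 0]) (auto simp: near_def split: if_splits)
next
  case (Cons l w)
  obtain s b where l: "l = (s, b)" by (cases l)
  then have s: "s \<in> S" "s \<in> carrier G" and w: "w \<in> words S" using Cons.prems S_carrier by auto
  show ?case
  proof (cases "\<xi> \<le> 1")
    case True
    have "a = g \<and> \<xi> < 1 \<or> a \<otimes> lval l = g \<and> 0 < \<xi>"
    proof (cases b)
      case b: True
      have "tent_graph g (edge_map G a s \<xi>) > 0" using Cons.prems(5) True b l by simp
      then show ?thesis
        using Cons.prems(3) True b l by (auto simp: tent_graph_edge_map letter_val_def split: if_splits)
    next
      case b: False
      have "tent_graph g (edge_map G (a \<otimes> inv s) s (1 - \<xi>)) > 0" using Cons.prems(5) True b l by simp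
      moreover have "a \<otimes> inv s \<otimes> s = a" using s Cons.prems(1) by (simp add: m_assoc)
      ultimately show ?thesis
        using Cons.prems(3) True b l by (auto simp: tent_graph_edge_map letter_val_def split: if_splits)
    qed
    then show ?thesis
    proof
      assume "a = g \<and> \<xi> < 1"
      then show ?thesis using Cons.prems by (intro exI[of _ 0]) (auto simp: near_def)
    next
      assume "a \<otimes> lval l = g \<and> 0 < \<xi>"
      then show ?thesis using Cons.prems True by (intro exI[of _ 1]) (auto simp: near_def)
    qed
  next
    case False
    have "tent_graph g (edge_path G (a \<otimes> lval l) w (\<xi> - 1)) > 0"
      using Cons.prems False by (simp add: edge_path_Cons_ge del: edge_path.simps)
    then obtain k where "near g (a \<otimes> lval l) w (\<xi> - 1) k"
      using Cons.IH[of "a \<otimes> lval l" "\<xi> - 1"] Cons.prems False by auto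
    then show ?thesis using Cons.prems by (intro exI[of _ "Suc k"]) (auto simp: near_def m_assoc)
  qed
qed

text \<open>In a 2-cell the angle moves to that of the nearby visit of \<open>g\<close> while the radius moves to
  \<open>1\<close>.\<close>

fun star_contraction :: "'a \<Rightarrow> 'a cayley_point \<Rightarrow> real \<Rightarrow> 'a cayley_point" where
  "star_contraction g (Vertex a) t = Vertex a"
| "star_contraction g (EdgePoint a s u) t =
    (if a = g then edge_map G a s ((1 - t) * u) else edge_map G a s (1 - (1 - t) * (1 - u)))"
| "star_contraction g (CellPoint a w z) t =
    (let \<xi> = real (length w) * (Arg2pi z / (2 * pi)); k = real (SOME k. near g a w \<xi> k)
     in pcell a w (1 - (1 - t) * (1 - norm z), (k + (1 - t) * (\<xi> - k)) / real (length w)))"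

lemma star_contraction_edge_map:
  assumes "c \<in> carrier G" "s \<in> S" "0 \<le> u" "u \<le> 1"
  shows "c = g \<Longrightarrow> u < 1 \<Longrightarrow> star_contraction g (edge_map G c s u) t = edge_map G c s ((1 - t) * u)"
    "c \<otimes> s = g \<Longrightarrow> 0 < u \<Longrightarrow> star_contraction g (edge_map G c s u) t = edge_map G c s (1 - (1 - t) * (1 - u))"
  using assms mult_gen_neq[OF assms(1,2)] by (auto simp: edge_map_def)

lemma star_contraction_edge_path:
  assumes "a \<in> carrier G" "w \<in> words S" "0 \<le> \<xi>" "\<xi> \<le> real (length w)" "near g a w \<xi> k" "0 \<le> t" "t \<le> 1"
  shows "star_contraction g (edge_path G a w \<xi>) t = edge_path G a w (real k + (1 - t) * (\<xi> - real k))"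
  using assms
proof (induction w arbitrary: a \<xi> k)
  case Nil
  then show ?case by simp
next
  case (Cons l w)
  obtain s b where l: "l = (s, b)" by (cases l)
  then have s: "s \<in> S" "s \<in> carrier G" and w: "w \<in> words S" using Cons.prems S_carrier by auto
  define \<eta> where "\<eta> = real k + (1 - t) * (\<xi> - real k)"
  have inv: "a \<otimes> inv s \<otimes> s = a" and c: "a \<otimes> inv s \<in> carrier G" using s Cons.prems(1) by (simp_all add: m_assoc)
  show ?case
  proof (cases "\<xi> \<le> 1")
    case True
    then have "k = 0 \<or> k = 1" using Cons.prems(5) by (auto simp: near_def)
    then show ?thesis
    proof
      assume k: "k = 0"
      then have g: "a = g" "\<xi> < 1" using Cons.prems by (auto simp: near_def)
      have \<eta>: "\<eta> = (1 - t) * \<xi>" "\<eta> \<le> 1" 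
        using k Cons.prems True mult_mono[of "1 - t" 1 \<xi> 1] by (auto simp: \<eta>_def)
      show ?thesis
      proof (cases b)
        case True
        then show ?thesis
          using star_contraction_edge_map(1)[OF Cons.prems(1) s(1) Cons.prems(3) \<open>\<xi> \<le> 1\<close> g, of t] \<eta> \<open>\<xi> \<le> 1\<close> l
          unfolding \<eta>_def[symmetric] by simp
      next
        case False
        then show ?thesis
          using star_contraction_edge_map(2)[OF c s(1), of "1 - \<xi>" g t] \<eta> \<open>\<xi> \<le> 1\<close> l g inv Cons.prems(3)
          unfolding \<eta>_def[symmetric] by simp
      qed
    next
      assume k: "k = 1"
      then have g: "a \<otimes> lval l = g" "0 < \<xi>" using Cons.prems s l by (auto simp: near_def)
      have \<eta>1: "\<eta> = 1 - (1 - t) * (1 - \<xi>)" using k by (simp add: \<eta>_def algebra_simps)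
      have "0 \<le> (1 - t) * (1 - \<xi>)" using Cons.prems True by simp
      with \<eta>1 have \<eta>: "\<eta> = 1 - (1 - t) * (1 - \<xi>)" "\<eta> \<le> 1" by simp_all
      show ?thesis
      proof (cases b)
        case True
        then show ?thesis
          using star_contraction_edge_map(2)[OF Cons.prems(1) s(1) Cons.prems(3) \<open>\<xi> \<le> 1\<close>, of g t] \<eta> \<open>\<xi> \<le> 1\<close> l g
          unfolding \<eta>_def[symmetric] by (simp add: letter_val_def)
      next
        case False
        have "a \<otimes> inv s = g" using g False l by (simp add: letter_val_def)
        then show ?thesis
          using star_contraction_edge_map(1)[OF c s(1), of "1 - \<xi>" g t] \<eta> \<open>\<xi> \<le> 1\<close> l g inv Cons.prems(3) False
          unfolding \<eta>_def[symmetric] by simp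
      qed
    qed
  next
    case False
    then obtain k' where k': "k = Suc k'" using Cons.prems(5) by (cases k) (auto simp: near_def)
    have n: "near g (a \<otimes> lval l) w (\<xi> - 1) k'" using Cons.prems k' s l by (auto simp: near_def m_assoc)
    have "0 \<le> (1 - t) * (\<xi> - 1) + t * (real k - 1)" using Cons.prems False k' by simp
    then have \<eta>: "1 \<le> \<eta>" "\<eta> - 1 = real k' + (1 - t) * (\<xi> - 1 - real k')"
      using k' by (auto simp: \<eta>_def algebra_simps)
    have "star_contraction g (edge_path G a (l # w) \<xi>) t = star_contraction g (edge_path G (a \<otimes> lval l) w (\<xi> - 1)) t"
      using Cons.prems False by (simp add: edge_path_Cons_ge del: edge_path.simps)
    also have "\<dots> = edge_path G (a \<otimes> lval l) w (real k' + (1 - t) * (\<xi> - 1 - real k'))"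
      using Cons.prems False l s w by (intro Cons.IH n) auto
    also have "\<dots> = edge_path G (a \<otimes> lval l) w (\<eta> - 1)" by (simp only: \<eta>(2))
    also have "\<dots> = edge_path G a (l # w) \<eta>" by (rule edge_path_Cons_ge[symmetric, OF Cons.prems(1,2) \<eta>(1)])
    finally show ?thesis unfolding \<eta>_def .
  qed
qed

lemma edge_path_at_nat:
  assumes "a \<in> carrier G" "w \<in> words S" "k \<le> length w"
  shows "edge_path G a w (real k) = Vertex (a \<otimes> val (take k w))"
proof -
  have "edge_path G a (take k w @ drop k w) (real k) = edge_path G a (take k w) (real k)"
    using assms by (subst edge_path_append) auto
  then show ?thesis using assms by simp
qed

lemma star_vertex: "Vertex a \<in> star g \<longleftrightarrow> a = g \<and> a \<in> carrier G"
  by (auto simp: star_def tent_def cayley_points_def)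

lemma star_edge:
  assumes "EdgePoint a s u \<in> star g" shows "a = g \<or> a \<otimes> s = g"
  using assms by (auto simp: star_def tent_def split: if_splits)

lemma star_pcell_near:
  assumes a: "a \<in> carrier G" and w: "w \<in> P" and z: "z \<in> unit_square" and st: "pcell a w z \<in> star g"
  shows "0 < fst z" "\<exists>k. near g a w (real (length w) * snd z) k"
proof -
  obtain \<rho> x where zz: "z = (\<rho>, x)" and r: "0 \<le> \<rho>" "\<rho> \<le> 1" "0 \<le> x" "x \<le> 1" using z by auto
  have "tent g (pcell a w z) = \<rho> * tent_graph g (edge_path G a w (real (length w) * x))"
    unfolding tent_def zz using cone_extension_pcell[OF a w r] by simp
  then have pos: "\<rho> * tent_graph g (edge_path G a w (real (length w) * x)) > 0" using st by (simp add: star_def)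
  then show "0 < fst z" using r zz by (auto simp: zero_less_mult_iff)
  have "tent_graph g (edge_path G a w (real (length w) * x)) > 0" using pos r by (auto simp: zero_less_mult_iff)
  moreover have "real (length w) * x \<le> real (length w)" using r by (simp add: mult_left_le)
  ultimately show "\<exists>k. near g a w (real (length w) * snd z) k"
    using a w r P_words zz by (auto intro!: near_if_tent_pos)
qed

definition visit :: "'a \<Rightarrow> 'a \<Rightarrow> 'a word \<Rightarrow> real \<Rightarrow> nat" where
  "visit g a w \<xi> = (SOME k. near g a w \<xi> k)"

lemma visit_eq:
  assumes "near g a w \<xi> k" "a \<in> carrier G" "w \<in> words S" shows "visit g a w \<xi> = k"
  unfolding visit_def using assms near_unique by (intro some_equality) auto

text \<open>The star contraction in the polar coordinates of a 2-cell, towards the \<open>k\<close>-th corner.\<close>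

definition squeeze :: "'a word \<Rightarrow> nat \<Rightarrow> real \<Rightarrow> real \<times> real \<Rightarrow> real \<times> real" where
  "squeeze w k t z = (1 - (1 - t) * (1 - fst z), (real k + (1 - t) * (real (length w) * snd z - real k)) / real (length w))"

lemma P_length: "w \<in> P \<Longrightarrow> 0 < real (length w)"
  using P_nonempty by (cases w) auto

lemma squeeze_in:
  assumes w: "w \<in> P" and k: "k \<le> length w" and z: "z \<in> unit_square" and t: "0 \<le> t" "t \<le> 1"
  shows "squeeze w k t z \<in> unit_square"
proof -
  obtain \<rho> x where zz: "z = (\<rho>, x)" and r: "0 \<le> \<rho>" "\<rho> \<le> 1" "0 \<le> x" "x \<le> 1" using z by auto
  let ?n = "real (length w)"
  have n: "0 < ?n" by (rule P_length[OF w])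
  have b1: "(1 - t) * (1 - \<rho>) \<le> 1 * 1" using r t by (intro mult_mono) auto
  have b2: "0 \<le> (1 - t) * (1 - \<rho>)" using r t by simp
  have "0 \<le> t * real k" "0 \<le> (1 - t) * (?n * x)" using r t by simp_all
  then have b3: "0 \<le> real k + (1 - t) * (?n * x - real k)" by (simp add: algebra_simps)
  have "t * real k \<le> t * ?n" using t k by (intro mult_left_mono) auto
  moreover have "(1 - t) * (?n * x) \<le> (1 - t) * (?n * 1)" using r t by (intro mult_left_mono) auto
  ultimately have "real k + (1 - t) * (?n * x - real k) \<le> ?n" by (simp add: algebra_simps)
  with b1 b2 b3 show ?thesis using n by (simp add: squeeze_def zz)
qed

lemma star_contraction_pcell:
  assumes a: "a \<in> carrier G" and w: "w \<in> P" and z: "z \<in> unit_square"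
    and k: "near g a w (real (length w) * snd z) k" and t: "0 \<le> t" "t \<le> 1" and z0: "0 < fst z"
  shows "star_contraction g (pcell a w z) t = pcell a w (squeeze w k t z)"
proof -
  obtain \<rho> x where zz: "z = (\<rho>, x)" and r: "0 \<le> \<rho>" "\<rho> \<le> 1" "0 \<le> x" "x \<le> 1" using z by auto
  let ?n = "real (length w)"
  have n: "0 < ?n" by (rule P_length[OF w])
  have wS: "w \<in> words S" using w P_words by blast
  have k': "near g a w (?n * x) k" "k \<le> length w" using k by (auto simp: zz near_def)
  have sq: "squeeze w k t z \<in> unit_square" by (rule squeeze_in[OF w k'(2) z t])
  have xn: "0 \<le> ?n * x" "?n * x \<le> ?n" using r by (simp_all add: mult_left_le)
  show ?thesis
  proof (cases "\<rho> = 1")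
    case True
    have "star_contraction g (pcell a w z) t = edge_path G a w (real k + (1 - t) * (?n * x - real k))"
      unfolding zz True pcell_boundary[OF a w r(3,4)]
      by (rule star_contraction_edge_path[OF a wS xn k'(1) t])
    also have "\<dots> = edge_path G a w (?n * snd (squeeze w k t z))"
      using n by (simp add: squeeze_def zz)
    also have "\<dots> = pcell a w (1, snd (squeeze w k t z))"
      using sq by (intro pcell_boundary[OF a w, symmetric]) (auto simp: mem_Times_iff)
    also have "(1, snd (squeeze w k t z)) = squeeze w k t z" by (simp add: squeeze_def zz True)
    finally show ?thesis .
  next
    case False
    then have \<rho>: "\<rho> < 1" using r by simp
    have p: "pcell a w z = CellPoint a w (polar (\<rho>, x))" and nm: "norm (polar (\<rho>, x)) = \<rho>"
      unfolding zz using pcell_inner[OF r(1) \<rho>] norm_polar[OF r(1)] by simp_all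
    let ?\<xi> = "?n * (Arg2pi (polar (\<rho>, x)) / (2 * pi))"
    have sc: "star_contraction g (pcell a w z) t =
        pcell a w (1 - (1 - t) * (1 - \<rho>), (real (visit g a w ?\<xi>) + (1 - t) * (?\<xi> - real (visit g a w ?\<xi>))) / ?n)"
      unfolding p by (simp only: star_contraction.simps Let_def visit_def nm)
    consider (2) "\<rho> > 0" "x < 1" | (3) "\<rho> > 0" "x = 1" using r z0 zz by fastforce
    then show ?thesis
    proof cases
      case 2
      then have "?\<xi> = ?n * x" using Arg2pi_polar[of \<rho> x] r by simp
      then show ?thesis unfolding sc using visit_eq[OF k'(1) a wS] by (simp add: squeeze_def zz)
    next
      case 3
      have \<xi>: "?\<xi> = 0" using Arg2pi_polar[of \<rho> 0] 3 by (simp add: polar_1)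
      have kn: "k = length w" using k' 3 by (auto simp: near_def)
      then have "a = g" using k' w P_val a by (simp add: near_def)
      then have "near g a w 0 0" using a by (simp add: near_def)
      then have "visit g a w 0 = 0" using visit_eq a wS by simp
      then have "star_contraction g (pcell a w z) t = pcell a w (1 - (1 - t) * (1 - \<rho>), 0)"
        unfolding sc \<xi> by simp
      also have "\<dots> = pcell a w (1 - (1 - t) * (1 - \<rho>), 1)" by (simp only: pcell_def polar_1)
      also have "(1 - (1 - t) * (1 - \<rho>), 1) = squeeze w k t z" using n 3 kn by (simp add: squeeze_def zz)
      finally show ?thesis .
    qed
  qed
qed

lemma continuous_on_visit:
  assumes a: "a \<in> carrier G" and w: "w \<in> words S" and A: "\<And>z. z \<in> A \<Longrightarrow> \<exists>k. near g a w (real (length w) * snd z) k"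
  shows "continuous_on A (\<lambda>z :: real \<times> real. real (visit g a w (real (length w) * snd z)))"
proof (rule continuous_on_locally_constant)
  fix z assume "z \<in> A"
  let ?n = "real (length w)"
  obtain k where k: "near g a w (?n * snd z) k" using A \<open>z \<in> A\<close> by blast
  define d where "d = (1 - \<bar>?n * snd z - real k\<bar>) / (?n + 1)"
  have d: "d > 0" using k by (simp add: d_def near_def)
  have "visit g a w (?n * snd y) = visit g a w (?n * snd z)" if y: "dist y z < d" for y
  proof -
    have "\<bar>snd y - snd z\<bar> \<le> dist y z" using dist_snd_le[of y z] by (simp add: dist_real_def)
    then have "?n * \<bar>snd y - snd z\<bar> \<le> (?n + 1) * dist y z" by (intro mult_mono) auto
    also have "\<dots> < (?n + 1) * d" using y by (intro mult_strict_left_mono) auto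
    also have "\<dots> = 1 - \<bar>?n * snd z - real k\<bar>" by (simp add: d_def)
    finally have "\<bar>?n * snd y - ?n * snd z\<bar> < 1 - \<bar>?n * snd z - real k\<bar>"
      by (simp add: abs_mult flip: right_diff_distrib)
    then have "near g a w (?n * snd y) k" using k by (auto simp: near_def)
    then show ?thesis using visit_eq[OF _ a w] k by metis
  qed
  then show "\<exists>d>0. \<forall>y\<in>A. dist y z < d \<longrightarrow> real (visit g a w (?n * snd y)) = real (visit g a w (?n * snd z))"
    using d by (intro exI[of _ d] conjI ballI impI arg_cong[of _ _ real])
qed

lemma take_in_path_verts:
  assumes "a \<in> carrier G" "w \<in> words S" shows "pverts a (take k w) \<subseteq> pverts a w"
  using path_verts_append[of a "take k w" "drop k w"] assms by simp

text \<open>The star of \<open>g\<close> contracts to \<open>g\<close>; on a 2-cell the contraction is linear in polar coordinates around each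
  corner at \<open>g\<close>.\<close>

lemma contracts_star:
  assumes g: "g \<in> carrier G"
  shows "contracts (star g) g (\<lambda>(y, t). star_contraction g y t)" (is "contracts _ _ ?H")
proof -
  have edge: "continuous_map (top_of_set ({u \<in> {0..1}. edge_map G a s u \<in> star g} \<times> {0..1})) K (\<lambda>z. ?H (edge_map G a s (fst z), snd z))"
    if as: "a \<in> carrier G" "s \<in> S" for a s
  proof -
    let ?A = "{u \<in> {0..1}. edge_map G a s u \<in> star g} \<times> {0..1::real}"
    have A: "0 \<le> u" "u \<le> 1" "0 \<le> t" "t \<le> 1" "(a = g \<and> u < 1) \<or> (a \<otimes> s = g \<and> 0 < u)" if "(u, t) \<in> ?A" for u t
    proof -
      have "tent_graph g (edge_map G a s u) > 0" and r: "0 \<le> u" "u \<le> 1" "0 \<le> t" "t \<le> 1"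
        using that by (auto simp: star_def tent_edge_map)
      then show "(a = g \<and> u < 1) \<or> (a \<otimes> s = g \<and> 0 < u)" 
        by (auto simp: tent_graph_edge_map split: if_splits)
      show "0 \<le> u" "u \<le> 1" "0 \<le> t" "t \<le> 1" by fact+
    qed
    have in01: "(1 - t) * u \<in> {0..1}" if "0 \<le> u" "u \<le> 1" "0 \<le> t" "t \<le> 1" for u t :: real
      using that mult_mono[of "1 - t" 1 u 1] by auto
    consider (1) "a = g" | (2) "a \<noteq> g" "a \<otimes> s = g" | (3) "a \<noteq> g" "a \<otimes> s \<noteq> g" by blast
    then show ?thesis
    proof cases
      case 1
      have u1: "fst z < 1" if "z \<in> ?A" for z using A(5)[of "fst z" "snd z"] that 1 mult_gen_neq[OF as] by auto
      have "continuous_map (top_of_set ?A) K (\<lambda>z. edge_map G a s ((1 - snd z) * fst z))"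
        by (rule continuous_map_compose_on[OF continuous_map_edge_map[OF as]])
           (intro continuous_intros, rule in01, simp_all add: mem_Times_iff)
      then show ?thesis
        by (rule continuous_map_eq) (use u1 star_contraction_edge_map(1)[OF as _ _ 1] in auto)
    next
      case 2
      have u1: "0 < fst z" if "z \<in> ?A" for z using A(5)[of "fst z" "snd z"] that 2 by auto
      have "continuous_map (top_of_set ?A) K (\<lambda>z. edge_map G a s (1 - (1 - snd z) * (1 - fst z)))"
        by (rule continuous_map_compose_on[OF continuous_map_edge_map[OF as]])
           (intro continuous_intros, use in01 in \<open>simp add: mem_Times_iff\<close>)
      then show ?thesis
        by (rule continuous_map_eq) (use u1 star_contraction_edge_map(2)[OF as _ _ 2(2)] in auto)
    next
      case 3
      then have "?A = {}" using A(5) by fast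
      then show ?thesis by (simp only:) simp
    qed
  qed
  have cell: "continuous_map (top_of_set ({z \<in> unit_square. pcell a w z \<in> star g} \<times> {0..1})) K (\<lambda>z. ?H (pcell a w (fst z), snd z))"
    if aw: "a \<in> carrier G" "w \<in> P" for a w
  proof -
    let ?B = "{z \<in> unit_square. pcell a w z \<in> star g}"
    let ?n = "real (length w)"
    have wS: "w \<in> words S" using aw P_words by blast
    have n: "0 < ?n" by (rule P_length[OF aw(2)])
    have B: "z \<in> unit_square" "0 < fst z" "near g a w (?n * snd z) (visit g a w (?n * snd z))" if "z \<in> ?B" for z
    proof -
      show z: "z \<in> unit_square" using that by blast
      have st: "pcell a w z \<in> star g" using that by blast
      show "0 < fst z" by (rule star_pcell_near(1)[OF aw z st])
      show "near g a w (?n * snd z) (visit g a w (?n * snd z))"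
        unfolding visit_def by (rule someI_ex[OF star_pcell_near(2)[OF aw z st]])
    qed
    have "continuous_on ?B (\<lambda>z. real (visit g a w (?n * snd z)))"
      using B(3) by (intro continuous_on_visit[OF aw(1) wS]) blast
    then have vis: "continuous_on (?B \<times> {0..1}) (\<lambda>z. real (visit g a w (?n * snd (fst z))))"
      by (rule continuous_on_compose2[of _ "\<lambda>z. real (visit g a w (?n * snd z))" _ fst]) (auto intro!: continuous_intros)
    have "continuous_map (top_of_set (?B \<times> {0..1})) K (\<lambda>z. pcell a w (squeeze w (visit g a w (?n * snd (fst z))) (snd z) (fst z)))"
    proof (rule continuous_map_compose_on[OF continuous_map_pcell[OF aw]])
      show "continuous_on (?B \<times> {0..1}) (\<lambda>z. squeeze w (visit g a w (?n * snd (fst z))) (snd z) (fst z))"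
        unfolding squeeze_def using n by (intro continuous_intros vis) auto
      show "squeeze w (visit g a w (?n * snd (fst z))) (snd z) (fst z) \<in> unit_square" if "z \<in> ?B \<times> {0..1}" for z
      proof -
        have z: "fst z \<in> ?B" "0 \<le> snd z" "snd z \<le> 1" using that by (simp_all add: mem_Times_iff)
        show ?thesis using B(3)[OF z(1)] by (intro squeeze_in[OF aw(2) _ B(1)[OF z(1)] z(2,3)]) (simp add: near_def)
      qed
    qed
    then show ?thesis
    proof (rule continuous_map_eq)
      fix z assume "z \<in> topspace (top_of_set (?B \<times> {0..1::real}))"
      then have z: "fst z \<in> ?B" "0 \<le> snd z" "snd z \<le> 1"
        by (simp_all only: topspace_euclidean_subtopology mem_Times_iff atLeastAtMost_iff)
      show "pcell a w (squeeze w (visit g a w (?n * snd (fst z))) (snd z) (fst z)) = ?H (pcell a w (fst z), snd z)"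
        using star_contraction_pcell[OF aw B(1)[OF z(1)] B(3)[OF z(1)] z(2,3) B(2)[OF z(1)]] by simp
    qed
  qed
  have cont: "continuous_map (prod_topology (subtopology K (star g)) (top_of_set {0..1})) K ?H"
    by (rule continuous_map_homotopy_from_K[OF openin_star edge cell])
  have main: "?H (y, 0) = y \<and> ?H (y, 1) = Vertex g \<and> (\<forall>t\<in>{0..1}. ?H (y, t) \<in> full (cell_verts y)) \<and>
      (\<exists>u\<in>words S. pverts (base y) u \<subseteq> cell_verts y \<and>
        path_homotopic (KV (cell_verts y)) (\<lambda>t. ?H (y, t)) (path_join (base_path y) (epath (base y) u)))"
    if y: "y \<in> star g" for y
  proof -
    have yp: "y \<in> cayley_points G S P" using y by (simp add: star_def)
    then show ?thesis
    proof (cases rule: point_cases)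
      case (1 a)
      then have "a = g" using y star_vertex by simp
      then show ?thesis using base_path_const_right[OF yp] 1 yp
        by (intro conjI bexI[of _ "[]"]) (auto simp: full_def cell_verts_def base_path_def[abs_def])
    next
      case (2 a s v)
      have sc: "s \<in> carrier G" using 2 S_carrier by blast
      have full: "edge_map G a s x \<in> full (cell_verts y)" for x
        using 2 by (intro edge_map_full) (auto simp: cell_verts_def)
      have end0: "edge_map G a s v = y" using 2 by (simp add: edge_map_def)
      show ?thesis
      proof (cases "a = g")
        case True
        have "(\<lambda>t. ?H (y, t)) = base_path y" using 2 True by (simp add: base_path_def fun_eq_iff)
        then show ?thesis using base_path_const_right[OF yp] 2 True full end0
          by (intro conjI bexI[of _ "[]"]) (auto simp: cell_verts_def)
      next
        case False
        then have g': "a \<otimes> s = g" using star_edge[of a s v g] y 2 by auto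
        let ?\<beta> = "\<lambda>x. max ((1 - 2 * x) * v) (2 * x - 1)"
        have "path_homotopic (KV (cell_verts y)) (\<lambda>x. edge_map G a s (1 - (1 - x) * (1 - v))) (\<lambda>x. edge_map G a s (?\<beta> x))"
        proof (rule path_homotopic_factor[OF _ edge_map_KV])
          show "1 - (1 - x) * (1 - v) \<in> {0..1}" if "x \<in> {0..1}" for x
            using that 2 mult_mono[of "1 - x" 1 "1 - v" 1] by auto
          show "?\<beta> x \<in> {0..1}" if "x \<in> {0..1}" for x
          proof (cases "x \<le> 1/2")
            case True
            then have "0 \<le> (1 - 2 * x) * v" "(1 - 2 * x) * v \<le> 1 * 1"
              using that 2 by (simp, intro mult_mono) auto
            then show ?thesis using True by auto
          next
            case False
            then have "(1 - 2 * x) * v \<le> 0" using 2 by (intro mult_nonpos_nonneg) auto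
            then show ?thesis using False that by auto
          qed
        qed (use 2 in \<open>auto simp: cell_verts_def intro!: continuous_intros\<close>)
        then have "path_homotopic (KV (cell_verts y)) (\<lambda>t. ?H (y, t)) (path_join (base_path y) (epath (base y) [(s, True)]))"
        proof (rule path_homotopic_cong)
          show "edge_map G a s (1 - (1 - x) * (1 - v)) = ?H (y, x)" for x using 2 False by simp
          fix x :: real assume x: "0 \<le> x" "x \<le> 1"
          show "edge_map G a s (?\<beta> x) = path_join (base_path y) (epath (base y) [(s, True)]) x"
          proof (cases "x \<le> 1/2")
            case True
            then have "0 \<le> (1 - 2 * x) * v" using 2 by simp
            then have "?\<beta> x = (1 - 2 * x) * v" using True by (simp add: max_def)
            then show ?thesis using True 2 by (simp add: path_join_def base_path_def)
          next
            case False
            then have "(1 - 2 * x) * v \<le> 0" using 2 by (intro mult_nonpos_nonneg) auto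
            then have "?\<beta> x = 2 * x - 1" using False by (simp add: max_def)
            then show ?thesis using False 2 x by (simp add: path_join_def epath_def)
          qed
        qed
        then show ?thesis using 2 False g' full end0 sc
          by (intro conjI bexI[of _ "[(s, True)]"]) (auto simp: cell_verts_def letter_val_def)
      qed
    next
      case (3 a w z)
      have wS: "w \<in> words S" using 3 P_words by blast
      let ?n = "real (length w)"
      have n: "0 < ?n" by (rule P_length[OF 3(3)])
      define zz where "zz = (norm z, Arg2pi z / (2 * pi))"
      have zz: "zz \<in> unit_square" "snd zz < 1" using 3 Arg2pi_ge_0[of z] Arg2pi_lt_2pi[of z] by (auto simp: zz_def)
      have pz: "polar zz = z" using Arg2pi_eq[of z] by (simp add: polar_def zz_def cis_conv_exp)
      have yz: "y = pcell a w zz" using 3 pz by (simp add: pcell_def cell_map_def)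
      have st: "pcell a w zz \<in> star g" using y yz by simp
      have pos: "0 < fst zz" by (rule star_pcell_near(1)[OF 3(2,3) zz(1) st])
      obtain k where k: "near g a w (?n * snd zz) k" using star_pcell_near(2)[OF 3(2,3) zz(1) st] by blast
      have kl: "k \<le> length w" and kg: "a \<otimes> val (take k w) = g" using k by (auto simp: near_def)
      have Ht: "?H (y, t) = pcell a w (squeeze w k t zz)" if "0 \<le> t" "t \<le> 1" for t
        using star_contraction_pcell[OF 3(2,3) zz(1) k that pos] yz by simp
      have sq: "squeeze w k t zz \<in> unit_square" if "0 \<le> t" "t \<le> 1" for t
        by (rule squeeze_in[OF 3(3) kl zz(1) that])
      have s0: "squeeze w k 0 zz = zz" using n by (cases zz) (simp add: squeeze_def)
      have s1: "squeeze w k 1 zz = (1, real k / ?n)" by (simp add: squeeze_def)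
      have kn: "0 \<le> real k / ?n" "real k / ?n \<le> 1" using kl n by simp_all
      have cv: "cell_verts y = pverts a w" using 3 by (simp add: cell_verts_def)
      have H1: "?H (y, 1) = Vertex g"
        using Ht[of 1] s1 pcell_boundary[OF 3(2,3) kn] n edge_path_at_nat[OF 3(2) wS kl] kg by simp
      have Hf: "?H (y, t) \<in> full (cell_verts y)" if "t \<in> {0..1}" for t
        using Ht[of t] that cell_map_full[OF 3(2,3) order_refl] by (simp add: cv pcell_def)
      let ?\<gamma> = "path_join (\<lambda>x. (1 - x) *\<^sub>R z + x *\<^sub>R 1) (\<lambda>x. polar (1, real k * x / ?n))"
      have g_in: "?\<gamma> x \<in> cball 0 1" if "x \<in> {0..1}" for x
      proof (cases "x \<le> 1/2")
        case True
        then show ?thesis using base_path_cell[of z "2 * x"] 3 that by (simp add: path_join_def)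
      next
        case False
        then show ?thesis by (simp add: path_join_def norm_polar)
      qed
      have "path_homotopic (KV (cell_verts y)) (\<lambda>t. cell_map G a w (polar (squeeze w k t zz))) (\<lambda>x. cell_map G a w (?\<gamma> x))"
      proof (rule path_homotopic_factor[OF convex_cball cell_map_KV[OF 3(2,3)]])
        show "continuous_on {0..1} (\<lambda>t. polar (squeeze w k t zz))"
          unfolding squeeze_def using n
          by (intro continuous_on_compose2[OF continuous_on_polar[of UNIV]] continuous_intros) auto
        show "continuous_on {0..1} ?\<gamma>"
        proof (rule continuous_on_path_join)
          show "continuous_on {0..1} (\<lambda>x. polar (1, real k * x / ?n))"
            using n by (intro continuous_on_compose2[OF continuous_on_polar[of UNIV]] continuous_intros) auto
        qed (auto intro!: continuous_intros simp: polar_def)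
        show "polar (squeeze w k t zz) \<in> cball 0 1" if "t \<in> {0..1}" for t
          using that sq by (intro polar_in_cball) auto
      qed (use g_in cv s0 s1 pz in \<open>auto simp del: mem_cball\<close>)
      then have "path_homotopic (KV (cell_verts y)) (\<lambda>t. ?H (y, t)) (path_join (base_path y) (epath (base y) (take k w)))"
      proof (rule path_homotopic_cong)
        show "cell_map G a w (polar (squeeze w k t zz)) = ?H (y, t)" if "0 \<le> t" "t \<le> 1" for t
          using Ht[OF that] by (simp add: pcell_def)
        fix x :: real assume x: "0 \<le> x" "x \<le> 1"
        show "cell_map G a w (?\<gamma> x) = path_join (base_path y) (epath (base y) (take k w)) x"
        proof (cases "x \<le> 1/2")
          case True
          then show ?thesis using 3 by (simp add: path_join_def base_path_def)
        next
          case False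
          define \<xi> where "\<xi> = real k * (2 * x - 1)"
          have "real k * (2 * x - 1) \<le> real k * 1" using x by (intro mult_left_mono) auto
          then have \<xi>: "0 \<le> \<xi>" "\<xi> \<le> real k" using False by (auto simp: \<xi>_def)
          then have \<xi>n: "0 \<le> \<xi> / ?n" "\<xi> / ?n \<le> 1" using kl n by (simp_all add: divide_le_eq)
          have "cell_map G a w (polar (1, \<xi> / ?n)) = edge_path G a w (?n * (\<xi> / ?n))"
            using pcell_boundary[OF 3(2,3) \<xi>n] by (simp add: pcell_def)
          also have "?n * (\<xi> / ?n) = \<xi>" using n by simp
          also have "edge_path G a (take k w @ drop k w) \<xi> = edge_path G a (take k w) \<xi>"
            using \<xi> 3 wS kl by (subst edge_path_append) auto
          then have "edge_path G a w \<xi> = edge_path G a (take k w) \<xi>" by simp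
          finally show ?thesis using False 3 kl by (simp add: path_join_def epath_def \<xi>_def)
        qed
      qed
      moreover have "?H (y, 0) = y" using Ht[of 0] s0 yz by simp
      ultimately show ?thesis
        using H1 Hf 3 wS take_in_path_verts[OF 3(2) wS] cv by (intro conjI bexI[of _ "take k w"]) auto
    qed
  qed
  show ?thesis unfolding contracts_def using openin_star cont main by blast
qed

text \<open>Vertices and edge points lie in vertex stars, all other points in open 2-cells.\<close>

lemma exists_contracts:
  assumes y: "y \<in> cayley_points G S P"
  obtains U g H where "y \<in> U" "contracts U g H"
  using y
proof (cases rule: point_cases)
  case (1 g)
  then show ?thesis using that[of "star g", OF _ contracts_star] star_vertex by simp
next
  case (2 g s u)
  have "0 < tent g y" using 2 by (auto simp: tent_def)
  then show ?thesis using that[of "star g", OF _ contracts_star] 2 y by (simp add: star_def)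
next
  case (3 g w z)
  then show ?thesis using that[OF _ contracts_open_cell, of g w] by blast
qed

section \<open>Edge path approximation and ladders\<close>

text \<open>From time \<open>a\<close> to time \<open>b\<close> the path \<open>r\<close> is homotopic to an edge path, up to the
  base paths at its two ends and inside the full subcomplex on \<open>V\<close>.\<close>

definition approximable :: "'a set \<Rightarrow> (real \<Rightarrow> 'a cayley_point) \<Rightarrow> real \<Rightarrow> real \<Rightarrow> bool" where
  "approximable V r a b \<longleftrightarrow> (\<exists>w\<in>words S. pverts (base (r a)) w \<subseteq> V \<and> base (r a) \<otimes> val w = base (r b) \<and>
    path_homotopic (KV V) (path_join (\<lambda>x. r (a + (b - a) * x)) (base_path (r b)))
      (path_join (base_path (r a)) (epath (base (r a)) w)))"

lemma base_carrier: "y \<in> cayley_points G S P \<Longrightarrow> base y \<in> carrier G"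
  by (auto simp: cayley_points_def)

lemma pathin_segment:
  assumes r: "continuous_map (top_of_set {a..b}) K r" and ab: "a \<le> b"
    and V: "\<And>\<tau>. \<tau> \<in> {a..b} \<Longrightarrow> cell_verts (r \<tau>) \<subseteq> V"
  shows "pathin (KV V) (\<lambda>x. r (a + (b - a) * x))"
proof (rule pathin_KV)
  have in_ab: "a + (b - a) * x \<in> {a..b}" if "0 \<le> x" "x \<le> 1" for x
    using that ab mult_left_mono[of x 1 "b - a"] by auto
  show "pathin K (\<lambda>x. r (a + (b - a) * x))"
    unfolding pathin_def by (rule continuous_map_compose_on[OF r]) (use in_ab in \<open>auto intro!: continuous_intros\<close>)
  show "r (a + (b - a) * x) \<in> full V" if "0 \<le> x" "x \<le> 1" for x
    using r V[OF in_ab[OF that]] in_ab[OF that] by (auto simp: full_def continuous_map_def Pi_iff topspace_K)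
qed

lemma approximable_trans:
  assumes r: "continuous_map (top_of_set {a..c}) K r" and abc: "a \<le> b" "b \<le> c"
    and V: "\<And>\<tau>. \<tau> \<in> {a..c} \<Longrightarrow> cell_verts (r \<tau>) \<subseteq> V"
    and 1: "approximable V r a b" and 2: "approximable V r b c"
  shows "approximable V r a c"
proof -
  obtain u where u: "u \<in> words S" "pverts (base (r a)) u \<subseteq> V" "base (r a) \<otimes> val u = base (r b)"
    and hu: "path_homotopic (KV V) (path_join (\<lambda>x. r (a + (b - a) * x)) (base_path (r b)))
      (path_join (base_path (r a)) (epath (base (r a)) u))" using 1 unfolding approximable_def by blast
  obtain v where v: "v \<in> words S" "pverts (base (r b)) v \<subseteq> V" "base (r b) \<otimes> val v = base (r c)"
    and hv: "path_homotopic (KV V) (path_join (\<lambda>x. r (b + (c - b) * x)) (base_path (r c)))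
      (path_join (base_path (r b)) (epath (base (r b)) v))" using 2 unfolding approximable_def by blast
  let ?p = "\<lambda>x. r (a + (b - a) * x)" and ?q = "\<lambda>x. r (b + (c - b) * x)"
  let ?ca = "base_path (r a)" and ?cb = "base_path (r b)" and ?cc = "base_path (r c)"
  let ?e = "epath (base (r a)) u" and ?f = "epath (base (r b)) v"
  have pts: "r \<tau> \<in> cayley_points G S P" if "\<tau> \<in> {a..c}" for \<tau>
    using r that by (auto simp: continuous_map_def Pi_iff topspace_K)
  have sub: "continuous_map (top_of_set {d..e}) K r" if "{d..e} \<subseteq> {a..c}" for d e
    using continuous_map_compose_on[OF r, of "{d..e}" "\<lambda>x. x"] that by auto
  have p: "pathin (KV V) ?p" "pathin (KV V) ?q"
    using abc by (auto intro!: pathin_segment sub V)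
  have pa: "r a \<in> cayley_points G S P" "r b \<in> cayley_points G S P" "r c \<in> cayley_points G S P"
    using abc by (auto intro!: pts)
  have cp: "pathin (KV V) ?ca" "pathin (KV V) ?cb" "pathin (KV V) ?cc"
    using pa abc by (auto intro!: pathin_base_path V)
  have g: "base (r a) \<in> carrier G" "base (r b) \<in> carrier G" using pa base_carrier by auto
  have ep: "pathin (KV V) ?e" "pathin (KV V) ?f" using g u v by (auto intro!: pathin_epath)
  have ends: "?p 0 = r a" "?p 1 = r b" "?q 0 = r b" "?q 1 = r c" by simp_all
  have ends': "?ca 0 = r a" "?ca 1 = Vertex (base (r a))" "?cb 0 = r b" "?cb 1 = Vertex (base (r b))" "?cc 0 = r c"
    "?e 0 = Vertex (base (r a))" "?e 1 = Vertex (base (r b))" "?f 0 = Vertex (base (r b))"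
    using base_path_ends pa g u v by simp_all
  have split: "path_homotopic (KV V) (\<lambda>x. r (a + (c - a) * x)) (path_join ?p ?q)"
  proof -
    have "path_homotopic (KV V) (\<lambda>x. r (a + (c - a) * x)) (\<lambda>x. r (path_join (\<lambda>x. a + (b - a) * x) (\<lambda>x. b + (c - b) * x) x))"
    proof (rule path_homotopic_factor[of "{a..c}"])
      show "continuous_map (top_of_set {a..c}) (KV V) r"
        using r V pts by (auto simp: continuous_map_in_subtopology full_def)
      show "continuous_on {0..1} (path_join (\<lambda>x. a + (b - a) * x) (\<lambda>x. b + (c - b) * x))"
        by (rule continuous_on_path_join) (auto intro!: continuous_intros)
      show "a + (c - a) * x \<in> {a..c}" if "x \<in> {0..1}" for x
        using that abc mult_left_mono[of x 1 "c - a"] by auto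
      show "path_join (\<lambda>x. a + (b - a) * x) (\<lambda>x. b + (c - b) * x) x \<in> {a..c}" if "x \<in> {0..1}" for x
      proof (cases "x \<le> 1/2")
        case True
        have h1: "0 \<le> (b - a) * (2 * x)" using that abc by (intro mult_nonneg_nonneg) auto
        have "(b - a) * (2 * x) \<le> (b - a) * 1" using True abc by (intro mult_left_mono) auto
        with h1 have h: "0 \<le> (b - a) * (2 * x)" "(b - a) * (2 * x) \<le> b - a" by (simp_all only: mult_1_right)
        have "path_join (\<lambda>x. a + (b - a) * x) (\<lambda>x. b + (c - b) * x) x = a + (b - a) * (2 * x)"
          using True by (simp add: path_join_def)
        then have "a \<le> path_join (\<lambda>x. a + (b - a) * x) (\<lambda>x. b + (c - b) * x) x"
          "path_join (\<lambda>x. a + (b - a) * x) (\<lambda>x. b + (c - b) * x) x \<le> c" using h abc by linarith+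
        then show ?thesis by simp
      next
        case False
        have h1: "0 \<le> (c - b) * (2 * x - 1)" using False abc by (intro mult_nonneg_nonneg) auto
        have "(c - b) * (2 * x - 1) \<le> (c - b) * 1" using that abc by (intro mult_left_mono) auto
        with h1 have h: "0 \<le> (c - b) * (2 * x - 1)" "(c - b) * (2 * x - 1) \<le> c - b" by (simp_all only: mult_1_right)
        have "path_join (\<lambda>x. a + (b - a) * x) (\<lambda>x. b + (c - b) * x) x = b + (c - b) * (2 * x - 1)"
          using False by (simp add: path_join_def)
        then have "a \<le> path_join (\<lambda>x. a + (b - a) * x) (\<lambda>x. b + (c - b) * x) x"
          "path_join (\<lambda>x. a + (b - a) * x) (\<lambda>x. b + (c - b) * x) x \<le> c" using h abc by linarith+
        then show ?thesis by simp
      qed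
    qed (auto intro!: continuous_intros)
    then show ?thesis by (rule path_homotopic_cong) (auto simp: path_join_def)
  qed
  have "path_homotopic (KV V) (path_join (\<lambda>x. r (a + (c - a) * x)) ?cc) (path_join (path_join ?p ?q) ?cc)"
    using cp ends ends' by (intro path_homotopic_join split path_homotopic_refl) auto
  also have "path_homotopic (KV V) \<dots> (path_join ?p (path_join ?q ?cc))"
    using p cp ends ends' by (intro path_homotopic_assoc) auto
  also have "path_homotopic (KV V) \<dots> (path_join ?p (path_join ?cb ?f))"
    using p ends ends' by (intro path_homotopic_join hv path_homotopic_refl) auto
  also have "path_homotopic (KV V) \<dots> (path_join (path_join ?p ?cb) ?f)"
    using p cp ep ends ends' by (intro path_homotopic_sym[OF path_homotopic_assoc]) auto
  also have "path_homotopic (KV V) \<dots> (path_join (path_join ?ca ?e) ?f)"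
    using ep ends ends' by (intro path_homotopic_join hu path_homotopic_refl) auto
  also have "path_homotopic (KV V) \<dots> (path_join ?ca (path_join ?e ?f))"
    using cp ep ends ends' by (intro path_homotopic_assoc) auto
  also have "path_homotopic (KV V) \<dots> (path_join ?ca (epath (base (r a)) (u @ v)))"
  proof -
    have "path_homotopic (KV V) (path_join ?e ?f) (epath (base (r a)) (u @ v))"
      using path_homotopic_sym[OF epath_append[of "base (r a)" u V v]] u v g by simp
    then show ?thesis using cp ends' by (intro path_homotopic_join path_homotopic_refl) auto
  qed
  finally show ?thesis
    unfolding approximable_def using u v g
    by (intro bexI[of _ "u @ v"]) (auto simp: path_verts_append simp flip: m_assoc)
qed

text \<open>The contraction shrinks \<open>r\<close> to the vertex \<open>g\<close>, so \<open>r\<close> is homotopic to the track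
  of its start followed by the reversed track of its end, and each track is homotopic to a base path followed by an edge
  path.\<close>

lemma approximable_local:
  assumes H: "contracts U g H" and ab: "a \<le> b" and r: "continuous_map (top_of_set {a..b}) K r"
    and inU: "\<And>\<tau>. \<tau> \<in> {a..b} \<Longrightarrow> r \<tau> \<in> U" and V: "\<And>\<tau>. \<tau> \<in> {a..b} \<Longrightarrow> cell_verts (r \<tau>) \<subseteq> V"
  shows "approximable V r a b"
proof -
  define p where "p x = r (a + (b - a) * x)" for x
  have in_ab: "a + (b - a) * x \<in> {a..b}" if "x \<in> {0..1}" for x
    using that ab mult_left_mono[of x 1 "b - a"] by auto
  have p01: "p 0 = r a" "p 1 = r b" by (simp_all add: p_def)
  have p: "pathin (KV V) p" unfolding p_def by (rule pathin_segment[OF r ab V])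
  have Hcont: "continuous_map (prod_topology (subtopology K U) (top_of_set {0..1})) K H"
    and Hy: "\<And>y. y \<in> U \<Longrightarrow> H (y, 0) = y \<and> H (y, 1) = Vertex g \<and> (\<forall>t\<in>{0..1}. H (y, t) \<in> full (cell_verts y)) \<and>
      (\<exists>u\<in>words S. pverts (base y) u \<subseteq> cell_verts y \<and>
        path_homotopic (KV (cell_verts y)) (\<lambda>t. H (y, t)) (path_join (base_path y) (epath (base y) u)))"
    using H unfolding contracts_def by blast+
  have yU: "r a \<in> U" "r b \<in> U" and yV: "cell_verts (r a) \<subseteq> V" "cell_verts (r b) \<subseteq> V"
    using ab by (auto intro!: inU V)
  have yp: "r a \<in> cayley_points G S P" "r b \<in> cayley_points G S P"
    using r ab by (auto simp: continuous_map_def Pi_iff topspace_K)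
  have pU: "p x \<in> U" "cell_verts (p x) \<subseteq> V" if "x \<in> {0..1}" for x
    unfolding p_def by (rule inU[OF in_ab[OF that]], rule V[OF in_ab[OF that]])
  have h: "continuous_map (top_of_set unit_square) (KV V) (\<lambda>z. H (p (fst z), snd z))"
  proof -
    have pK: "continuous_map (top_of_set {0..1}) K p"
      using p unfolding pathin_def by (simp add: continuous_map_in_subtopology)
    have "continuous_map (top_of_set unit_square) K (\<lambda>z. p (fst z))"
      by (rule continuous_map_compose_on[OF pK]) (auto intro!: continuous_intros)
    then have 1: "continuous_map (top_of_set unit_square) (subtopology K U) (\<lambda>z. p (fst z))"
      using pU(1) by (auto simp: continuous_map_in_subtopology)
    have 2: "continuous_map (top_of_set unit_square) (top_of_set {0..1}) snd"
      by (auto simp: continuous_map_in_subtopology intro!: continuous_intros)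
    have "continuous_map (top_of_set unit_square) (prod_topology (subtopology K U) (top_of_set {0..1})) (\<lambda>z. (p (fst z), snd z))"
      using 1 2 by (simp add: continuous_map_pairwise o_def)
    from continuous_map_compose[OF this Hcont]
    have "continuous_map (top_of_set unit_square) K (\<lambda>z. H (p (fst z), snd z))" by (simp add: o_def)
    moreover have "H (p (fst z), snd z) \<in> full V" if "z \<in> unit_square" for z
    proof -
      have z: "fst z \<in> {0..1}" "snd z \<in> {0..1}" using that by (simp_all only: mem_Times_iff)
      show ?thesis using Hy[OF pU(1)[OF z(1)]] z(2) full_mono[OF pU(2)[OF z(1)]] by blast
    qed
    ultimately show ?thesis by (auto simp: continuous_map_in_subtopology simp del: mem_Times_iff)
  qed
  let ?ta = "\<lambda>t. H (r a, t)" and ?tb = "\<lambda>t. H (r b, t)"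
  have sq: "path_homotopic (KV V) (path_join p ?tb) (path_join ?ta (\<lambda>_. Vertex g))"
  proof -
    let ?\<alpha> = "path_join (\<lambda>x::real. (x, 0::real)) (\<lambda>x. (1, x))" and ?\<beta> = "path_join (\<lambda>x::real. (0::real, x)) (\<lambda>x. (x, 1))"
    have "path_homotopic (KV V) (\<lambda>x. H (p (fst (?\<alpha> x)), snd (?\<alpha> x))) (\<lambda>x. H (p (fst (?\<beta> x)), snd (?\<beta> x)))"
    proof (rule path_homotopic_factor[OF _ h])
      show "convex unit_square" by (intro convex_Times convex_real_interval)
      show "continuous_on {0..1} ?\<alpha>" "continuous_on {0..1} ?\<beta>"
        by (rule continuous_on_path_join; auto intro!: continuous_intros)+
    qed (auto simp: path_join_def)
    then show ?thesis
    proof (rule path_homotopic_cong)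
      fix x :: real assume x: "0 \<le> x" "x \<le> 1"
      have H0: "H (p y, 0) = p y" "H (p y, 1) = Vertex g" if "0 \<le> y" "y \<le> 1" for y using Hy[OF pU(1), of y] that by auto
      show "H (p (fst (?\<alpha> x)), snd (?\<alpha> x)) = path_join p ?tb x"
        using x H0 p01 by (simp add: path_join_def)
      show "H (p (fst (?\<beta> x)), snd (?\<beta> x)) = path_join ?ta (\<lambda>_. Vertex g) x"
        using x H0 p01 by (simp add: path_join_def)
    qed
  qed
  obtain u where u: "u \<in> words S" "pverts (base (r a)) u \<subseteq> V"
    and hu: "path_homotopic (KV V) ?ta (path_join (base_path (r a)) (epath (base (r a)) u))"
    using Hy[OF yU(1)] yV(1) path_homotopic_subtopology_mono[OF _ full_mono[OF yV(1)]] by (meson order_trans)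
  obtain v where v: "v \<in> words S" "pverts (base (r b)) v \<subseteq> V"
    and hv: "path_homotopic (KV V) ?tb (path_join (base_path (r b)) (epath (base (r b)) v))"
    using Hy[OF yU(2)] yV(2) path_homotopic_subtopology_mono[OF _ full_mono[OF yV(2)]] by (meson order_trans)
  let ?ca = "base_path (r a)" and ?cb = "base_path (r b)" and ?ea = "epath (base (r a)) u" and ?eb = "epath (base (r b)) v"
  let ?eb' = "epath g (inv_word v)"
  have gc: "base (r a) \<in> carrier G" "base (r b) \<in> carrier G" using yp base_carrier by auto
  have ga: "base (r a) \<otimes> val u = g" using path_homotopic_ends(2)[OF hu] Hy[OF yU(1)] gc u by simp
  have gb: "base (r b) \<otimes> val v = g" using path_homotopic_ends(2)[OF hv] Hy[OF yU(2)] gc v by simp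
  have g: "g \<in> carrier G" using ga gc u by auto
  have Vv: "pverts g (inv_word v) \<subseteq> V" using path_verts_inv_word[OF gc(2) v(1)] v(2) gb by simp
  have cp: "pathin (KV V) ?ca" "pathin (KV V) ?cb" using yp yV by (auto intro!: pathin_base_path)
  have ep: "pathin (KV V) ?ea" "pathin (KV V) ?eb" "pathin (KV V) ?eb'" using gc u v g Vv by (auto intro!: pathin_epath)
  have tp: "pathin (KV V) ?ta" "pathin (KV V) ?tb" using path_homotopic_pathin[OF hu] path_homotopic_pathin[OF hv] by auto
  have ends: "?ca 0 = r a" "?ca 1 = Vertex (base (r a))" "?cb 0 = r b" "?cb 1 = Vertex (base (r b))"
    "?ea 0 = Vertex (base (r a))" "?ea 1 = Vertex g" "?eb 0 = Vertex (base (r b))" "?eb 1 = Vertex g" "?eb' 0 = Vertex g"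
    "?ta 1 = Vertex g" "?tb 0 = r b"
    using base_path_ends yp gc u v ga gb g Hy[OF yU(1)] Hy[OF yU(2)] by simp_all
  have "path_homotopic (KV V) (path_join (path_join p ?cb) ?eb) (path_join p (path_join ?cb ?eb))"
    using p cp ep ends p01 by (intro path_homotopic_assoc) auto
  also have "path_homotopic (KV V) \<dots> (path_join p ?tb)"
    using p ends p01 by (intro path_homotopic_join path_homotopic_sym[OF hv] path_homotopic_refl) auto
  also note sq
  also have "path_homotopic (KV V) (path_join ?ta (\<lambda>_. Vertex g)) ?ta"
    using path_homotopic_const_right[OF tp(1)] ends by simp
  also note hu
  finally have main: "path_homotopic (KV V) (path_join (path_join p ?cb) ?eb) (path_join ?ca ?ea)" .
  have pj: "pathin (KV V) (path_join p ?cb)" using p cp p01 ends by (intro pathin_join) auto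
  have loop: "path_homotopic (KV V) (\<lambda>_. path_join p ?cb 1) (path_join ?eb ?eb')"
  proof -
    have "path_homotopic (KV V) (epath (base (r b)) []) (epath (base (r b)) (v @ inv_word v))"
      by (rule path_homotopic_sym[OF ehomD(6)[OF ehom_cancel[OF gc(2) v]]])
    also have "path_homotopic (KV V) \<dots> (path_join ?eb ?eb')"
      using epath_append[OF gc(2) v, of "inv_word v"] Vv gb v by simp
    finally show ?thesis using ends by (simp add: epath_def[abs_def])
  qed
  have "path_homotopic (KV V) (path_join p ?cb) (path_join (path_join p ?cb) (\<lambda>_. path_join p ?cb 1))"
    by (rule path_homotopic_sym[OF path_homotopic_const_right[OF pj]])
  also have "path_homotopic (KV V) \<dots> (path_join (path_join p ?cb) (path_join ?eb ?eb'))"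
    using pj by (intro path_homotopic_join path_homotopic_refl loop) auto
  also have "path_homotopic (KV V) \<dots> (path_join (path_join (path_join p ?cb) ?eb) ?eb')"
    using pj ep ends by (intro path_homotopic_sym[OF path_homotopic_assoc]) auto
  also have "path_homotopic (KV V) \<dots> (path_join (path_join ?ca ?ea) ?eb')"
    using ep ends by (intro path_homotopic_join main path_homotopic_refl) auto
  also have "path_homotopic (KV V) \<dots> (path_join ?ca (path_join ?ea ?eb'))"
    using cp ep ends by (intro path_homotopic_assoc) auto
  also have "path_homotopic (KV V) \<dots> (path_join ?ca (epath (base (r a)) (u @ inv_word v)))"
  proof -
    have "path_homotopic (KV V) (path_join ?ea ?eb') (epath (base (r a)) (u @ inv_word v))"
      using path_homotopic_sym[OF epath_append[OF gc(1) u, of "inv_word v"]] Vv ga v by simp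
    then show ?thesis using cp ends by (intro path_homotopic_join path_homotopic_refl) auto
  qed
  finally have "path_homotopic (KV V) (path_join p ?cb) (path_join ?ca (epath (base (r a)) (u @ inv_word v)))" .
  moreover have "base (r a) \<otimes> val (u @ inv_word v) = base (r b)"
  proof -
    have "base (r a) \<otimes> val (u @ inv_word v) = (base (r a) \<otimes> val u) \<otimes> inv (val v)" using u v gc by (simp add: m_assoc)
    also have "\<dots> = (base (r b) \<otimes> val v) \<otimes> inv (val v)" by (simp only: ga gb)
    also have "\<dots> = base (r b)" using gc v by (simp add: m_assoc)
    finally show ?thesis .
  qed
  ultimately show ?thesis
    unfolding approximable_def
    using u v gc Vv ga by (intro bexI[of _ "u @ inv_word v"]) (auto simp: path_verts_append p_def[abs_def])
qed

text \<open>Approximations concatenate, and they exist locally since contractible open sets cover the complex; bisection does the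
  rest.\<close>

lemma approximable_segment:
  assumes r: "continuous_map (top_of_set {c..d}) K r" and cd: "c \<le> d"
  shows "approximable (\<Union>\<tau>\<in>{c..d}. cell_verts (r \<tau>)) r c d"
proof -
  let ?V = "\<Union>\<tau>\<in>{c..d}. cell_verts (r \<tau>)"
  have sub: "continuous_map (top_of_set {a..b}) K r" if "{a..b} \<subseteq> {c..d}" for a b
    using continuous_map_compose_on[OF r, of "{a..b}" "\<lambda>x. x"] that by auto
  have "c \<le> c \<and> d \<le> d \<longrightarrow> approximable ?V r c d"
  proof (rule Bolzano[where P = "\<lambda>a b. c \<le> a \<and> b \<le> d \<longrightarrow> approximable ?V r a b", OF cd], goal_cases)
    case (1 a b e)
    show ?case
    proof
      assume ae: "c \<le> a \<and> e \<le> d"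
      show "approximable ?V r a e"
      proof (rule approximable_trans[of a e r b])
        show "cell_verts (r \<tau>) \<subseteq> ?V" if "\<tau> \<in> {a..e}" for \<tau>
          using that ae by (intro UN_upper) auto
        show "approximable ?V r a b" "approximable ?V r b e" using 1 ae by (auto simp del: UN_simps)
      qed (use 1 ae in \<open>auto intro!: sub\<close>)
    qed
  next
    case (2 x)
    note local = 2
    have "r x \<in> cayley_points G S P" using r local by (auto simp: continuous_map_def Pi_iff topspace_K)
    then obtain U g H where U: "r x \<in> U" "contracts U g H" by (rule exists_contracts)
    have "openin (top_of_set {c..d}) {\<tau> \<in> topspace (top_of_set {c..d}). r \<tau> \<in> U}"
      using U(2) by (intro openin_continuous_map_preimage[OF r]) (simp add: contracts_def)
    then obtain T where T: "open T" "{\<tau> \<in> {c..d}. r \<tau> \<in> U} = {c..d} \<inter> T" by (auto simp: openin_open)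
    have "x \<in> T" using T(2) U(1) local by auto
    then obtain \<delta> where \<delta>: "\<delta> > 0" "ball x \<delta> \<subseteq> T" using T(1) open_contains_ball by blast
    have "approximable ?V r a b" if ab: "a \<le> x" "x \<le> b" "b - a < \<delta>" "c \<le> a" "b \<le> d" for a b
    proof (rule approximable_local[OF U(2)])
      show "r \<tau> \<in> U" if "\<tau> \<in> {a..b}" for \<tau>
      proof -
        have "\<tau> \<in> ball x \<delta>" "\<tau> \<in> {c..d}" using that ab by (auto simp: dist_real_def)
        then have "\<tau> \<in> {\<tau> \<in> {c..d}. r \<tau> \<in> U}" unfolding T(2) using \<delta>(2) by blast
        then show ?thesis by simp
      qed
      show "cell_verts (r \<tau>) \<subseteq> ?V" if "\<tau> \<in> {a..b}" for \<tau> using that ab by (intro UN_upper) auto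
    qed (use ab in \<open>auto intro!: sub\<close>)
    then show ?case using \<delta>(1) by blast
  qed
  then show ?thesis by simp
qed

primrec pos :: "'a \<Rightarrow> (nat \<Rightarrow> 'a word) \<Rightarrow> nat \<Rightarrow> 'a" where
  "pos g \<gamma> 0 = g"
| "pos g \<gamma> (Suc j) = pos g \<gamma> j \<otimes> val (\<gamma> j)"

lemma pos_closed: "g \<in> carrier G \<Longrightarrow> (\<And>j. \<gamma> j \<in> words S) \<Longrightarrow> pos g \<gamma> j \<in> carrier G"
  by (induction j) auto

text \<open>A ladder joins two rays of edge words: the rungs \<open>E j\<close> start with \<open>w\<close>, and the \<open>j\<close>-th square is
  filled inside the full subcomplex on \<open>U j\<close>.\<close>

definition ladder :: "'a \<Rightarrow> 'a word \<Rightarrow> (nat \<Rightarrow> 'a word) \<Rightarrow> (nat \<Rightarrow> 'a word) \<Rightarrow> (nat \<Rightarrow> 'a set) \<Rightarrow> bool" where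
  "ladder v w \<gamma> \<gamma>' U \<longleftrightarrow> (\<exists>E. E 0 = w \<and> (\<forall>j. ehom (U j) (pos v \<gamma> j) (\<gamma> j @ E (Suc j)) (E j @ \<gamma>' j)))"

lemma ladder_pos:
  assumes E: "\<And>j. ehom (U j) (pos v \<gamma> j) (\<gamma> j @ E (Suc j)) (E j @ \<gamma>' j)"
  shows "pos v \<gamma> j \<otimes> val (E j) = pos (v \<otimes> val (E 0)) \<gamma>' j"
proof (induction j)
  case (Suc j)
  note D = ehomD[OF E[of j]]
  have "pos v \<gamma> (Suc j) \<otimes> val (E (Suc j)) = pos v \<gamma> j \<otimes> val (\<gamma> j @ E (Suc j))" using D by (simp add: m_assoc)
  also have "\<dots> = pos v \<gamma> j \<otimes> val (E j @ \<gamma>' j)" using ehom_val[OF E[of j]] by simp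
  also have "\<dots> = pos v \<gamma> j \<otimes> val (E j) \<otimes> val (\<gamma>' j)" using D by (simp add: m_assoc)
  finally show ?case using Suc by simp
qed simp

lemma ladder_trans:
  assumes "ladder v w \<gamma> \<gamma>' U" "ladder (v \<otimes> val w) w' \<gamma>' \<gamma>'' U'"
  shows "ladder v (w @ w') \<gamma> \<gamma>'' (\<lambda>j. U j \<union> U' j)"
proof -
  obtain E where E: "E 0 = w" "\<And>j. ehom (U j) (pos v \<gamma> j) (\<gamma> j @ E (Suc j)) (E j @ \<gamma>' j)"
    using assms(1) unfolding ladder_def by blast
  obtain F where F: "F 0 = w'" "\<And>j. ehom (U' j) (pos (v \<otimes> val w) \<gamma>' j) (\<gamma>' j @ F (Suc j)) (F j @ \<gamma>'' j)"
    using assms(2) unfolding ladder_def by blast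
  have pos: "pos v \<gamma> j \<otimes> val (E j) = pos (v \<otimes> val w) \<gamma>' j" for j
    using ladder_pos[of U v \<gamma> E \<gamma>'] E by simp
  have "ehom (U j \<union> U' j) (pos v \<gamma> j) (\<gamma> j @ (E (Suc j) @ F (Suc j))) ((E j @ F j) @ \<gamma>'' j)" for j
  proof -
    note D = ehomD[OF E(2)[of j]] and D' = ehomD[OF F(2)[of j]]
    have e1: "ehom (U j \<union> U' j) (pos v \<gamma> j) (\<gamma> j @ E (Suc j)) (E j @ \<gamma>' j)" by (rule ehom_mono[OF E(2)]) blast
    have e2: "ehom (U j \<union> U' j) (pos (v \<otimes> val w) \<gamma>' j) (\<gamma>' j @ F (Suc j)) (F j @ \<gamma>'' j)" by (rule ehom_mono[OF F(2)]) blast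
    have q: "pos v \<gamma> j \<otimes> val (\<gamma> j @ E (Suc j)) = pos (v \<otimes> val w) \<gamma>' j \<otimes> val (\<gamma>' j)"
    proof -
      have "pos v \<gamma> j \<otimes> val (\<gamma> j @ E (Suc j)) = pos v \<gamma> j \<otimes> val (E j @ \<gamma>' j)" by (simp only: ehom_val[OF E(2)[of j]])
      also have "\<dots> = pos v \<gamma> j \<otimes> val (E j) \<otimes> val (\<gamma>' j)" using D by (simp add: m_assoc)
      finally show ?thesis by (simp only: pos)
    qed
    have r: "ehom (U j \<union> U' j) (pos v \<gamma> j \<otimes> val (\<gamma> j @ E (Suc j))) (F (Suc j)) (F (Suc j))"
      unfolding q using D' by (intro ehom_refl) (auto simp: path_verts_append)
    have r': "ehom (U j \<union> U' j) (pos v \<gamma> j) (E j) (E j)"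
      using D by (intro ehom_refl) (auto simp: path_verts_append)
    have "ehom (U j \<union> U' j) (pos v \<gamma> j) ((\<gamma> j @ E (Suc j)) @ F (Suc j)) ((E j @ \<gamma>' j) @ F (Suc j))"
      by (rule ehom_append[OF e1 r])
    also have "ehom (U j \<union> U' j) (pos v \<gamma> j) ((E j @ \<gamma>' j) @ F (Suc j)) (E j @ (F j @ \<gamma>'' j))"
      using ehom_append[OF r' e2[folded pos]] by simp
    finally show ?thesis by simp
  qed
  then show ?thesis unfolding ladder_def using E(1) F(1) by (intro exI[of _ "\<lambda>j. E j @ F j"]) auto
qed

lemma ehom_square_flip:
  assumes "ehom V g (a @ e') (e @ b)"
  shows "ehom V (g \<otimes> val e) (b @ inv_word e') (inv_word e @ a)"
proof -
  note D = ehomD[OF assms]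
  have w: "a \<in> words S" "e \<in> words S" "e' \<in> words S" "b \<in> words S" using D by auto
  let ?h = "g \<otimes> val e"
  have h: "?h \<in> carrier G" using D w by simp
  have V: "pverts g a \<subseteq> V" "pverts (g \<otimes> val a) e' \<subseteq> V" "pverts g e \<subseteq> V" "pverts ?h b \<subseteq> V"
    using D w by (auto simp: path_verts_append)
  have bk: "?h \<otimes> val (inv_word e) = g" using D w by (simp add: m_assoc)
  have Vi: "pverts ?h (inv_word e) \<subseteq> V" using path_verts_inv_word[of g e] V D w by simp
  have q: "?h \<otimes> val b = g \<otimes> val a \<otimes> val e'" using ehom_val[OF assms] D w by (simp add: m_assoc)
  have Vi': "pverts (?h \<otimes> val b) (inv_word e') \<subseteq> V"
    unfolding q using path_verts_inv_word[of "g \<otimes> val a" e'] V D w by simp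
  have ri: "ehom V ?h (inv_word e) (inv_word e)" using h w Vi by (intro ehom_refl) auto
  have "ehom V ?h ([] @ (b @ inv_word e')) ((inv_word e @ e) @ (b @ inv_word e'))"
  proof (rule ehom_append)
    show "ehom V ?h [] (inv_word e @ e)"
      by (rule ehom_sym[OF ehom_cancel'[OF h w(2) Vi]])
    show "ehom V (?h \<otimes> val []) (b @ inv_word e') (b @ inv_word e')"
      using h w V Vi' by (intro ehom_refl) (auto simp: path_verts_append)
  qed
  also have "ehom V ?h ((inv_word e @ e) @ (b @ inv_word e')) (inv_word e @ ((a @ e') @ inv_word e'))"
  proof -
    have "ehom V g ((e @ b) @ inv_word e') ((a @ e') @ inv_word e')"
    proof (rule ehom_append[OF ehom_sym[OF assms]])
      show "ehom V (g \<otimes> val (e @ b)) (inv_word e') (inv_word e')"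
        using D w Vi' by (intro ehom_refl) (auto simp: m_assoc)
    qed
    then have "ehom V (?h \<otimes> val (inv_word e)) ((e @ b) @ inv_word e') ((a @ e') @ inv_word e')" by (simp only: bk)
    from ehom_append[OF ri this] show ?thesis by simp
  qed
  also have "ehom V ?h (inv_word e @ ((a @ e') @ inv_word e')) (inv_word e @ (a @ []))"
  proof -
    have "ehom V (g \<otimes> val a) (e' @ inv_word e') []" using D w V by (intro ehom_cancel) auto
    moreover have "ehom V g a a" using D w V by (intro ehom_refl) auto
    ultimately have "ehom V g (a @ (e' @ inv_word e')) (a @ [])" by (intro ehom_append)
    then have "ehom V (?h \<otimes> val (inv_word e)) (a @ (e' @ inv_word e')) (a @ [])" by (simp only: bk)
    from ehom_append[OF ri this] show ?thesis by simp
  qed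
  finally show ?thesis by simp
qed

text \<open>The same squares, with each rung traversed backwards.\<close>

lemma ladder_sym:
  assumes "ladder v w \<gamma> \<gamma>' U"
  shows "ladder (v \<otimes> val w) (inv_word w) \<gamma>' \<gamma> U"
proof -
  obtain E where E: "E 0 = w" "\<And>j. ehom (U j) (pos v \<gamma> j) (\<gamma> j @ E (Suc j)) (E j @ \<gamma>' j)"
    using assms unfolding ladder_def by blast
  have pos: "pos v \<gamma> j \<otimes> val (E j) = pos (v \<otimes> val w) \<gamma>' j" for j
    using ladder_pos[of U v \<gamma> E \<gamma>'] E by simp
  show ?thesis
    unfolding ladder_def using E(1) ehom_square_flip[OF E(2)] pos
    by (intro exI[of _ "\<lambda>j. inv_word (E j)"]) auto
qed

lemma ladder_nil:
  assumes "v \<in> carrier G" "\<And>j. \<gamma> j \<in> words S"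
  shows "ladder v [] \<gamma> \<gamma> (\<lambda>j. pverts (pos v \<gamma> j) (\<gamma> j))"
  unfolding ladder_def using assms pos_closed
  by (intro exI[of _ "\<lambda>_. []"]) (auto intro!: ehom_refl)

text \<open>Ladders with properly escaping squares: a vertex lies in finitely many squares, and only if the bottom rung
  passes through the finite set \<open>N x\<close>.\<close>

definition proper_ladder :: "('a \<Rightarrow> 'a set) \<Rightarrow> 'a \<Rightarrow> 'a word \<Rightarrow> (nat \<Rightarrow> 'a word) \<Rightarrow> (nat \<Rightarrow> 'a word) \<Rightarrow> bool" where
  "proper_ladder N v w \<gamma> \<gamma>' \<longleftrightarrow> (\<exists>U. ladder v w \<gamma> \<gamma>' U \<and> (\<forall>x. finite {j. x \<in> U j}) \<and>
     (\<forall>j. \<forall>x\<in>U j. pverts v w \<inter> N x \<noteq> {}))"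

text \<open>Ladders over the letters of a word are put side by side.\<close>

lemma proper_ladder_word:
  assumes Y: "Y \<subseteq> carrier G"
    and nil: "\<And>v. v \<in> Y \<Longrightarrow> proper_ladder N v [] (\<gamma> v) (\<gamma> v)"
    and letter: "\<And>v l. v \<in> Y \<Longrightarrow> fst l \<in> S \<Longrightarrow> v \<otimes> lval l \<in> Y \<Longrightarrow> proper_ladder N v [l] (\<gamma> v) (\<gamma> (v \<otimes> lval l))"
    and w: "w \<in> words S" "pverts v w \<subseteq> Y"
  shows "proper_ladder N v w (\<gamma> v) (\<gamma> (v \<otimes> val w))"
  using w
proof (induction w arbitrary: v)
  case Nil
  then have "v \<in> Y" "v \<otimes> \<one> = v" using Y by auto
  then show ?case using nil by simp
next
  case (Cons l w)
  let ?h = "v \<otimes> lval l"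
  have v: "v \<in> Y" "v \<in> carrier G" and l: "fst l \<in> S" and w: "w \<in> words S" "pverts ?h w \<subseteq> Y" and h: "?h \<in> Y"
    using Cons.prems Y by (auto dest: subsetD[OF _ start_in_path_verts])
  obtain U where U: "ladder v [l] (\<gamma> v) (\<gamma> ?h) U" "\<And>x. finite {j. x \<in> U j}" "\<And>j x. x \<in> U j \<Longrightarrow> pverts v [l] \<inter> N x \<noteq> {}"
    using letter[OF v(1) l h] unfolding proper_ladder_def by blast
  obtain U' where U': "ladder ?h w (\<gamma> ?h) (\<gamma> (?h \<otimes> val w)) U'" "\<And>x. finite {j. x \<in> U' j}" "\<And>j x. x \<in> U' j \<Longrightarrow> pverts ?h w \<inter> N x \<noteq> {}"
    using Cons.IH[OF w] unfolding proper_ladder_def by blast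
  have "ladder v ([l] @ w) (\<gamma> v) (\<gamma> (?h \<otimes> val w)) (\<lambda>j. U j \<union> U' j)"
    by (rule ladder_trans[OF U(1)]) (use U'(1) v l in simp)
  then have L: "ladder v (l # w) (\<gamma> v) (\<gamma> (v \<otimes> val (l # w))) (\<lambda>j. U j \<union> U' j)"
    using v l w by (simp add: m_assoc)
  have F: "finite {j. x \<in> U j \<union> U' j}" for x
    using U(2)[of x] U'(2)[of x] by (simp add: Collect_disj_eq)
  have M: "pverts v (l # w) \<inter> N x \<noteq> {}" if "x \<in> U j \<union> U' j" for x j
  proof -
    have "pverts v [l] \<subseteq> pverts v (l # w)" "pverts ?h w \<subseteq> pverts v (l # w)" by auto
    then show ?thesis using that U(3)[of x j] U'(3)[of x j] by blast
  qed
  show ?case unfolding proper_ladder_def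
    by (intro exI[of _ "\<lambda>j. U j \<union> U' j"] conjI allI ballI, rule L, rule F, rule M)
qed

section \<open>Sweeping rays onto columns\<close>

lemma path_verts_take:
  "g \<in> carrier G \<Longrightarrow> w \<in> words S \<Longrightarrow> x \<in> pverts g w \<Longrightarrow> \<exists>k\<le>length w. x = g \<otimes> val (take k w)"
proof (induction w arbitrary: g)
  case (Cons l w)
  show ?case
  proof (cases "x = g")
    case True
    then show ?thesis using Cons.prems by (intro exI[of _ 0]) auto
  next
    case False
    then obtain k where "k \<le> length w" "x = g \<otimes> lval l \<otimes> val (take k w)"
      using Cons.IH[of "g \<otimes> lval l"] Cons.prems by auto
    then show ?thesis using Cons.prems by (intro exI[of _ "Suc k"]) (auto simp: m_assoc)
  qed
qed simp

lemma finite_bases_of_vertex: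
  assumes x: "x \<in> carrier G" shows "finite (base ` {y \<in> cayley_points G S P. x \<in> cell_verts y})"
proof (rule finite_subset)
  let ?B = "{x} \<union> (\<lambda>s. x \<otimes> inv s) ` S \<union> (\<Union>w\<in>P. (\<lambda>k. x \<otimes> inv (val (take k w))) ` {..length w})"
  have "base y \<in> ?B" if y: "y \<in> cayley_points G S P" "x \<in> cell_verts y" for y
    using y(1)
  proof (cases rule: point_cases)
    case (1 g)
    then show ?thesis using y by (simp add: cell_verts_def)
  next
    case (2 g s u)
    then have s: "s \<in> carrier G" using S_carrier by blast
    have "x = g \<or> x = g \<otimes> s" using 2 y by (auto simp: cell_verts_def)
    then have "g = x \<or> g = x \<otimes> inv s" using 2 s by (auto simp: m_assoc)
    then show ?thesis using 2 by auto
  next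
    case (3 g w z)
    have wS: "w \<in> words S" using 3 P_words by blast
    have "x \<in> pverts g w" using 3 y by (simp add: cell_verts_def)
    then obtain k where k: "k \<le> length w" "x = g \<otimes> val (take k w)" using path_verts_take 3 wS by blast
    then have "g = x \<otimes> inv (val (take k w))" using 3 wS by (simp add: m_assoc)
    then show ?thesis using 3 k(1) by auto
  qed
  then show "base ` {y \<in> cayley_points G S P. x \<in> cell_verts y} \<subseteq> ?B" by blast
  show "finite ?B" using finite_S finite_P by simp
qed

text \<open>The initial unit of time spent at \<open>v\<close> makes room for the row of the grid that compares a ray with its
  edge path.\<close>

definition column :: "'a \<Rightarrow> (nat \<Rightarrow> 'a word) \<Rightarrow> real \<Rightarrow> 'a cayley_point" where
  "column v \<gamma> y = (case nat \<lfloor>y\<rfloor> of 0 \<Rightarrow> Vertex v | Suc j \<Rightarrow> epath (pos v \<gamma> j) (\<gamma> j) (frac y))"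

lemma ehom_square_paths:
  assumes "ehom V g (a @ e') (e @ b)"
  shows "path_homotopic (KV V) (path_join (epath g e) (epath (g \<otimes> val e) b))
    (path_join (epath g a) (epath (g \<otimes> val a) e'))"
proof -
  note D = ehomD[OF assms]
  have w: "a \<in> words S" "e' \<in> words S" "e \<in> words S" "b \<in> words S" using D by auto
  have "path_homotopic (KV V) (path_join (epath g e) (epath (g \<otimes> val e) b)) (epath g (e @ b))"
    using D w by (intro path_homotopic_sym[OF epath_append]) (auto simp: path_verts_append)
  also have "path_homotopic (KV V) \<dots> (epath g (a @ e'))" by (rule path_homotopic_sym[OF D(6)])
  also have "path_homotopic (KV V) \<dots> (path_join (epath g a) (epath (g \<otimes> val a) e'))"
    using D w by (intro epath_append) (auto simp: path_verts_append)
  finally show ?thesis .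
qed

text \<open>The corner of the grid: the way from the fixed vertex to the start of a ray, followed by the base path there, is
  homotopic to the edge path to the base vertex.\<close>

lemma start_square:
  assumes y: "y \<in> cayley_points G S P" and w: "w \<in> words S" "v \<in> carrier G" "v \<otimes> val w = base y"
    and V: "pverts v w \<subseteq> V" "cell_verts y \<subseteq> V"
  shows "path_homotopic (KV V) (path_join (path_join (epath v w) (path_reverse (base_path y))) (base_path y))
    (path_join (\<lambda>_. Vertex v) (epath v w))"
proof -
  let ?e = "epath v w" and ?c = "base_path y"
  have p: "pathin (KV V) ?e" "pathin (KV V) ?c" using w V y by (auto intro!: pathin_epath pathin_base_path)
  have ends: "?e 0 = Vertex v" "?e 1 = Vertex (base y)" "?c 1 = Vertex (base y)" using w base_path_ends[OF y] by simp_all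
  have pr: "pathin (KV V) (path_reverse ?c)" by (rule pathin_reverse[OF p(2)])
  have "path_homotopic (KV V) (path_join (path_join ?e (path_reverse ?c)) ?c) (path_join ?e (path_join (path_reverse ?c) ?c))"
    using p pr ends by (intro path_homotopic_assoc) auto
  also have "path_homotopic (KV V) \<dots> (path_join ?e (\<lambda>_. ?c 1))"
    using p pr ends by (intro path_homotopic_join path_homotopic_refl path_homotopic_reverse_left) auto
  also have "path_homotopic (KV V) \<dots> ?e" using path_homotopic_const_right[OF p(1)] ends by simp
  also have "path_homotopic (KV V) ?e (path_join (\<lambda>_. Vertex v) ?e)"
    using path_homotopic_sym[OF path_homotopic_const_left[OF p(1)]] ends by simp
  finally show ?thesis .
qed

text \<open>The ray is cut into unit segments, each homotopic to an edge path. These edge paths are the bottom rungs of proper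
  ladders, which fill the grid above the row that compares the segments with them. A vertex \<open>x\<close> meets
  finitely many squares: only finitely many of the edge paths meet \<open>N x\<close>, because the ray is proper, and
  each ladder has finitely many squares at \<open>x\<close>.\<close>

theorem ray_homotopic_column:
  assumes Y: "Y \<subseteq> carrier G" and \<gamma>: "\<And>v j. v \<in> Y \<Longrightarrow> \<gamma> v j \<in> words S" and N: "\<And>x. finite (N x)"
    and lad: "\<And>v w. w \<in> words S \<Longrightarrow> pverts v w \<subseteq> Y \<Longrightarrow> proper_ladder N v w (\<gamma> v) (\<gamma> (v \<otimes> val w))"
    and r: "is_ray K r" and rY: "\<And>x. x \<ge> 0 \<Longrightarrow> cell_verts (r x) \<subseteq> Y"
    and w0: "w0 \<in> words S" "pverts v0 w0 \<subseteq> Y" "v0 \<otimes> val w0 = base (r 0)"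
  shows "properly_homotopic K r (column v0 (\<gamma> v0))"
proof -
  have rc: "continuous_map (top_of_set {0..}) K r"
    and rp: "\<And>C. compactin K C \<Longrightarrow> \<exists>M. \<forall>x\<ge>0. r x \<in> C \<longrightarrow> x \<le> M"
    using r by (auto simp: is_ray_iff[OF Hausdorff_K])
  have pts: "r x \<in> cayley_points G S P" if "x \<ge> 0" for x
    using rc that by (auto simp: continuous_map_def Pi_iff topspace_K)
  define V where "V n = (\<Union>\<tau>\<in>{real n..real (Suc n)}. cell_verts (r \<tau>))" for n
  have "approximable (V n) r (real n) (real (Suc n))" for n
    unfolding V_def
  proof (rule approximable_segment)
    show "continuous_map (top_of_set {real n..real (Suc n)}) K r"
      using continuous_map_compose_on[OF rc, of "{real n..real (Suc n)}" "\<lambda>x. x"] by auto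
  qed simp
  then have "\<forall>n. \<exists>w. w \<in> words S \<and> pverts (base (r (real n))) w \<subseteq> V n \<and> base (r (real n)) \<otimes> val w = base (r (real (Suc n))) \<and>
    path_homotopic (KV (V n)) (path_join (\<lambda>x. r (real n + (real (Suc n) - real n) * x)) (base_path (r (real (Suc n)))))
      (path_join (base_path (r (real n))) (epath (base (r (real n))) w))"
    unfolding approximable_def by blast
  from choice[OF this] obtain ws where ws: "\<And>n. ws n \<in> words S" "\<And>n. pverts (base (r (real n))) (ws n) \<subseteq> V n"
      "\<And>n. base (r (real n)) \<otimes> val (ws n) = base (r (real (Suc n)))"
    and wh: "\<And>n. path_homotopic (KV (V n)) (path_join (\<lambda>x. r (real n + (real (Suc n) - real n) * x)) (base_path (r (real (Suc n)))))
      (path_join (base_path (r (real n))) (epath (base (r (real n))) (ws n)))"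
    by blast
  define v where "v n = (case n of 0 \<Rightarrow> v0 | Suc m \<Rightarrow> base (r (real m)))" for n
  define w where "w n = (case n of 0 \<Rightarrow> w0 | Suc m \<Rightarrow> ws m)" for n
  \<comment> \<open>Index \<open>0\<close> stands for the way from \<open>v0\<close> to the start of the ray, index \<open>Suc m\<close> for its \<open>m\<close>-th segment.\<close>
  define VV where "VV n = (case n of 0 \<Rightarrow> pverts v0 w0 \<union> cell_verts (r 0) | Suc m \<Rightarrow> V m)" for n
  have "V m \<subseteq> Y" for m
    unfolding V_def by (intro UN_least rY) (auto intro: order_trans[OF of_nat_0_le_iff])
  then have VY: "VV n \<subseteq> Y" for n using w0(2) rY[of 0] by (auto simp: VV_def split: nat.split)
  have wS: "w n \<in> words S" and wV: "pverts (v n) (w n) \<subseteq> VV n" and vw: "v n \<otimes> val (w n) = v (Suc n)" for n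
    using w0 ws by (auto simp: w_def v_def VV_def split: nat.split)
  have vY: "v n \<in> Y" for n using wV[of n] VY[of n] by (meson start_in_path_verts subsetD)
  have vc: "v n \<in> carrier G" for n using vY Y by blast
  have \<gamma>v: "\<gamma> (v n) j \<in> words S" for n j by (rule \<gamma>[OF vY])
  have "\<forall>n. \<exists>E. \<exists>U. (E 0 = w n \<and> (\<forall>j. ehom (U j) (pos (v n) (\<gamma> (v n)) j) (\<gamma> (v n) j @ E (Suc j)) (E j @ \<gamma> (v (Suc n)) j))) \<and>
      (\<forall>x. finite {j. x \<in> U j}) \<and> (\<forall>j. \<forall>x\<in>U j. pverts (v n) (w n) \<inter> N x \<noteq> {})"
  proof
    fix n
    have "proper_ladder N (v n) (w n) (\<gamma> (v n)) (\<gamma> (v (Suc n)))"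
      using lad[OF wS order_trans[OF wV VY], of n] by (simp only: vw)
    then show "\<exists>E. \<exists>U. (E 0 = w n \<and> (\<forall>j. ehom (U j) (pos (v n) (\<gamma> (v n)) j) (\<gamma> (v n) j @ E (Suc j)) (E j @ \<gamma> (v (Suc n)) j))) \<and>
      (\<forall>x. finite {j. x \<in> U j}) \<and> (\<forall>j. \<forall>x\<in>U j. pverts (v n) (w n) \<inter> N x \<noteq> {})"
      unfolding proper_ladder_def ladder_def by blast
  qed
  from choice[OF this] obtain E where "\<forall>n. \<exists>U. (E n 0 = w n \<and> (\<forall>j. ehom (U j) (pos (v n) (\<gamma> (v n)) j) (\<gamma> (v n) j @ E n (Suc j)) (E n j @ \<gamma> (v (Suc n)) j))) \<and>
      (\<forall>x. finite {j. x \<in> U j}) \<and> (\<forall>j. \<forall>x\<in>U j. pverts (v n) (w n) \<inter> N x \<noteq> {})" by blast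
  from choice[OF this] obtain U where EU: "\<And>n. E n 0 = w n"
      "\<And>n j. ehom (U n j) (pos (v n) (\<gamma> (v n)) j) (\<gamma> (v n) j @ E n (Suc j)) (E n j @ \<gamma> (v (Suc n)) j)"
      "\<And>n x. finite {j. x \<in> U n j}" "\<And>n j x. x \<in> U n j \<Longrightarrow> pverts (v n) (w n) \<inter> N x \<noteq> {}" by blast
  define p where "p n j = pos (v n) (\<gamma> (v n)) j" for n j
  have pc: "p n j \<in> carrier G" for n j unfolding p_def by (rule pos_closed[OF vc \<gamma>v])
  have pE: "p n j \<otimes> val (E n j) = p (Suc n) j" for n j
    unfolding p_def using ladder_pos[OF EU(2), of n j] EU(1)[of n] vw[of n] by simp
  have ES: "E n j \<in> words S" for n j using ehomD(3)[OF EU(2)[of n j]] by simp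
  have p0: "p n 0 = v n" and pS: "p n (Suc j) = p n j \<otimes> val (\<gamma> (v n) j)" for n j by (simp_all add: p_def)
  define a where "a n j = (case j of Suc i \<Rightarrow> epath (p n i) (E n i)
     | 0 \<Rightarrow> (case n of 0 \<Rightarrow> path_join (epath v0 w0) (path_reverse (base_path (r 0))) | Suc m \<Rightarrow> (\<lambda>x. r (x + real m))))" for n j
  define b where "b n j = (case j of Suc i \<Rightarrow> epath (p n i) (\<gamma> (v n) i)
     | 0 \<Rightarrow> (case n of 0 \<Rightarrow> (\<lambda>_. Vertex v0) | Suc m \<Rightarrow> base_path (r (real m))))" for n j
  define A where "A n j = full (case j of Suc i \<Rightarrow> U n i | 0 \<Rightarrow> VV n)" for n j
  have ends: "base_path (r (real m)) 0 = r (real m)" "base_path (r (real m)) 1 = Vertex (base (r (real m)))" for m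
    using base_path_ends[OF pts] by auto
  have v0c: "v0 \<in> carrier G" using vc[of 0] by (simp add: v_def)
  have hom: "path_homotopic (subtopology K (A n j)) (path_join (a n j) (b (Suc n) j)) (path_join (b n j) (a n (Suc j)))" for n j
  proof (cases j)
    case (Suc i)
    then show ?thesis using ehom_square_paths[OF EU(2)[of n i]]
      by (simp add: a_def b_def A_def pS p_def[symmetric] pE)
  next
    case 0
    show ?thesis
    proof (cases n)
      case (Suc m)
      have "(\<lambda>x. r (real m + (real (Suc m) - real m) * x)) = (\<lambda>x. r (x + real m))" by (simp add: fun_eq_iff add.commute)
      with wh[of m] show ?thesis
        using 0 Suc EU(1)[of "Suc m"] p0[of "Suc m"] by (simp add: a_def b_def A_def VV_def v_def w_def)
    next
      case n: 0
      have "path_homotopic (KV (VV 0)) (path_join (path_join (epath v0 w0) (path_reverse (base_path (r 0)))) (base_path (r 0)))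
        (path_join (\<lambda>_. Vertex v0) (epath v0 w0))"
        using w0 v0c by (intro start_square pts) (auto simp: VV_def)
      then show ?thesis
        using 0 n EU(1)[of 0] p0[of 0] by (simp add: a_def b_def A_def v_def w_def)
    qed
  qed
  have e1: "a n j 1 = b (Suc n) j 0" for n j
    using ends pc pE[of n] ES \<gamma>v ends[of 0] by (auto simp: a_def b_def split: nat.split)
  have e2: "b n j 1 = a n (Suc j) 0" for n j
  proof (cases j)
    case (Suc i)
    then show ?thesis using pc pS ES \<gamma>v by (simp add: a_def b_def)
  next
    case 0
    then show ?thesis using ends pc[of n 0] ES p0[of n] by (auto simp: a_def b_def v_def split: nat.split)
  qed
  have finV: "finite {n. x \<in> VV n}" for x
  proof (cases "x \<in> carrier G")
    case False
    then have "{n. x \<in> VV n} = {}" using VY Y by blast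
    then show ?thesis by simp
  next
    case True
    let ?F = "base ` {y \<in> cayley_points G S P. x \<in> cell_verts y}"
    have "?F \<subseteq> carrier G" using base_carrier by auto
    then obtain C where C: "compactin K C" "{y \<in> cayley_points G S P. base y \<in> ?F} \<subseteq> C"
      using compactin_over_finite[OF finite_bases_of_vertex[OF True]] by blast
    obtain M where M: "\<And>t. t \<ge> 0 \<Longrightarrow> r t \<in> C \<Longrightarrow> t \<le> M" using rp[OF C(1)] by blast
    have "n \<le> Suc (nat \<lceil>M\<rceil>)" if xn: "x \<in> VV n" for n
    proof (cases n)
      case (Suc m)
      then obtain \<tau> where \<tau>: "\<tau> \<in> {real m..real (Suc m)}" "x \<in> cell_verts (r \<tau>)" using xn by (auto simp: VV_def V_def)
      then have \<tau>0: "\<tau> \<ge> 0" by auto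
      have "r \<tau> \<in> {y \<in> cayley_points G S P. base y \<in> ?F}" using \<tau>(2) pts[OF \<tau>0] by blast
      then have "r \<tau> \<in> C" using C(2) by blast
      then have "\<tau> \<le> M" by (rule M[OF \<tau>0])
      then show ?thesis using \<tau>(1) Suc by (simp; linarith)
    qed simp
    then show ?thesis by (meson finite_nat_set_iff_bounded_le mem_Collect_eq)
  qed
  have fin: "finite {(n, j). A n j \<inter> C \<noteq> {}}" if C: "compactin K C" for C
  proof (rule finite_subset)
    let ?F = "base ` C"
    let ?T = "\<lambda>x. (\<lambda>n. (n, 0)) ` {n. x \<in> VV n} \<union> (SIGMA n:(\<Union>z\<in>N x. {n. z \<in> VV n}). Suc ` {j. x \<in> U n j})"
    have "(n, j) \<in> \<Union>(?T ` ?F)" if nj: "A n j \<inter> C \<noteq> {}" for n j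
    proof -
      obtain y where y: "y \<in> A n j" "y \<in> C" using nj by blast
      then have bs: "base y \<in> (case j of Suc i \<Rightarrow> U n i | 0 \<Rightarrow> VV n)"
        using base_in_cell_verts[of y] by (auto simp: A_def full_def)
      have bF: "base y \<in> ?F" using y(2) by blast
      have "(n, j) \<in> ?T (base y)"
      proof (cases j)
        case 0
        then show ?thesis using bs by auto
      next
        case (Suc i)
        then have u: "base y \<in> U n i" using bs by simp
        obtain z where "z \<in> N (base y)" "z \<in> VV n" using EU(4)[OF u] wV[of n] by blast
        then show ?thesis using u Suc by auto
      qed
      then show ?thesis using bF by blast
    qed
    then show "{(n, j). A n j \<inter> C \<noteq> {}} \<subseteq> \<Union>(?T ` ?F)" by blast
    have "finite (?T x)" for x
      using finV N EU(3) by (intro finite_UnI finite_imageI finite_SigmaI finite_UN_I)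
    then show "finite (\<Union>(?T ` ?F))" using compactin_finite_base[OF C] by blast
  qed
  have row: "is_ray K (\<lambda>x. a (nat \<lfloor>x\<rfloor>) 0 (frac x))"
    and rowcol: "properly_homotopic K (\<lambda>x. a (nat \<lfloor>x\<rfloor>) 0 (frac x)) (\<lambda>y. b 0 (nat \<lfloor>y\<rfloor>) (frac y))"
    using grid_properly_homotopic[OF Hausdorff_K hom e1 e2 fin] by auto
  have shift: "a (nat \<lfloor>x + 1\<rfloor>) 0 (frac (x + 1)) = r x" if "x \<ge> 0" for x
  proof -
    have "nat \<lfloor>x + 1\<rfloor> = Suc (nat \<lfloor>x\<rfloor>)" "frac (x + 1) = frac x" using that by (simp_all add: frac_def nat_add_distrib)
    moreover have "frac x + real (nat \<lfloor>x\<rfloor>) = x" using that by (simp add: frac_def)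
    ultimately show ?thesis by (simp add: a_def)
  qed
  have "properly_homotopic K (\<lambda>x. a (nat \<lfloor>x\<rfloor>) 0 (frac x)) (\<lambda>x. a (nat \<lfloor>x + 1\<rfloor>) 0 (frac (x + 1)))"
    using properly_homotopic_shift[OF Hausdorff_K row, of 1] by simp
  then have "properly_homotopic K (\<lambda>x. a (nat \<lfloor>x\<rfloor>) 0 (frac x)) r"
    by (rule properly_homotopic_cong) (rule refl, rule shift)
  from properly_homotopic_trans[OF Hausdorff_K properly_homotopic_sym[OF Hausdorff_K this] rowcol]
  show ?thesis
  proof (rule properly_homotopic_cong)
    show "b 0 (nat \<lfloor>y\<rfloor>) (frac y) = column v0 (\<gamma> v0) y" for y
      by (simp add: b_def column_def v_def p_def split: nat.split)
  qed simp
qed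

fun level_graph :: "('a \<Rightarrow> real) \<Rightarrow> 'a cayley_point \<Rightarrow> real" where
  "level_graph lev (Vertex g) = lev g"
| "level_graph lev (EdgePoint g s u) = (1 - u) * lev g + u * lev (g \<otimes> s)"
| "level_graph lev (CellPoint g w z) = 0"

text \<open>The affine extension of a function on the vertices; at the centre of a 2-cell it has the value of the base vertex.\<close>

definition level_fun :: "('a \<Rightarrow> real) \<Rightarrow> 'a cayley_point \<Rightarrow> real" where
  "level_fun lev = cone_extension G lev (level_graph lev)"

lemma continuous_map_level_fun: "continuous_map K euclideanreal (level_fun lev)"
  unfolding level_fun_def
proof (rule continuous_map_cone_extension)
  show "continuous_on {0..1} (\<lambda>u. level_graph lev (edge_map G a s u))" for a s
    by (rule continuous_on_eq[of _ "\<lambda>u. (1 - u) * lev a + u * lev (a \<otimes> s)"])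
       (auto intro!: continuous_intros simp: edge_map_def)
qed

lemma level_graph_le:
  assumes "\<And>x. x \<in> cell_verts y \<Longrightarrow> lev x \<le> c" "\<And>g w z. y \<noteq> CellPoint g w z" "\<And>g s u. y = EdgePoint g s u \<Longrightarrow> 0 < u \<and> u < 1"
  shows "level_graph lev y \<le> c"
proof (cases y)
  case (EdgePoint g s u)
  then have "lev g \<le> c" "lev (g \<otimes> s) \<le> c" "0 < u" "u < 1" using assms by (auto simp: cell_verts_def)
  then show ?thesis using EdgePoint convex_bound_le[of "lev g" c "lev (g \<otimes> s)" "1 - u" u] by simp
qed (use assms in \<open>auto simp: cell_verts_def\<close>)

text \<open>On each closed cell the extension is a convex combination of values at vertices of this cell.\<close>

lemma level_fun_le:
  assumes y: "y \<in> cayley_points G S P" and c: "\<And>x. x \<in> cell_verts y \<Longrightarrow> lev x \<le> c"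
  shows "level_fun lev y \<le> c"
proof (cases y)
  case (CellPoint g w z)
  then have g: "g \<in> carrier G" "w \<in> P" and z: "norm z < 1" using y by (auto simp: cayley_points_def)
  then have wS: "w \<in> words S" using P_words by blast
  let ?x = "edge_path G g w (real (length w) * (Arg2pi z / (2 * pi)))"
  have cv: "cell_verts y = pverts g w" using CellPoint by (simp add: cell_verts_def)
  have "?x \<in> cayley_points G S P" by (rule edge_path_in_points[OF is_group S_carrier g(1) wS])
  then have "level_graph lev ?x \<le> c"
  proof (intro level_graph_le)
    show "lev x \<le> c" if "x \<in> cell_verts ?x" for x
      using that cell_verts_edge_path[OF g(1) wS] cv c by blast
    have m: "edge_map G h s u \<noteq> CellPoint g' w' z'" for h s u g' w' z' by (simp add: edge_map_def)
    show "edge_path G h v u \<noteq> CellPoint g' w' z'" for h v u g' w' z'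
    proof (induction v arbitrary: h u)
      case (Cons l v)
      then show ?case using m by (cases l) auto
    qed simp
  qed (auto simp: cayley_points_def)
  moreover have "lev g \<le> c" using c cv by simp
  ultimately have "(1 - norm z) * lev g + norm z * level_graph lev ?x \<le> c" using z by (intro convex_bound_le) auto
  then show ?thesis unfolding level_fun_def CellPoint by simp
next
  case (Vertex g)
  then show ?thesis using level_graph_le[of y lev c] c by (simp add: level_fun_def)
next
  case (EdgePoint g s u)
  then show ?thesis using level_graph_le[of y lev c] c y by (auto simp: level_fun_def cayley_points_def)
qed

lemma level_fun_minus: "level_fun (\<lambda>x. - lev x) y = - level_fun lev y"
proof -
  have "level_graph (\<lambda>x. - lev x) y = - level_graph lev y" for y by (cases y) (auto simp: algebra_simps)
  then show ?thesis by (cases y) (auto simp: level_fun_def algebra_simps)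
qed

lemma connected_nonzero_sign:
  fixes A :: "real set"
  assumes "connected A" "0 \<notin> A" shows "(\<forall>x\<in>A. 0 < x) \<or> (\<forall>x\<in>A. x < 0)"
proof (rule ccontr)
  assume "\<not> ?thesis"
  then obtain x y where xy: "x \<in> A" "\<not> 0 < x" "y \<in> A" "\<not> y < 0" by blast
  then have "0 \<in> {x..y}" by simp
  with connected_contains_Icc[OF assms(1) xy(1,3)] show False using assms(2) by blast
qed

text \<open>A closed cell with a zero of the level has vertices of level between \<open>- D\<close> and \<open>D\<close> only, so there are finitely many
  such cells.\<close>

lemma level_zero_compact:
  assumes D: "\<And>y x x'. y \<in> cayley_points G S P \<Longrightarrow> x \<in> cell_verts y \<Longrightarrow> x' \<in> cell_verts y \<Longrightarrow> lev x \<le> lev x' + D"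
    and fin: "finite {g \<in> carrier G. \<bar>lev g\<bar> \<le> D}"
  shows "\<exists>C. compactin K C \<and> (\<forall>y\<in>cayley_points G S P. level_fun lev y = 0 \<longrightarrow> y \<in> C)"
proof -
  obtain C where C: "compactin K C" "{y \<in> cayley_points G S P. base y \<in> {g \<in> carrier G. \<bar>lev g\<bar> \<le> D}} \<subseteq> C"
    by (rule compactin_over_finite[OF fin]) auto
  have "y \<in> C" if y: "y \<in> cayley_points G S P" and z: "level_fun lev y = 0" for y
  proof -
    have "level_fun lev y \<le> lev (base y) + D" by (rule level_fun_le[OF y D[OF y _ base_in_cell_verts]])
    moreover have "level_fun (\<lambda>x. - lev x) y \<le> - lev (base y) + D"
    proof (rule level_fun_le[OF y])
      show "- lev x \<le> - lev (base y) + D" if "x \<in> cell_verts y" for x using D[OF y base_in_cell_verts that] by simp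
    qed
    ultimately have "\<bar>lev (base y)\<bar> \<le> D" using z by (simp add: level_fun_minus abs_le_iff)
    then show ?thesis using C(2) y base_carrier[OF y] by blast
  qed
  then show ?thesis using C(1) by blast
qed

text \<open>The zeros of the level lie in a compact set, which a ray leaves for good; from then on the sign of the level is
  constant.\<close>

lemma ray_level_sign:
  assumes D: "\<And>y x x'. y \<in> cayley_points G S P \<Longrightarrow> x \<in> cell_verts y \<Longrightarrow> x' \<in> cell_verts y \<Longrightarrow> lev x \<le> lev x' + D"
    and fin: "finite {g \<in> carrier G. \<bar>lev g\<bar> \<le> D}" and r: "is_ray K r"
  obtains M where "M \<ge> 0" "(\<forall>x\<ge>M. 0 < level_fun lev (r x)) \<or> (\<forall>x\<ge>M. level_fun lev (r x) < 0)"
proof -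
  have rc: "continuous_map (top_of_set {0..}) K r"
    and rp: "\<And>C. compactin K C \<Longrightarrow> \<exists>M. \<forall>x\<ge>0. r x \<in> C \<longrightarrow> x \<le> M"
    using r by (auto simp: is_ray_iff[OF Hausdorff_K])
  have "\<exists>C. compactin K C \<and> (\<forall>y\<in>cayley_points G S P. level_fun lev y = 0 \<longrightarrow> y \<in> C)"
    by (rule level_zero_compact[of lev D], rule D, assumption+, rule fin)
  then obtain C where C: "compactin K C" "\<And>y. y \<in> cayley_points G S P \<Longrightarrow> level_fun lev y = 0 \<Longrightarrow> y \<in> C"
    by blast
  obtain M0 where M0: "\<And>x. x \<ge> 0 \<Longrightarrow> r x \<in> C \<Longrightarrow> x \<le> M0" using rp[OF C(1)] by blast
  define M where "M = max 0 (M0 + 1)"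
  have pts: "r x \<in> cayley_points G S P" if "x \<ge> 0" for x
    using rc that by (auto simp: continuous_map_def Pi_iff topspace_K)
  have "continuous_map (top_of_set {0..}) euclideanreal (\<lambda>x. level_fun lev (r x))"
    using continuous_map_compose[OF rc continuous_map_level_fun] by (simp add: o_def)
  then have "continuous_on {0..} (\<lambda>x. level_fun lev (r x))" by simp
  then have "continuous_on {M..} (\<lambda>x. level_fun lev (r x))" by (rule continuous_on_subset) (auto simp: M_def)
  then have con: "connected ((\<lambda>x. level_fun lev (r x)) ` {M..})" by (rule connected_continuous_image) simp
  have nz: "level_fun lev (r x) \<noteq> 0" if "x \<in> {M..}" for x
    using C(2)[OF pts, of x] M0[of x] that by (auto simp: M_def)
  have "0 \<notin> (\<lambda>x. level_fun lev (r x)) ` {M..}"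
  proof
    assume "0 \<in> (\<lambda>x. level_fun lev (r x)) ` {M..}"
    then obtain x where "x \<in> {M..}" "0 = level_fun lev (r x)" by (elim imageE)
    with nz[of x] show False by simp
  qed
  from connected_nonzero_sign[OF con this] have "(\<forall>x\<ge>M. 0 < level_fun lev (r x)) \<or> (\<forall>x\<ge>M. level_fun lev (r x) < 0)"
    by auto
  then show thesis using that[of M] by (simp add: M_def)
qed

text \<open>After time \<open>M\<close> the level is positive, before that the ray meets finitely many closed cells only; within
  each cell the level varies by at most \<open>D\<close>.\<close>

lemma ray_level_bounded_below:
  assumes D: "\<And>y x x'. y \<in> cayley_points G S P \<Longrightarrow> x \<in> cell_verts y \<Longrightarrow> x' \<in> cell_verts y \<Longrightarrow> lev x \<le> lev x' + D"
    and r: "is_ray K r" and M: "M \<ge> 0" "\<And>x. x \<ge> M \<Longrightarrow> 0 < level_fun lev (r x)"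
  obtains L where "\<And>x. x \<ge> 0 \<Longrightarrow> cell_verts (r x) \<subseteq> {v \<in> carrier G. - L \<le> lev v}"
proof -
  have rc: "continuous_map (top_of_set {0..}) K r" using r by (auto simp: is_ray_iff[OF Hausdorff_K])
  have pts: "r x \<in> cayley_points G S P" if "x \<ge> 0" for x
    using rc that by (auto simp: continuous_map_def Pi_iff topspace_K)
  have "compactin (top_of_set {0..}) {0..M}" by (auto simp: compactin_subtopology)
  then have "finite (base ` r ` {0..M})" by (intro compactin_finite_base image_compactin[OF _ rc])
  then have fin: "finite (lev ` base ` r ` {0..M})" by (rule finite_imageI)
  define B where "B = Min (lev ` base ` r ` {0..M})"
  have B: "B \<le> lev (base (r x))" if "0 \<le> x" "x \<le> M" for x
    unfolding B_def by (rule Min_le[OF fin]) (use that in auto)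
  have "cell_verts (r x) \<subseteq> {v \<in> carrier G. - (\<bar>B\<bar> + \<bar>D\<bar>) \<le> lev v}" if x: "x \<ge> 0" for x
  proof
    fix v assume v: "v \<in> cell_verts (r x)"
    have vc: "v \<in> carrier G"
      using pts[OF x]
    proof (cases rule: point_cases)
      case (2 g s u)
      then show ?thesis using v S_carrier by (auto simp: cell_verts_def)
    next
      case (3 g w z)
      then have "w \<in> words S" using P_words by blast
      then show ?thesis using v 3 path_verts_carrier by (auto simp: cell_verts_def)
    qed (use v in \<open>auto simp: cell_verts_def\<close>)
    have "- (\<bar>B\<bar> + \<bar>D\<bar>) \<le> lev v"
    proof (cases "x \<le> M")
      case True
      then show ?thesis using B[OF x True] D[OF pts[OF x] base_in_cell_verts v] by linarith
    next
      case False
      then have "0 < level_fun lev (r x)" using M(2) by simp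
      moreover have "level_fun lev (r x) \<le> lev v + D" by (rule level_fun_le[OF pts[OF x] D[OF pts[OF x] _ v]])
      ultimately show ?thesis by linarith
    qed
    then show "v \<in> {v \<in> carrier G. - (\<bar>B\<bar> + \<bar>D\<bar>) \<le> lev v}" using vc by simp
  qed
  then show thesis by (rule that)
qed

lemma level_separates_ends:
  assumes D: "\<And>y x x'. y \<in> cayley_points G S P \<Longrightarrow> x \<in> cell_verts y \<Longrightarrow> x' \<in> cell_verts y \<Longrightarrow> lev x \<le> lev x' + D"
    and fin: "finite {g \<in> carrier G. \<bar>lev g\<bar> \<le> D}" and e: "converge_to_same_end K r s"
    and r: "\<And>x. x \<ge> M \<Longrightarrow> 0 < level_fun lev (r x)" and s: "\<And>x. x \<ge> M' \<Longrightarrow> level_fun lev (s x) < 0"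
  shows False
proof -
  have "\<exists>C. compactin K C \<and> (\<forall>y\<in>cayley_points G S P. level_fun lev y = 0 \<longrightarrow> y \<in> C)"
    by (rule level_zero_compact[of lev D], rule D, assumption+, rule fin)
  then obtain C where C: "compactin K C" "\<And>y. y \<in> cayley_points G S P \<Longrightarrow> level_fun lev y = 0 \<Longrightarrow> y \<in> C"
    by blast
  obtain N Q where N: "N \<ge> 0" and Q: "Q \<in> path_components_of (subtopology K (topspace K - C))"
    "r ` {N..} \<subseteq> Q" "s ` {N..} \<subseteq> Q" using e C(1) unfolding converge_to_same_end_def by blast
  have pQ: "path_connectedin (subtopology K (topspace K - C)) Q"
    using Q(1) by (rule path_connectedin_path_components_of)
  then have QC: "Q \<subseteq> topspace K - C" and "path_connectedin K Q"
    by (auto simp: path_connectedin_subtopology)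
  then have "connectedin euclideanreal (level_fun lev ` Q)"
    by (intro connectedin_continuous_map_image[OF continuous_map_level_fun] path_connectedin_imp_connectedin)
  then have con: "connected (level_fun lev ` Q)" by simp
  have "0 \<notin> level_fun lev ` Q" using QC C(2) by (auto simp: topspace_K)
  from connected_nonzero_sign[OF con this] show False
  proof
    assume *: "\<forall>x\<in>level_fun lev ` Q. 0 < x"
    have "s (max N M') \<in> Q" using Q(3) by auto
    then show False using * s[of "max N M'"] by fastforce
  next
    assume *: "\<forall>x\<in>level_fun lev ` Q. x < 0"
    have "r (max N M) \<in> Q" using Q(2) by auto
    then show False using * r[of "max N M"] by fastforce
  qed
qed

section \<open>Quadrants and the word metric\<close>

text \<open>A quarter-plane of squares, with rows \<open>R k\<close> and columns \<open>D\<close>, read as a ladder from the bottom row to the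
  left column: the \<open>j\<close>-th rung goes up the \<open>j\<close>-th column and back along the \<open>j\<close>-th row.\<close>

lemma quadrant_ladder:
  assumes sq: "\<And>k i. ehom (V k i) (q k i) (R k i @ D k (Suc i)) (D k i @ R (Suc k) i)"
    and q0: "\<And>i. q 0 (Suc i) = q 0 i \<otimes> val (R 0 i)" and qS: "\<And>k i. q (Suc k) i = q k i \<otimes> val (D k i)"
  shows "ladder (q 0 0) [] (R 0) (\<lambda>k. D k 0) (\<lambda>j. \<Union>(k, i)\<in>{(k, i). max k i = j}. V k i)"
proof -
  have RS: "R k i \<in> words S" and DS: "D k i \<in> words S" and qc: "q k i \<in> carrier G" for k i
    using ehomD[OF sq[of k i]] by auto
  have qR: "q k (Suc i) = q k i \<otimes> val (R k i)" for k i
  proof (induction k)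
    case (Suc k)
    have "q (Suc k) (Suc i) = q k i \<otimes> val (R k i) \<otimes> val (D k (Suc i))" using Suc qS by simp
    also have "\<dots> = q k i \<otimes> val (R k i @ D k (Suc i))" using RS DS qc by (simp add: m_assoc)
    also have "\<dots> = q k i \<otimes> val (D k i @ R (Suc k) i)" by (simp only: ehom_val[OF sq])
    also have "\<dots> = q (Suc k) i \<otimes> val (R (Suc k) i)" using RS DS qc by (simp add: m_assoc qS)
    finally show ?case .
  qed (rule q0)
  have vR: "pverts (q k i) (R k i) \<subseteq> V k i" and vD: "pverts (q k i) (D k i) \<subseteq> V k i"
    and vR': "pverts (q (Suc k) i) (R (Suc k) i) \<subseteq> V k i" for k i
    using ehomD(4,5)[OF sq[of k i]] RS DS qc by (auto simp: path_verts_append qS)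
  define col where "col j m = concat (map (\<lambda>k. D k j) [0..<m])" for j m
  define row where "row k j = concat (map (R k) [0..<j])" for k j
  have col: "col j 0 = []" "col j (Suc m) = col j m @ D m j" and row: "row k 0 = []" "row k (Suc j) = row k j @ R k j" for j m k
    by (simp_all add: col_def row_def)
  have colS: "col j m \<in> words S" and rowS: "row k j \<in> words S" for j m k
    by (induction m, simp_all add: col DS) (induction j, simp_all add: row RS)
  have colq: "q 0 j \<otimes> val (col j m) = q m j" for j m
    by (induction m) (simp_all add: col colS DS qc qS flip: m_assoc)
  have rowq: "q k 0 \<otimes> val (row k j) = q k j" for k j
    by (induction j) (simp_all add: row rowS RS qc qR flip: m_assoc)
  define U where "U j = (\<Union>(k, i)\<in>{(k, i). max k i = j}. V k i)" for j
  have VU: "V k j \<subseteq> U j" "V j k \<subseteq> U j" if "k \<le> j" for k j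
    using that unfolding U_def by (intro UN_upper[of "(k, j)" _ "\<lambda>(k, i). V k i", simplified] UN_upper[of "(j, k)" _ "\<lambda>(k, i). V k i", simplified]; simp)+
  have colv: "pverts (q 0 j) (col j m) \<subseteq> U j" if "m \<le> Suc j" for j m
    using that
  proof (induction m)
    case 0
    have "q 0 j \<in> V 0 j" by (rule subsetD[OF vR[of 0 j] start_in_path_verts])
    then show ?case using VU(1)[of 0 j] by (auto simp: col)
  next
    case (Suc m)
    then show ?case using vD[of m j] VU(1)[of m j] colS DS qc by (auto simp: col path_verts_append colq)
  qed
  have rowv: "pverts (q (Suc j) 0) (row (Suc j) n) \<subseteq> U j" if "n \<le> Suc j" for j n
    using that
  proof (induction n)
    case 0
    have "q (Suc j) 0 \<in> V j 0" by (rule subsetD[OF vR'[of j 0] start_in_path_verts])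
    then show ?case using VU(2)[of 0 j] by (auto simp: row)
  next
    case (Suc n)
    then show ?case using vR'[of j n] VU(2)[of n j] rowS RS qc by (auto simp: row path_verts_append rowq)
  qed
  have rowv': "pverts (q j 0) (row j n) \<subseteq> U j" if "n \<le> j" for j n
    using that
  proof (induction n)
    case 0
    have "q j 0 \<in> V j 0" by (rule subsetD[OF vR[of j 0] start_in_path_verts])
    then show ?case using VU(2)[of 0 j] by (auto simp: row)
  next
    case (Suc n)
    then show ?case using vR[of j n] VU(2)[of n j] rowS RS qc by (auto simp: row path_verts_append rowq)
  qed
  have colpush: "ehom (U j) (q 0 j) (R 0 j @ col (Suc j) m) (col j m @ R m j)" if "m \<le> Suc j" for j m
    using that
  proof (induction m)
    case 0
    then show ?case using vR[of 0 j] VU(1)[of 0 j] RS qc by (auto simp: col intro!: ehom_refl)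
  next
    case (Suc m)
    have s: "ehom (U j) (q m j) (R m j @ D m (Suc j)) (D m j @ R (Suc m) j)"
      by (rule ehom_mono[OF sq VU(1)]) (use Suc in simp)
    have q': "q 0 j \<otimes> val (R 0 j @ col (Suc j) m) = q m (Suc j)"
      using qc RS colS colq[of "Suc j" m] by (simp add: q0 flip: m_assoc)
    have d: "ehom (U j) (q m (Suc j)) (D m (Suc j)) (D m (Suc j))"
      using ehomD(4)[OF s] RS DS qc by (intro ehom_refl) (auto simp: path_verts_append qR)
    have ih: "ehom (U j) (q 0 j) (R 0 j @ col (Suc j) m) (col j m @ R m j)" using Suc by simp
    have "ehom (U j) (q 0 j) ((R 0 j @ col (Suc j) m) @ D m (Suc j)) ((col j m @ R m j) @ D m (Suc j))"
      by (rule ehom_append[OF ih]) (unfold q', rule d)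
    also have "ehom (U j) (q 0 j) ((col j m @ R m j) @ D m (Suc j)) (col j m @ (D m j @ R (Suc m) j))"
    proof -
      have "ehom (U j) (q 0 j) (col j m) (col j m)" using colS qc colv[of m j] Suc by (intro ehom_refl) auto
      moreover have "ehom (U j) (q 0 j \<otimes> val (col j m)) (R m j @ D m (Suc j)) (D m j @ R (Suc m) j)" unfolding colq by (rule s)
      ultimately show ?thesis using ehom_append by fastforce
    qed
    finally show ?case by (simp add: col)
  qed
  have rowpush: "ehom (U j) (q j 0) (row j n @ D j n) (D j 0 @ row (Suc j) n)" if "n \<le> j" for j n
    using that
  proof (induction n)
    case 0
    then show ?case using vD[of j 0] VU(2)[of 0 j] DS qc by (auto simp: row intro!: ehom_refl)
  next
    case (Suc n)
    have s: "ehom (U j) (q j n) (R j n @ D j (Suc n)) (D j n @ R (Suc j) n)"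
      by (rule ehom_mono[OF sq VU(2)]) (use Suc in simp)
    have "ehom (U j) (q j 0) (row j n @ (R j n @ D j (Suc n))) (row j n @ (D j n @ R (Suc j) n))"
    proof (rule ehom_append)
      show "ehom (U j) (q j 0) (row j n) (row j n)" using rowS qc rowv'[of n j] Suc by (intro ehom_refl) auto
      show "ehom (U j) (q j 0 \<otimes> val (row j n)) (R j n @ D j (Suc n)) (D j n @ R (Suc j) n)" unfolding rowq by (rule s)
    qed
    then have "ehom (U j) (q j 0) (row j (Suc n) @ D j (Suc n)) ((row j n @ D j n) @ R (Suc j) n)" by (simp add: row)
    also have "ehom (U j) (q j 0) ((row j n @ D j n) @ R (Suc j) n) ((D j 0 @ row (Suc j) n) @ R (Suc j) n)"
    proof (rule ehom_append)
      show "ehom (U j) (q j 0) (row j n @ D j n) (D j 0 @ row (Suc j) n)" using Suc by simp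
      have "q j 0 \<otimes> val (row j n @ D j n) = q (Suc j) n" using qc rowS DS rowq[of j n] by (simp add: qS flip: m_assoc)
      moreover have "ehom (U j) (q (Suc j) n) (R (Suc j) n) (R (Suc j) n)"
        using vR'[of j n] VU(2)[of n j] Suc RS qc by (intro ehom_refl) auto
      ultimately show "ehom (U j) (q j 0 \<otimes> val (row j n @ D j n)) (R (Suc j) n) (R (Suc j) n)" by simp
    qed
    finally show ?case by (simp add: row)
  qed
  define E where "E j = col j j @ inv_word (row j j)" for j
  have pos: "pos (q 0 0) (R 0) j = q 0 j" for j by (induction j) (simp_all add: q0)
  have main: "ehom (U j) (q 0 j) (R 0 j @ E (Suc j)) (E j @ D j 0)" for j
  proof -
    let ?r = "row (Suc j) j" and ?R = "R (Suc j) j" and ?c = "col j (Suc j)"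
    have bk1: "pverts (q (Suc j) (Suc j)) (inv_word (row (Suc j) (Suc j))) \<subseteq> U j"
      using path_verts_inv_word[OF qc rowS, of "Suc j" 0 "Suc j" "Suc j"] rowv[of "Suc j" j] by (simp add: rowq)
    have bk2: "pverts (q (Suc j) j) (inv_word ?r) \<subseteq> U j"
      using path_verts_inv_word[OF qc rowS, of "Suc j" 0 "Suc j" j] rowv[of j j] by (simp add: rowq)
    have cc: "ehom (U j) (q 0 j) ?c ?c" using colS qc colv[of "Suc j" j] by (intro ehom_refl) auto
    have end1: "q 0 j \<otimes> val (R 0 j @ col (Suc j) (Suc j)) = q (Suc j) (Suc j)"
      using qc RS colS colq[of "Suc j" "Suc j"] by (simp add: q0 flip: m_assoc)
    have "ehom (U j) (q 0 j) ((R 0 j @ col (Suc j) (Suc j)) @ inv_word (row (Suc j) (Suc j)))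
        ((?c @ ?R) @ inv_word (row (Suc j) (Suc j)))"
    proof (rule ehom_append[OF colpush])
      show "ehom (U j) (q 0 j \<otimes> val (R 0 j @ col (Suc j) (Suc j))) (inv_word (row (Suc j) (Suc j))) (inv_word (row (Suc j) (Suc j)))"
        unfolding end1 using bk1 rowS qc by (intro ehom_refl) auto
    qed simp
    then have "ehom (U j) (q 0 j) (R 0 j @ E (Suc j)) (?c @ ((?R @ inv_word ?R) @ inv_word ?r))"
      by (simp add: E_def row)
    also have "ehom (U j) (q 0 j) (?c @ ((?R @ inv_word ?R) @ inv_word ?r)) (?c @ ([] @ inv_word ?r))"
    proof (rule ehom_append[OF cc], unfold colq, rule ehom_append)
      show "ehom (U j) (q (Suc j) j) (?R @ inv_word ?R) []"
        using RS qc vR'[of j j] VU(1)[of j j] by (intro ehom_cancel) auto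
      show "ehom (U j) (q (Suc j) j \<otimes> val (?R @ inv_word ?R)) (inv_word ?r) (inv_word ?r)"
        using bk2 rowS qc RS by (intro ehom_refl) auto
    qed
    also have "ehom (U j) (q 0 j) (?c @ ([] @ inv_word ?r)) (col j j @ (inv_word (row j j) @ D j 0))"
    proof -
      have "ehom (U j) (q j 0 \<otimes> val (row j j)) (D j j @ inv_word ?r) (inv_word (row j j) @ D j 0)"
        by (rule ehom_square_flip[OF ehom_sym[OF rowpush]]) simp
      then have f1: "ehom (U j) (q 0 j \<otimes> val (col j j)) (D j j @ inv_word ?r) (inv_word (row j j) @ D j 0)" by (simp only: rowq colq)
      have f2: "ehom (U j) (q 0 j) (col j j) (col j j)" using colS qc colv[of j j] by (intro ehom_refl) auto
      have "ehom (U j) (q 0 j) (col j j @ (D j j @ inv_word ?r)) (col j j @ (inv_word (row j j) @ D j 0))"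
        by (rule ehom_append[OF f2 f1])
      then show ?thesis by (simp add: col)
    qed
    finally show ?thesis by (simp add: E_def)
  qed
  show ?thesis
    unfolding ladder_def U_def[symmetric] pos
    by (intro exI[of _ E] conjI allI main) (simp add: E_def col row)
qed

definition ball :: "nat \<Rightarrow> 'a set" where
  "ball n = val ` {w \<in> words S. length w \<le> n}"

lemma finite_ball: "finite (ball n)"
proof -
  have "{w \<in> words S. length w \<le> n} = {w. set w \<subseteq> S \<times> UNIV \<and> length w \<le> n}"
    by (auto simp: words_def lists_eq_set)
  then show ?thesis unfolding ball_def using finite_S by (simp add: finite_lists_length_le)
qed

lemma val_in_ball: "w \<in> words S \<Longrightarrow> length w \<le> n \<Longrightarrow> val w \<in> ball n"
  by (auto simp: ball_def)

lemma ball_mono: "m \<le> n \<Longrightarrow> ball m \<subseteq> ball n"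
  by (auto simp: ball_def)

lemma one_in_ball: "\<one> \<in> ball n"
  using val_in_ball[of "[]" n] by simp

lemma ball_mult: "x \<in> ball m \<Longrightarrow> y \<in> ball n \<Longrightarrow> x \<otimes> y \<in> ball (m + n)"
proof -
  assume "x \<in> ball m" "y \<in> ball n"
  then obtain u v where "u \<in> words S" "length u \<le> m" "x = val u" "v \<in> words S" "length v \<le> n" "y = val v"
    unfolding ball_def by blast
  then show ?thesis using val_in_ball[of "u @ v" "m + n"] by simp
qed

lemma ball_inv: "x \<in> ball n \<Longrightarrow> inv x \<in> ball n"
proof -
  assume "x \<in> ball n"
  then obtain u where "u \<in> words S" "length u \<le> n" "x = val u" unfolding ball_def by blast
  then show ?thesis using val_in_ball[of "inv_word u" n] by simp
qed

text \<open>\<open>close n g h\<close>: the word metric distance of \<open>g\<close> and \<open>h\<close> is at most \<open>n\<close>.\<close>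

definition close :: "nat \<Rightarrow> 'a \<Rightarrow> 'a \<Rightarrow> bool" where
  "close n g h \<longleftrightarrow> g \<in> carrier G \<and> h \<in> carrier G \<and> inv g \<otimes> h \<in> ball n"

lemma close_refl: "g \<in> carrier G \<Longrightarrow> close n g g"
  by (simp add: close_def one_in_ball)

lemma close_sym: "close n g h \<Longrightarrow> close n h g"
  using ball_inv[of "inv g \<otimes> h" n] by (simp add: close_def inv_mult_group)

lemma close_mono: "close m g h \<Longrightarrow> m \<le> n \<Longrightarrow> close n g h"
  using ball_mono by (auto simp: close_def)

lemma close_trans: "close m g h \<Longrightarrow> close n h k \<Longrightarrow> close (m + n) g k"
proof -
  assume a: "close m g h" "close n h k"
  then have "(inv g \<otimes> h) \<otimes> (inv h \<otimes> k) \<in> ball (m + n)" by (intro ball_mult) (auto simp: close_def)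
  moreover have "(inv g \<otimes> h) \<otimes> (inv h \<otimes> k) = inv g \<otimes> k"
  proof -
    have c: "g \<in> carrier G" "h \<in> carrier G" "k \<in> carrier G" using a by (auto simp: close_def)
    have "h \<otimes> (inv h \<otimes> k) = k" using c by (simp add: m_assoc[symmetric])
    moreover have "(inv g \<otimes> h) \<otimes> (inv h \<otimes> k) = inv g \<otimes> (h \<otimes> (inv h \<otimes> k))"
      using c by (simp only: m_assoc inv_closed m_closed)
    ultimately show ?thesis by simp
  qed
  ultimately show ?thesis using a by (simp add: close_def)
qed

lemma close_word: "g \<in> carrier G \<Longrightarrow> w \<in> words S \<Longrightarrow> length w \<le> n \<Longrightarrow> close n g (g \<otimes> val w)"
  by (simp add: close_def m_assoc[symmetric] val_in_ball)

lemma close_path_verts: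
  assumes "g \<in> carrier G" "w \<in> words S" "x \<in> pverts g w" "length w \<le> n" shows "close n g x"
proof -
  obtain k where "k \<le> length w" "x = g \<otimes> val (take k w)" using path_verts_take[OF assms(1-3)] by blast
  then show ?thesis using close_word[of g "take k w" n] assms by simp
qed

lemma close_ball: "close m g h \<Longrightarrow> g \<in> ball n \<Longrightarrow> h \<in> ball (n + m)"
proof -
  assume a: "close m g h" "g \<in> ball n"
  then have "g \<otimes> (inv g \<otimes> h) \<in> ball (n + m)" by (intro ball_mult) (auto simp: close_def)
  then show ?thesis using a by (simp add: close_def m_assoc[symmetric])
qed

lemma finite_close: "finite {h. close n g h}"
proof (cases "g \<in> carrier G")
  case True
  have "h \<in> (\<lambda>b. g \<otimes> b) ` ball n" if "close n g h" for h
  proof (rule image_eqI)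
    show "inv g \<otimes> h \<in> ball n" using that by (simp add: close_def)
    show "h = g \<otimes> (inv g \<otimes> h)" using that by (simp add: close_def m_assoc[symmetric])
  qed
  then have "{h. close n g h} \<subseteq> (\<lambda>b. g \<otimes> b) ` ball n" by blast
  then show ?thesis using finite_ball finite_surj by blast
qed (simp add: close_def)

end

section \<open>Pushing words past the stable letter\<close>

lemma (in group) word_val_in_generate:
  assumes "X \<subseteq> carrier G" "w \<in> words X" shows "word_val G w \<in> generate G X"
  using assms(2)
proof (induction w)
  case (Cons l w)
  then have "fst l \<in> X" by simp
  then have "letter_val G l \<in> generate G X"
    by (auto simp: letter_val_def intro: generate.incl generate.inv)
  then show ?case using Cons by (auto intro: generate.eng)
qed (simp add: generate.one)

lemma (in group) word_val_closed:
  assumes "X \<subseteq> carrier G" "w \<in> words X" shows "word_val G w \<in> carrier G"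
  using word_val_in_generate[OF assms] generate_incl[OF assms(1)] by blast

lemma (in group) word_val_append:
  assumes "X \<subseteq> carrier G" "u \<in> words X" "v \<in> words X"
  shows "word_val G (u @ v) = word_val G u \<otimes> word_val G v"
  using assms(2)
proof (induction u)
  case (Cons l u)
  then have "letter_val G l \<in> carrier G" using assms(1) by (auto simp: letter_val_def)
  then show ?case using Cons word_val_closed[OF assms(1)] assms(3) by (simp add: m_assoc)
qed (simp add: word_val_closed[OF assms(1,3)])

lemma (in group) generate_word:
  assumes X: "X \<subseteq> carrier G" and g: "g \<in> generate G X"
  obtains w where "w \<in> words X" "word_val G w = g"
proof -
  have "\<exists>w\<in>words X. word_val G w = g" using g
  proof induction
    case one
    show ?case by (intro bexI[of _ "[]"]) simp_all
  next
    case (incl h)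
    then show ?case using X by (intro bexI[of _ "[(h, True)]"]) (auto simp: letter_val_def)
  next
    case (inv h)
    then show ?case using X by (intro bexI[of _ "[(h, False)]"]) (auto simp: letter_val_def)
  next
    case (eng h k)
    then obtain u v where "u \<in> words X" "word_val G u = h" "v \<in> words X" "word_val G v = k" by blast
    then show ?case using word_val_append[OF X] by (intro bexI[of _ "u @ v"]) auto
  qed
  then show thesis using that by blast
qed

text \<open>What is needed of an ascending HNN extension with base group \<open>H = generate G S0\<close>: for both signs
  \<open>b\<close> of the stable letter a finite set \<open>T b\<close> of corrections after which an element of
  \<open>H\<close> is conjugated into \<open>H\<close>.\<close>

locale ascending = group G for G :: "('a, 'b) monoid_scheme" (structure) +
  fixes S0 :: "'a set" and t :: 'a and lev :: "'a \<Rightarrow> int" and T :: "bool \<Rightarrow> 'a set"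
  assumes finite_S0: "finite S0" and S0_carrier: "S0 \<subseteq> carrier G" and one_notin_S0: "\<one> \<notin> S0"
    and t_carrier: "t \<in> carrier G"
    and lev_mult: "\<And>x y. x \<in> carrier G \<Longrightarrow> y \<in> carrier G \<Longrightarrow> lev (x \<otimes> y) = lev x + lev y"
    and lev_S0: "\<And>s. s \<in> S0 \<Longrightarrow> lev s = 0" and lev_t: "lev t = 1"
    and gen: "generate G (insert t S0) = carrier G"
    and finite_T: "\<And>b. finite (T b)" and T_sub: "\<And>b. T b \<subseteq> generate G S0" and T_one: "\<And>b. \<one> \<in> T b"
    and T_cover: "\<And>b h. h \<in> generate G S0 \<Longrightarrow> \<exists>c\<in>T b.
      inv (letter_val G (t, b)) \<otimes> (h \<otimes> inv c) \<otimes> letter_val G (t, b) \<in> generate G S0"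
begin

abbreviation H :: "'a set" where "H \<equiv> generate G S0"
abbreviation S :: "'a set" where "S \<equiv> insert t S0"
abbreviation tau :: "bool \<Rightarrow> 'a" where "tau b \<equiv> letter_val G (t, b)"

lemma H_subgroup: "subgroup H G" by (rule generate_is_subgroup[OF S0_carrier])
lemma H_carrier: "H \<subseteq> carrier G" by (rule generate_incl[OF S0_carrier])
lemma tau_closed [simp]: "tau b \<in> carrier G" using t_carrier by (simp add: letter_val_def)

definition conj :: "bool \<Rightarrow> 'a \<Rightarrow> 'a" where
  "conj b h = inv (tau b) \<otimes> h \<otimes> tau b"

text \<open>Preferring the representative \<open>\<one>\<close> makes the transducer below stateless when \<open>tau b\<close> normalises \<open>H\<close>.\<close>

definition rep :: "bool \<Rightarrow> 'a \<Rightarrow> 'a" where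
  "rep b h = (if conj b h \<in> H then \<one> else (SOME c. c \<in> T b \<and> conj b (h \<otimes> inv c) \<in> H))"

lemma rep:
  assumes "h \<in> H" shows "rep b h \<in> T b" "conj b (h \<otimes> inv (rep b h)) \<in> H"
proof -
  have "\<exists>c. c \<in> T b \<and> conj b (h \<otimes> inv c) \<in> H" using T_cover[OF assms, of b] by (auto simp: conj_def)
  from someI_ex[OF this] have "rep b h \<in> T b \<and> conj b (h \<otimes> inv (rep b h)) \<in> H"
    unfolding rep_def using T_one[of b] assms H_carrier by auto
  then show "rep b h \<in> T b" "conj b (h \<otimes> inv (rep b h)) \<in> H" by auto
qed

lemma rep_H: "h \<in> H \<Longrightarrow> rep b h \<in> H" using rep(1) T_sub by blast

definition wd :: "'a \<Rightarrow> 'a word" where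
  "wd h = (if h = \<one> then [] else (SOME w. w \<in> words S0 \<and> word_val G w = h))"

lemma wd: assumes "h \<in> H" shows "wd h \<in> words S0" "word_val G (wd h) = h"
proof -
  have "\<exists>w. w \<in> words S0 \<and> word_val G w = h" using generate_word[OF S0_carrier assms] by blast
  from someI_ex[OF this] show "wd h \<in> words S0" "word_val G (wd h) = h" unfolding wd_def by auto
qed

text \<open>In state \<open>c\<close> the word \<open>D b c\<close> leads from a vertex to the adjacent level; its value is
  \<open>c\<^sup>-\<^sup>1 tau\<close>.\<close>

definition D :: "bool \<Rightarrow> 'a \<Rightarrow> 'a word" where "D b c = wd (inv c) @ [(t, b)]"

text \<open>The word over \<open>S0\<close> that is written when the letter \<open>l\<close> is read in state \<open>c\<close>.\<close>

definition Z :: "bool \<Rightarrow> 'a \<Rightarrow> 'a \<times> bool \<Rightarrow> 'a word" where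
  "Z b c l = wd (conj b (c \<otimes> letter_val G l \<otimes> inv (rep b (c \<otimes> letter_val G l))))"

text \<open>One step of the transducer: reading \<open>l\<close> and then changing level agrees with changing level and then
  writing \<open>Z b c l\<close>.\<close>

definition relator :: "bool \<Rightarrow> 'a \<Rightarrow> 'a \<times> bool \<Rightarrow> 'a word" where
  "relator b c l = ([l] @ D b (rep b (c \<otimes> letter_val G l))) @ inv_word (D b c @ Z b c l)"

definition P :: "'a word set" where
  "P = (\<lambda>(b, c, l). relator b c l) ` (SIGMA b:UNIV. T b \<times> (S0 \<times> UNIV))"

lemma words_mono: "X \<subseteq> Y \<Longrightarrow> w \<in> words X \<Longrightarrow> w \<in> words Y"
  by (auto simp: words_def)

lemma words_S: "w \<in> words S0 \<Longrightarrow> w \<in> words S" by (erule words_mono[rotated]) blast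

lemma S_sub: "S \<subseteq> carrier G" using S0_carrier t_carrier by blast

lemma letter_H: "fst l \<in> S0 \<Longrightarrow> letter_val G l \<in> H"
  by (auto simp: letter_val_def intro: generate.incl generate.inv)

lemma H_mult: "x \<in> H \<Longrightarrow> y \<in> H \<Longrightarrow> x \<otimes> y \<in> H" by (rule generate.eng)
lemma H_inv: "x \<in> H \<Longrightarrow> inv x \<in> H" by (rule subgroup.m_inv_closed[OF H_subgroup])

lemma D_words: "c \<in> H \<Longrightarrow> D b c \<in> words S"
  using wd(1)[OF H_inv] words_S by (simp add: D_def)

lemma D_val: "c \<in> H \<Longrightarrow> word_val G (D b c) = inv c \<otimes> tau b"
  unfolding D_def using wd[OF H_inv] words_S by (subst word_val_append[OF S_sub]) auto

lemma Z_H: "c \<in> H \<Longrightarrow> fst l \<in> S0 \<Longrightarrow> conj b (c \<otimes> letter_val G l \<otimes> inv (rep b (c \<otimes> letter_val G l))) \<in> H"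
  by (intro rep(2) H_mult letter_H)

lemma Z_words: "c \<in> H \<Longrightarrow> fst l \<in> S0 \<Longrightarrow> Z b c l \<in> words S0"
  unfolding Z_def by (rule wd(1)[OF Z_H])

lemma Z_val: "c \<in> H \<Longrightarrow> fst l \<in> S0 \<Longrightarrow> word_val G (Z b c l) = conj b (c \<otimes> letter_val G l \<otimes> inv (rep b (c \<otimes> letter_val G l)))"
  unfolding Z_def by (rule wd(2)[OF Z_H])

lemma relator_sides:
  assumes c: "c \<in> H" and l: "fst l \<in> S0"
  shows "word_val G ([l] @ D b (rep b (c \<otimes> letter_val G l))) = word_val G (D b c @ Z b c l)"
proof -
  let ?l = "letter_val G l" let ?r = "rep b (c \<otimes> ?l)"
  have r: "?r \<in> H" using c l by (intro rep_H H_mult letter_H)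
  have car: "c \<in> carrier G" "?l \<in> carrier G" "?r \<in> carrier G" using c r letter_H[OF l] H_carrier by auto
  have lw: "[l] \<in> words S" using l by simp
  have "word_val G (D b c @ Z b c l) = inv c \<otimes> tau b \<otimes> (inv (tau b) \<otimes> (c \<otimes> ?l \<otimes> inv ?r) \<otimes> tau b)"
    using D_words[OF c] words_S[OF Z_words[OF c l]] D_val[OF c] Z_val[OF c l]
    by (simp add: word_val_append[OF S_sub] conj_def)
  also have "\<dots> = inv c \<otimes> (tau b \<otimes> inv (tau b)) \<otimes> c \<otimes> ?l \<otimes> inv ?r \<otimes> tau b"
    using car by (simp only: m_assoc m_closed inv_closed tau_closed)
  also have "\<dots> = ?l \<otimes> (inv ?r \<otimes> tau b)" using car by (simp add: m_assoc)
  also have "\<dots> = word_val G ([l] @ D b ?r)"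
    using D_words[OF r] D_val[OF r] lw car by (simp add: word_val_append[OF S_sub])
  finally show ?thesis by simp
qed

lemma finite_P: "finite P"
  unfolding P_def using finite_T finite_S0 by (intro finite_imageI finite_SigmaI finite_cartesian_product) auto

lemma one_notin: "\<one> \<notin> S"
proof
  assume "\<one> \<in> S"
  then have "t = \<one>" using one_notin_S0 by simp
  then have "lev t = lev t + lev t" using lev_mult[of \<one> \<one>] by simp
  then show False using lev_t by simp
qed

lemma relator_words: "c \<in> H \<Longrightarrow> fst l \<in> S0 \<Longrightarrow> relator b c l \<in> words S"
  unfolding relator_def using D_words[of c] D_words[OF rep_H[OF H_mult[OF _ letter_H]]] words_S[OF Z_words] by simp

lemma relator_val:
  assumes c: "c \<in> H" and l: "fst l \<in> S0" shows "word_val G (relator b c l) = \<one>"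
proof -
  let ?u = "[l] @ D b (rep b (c \<otimes> letter_val G l))" and ?v = "D b c @ Z b c l"
  have w: "?u \<in> words S" "?v \<in> words S"
    using l D_words[OF c] D_words[OF rep_H[OF H_mult[OF c letter_H[OF l]]]] words_S[OF Z_words[OF c l]] by simp_all
  have inv: "word_val G (inv_word v) = inv (word_val G v)" if "v \<in> words S" for v
    using that
  proof (induction v)
    case (Cons k v)
    then have k: "fst k \<in> carrier G" "letter_val G (fst k, \<not> snd k) = inv (letter_val G k)" "letter_val G k \<in> carrier G"
      using S_sub by (auto simp: letter_val_def)
    then show ?case using Cons word_val_closed[OF S_sub]
      by (simp add: word_val_append[OF S_sub] inv_mult_group)
  qed simp
  have "word_val G (relator b c l) = word_val G ?u \<otimes> inv (word_val G ?v)"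
    unfolding relator_def using w inv by (simp only: word_val_append[OF S_sub] inv_word_words)
  also have "\<dots> = \<one>" unfolding relator_sides[OF c l] using word_val_closed[OF S_sub w(2)] by simp
  finally show ?thesis .
qed

sublocale cayley G S P
proof
  show "finite S" "S \<subseteq> carrier G" "\<one> \<notin> S" "S \<noteq> {}" "finite P"
    using finite_S0 S_sub one_notin finite_P by auto
  show "P \<subseteq> words S" by (auto simp: P_def intro!: relator_words subsetD[OF T_sub])
  show "[] \<notin> P" by (auto simp: P_def relator_def)
  show "word_val G w = \<one>" if "w \<in> P" for w using that by (auto simp: P_def intro!: relator_val subsetD[OF T_sub])
qed

lemma lev_one: "lev \<one> = 0" using lev_mult[of \<one> \<one>] by simp
lemma lev_inv: "x \<in> carrier G \<Longrightarrow> lev (inv x) = - lev x" using lev_mult[of x "inv x"] lev_one by simp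
lemma lev_tau: "lev (tau b) = (if b then 1 else -1)" using lev_inv[OF t_carrier] lev_t by (simp add: letter_val_def)

lemma lev_H: "h \<in> H \<Longrightarrow> lev h = 0"
proof (induction rule: generate.induct)
  case (eng h k)
  then have "h \<in> carrier G" "k \<in> carrier G" using H_carrier by blast+
  then show ?case using eng lev_mult by simp
qed (use lev_one lev_S0 lev_inv S0_carrier in auto)

lemma val_words_H: "w \<in> words S0 \<Longrightarrow> val w \<in> H"
  by (rule word_val_in_generate[OF S0_carrier])

lemma lev_path_H: "g \<in> carrier G \<Longrightarrow> w \<in> words S0 \<Longrightarrow> x \<in> pverts g w \<Longrightarrow> lev x = lev g"
proof -
  assume g: "g \<in> carrier G" and w: "w \<in> words S0" and x: "x \<in> pverts g w"
  obtain k where k: "x = g \<otimes> val (take k w)" using path_verts_take[OF g words_S[OF w] x] by blast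
  have v: "val (take k w) \<in> H" using w by (intro val_words_H words_take)
  then have "val (take k w) \<in> carrier G" using H_carrier by blast
  then show "lev x = lev g" using g lev_H[OF v] by (simp add: k lev_mult)
qed

lemma every_word: "g \<in> carrier G \<Longrightarrow> \<exists>w\<in>words S. val w = g"
  using generate_word[OF S_sub, of g] gen by blast

lemma every_ball: "g \<in> carrier G \<Longrightarrow> \<exists>n. g \<in> ball n"
  using every_word[of g] val_in_ball by blast

text \<open>A common bound for the lengths of all connecting words and relators.\<close>

definition LM :: nat where
  "LM = Max (insert 1 (length ` (P \<union> (\<lambda>(b, c). D b c) ` (SIGMA b:UNIV. T b))))"

lemma LM: "1 \<le> LM" "w \<in> P \<Longrightarrow> length w \<le> LM" "c \<in> T b \<Longrightarrow> length (D b c) \<le> LM"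
proof -
  have "finite ((\<lambda>(b, c). D b c) ` (SIGMA b:UNIV. T b))" using finite_T by auto
  then have fin: "finite (insert 1 (length ` (P \<union> (\<lambda>(b, c). D b c) ` (SIGMA b:UNIV. T b))))"
    using finite_P by auto
  show "1 \<le> LM" unfolding LM_def by (rule Max_ge[OF fin]) simp
  show "length w \<le> LM" if "w \<in> P" unfolding LM_def by (rule Max_ge[OF fin]) (use that in auto)
  show "length (D b c) \<le> LM" if "c \<in> T b" unfolding LM_def
    by (rule Max_ge[OF fin], rule insertI2, rule imageI, rule UnI2, rule image_eqI[of _ _ "(b, c)"]) (use that in auto)
qed

text \<open>Vertices within distance \<open>M\<close> of \<open>g\<close> on the two levels between which a word is pushed.\<close>

definition slab :: "'a \<Rightarrow> nat \<Rightarrow> bool \<Rightarrow> 'a set" where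
  "slab g M b = {x. close M g x \<and> (lev x = lev g \<or> lev x = lev g + lev (tau b))}"

lemma slab_mono: "M \<le> N \<Longrightarrow> slab g M b \<subseteq> slab g N b"
  using close_mono by (auto simp: slab_def)

lemma slab_step: "g \<in> carrier G \<Longrightarrow> fst l \<in> S0 \<Longrightarrow> slab (g \<otimes> lval l) M b \<subseteq> slab g (Suc M) b"
proof
  fix x assume g: "g \<in> carrier G" and l: "fst l \<in> S0" and x: "x \<in> slab (g \<otimes> lval l) M b"
  have "close 1 g (g \<otimes> lval l)" using close_word[of g "[l]" 1] g l S_carrier by simp
  then have "close (1 + M) g x" using x close_trans[of 1 g "g \<otimes> lval l" M x] by (auto simp: slab_def)
  moreover have "lev (g \<otimes> lval l) = lev g" using g lev_mult lev_H[OF letter_H[OF l]] letter_H[OF l] H_carrier by auto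
  ultimately show "x \<in> slab g (Suc M) b" using x by (auto simp: slab_def)
qed

lemma slab_path:
  assumes "g \<in> carrier G" "w \<in> words S" "length w \<le> M" "\<And>x. x \<in> pverts g w \<Longrightarrow> lev x = lev g \<or> lev x = lev g + lev (tau b)"
  shows "pverts g w \<subseteq> slab g M b"
  using assms close_path_verts[OF assms(1,2) _ assms(3)] by (auto simp: slab_def)

lemma lev_path_D:
  assumes "g \<in> carrier G" "c \<in> H" "x \<in> pverts g (D b c)"
  shows "lev x = lev g \<or> lev x = lev g + lev (tau b)"
proof -
  have w: "wd (inv c) \<in> words S0" "wd (inv c) \<in> words S" using wd(1)[OF H_inv[OF assms(2)]] words_S by auto
  have v: "val (wd (inv c)) \<in> H" using val_words_H w by blast
  have "x \<in> pverts g (wd (inv c)) \<or> x = g \<otimes> val (wd (inv c)) \<otimes> tau b"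
    using assms w unfolding D_def by (subst (asm) path_verts_append) (auto dest: end_in_path_verts)
  then show ?thesis
  proof
    assume "x \<in> pverts g (wd (inv c))"
    then show ?thesis by (intro disjI1) (rule lev_path_H[OF assms(1) w(1)])
  next
    assume x: "x = g \<otimes> val (wd (inv c)) \<otimes> tau b"
    have "val (wd (inv c)) \<in> carrier G" using v H_carrier by blast
    then have "lev x = lev g + lev (tau b)" using x assms(1) lev_H[OF v] by (simp add: lev_mult)
    then show ?thesis by simp
  qed
qed

text \<open>The state of the transducer after reading a word in state \<open>c\<close>; the corresponding output is
  \<open>out\<close>.\<close>

fun st :: "bool \<Rightarrow> 'a \<Rightarrow> 'a word \<Rightarrow> 'a" where
  "st b c [] = c"
| "st b c (l # u) = st b (rep b (c \<otimes> letter_val G l)) u"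

fun out :: "bool \<Rightarrow> 'a \<Rightarrow> 'a word \<Rightarrow> 'a word" where
  "out b c [] = []"
| "out b c (l # u) = Z b c l @ out b (rep b (c \<otimes> letter_val G l)) u"

lemma next_T: "c \<in> T b \<Longrightarrow> fst l \<in> S0 \<Longrightarrow> rep b (c \<otimes> letter_val G l) \<in> T b"
  using T_sub by (intro rep(1) H_mult letter_H) blast

lemma st_T: "c \<in> T b \<Longrightarrow> u \<in> words S0 \<Longrightarrow> st b c u \<in> T b"
  by (induction u arbitrary: c) (auto intro: next_T)

lemma out_words: "c \<in> T b \<Longrightarrow> u \<in> words S0 \<Longrightarrow> out b c u \<in> words S0"
  using T_sub by (induction u arbitrary: c) (auto intro!: Z_words next_T)

lemma relator_in_P: "c \<in> T b \<Longrightarrow> fst l \<in> S0 \<Longrightarrow> relator b c l \<in> P"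
  unfolding P_def by (rule image_eqI[of _ _ "(b, c, l)"]) (auto simp: mem_Times_iff)

lemma length_Z: assumes "c \<in> T b" "fst l \<in> S0" shows "length (Z b c l) \<le> LM"
  using LM(2)[OF relator_in_P[OF assms]] by (simp add: relator_def)

lemma length_out: "c \<in> T b \<Longrightarrow> u \<in> words S0 \<Longrightarrow> length (out b c u) \<le> LM * length u"
proof (induction u arbitrary: c)
  case (Cons l u)
  then show ?case using length_Z[of c b l] Cons.IH[OF next_T[of c b l]] by simp
qed simp

text \<open>One relator for each letter of \<open>u\<close>. The filling touches two levels only; so fillings whose levels differ
  by more than one are disjoint.\<close>

lemma push_ehom:
  assumes "c \<in> T b" "u \<in> words S0" "g \<in> carrier G"
  shows "ehom (slab g ((LM + 1) * (length u + 1)) b) g (u @ D b (st b c u)) (D b c @ out b c u)"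
  using assms
proof (induction u arbitrary: g c)
  case Nil
  have c: "c \<in> H" using Nil T_sub by blast
  have "pverts g (D b c) \<subseteq> slab g (LM + 1) b"
    using Nil c LM(3)[of c b] D_words[OF c] lev_path_D[OF Nil(3) c] by (intro slab_path) auto
  then show ?case using D_words[OF c] Nil by (auto intro!: ehom_refl)
next
  case (Cons l u)
  let ?h = "g \<otimes> lval l" and ?c = "rep b (c \<otimes> lval l)" and ?M = "(LM + 1) * (length (l # u) + 1)"
  let ?V = "slab g ?M b"
  have l: "fst l \<in> S0" "fst l \<in> S" and u: "u \<in> words S0" and h: "?h \<in> carrier G" and g: "g \<in> carrier G"
    using Cons.prems by auto
  have c: "c \<in> H" "c \<in> T b" and c': "?c \<in> T b" "?c \<in> H" using Cons.prems T_sub next_T[of c b l] by auto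
  have Dw: "D b c \<in> words S" "D b ?c \<in> words S" using D_words c c' by auto
  have Zw: "Z b c l \<in> words S0" "Z b c l \<in> words S" using Z_words[OF c(1) l(1)] words_S by auto
  have ow: "out b ?c u \<in> words S0" "out b ?c u \<in> words S" using out_words[OF c'(1) u] words_S by auto
  have LR: "length (relator b c l) \<le> LM" by (rule LM(2)[OF relator_in_P[OF c(2) l(1)]])
  have levh: "lev ?h = lev g" by (rule lev_path_H[OF g, of "[l]"]) (use l in simp_all)
  have IH: "ehom ?V ?h (u @ D b (st b ?c u)) (D b ?c @ out b ?c u)"
  proof (rule ehom_mono[OF Cons.IH[OF c'(1) u h]])
    have "slab ?h ((LM + 1) * (length u + 1)) b \<subseteq> slab g (Suc ((LM + 1) * (length u + 1))) b"
      by (rule slab_step[OF g l(1)])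
    also have "\<dots> \<subseteq> ?V" by (rule slab_mono) simp
    finally show "slab ?h ((LM + 1) * (length u + 1)) b \<subseteq> ?V" .
  qed
  have v1: "pverts g ([l] @ D b ?c) \<subseteq> ?V"
  proof (rule slab_path[OF g])
    show "length ([l] @ D b ?c) \<le> ?M" using LR by (simp add: relator_def)
    show "lev x = lev g \<or> lev x = lev g + lev (tau b)" if "x \<in> pverts g ([l] @ D b ?c)" for x
    proof -
      have "x = g \<or> x \<in> pverts ?h (D b ?c)" using that by simp
      then show ?thesis using lev_path_D[OF h c'(2), of x] unfolding levh by blast
    qed
  qed (use Dw l in simp)
  have v2: "pverts g (D b c @ Z b c l) \<subseteq> ?V"
  proof (rule slab_path[OF g])
    show "length (D b c @ Z b c l) \<le> ?M" using LR by (simp add: relator_def)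
    have ed: "g \<otimes> val (D b c) \<in> carrier G" "lev (g \<otimes> val (D b c)) = lev g + lev (tau b)"
      using g c H_carrier lev_mult lev_inv lev_H by (auto simp: D_val)
    show "lev x = lev g \<or> lev x = lev g + lev (tau b)" if "x \<in> pverts g (D b c @ Z b c l)" for x
    proof -
      have "x \<in> pverts g (D b c) \<or> x \<in> pverts (g \<otimes> val (D b c)) (Z b c l)"
        using that Dw Zw g by (simp add: path_verts_append)
      then show ?thesis using lev_path_D[OF g c(1), of x] lev_path_H[OF ed(1) Zw(1), of x] unfolding ed(2) by blast
    qed
  qed (use Dw Zw in simp)
  have rel: "ehom ?V g ([l] @ D b ?c) (D b c @ Z b c l)"
    using relator_in_P[OF c(2) l(1)] Dw Zw l v1 v2 by (intro ehom_of_relator[OF g]) (auto simp: relator_def)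
  have lvl: "ehom ?V g [l] [l]" using ehomD(4)[OF rel] l g Dw by (intro ehom_refl) (auto simp: path_verts_append)
  have "ehom ?V g ([l] @ (u @ D b (st b ?c u))) ([l] @ (D b ?c @ out b ?c u))"
    by (rule ehom_append[OF lvl]) (use IH l in simp)
  also have "ehom ?V g ([l] @ (D b ?c @ out b ?c u)) ((D b c @ Z b c l) @ out b ?c u)"
  proof -
    have "ehom ?V (g \<otimes> val ([l] @ D b ?c)) (out b ?c u) (out b ?c u)"
      using ehomD(5)[OF IH] Dw ow h g l by (intro ehom_refl) (auto simp: path_verts_append m_assoc)
    from ehom_append[OF rel this] show ?thesis by simp
  qed
  finally show ?case by simp
qed

primrec pst :: "bool \<Rightarrow> (nat \<Rightarrow> 'a word) \<Rightarrow> nat \<Rightarrow> 'a" where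
  "pst b a 0 = \<one>"
| "pst b a (Suc j) = st b (pst b a j) (a j)"

definition prow :: "bool \<Rightarrow> (nat \<Rightarrow> 'a word) \<Rightarrow> nat \<Rightarrow> 'a word" where
  "prow b a j = out b (pst b a j) (a j)"

lemma pst_T: "(\<And>j. a j \<in> words S0) \<Longrightarrow> pst b a j \<in> T b"
  by (induction j) (auto simp: T_one st_T)

lemma prow_words: "(\<And>j. a j \<in> words S0) \<Longrightarrow> prow b a j \<in> words S0"
  unfolding prow_def by (intro out_words pst_T)

lemma prow_length:
  assumes "\<And>j. a j \<in> words S0" "\<And>j. length (a j) \<le> B" shows "length (prow b a j) \<le> LM * B"
proof -
  have "length (prow b a j) \<le> LM * length (a j)"
    unfolding prow_def by (rule length_out[OF pst_T[OF assms(1)] assms(1)])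
  also have "\<dots> \<le> LM * B" using assms(2)[of j] by simp
  finally show ?thesis .
qed

lemma D_one: "D b \<one> = [(t, b)]" by (simp add: D_def wd_def)

lemma push_square:
  assumes "\<And>j. a j \<in> words S0" "g \<in> carrier G" "length (a j) \<le> B"
  shows "ehom (slab g ((LM + 1) * (B + 1)) b) g (a j @ D b (pst b a (Suc j))) (D b (pst b a j) @ prow b a j)"
  unfolding prow_def pst.simps
  by (rule ehom_mono[OF push_ehom[OF pst_T[OF assms(1)] assms(1,2)] slab_mono[OF mult_le_mono2]])
     (use assms(3) in simp)

text \<open>An infinite word is pushed with the state carried along, so that the rungs of the ladder have bounded length.\<close>

lemma push_ladder:
  assumes a: "\<And>j. a j \<in> words S0" "\<And>j. length (a j) \<le> B" and g: "g \<in> carrier G"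
  shows "ladder g [(t, b)] a (prow b a) (\<lambda>j. slab (pos g a j) ((LM + 1) * (B + 1)) b)"
proof (unfold ladder_def, intro exI[of _ "\<lambda>j. D b (pst b a j)"] conjI allI)
  show "D b (pst b a 0) = [(t, b)]" by (simp add: D_one)
  show "ehom (slab (pos g a j) ((LM + 1) * (B + 1)) b) (pos g a j) (a j @ D b (pst b a (Suc j)))
      (D b (pst b a j) @ prow b a j)" for j
    by (rule push_square[OF a(1) pos_closed[OF g words_S[OF a(1)]] a(2)])
qed

end

section \<open>Rays escaping to infinite height\<close>

text \<open>Koenig's lemma for words over a finite alphabet.\<close>

lemma koenig:
  assumes A: "finite A" and pre: "\<And>xs ys. Q (xs @ ys) \<Longrightarrow> Q xs"
    and ex: "\<And>n. \<exists>xs. length xs = n \<and> set xs \<subseteq> A \<and> Q xs"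
  obtains f :: "nat \<Rightarrow> 'c" where "\<And>n. Q (map f [0..<n])" "\<And>n. f n \<in> A"
proof -
  define B where "B xs = {ys. set ys \<subseteq> A \<and> Q (xs @ ys)}" for xs
  have "\<not> finite (B [])"
  proof
    assume "finite (B [])"
    then have "finite (length ` B [])" by simp
    moreover have "UNIV \<subseteq> length ` B []"
    proof
      fix n :: nat
      obtain xs where "length xs = n" "set xs \<subseteq> A" "Q xs" using ex by blast
      then show "n \<in> length ` B []" by (auto simp: B_def)
    qed
    ultimately show False using infinite_UNIV_nat finite_subset by blast
  qed
  have step: "\<exists>x. x \<in> A \<and> infinite (B (xs @ [x]))" if "infinite (B xs)" for xs
  proof (rule ccontr)
    assume "\<not> ?thesis"
    then have "finite (\<Union>x\<in>A. (#) x ` B (xs @ [x]))" using A by blast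
    moreover have "B xs \<subseteq> {[]} \<union> (\<Union>x\<in>A. (#) x ` B (xs @ [x]))"
    proof
      fix ys assume "ys \<in> B xs"
      then show "ys \<in> {[]} \<union> (\<Union>x\<in>A. (#) x ` B (xs @ [x]))"
        by (cases ys) (auto simp: B_def)
    qed
    ultimately show False using that finite_subset by blast
  qed
  define nxt where "nxt xs = (SOME x. x \<in> A \<and> infinite (B (xs @ [x])))" for xs
  define s where "s = rec_nat [] (\<lambda>n xs. xs @ [nxt xs])"
  have s: "s 0 = []" "s (Suc n) = s n @ [nxt (s n)]" for n by (simp_all add: s_def)
  have inf: "infinite (B (s n))" for n
  proof (induction n)
    case (Suc n)
    from someI_ex[OF step[OF Suc]] show ?case unfolding s nxt_def by blast
  qed (use \<open>\<not> finite (B [])\<close> s in simp)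
  define f where "f n = nxt (s n)" for n
  have sm: "s n = map f [0..<n]" for n by (induction n) (simp_all add: s f_def)
  show thesis
  proof (rule that)
    show "Q (map f [0..<n])" for n
    proof -
      obtain ys where "ys \<in> B (s n)" using inf[of n] by (metis finite.emptyI ex_in_conv)
      then show ?thesis using pre unfolding B_def sm by blast
    qed
    show "f n \<in> A" for n using someI_ex[OF step[OF inf[of n]]] unfolding f_def nxt_def by blast
  qed
qed

context ascending begin

text \<open>The base vertex after \<open>k\<close> pushes; \<open>rows\<close> are the words that are then read there.\<close>

primrec vk :: "bool \<Rightarrow> 'a \<Rightarrow> nat \<Rightarrow> 'a" where
  "vk b g 0 = g"
| "vk b g (Suc k) = vk b g k \<otimes> tau b"

primrec rows :: "bool \<Rightarrow> (nat \<Rightarrow> 'a word) \<Rightarrow> nat \<Rightarrow> nat \<Rightarrow> 'a word" where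
  "rows b a 0 = a"
| "rows b a (Suc k) = prow b (rows b a k)"

lemma vk_closed [simp]: "g \<in> carrier G \<Longrightarrow> vk b g k \<in> carrier G"
  by (induction k) auto

lemma lev_vk: "g \<in> carrier G \<Longrightarrow> lev (vk b g k) = lev g + int k * lev (tau b)"
  by (induction k) (auto simp: lev_mult algebra_simps)

lemma rows_words: "(\<And>j. a j \<in> words S0) \<Longrightarrow> rows b a k j \<in> words S0"
proof (induction k arbitrary: j)
  case (Suc k)
  then show ?case using prow_words[of "rows b a k" b j] by simp
qed simp

lemma rows_length:
  assumes "\<And>j. a j \<in> words S0" "\<And>j. length (a j) \<le> B" shows "length (rows b a k j) \<le> LM ^ k * B"
proof (induction k arbitrary: j)
  case (Suc k)
  have "length (prow b (rows b a k) j) \<le> LM * (LM ^ k * B)" by (rule prow_length[OF rows_words[OF assms(1)] Suc])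
  then show ?case by (simp add: mult.assoc)
qed (use assms in simp)

lemma lev_pos:
  assumes "\<And>j. a j \<in> words S0" "g \<in> carrier G" shows "lev (pos g a j) = lev g"
proof (induction j)
  case (Suc j)
  have p: "pos g a j \<in> carrier G" using pos_closed[of g a j] assms words_S by blast
  have v: "val (a j) \<in> H" by (rule val_words_H[OF assms(1)])
  then have "val (a j) \<in> carrier G" using H_carrier by blast
  then show ?case using Suc p lev_H[OF v] by (simp add: lev_mult)
qed simp

text \<open>Each push moves a ray by at most \<open>LM\<close> and multiplies the length of its words by at most
  \<open>LM\<close>; the second summand bounds the size of the squares between the \<open>k\<close>-th push and the next
  one.\<close>

definition push_radius :: "nat \<Rightarrow> nat \<Rightarrow> nat" where
  "push_radius B k = k * LM + (LM + 1) * (LM ^ k * B + 1)"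

lemma push_radius_mono: "k \<le> n \<Longrightarrow> push_radius B k \<le> push_radius B n"
  unfolding push_radius_def using LM(1) by (intro add_mono mult_mono power_increasing) auto

text \<open>A ray \<open>a\<close> of \<open>H\<close>-words at a vertex of nonnegative level is pushed up, one at a vertex of nonpositive level is
  pushed down. Since this moves away from level \<open>0\<close>, the squares that contain \<open>x\<close> occur after at most \<open>\<bar>lev x\<bar>\<close>
  pushes, that is, at bounded distance from \<open>a\<close>.\<close>

lemma far_ladder:
  assumes g: "g \<in> carrier G" and a: "\<And>j. a j \<in> words S0" "\<And>j. length (a j) \<le> B"
    and fin: "\<And>x. finite {j. pos g a j = x}" and sgn: "0 \<le> lev g * lev (tau b)"
  shows "\<exists>U. ladder g [] a (\<lambda>_. [(t, b)]) U \<and> (\<forall>x. finite {j. x \<in> U j}) \<and>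
    (\<forall>j. \<forall>x\<in>U j. \<exists>i. close (push_radius B (nat \<bar>lev x\<bar>)) (pos g a i) x)"
proof -
  define q where "q k i = pos (vk b g k) (rows b a k) i" for k i
  define C where "C k i = D b (pst b (rows b a k) i)" for k i
  define V where "V k i = slab (q k i) ((LM + 1) * (LM ^ k * B + 1)) b" for k i
  have rw: "rows b a k j \<in> words S0" for k j by (rule rows_words[of a b k j, OF a(1)])
  have rl: "length (rows b a k j) \<le> LM ^ k * B" for k j by (rule rows_length[of a B b k j, OF a])
  have qc: "q k i \<in> carrier G" for k i unfolding q_def using g words_S[OF rw] by (intro pos_closed) auto
  have sq: "ehom (V k i) (q k i) (rows b a k i @ C k (Suc i)) (C k i @ rows b a (Suc k) i)" for k i
    unfolding V_def C_def rows.simps by (rule push_square[of "rows b a k", OF rw qc rl])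
  have qS: "q (Suc k) i = q k i \<otimes> val (C k i)" for k i
  proof -
    have "pos (vk b g k) (rows b a k) i \<otimes> val (C k i) = pos (vk b g k \<otimes> val (C k 0)) (rows b a (Suc k)) i"
      by (rule ladder_pos[of "V k" _ _ "C k"]) (use sq[of k] in \<open>simp add: q_def\<close>)
    also have "val (C k 0) = tau b" by (simp add: C_def D_one)
    finally show ?thesis by (simp add: q_def)
  qed
  define U where "U j = (\<Union>(k, i)\<in>{(k, i). max k i = j}. V k i)" for j
  have "ladder (q 0 0) [] (rows b a 0) (\<lambda>k. C k 0) (\<lambda>j. \<Union>(k, i)\<in>{(k, i). max k i = j}. V k i)"
    by (rule quadrant_ladder[of V q "rows b a" C], rule sq, simp add: q_def, rule qS)
  then have lad: "ladder g [] a (\<lambda>_. [(t, b)]) U" by (simp add: q_def C_def D_one U_def[abs_def])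
  have cl: "close (k * LM) (pos g a i) (q k i)" for k i
  proof (induction k)
    case 0
    show ?case using qc[of 0 i] by (simp add: q_def close_refl)
  next
    case (Suc k)
    have T: "pst b (rows b a k) i \<in> T b" by (rule pst_T[of "rows b a k", OF rw])
    then have "C k i \<in> words S" "length (C k i) \<le> LM" using LM(3) D_words T_sub unfolding C_def by blast+
    then have "close LM (q k i) (q (Suc k) i)" unfolding qS by (intro close_word qc)
    with Suc close_trans[of "k * LM" "pos g a i" "q k i" LM] show ?case by (simp add: add.commute)
  qed
  have est: "k \<le> nat \<bar>lev x\<bar> \<and> close (push_radius B (nat \<bar>lev x\<bar>)) (pos g a i) x" if x: "x \<in> V k i" for k i x
  proof -
    have "lev (q k i) = lev g + int k * lev (tau b)" unfolding q_def using lev_pos[of "rows b a k", OF rw vk_closed[OF g]] by (simp add: lev_vk g)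
    then have lx: "lev x = lev g + int k * lev (tau b) \<or> lev x = lev g + int (Suc k) * lev (tau b)"
      using x by (auto simp: V_def slab_def algebra_simps)
    have k: "k \<le> nat \<bar>lev x\<bar>" using lx sgn by (auto simp: lev_tau split: if_splits)
    have "close ((LM + 1) * (LM ^ k * B + 1)) (q k i) x" using x by (simp only: V_def slab_def mem_Collect_eq)
    from close_trans[OF cl this] have "close (push_radius B k) (pos g a i) x" by (simp only: push_radius_def)
    then have "close (push_radius B (nat \<bar>lev x\<bar>)) (pos g a i) x" by (rule close_mono[OF _ push_radius_mono[OF k]])
    then show ?thesis using k by blast
  qed
  have finU: "finite {j. x \<in> U j}" for x
  proof (rule finite_subset)
    let ?n = "push_radius B (nat \<bar>lev x\<bar>)"
    let ?I = "\<Union>h\<in>{h. close ?n x h}. {i. pos g a i = h}"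
    show "{j. x \<in> U j} \<subseteq> (\<lambda>(k, i). max k i) ` ({..nat \<bar>lev x\<bar>} \<times> ?I)"
    proof
      fix j assume "j \<in> {j. x \<in> U j}"
      then obtain k i where ki: "max k i = j" "x \<in> V k i" by (auto simp: U_def)
      then have "i \<in> ?I" "k \<in> {..nat \<bar>lev x\<bar>}" using est[OF ki(2)] close_sym by auto
      then show "j \<in> (\<lambda>(k, i). max k i) ` ({..nat \<bar>lev x\<bar>} \<times> ?I)" using ki(1) by (intro image_eqI[of _ _ "(k, i)"]) auto
    qed
    show "finite ((\<lambda>(k, i). max k i) ` ({..nat \<bar>lev x\<bar>} \<times> ?I))"
      using fin finite_close by (intro finite_imageI finite_cartesian_product finite_UN_I) auto
  qed
  have "\<exists>i. close (push_radius B (nat \<bar>lev x\<bar>)) (pos g a i) x" if "x \<in> U j" for x j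
    using that est by (auto simp: U_def)
  then show ?thesis using lad finU by blast
qed

definition geodesic :: "'a word \<Rightarrow> bool" where
  "geodesic w \<longleftrightarrow> w \<in> words S0 \<and> (\<forall>v\<in>words S0. val v = val w \<longrightarrow> length w \<le> length v)"

lemma geodesic_subword:
  assumes "geodesic (u @ v @ w)" shows "geodesic v"
proof -
  have W: "u \<in> words S0" "v \<in> words S0" "w \<in> words S0" using assms by (auto simp: geodesic_def)
  have "length v \<le> length v'" if v': "v' \<in> words S0" "val v' = val v" for v'
  proof -
    have "val (u @ v' @ w) = val (u @ v @ w)" using W v' words_S by simp
    then have "length (u @ v @ w) \<le> length (u @ v' @ w)" using assms W v'(1) by (auto simp: geodesic_def)
    then show ?thesis by simp
  qed
  then show ?thesis using W by (simp add: geodesic_def)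
qed

lemma geodesic_inv_word: assumes "geodesic w" shows "geodesic (inv_word w)"
proof -
  have w: "w \<in> words S0" using assms by (simp add: geodesic_def)
  have "length (inv_word w) \<le> length v" if v: "v \<in> words S0" "val v = val (inv_word w)" for v
  proof -
    have "val (inv_word v) = val w" using v w words_S by simp
    moreover have "inv_word v \<in> words S0" using v by simp
    ultimately have "length w \<le> length (inv_word v)" using assms unfolding geodesic_def by blast
    then show ?thesis by simp
  qed
  then show ?thesis using w by (simp add: geodesic_def)
qed

lemma exists_geodesic_for: assumes "h \<in> H" shows "\<exists>w. geodesic w \<and> val w = h"
proof -
  obtain w0 where "w0 \<in> words S0 \<and> val w0 = h" using generate_word[OF S0_carrier assms] by blast
  from ex_has_least_nat[of "\<lambda>w. w \<in> words S0 \<and> val w = h", OF this, of length]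
  obtain w where "w \<in> words S0 \<and> val w = h" "\<forall>v. v \<in> words S0 \<and> val v = h \<longrightarrow> length w \<le> length v"
    by (elim exE conjE) (rule that, simp_all)
  then show ?thesis by (intro exI[of _ w]) (auto simp: geodesic_def)
qed

lemma exists_geodesic_length:
  assumes inf: "infinite H" shows "\<exists>w. geodesic w \<and> length w = n"
proof (rule ccontr)
  assume none: "\<not> ?thesis"
  have "length w \<le> n" if "geodesic w" for w
  proof (rule ccontr)
    assume "\<not> length w \<le> n"
    moreover have "geodesic (take n w)" using geodesic_subword[of "[]" "take n w" "drop n w"] that by simp
    ultimately show False using none by auto
  qed
  note short = this
  have "H \<subseteq> ball n"
  proof
    fix h assume "h \<in> H"
    then obtain w where w: "geodesic w" "val w = h" using exists_geodesic_for by blast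
    then have "w \<in> words S" using words_S by (simp add: geodesic_def)
    then show "h \<in> ball n" using val_in_ball[OF _ short[OF w(1)]] w(2) by simp
  qed
  then show False using inf finite_ball finite_subset by blast
qed

text \<open>Geodesic words of even length, read from the middle outwards, form an infinite tree with finite branching, so it has
  an infinite branch.\<close>

lemma geodesic_line:
  assumes inf: "infinite H"
  obtains p m :: "nat \<Rightarrow> 'a \<times> bool" where "\<And>i j. geodesic (rev (map m [0..<i]) @ map p [0..<j])"
proof -
  \<comment> \<open>The \<open>i\<close>-th pair holds the two letters at distance \<open>i\<close> from the middle.\<close>
  define Q where "Q ps = geodesic (map fst (rev ps) @ map snd ps)" for ps :: "(('a \<times> bool) \<times> ('a \<times> bool)) list"
  let ?A = "(S0 \<times> UNIV) \<times> (S0 \<times> UNIV) :: (('a \<times> bool) \<times> ('a \<times> bool)) set"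
  have ex: "\<exists>ps. length ps = n \<and> set ps \<subseteq> ?A \<and> Q ps" for n
  proof -
    obtain w where w: "geodesic w" "length w = n + n" using exists_geodesic_length[OF inf] by blast
    let ?ps = "zip (rev (take n w)) (drop n w)"
    have "Q ?ps" using w by (simp add: Q_def rev_map[symmetric])
    moreover have "set ?ps \<subseteq> ?A"
    proof
      fix x assume x: "x \<in> set ?ps"
      obtain y z where yz: "x = (y, z)" by (cases x)
      have sw: "set w \<subseteq> S0 \<times> UNIV" using w(1) by (auto simp: geodesic_def words_def lists_eq_set)
      have "y \<in> set (rev (take n w))" "z \<in> set (drop n w)"
        using x unfolding yz by (rule set_zip_leftD, rule set_zip_rightD)
      then have "y \<in> set w" "z \<in> set w" by (auto dest: in_set_takeD in_set_dropD)
      then show "x \<in> ?A" using sw unfolding yz by blast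
    qed
    moreover have "length ?ps = n" using w by simp
    ultimately show ?thesis by blast
  qed
  have pre: "Q xs" if "Q (xs @ ys)" for xs ys
    using that geodesic_subword[of "map fst (rev ys)" "map fst (rev xs) @ map snd xs" "map snd ys"] by (simp add: Q_def)
  have fin: "finite ?A" using finite_S0 by simp
  obtain f where f: "\<And>n. Q (map f [0..<n])"
  proof (rule koenig[of ?A Q])
    fix f assume "\<And>n. Q (map f [0..<n])"
    then show thesis by (rule that)
  qed (rule fin, erule pre, rule ex)
  show thesis
  proof (rule that[of "\<lambda>i. fst (f i)" "\<lambda>i. snd (f i)"])
    fix i j :: nat
    let ?n = "max i j"
    have G: "geodesic (rev (map (\<lambda>i. fst (f i)) [0..<?n]) @ map (\<lambda>i. snd (f i)) [0..<?n])"
      using f[of ?n] by (simp add: Q_def rev_map comp_def)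
    have e1: "map (\<lambda>i. fst (f i)) [0..<?n] = map (\<lambda>i. fst (f i)) [0..<i] @ map (\<lambda>i. fst (f i)) [i..<?n]"
      using upt_add_eq_append[of 0 i "?n - i"] by (simp flip: map_append)
    have e2: "map (\<lambda>i. snd (f i)) [0..<?n] = map (\<lambda>i. snd (f i)) [0..<j] @ map (\<lambda>i. snd (f i)) [j..<?n]"
      using upt_add_eq_append[of 0 j "?n - j"] by (simp flip: map_append)
    have "geodesic (rev (map (\<lambda>i. fst (f i)) [i..<?n]) @ (rev (map (\<lambda>i. fst (f i)) [0..<i]) @ map (\<lambda>i. snd (f i)) [0..<j]) @
        map (\<lambda>i. snd (f i)) [j..<?n])"
      using G by (simp only: e1 e2 rev_append append_assoc)
    then show "geodesic (rev (map (\<lambda>i. fst (f i)) [0..<i]) @ map (\<lambda>i. snd (f i)) [0..<j])"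
      by (rule geodesic_subword)
  qed
qed

lemma pos_letters:
  assumes "v \<in> carrier G" "\<And>j. fst (p j) \<in> S0"
  shows "map p [0..<i] \<in> words S0" "pos v (\<lambda>j. [p j]) i = v \<otimes> val (map p [0..<i])"
proof -
  show w: "map p [0..<i] \<in> words S0" for i by (induction i) (simp_all add: assms(2))
  show "pos v (\<lambda>j. [p j]) i = v \<otimes> val (map p [0..<i])"
  proof (induction i)
    case (Suc i)
    have l: "[p i] \<in> words S" using assms(2)[of i] by simp
    have "val (map p [0..<Suc i]) = val (map p [0..<i]) \<otimes> val [p i]"
      using val_append[OF words_S[OF w] l] by simp
    then show ?case using Suc assms(1) words_S[OF w] l by (simp add: m_assoc)
  qed (use assms in simp)
qed

text \<open>A geodesic ray visits no vertex twice.\<close>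

lemma geodesic_ray_inj:
  assumes v: "v \<in> carrier G" and g: "\<And>i. geodesic (map p [0..<i])"
  shows "finite {j. pos v (\<lambda>j. [p j]) j = x}"
proof -
  have S: "fst (p j) \<in> S0" for j using g[of "Suc j"] by (simp add: geodesic_def)
  have "i \<le> j" if "pos v (\<lambda>j. [p j]) i = x" "pos v (\<lambda>j. [p j]) j = x" for i j
  proof -
    have w: "map p [0..<i] \<in> words S0" "map p [0..<j] \<in> words S0" using pos_letters(1)[OF v, of p] S by auto
    have "v \<otimes> val (map p [0..<i]) = v \<otimes> val (map p [0..<j])" using that pos_letters(2)[OF v, of p] S by simp
    then have "val (map p [0..<i]) = val (map p [0..<j])" using v w words_S by simp
    then show ?thesis using g[of i] w(2) by (auto simp: geodesic_def dest!: bspec[of _ _ "map p [0..<j]"])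
  qed
  then have one: "i = j" if "pos v (\<lambda>j. [p j]) i = x" "pos v (\<lambda>j. [p j]) j = x" for i j
    using that by (intro antisym)
  show ?thesis
  proof (cases "\<exists>j. pos v (\<lambda>j. [p j]) j = x")
    case True
    then obtain j where j: "pos v (\<lambda>j. [p j]) j = x" by blast
    have "{j. pos v (\<lambda>j. [p j]) j = x} \<subseteq> {j}" using one[OF _ j] by blast
    then show ?thesis by (rule finite_subset) simp
  qed simp
qed

text \<open>The two halves of a geodesic line through \<open>v\<close> cannot both come close to the identity unless \<open>v\<close> is itself
  close to it: points of the two halves that are close in \<open>G\<close> are close in \<open>H\<close>, hence close along the line.\<close>

lemma avoiding_rays:
  assumes inf: "infinite H"
  obtains f :: "nat \<Rightarrow> nat" where "\<And>v. v \<in> carrier G \<Longrightarrow> \<exists>p. (\<forall>j. fst (p j) \<in> S0) \<and>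
    (\<forall>x. finite {j. pos v (\<lambda>j. [p j]) j = x}) \<and> (\<forall>n. (\<exists>i. pos v (\<lambda>j. [p j]) i \<in> ball n) \<longrightarrow> v \<in> ball (f n))"
proof -
  obtain p m where line: "\<And>i j. geodesic (rev (map m [0..<i]) @ map p [0..<j])" 
  proof (rule geodesic_line[OF inf])
    fix p m :: "nat \<Rightarrow> 'a \<times> bool"
    assume "\<And>i j. geodesic (rev (map m [0..<i]) @ map p [0..<j])"
    then show thesis by (rule that)
  qed
  define m' where "m' j = (fst (m j), \<not> snd (m j))" for j
  have inv: "inv_word (rev (map m [0..<i])) = map m' [0..<i]" for i
    by (induction i) (simp_all add: m'_def)
  have gp: "geodesic (map p [0..<i])" for i using line[of 0 i] by simp
  have gm: "geodesic (map m' [0..<i])" for i using geodesic_inv_word[of "rev (map m [0..<i])"] line[of i 0] inv by simp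
  have S: "fst (p j) \<in> S0" "fst (m' j) \<in> S0" for j using gp[of "Suc j"] gm[of "Suc j"] by (simp_all add: geodesic_def)
  have "\<exists>L. \<forall>h\<in>ball k \<inter> H. \<forall>w. geodesic w \<and> val w = h \<longrightarrow> length w \<le> L" for k
  proof -
    define W where "W h = (SOME w. geodesic w \<and> val w = h)" for h
    have W: "geodesic (W h) \<and> val (W h) = h" if "h \<in> H" for h
      unfolding W_def by (rule someI_ex[OF exists_geodesic_for[OF that]])
    have fin: "finite (length ` W ` (ball k \<inter> H))" using finite_ball by blast
    have "length w \<le> Max (length ` W ` (ball k \<inter> H))" if h: "h \<in> ball k \<inter> H" and w: "geodesic w" "val w = h" for h w
    proof -
      have Wh: "geodesic (W h)" "val (W h) = val w" using W[of h] h w(2) by auto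
      then have "length w \<le> length (W h)" using w(1) by (auto simp: geodesic_def)
      also have "\<dots> \<le> Max (length ` W ` (ball k \<inter> H))" by (rule Max_ge[OF fin]) (use h in blast)
      finally show ?thesis .
    qed
    then show ?thesis by blast
  qed
  then have "\<forall>k. \<exists>L. \<forall>h\<in>ball k \<inter> H. \<forall>w. geodesic w \<and> val w = h \<longrightarrow> length w \<le> L" by blast
  from choice[OF this] obtain L where
    L0: "\<forall>k. \<forall>h\<in>ball k \<inter> H. \<forall>w. geodesic w \<and> val w = h \<longrightarrow> length w \<le> L k" by (rule exE)
  have L: "h \<in> ball k \<Longrightarrow> h \<in> H \<Longrightarrow> geodesic w \<Longrightarrow> val w = h \<Longrightarrow> length w \<le> L k" for k h w using L0 by blast
  define f where "f n = n + L (n + n)" for n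
  have both: "v \<in> ball (f n)" if v: "v \<in> carrier G" and hit: "pos v (\<lambda>j. [p j]) i \<in> ball n" "pos v (\<lambda>j. [m' j]) k \<in> ball n" for v n i k
  proof -
    have wp: "map p [0..<i] \<in> words S0" "map m' [0..<k] \<in> words S0" using pos_letters(1)[OF v] S by auto
    have wm: "rev (map m [0..<k]) \<in> words S0" using line[of k 0] by (simp add: geodesic_def)
    let ?w = "rev (map m [0..<k]) @ map p [0..<i]"
    have vm: "val (map m' [0..<k]) = inv (val (rev (map m [0..<k])))"
      using val_inv_word[OF words_S[OF wm]] inv by simp
    have vc: "val (map p [0..<i]) \<in> carrier G" "val (rev (map m [0..<k])) \<in> carrier G" using wp wm words_S by auto
    have pp: "pos v (\<lambda>j. [p j]) i = v \<otimes> val (map p [0..<i])" using pos_letters(2)[OF v] S by simp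
    have pm: "pos v (\<lambda>j. [m' j]) k = v \<otimes> val (map m' [0..<k])" using pos_letters(2)[OF v] S by simp
    have near: "inv (pos v (\<lambda>j. [m' j]) k) \<otimes> pos v (\<lambda>j. [p j]) i \<in> ball (n + n)" by (intro ball_mult ball_inv hit)
    have e: "inv v \<otimes> (v \<otimes> val (map p [0..<i])) = val (map p [0..<i])" using v vc by (simp flip: m_assoc)
    have "inv (pos v (\<lambda>j. [m' j]) k) \<otimes> pos v (\<lambda>j. [p j]) i = val (rev (map m [0..<k])) \<otimes> val (map p [0..<i])"
      unfolding pp pm vm using v vc by (simp add: inv_mult_group m_assoc e)
    also have "\<dots> = val ?w" using wm wp words_S by simp
    finally have "val ?w \<in> ball (n + n)" using near by simp
    then have "length ?w \<le> L (n + n)" using wm wp by (intro L[OF _ val_words_H line]) auto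
    then have "close (L (n + n)) v (pos v (\<lambda>j. [p j]) i)" unfolding pp using v wp words_S by (intro close_word) auto
    from close_ball[OF close_sym[OF this] hit(1)] show ?thesis by (simp add: f_def)
  qed
  show thesis
  proof (rule that)
    fix v assume v: "v \<in> carrier G"
    define hp where "hp n = (\<exists>i. pos v (\<lambda>j. [p j]) i \<in> ball n)" for n
    define hm where "hm n = (\<exists>i. pos v (\<lambda>j. [m' j]) i \<in> ball n)" for n
    have up: "hp k" if "hp n" "n \<le> k" for n k using that ball_mono unfolding hp_def by blast
    have um: "hm k" if "hm n" "n \<le> k" for n k using that ball_mono unfolding hm_def by blast
    have "(\<forall>n. hp n \<longrightarrow> hm n) \<or> (\<forall>n. hm n \<longrightarrow> hp n)"
    proof (rule ccontr)
      assume "\<not> ?thesis"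
      then obtain n k where nk: "hp n" "\<not> hm n" "hm k" "\<not> hp k" by blast
      then show False using up[of n k] um[of k n] by (cases "n \<le> k") auto
    qed
    then have "(\<forall>n. hp n \<longrightarrow> v \<in> ball (f n)) \<or> (\<forall>n. hm n \<longrightarrow> v \<in> ball (f n))"
      using both[OF v] unfolding hp_def hm_def by blast
    then show "\<exists>p. (\<forall>j. fst (p j) \<in> S0) \<and> (\<forall>x. finite {j. pos v (\<lambda>j. [p j]) j = x}) \<and>
        (\<forall>n. (\<exists>i. pos v (\<lambda>j. [p j]) i \<in> ball n) \<longrightarrow> v \<in> ball (f n))"
    proof
      assume "\<forall>n. hp n \<longrightarrow> v \<in> ball (f n)"
      then show ?thesis using S geodesic_ray_inj[OF v gp] unfolding hp_def by (intro exI[of _ p] conjI allI) auto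
    next
      assume "\<forall>n. hm n \<longrightarrow> v \<in> ball (f n)"
      then show ?thesis using S geodesic_ray_inj[OF v gm] unfolding hm_def by (intro exI[of _ m'] conjI allI) auto
    qed
  qed
qed

section \<open>Infinite base group\<close>

lemma cell_verts_carrier: assumes "y \<in> cayley_points G S P" shows "cell_verts y \<subseteq> carrier G"
  using assms
proof (cases rule: point_cases)
  case (3 g w z)
  then show ?thesis using path_verts_carrier[of g w] P_words by (auto simp: cell_verts_def)
qed (use S_carrier in \<open>auto simp: cell_verts_def\<close>)

lemma ladder_mono:
  assumes "ladder v w \<gamma> \<gamma>' U" "\<And>j. U j \<subseteq> U' j" shows "ladder v w \<gamma> \<gamma>' U'"
proof -
  obtain E where "E 0 = w" "\<And>j. ehom (U j) (pos v \<gamma> j) (\<gamma> j @ E (Suc j)) (E j @ \<gamma>' j)"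
    using assms(1) unfolding ladder_def by blast
  then show ?thesis unfolding ladder_def using ehom_mono[OF _ assms(2)] by (intro exI[of _ E]) simp
qed

text \<open>The second side of a ladder runs through its squares.\<close>

lemma ladder_pos_in:
  assumes "ladder v w \<gamma> \<gamma>' U" shows "pos (v \<otimes> val w) \<gamma>' j \<in> U j"
proof -
  obtain E where E: "E 0 = w" "\<And>j. ehom (U j) (pos v \<gamma> j) (\<gamma> j @ E (Suc j)) (E j @ \<gamma>' j)"
    using assms unfolding ladder_def by blast
  note D = ehomD[OF E(2)[of j]]
  have "pos v \<gamma> j \<otimes> val (E j) \<in> pverts (pos v \<gamma> j) (E j @ \<gamma>' j)" using D by (simp add: path_verts_append)
  then have "pos v \<gamma> j \<otimes> val (E j) \<in> U j" using D(5) by blast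
  moreover have "pos v \<gamma> j \<otimes> val (E j) = pos (v \<otimes> val (E 0)) \<gamma>' j" by (rule ladder_pos[of U], rule E(2))
  ultimately show ?thesis using E(1) by simp
qed

lemma finite_close_pos:
  assumes "\<And>x. finite {j. pos v \<gamma> j = x}" shows "finite {j. close m (pos v \<gamma> j) x}"
proof (rule finite_subset)
  show "{j. close m (pos v \<gamma> j) x} \<subseteq> (\<Union>h\<in>{h. close m x h}. {j. pos v \<gamma> j = h})"
    using close_sym by blast
  show "finite (\<Union>h\<in>{h. close m x h}. {j. pos v \<gamma> j = h})" using assms finite_close by blast
qed

text \<open>The ray at \<open>v\<close> is moved across one edge: a letter of \<open>H\<close> is prepended by a backtrack, and a
  stable letter pushes the ray to the next level.\<close>

lemma transport:
  assumes v: "v \<in> carrier G" and l: "fst l \<in> S" and p: "\<And>j. fst (p j) \<in> S0"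
  shows "\<exists>a. ladder v [l] (\<lambda>j. [p j]) a (\<lambda>j. {x. close ((LM + 1) * 2) (pos v (\<lambda>j. [p j]) j) x}) \<and>
    (\<forall>j. a j \<in> words S0 \<and> length (a j) \<le> LM + 2)"
proof -
  \<comment> \<open>The radius is that of \<open>push_ladder\<close> for words of length \<open>1\<close>; it is at least \<open>3\<close>, as the backtrack needs.\<close>
  let ?\<gamma> = "\<lambda>j. [p j]" and ?U = "\<lambda>j. {x. close ((LM + 1) * 2) (pos v (\<lambda>j. [p j]) j) x}"
  have pw: "?\<gamma> j \<in> words S0" "?\<gamma> j \<in> words S" for j using p[of j] by auto
  have pc: "pos v ?\<gamma> j \<in> carrier G" for j by (rule pos_closed[OF v pw(2)])
  have U: "pverts (pos v ?\<gamma> j) w \<subseteq> ?U j" if "w \<in> words S" "length w \<le> 3" for j w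
  proof
    fix x assume "x \<in> pverts (pos v ?\<gamma> j) w"
    from close_path_verts[OF pc that(1) this that(2)]
    have "close ((LM + 1) * 2) (pos v ?\<gamma> j) x" by (rule close_mono) (use LM(1) in simp)
    then show "x \<in> ?U j" by simp
  qed
  show ?thesis
  proof (cases "fst l \<in> S0")
    case True
    define a where "a = (\<lambda>j. if j = 0 then [(fst l, \<not> snd l), p 0] else [p j])"
    define E where "E = (\<lambda>j. if j = (0::nat) then [l] else [])"
    have "ehom (?U j) (pos v ?\<gamma> j) (?\<gamma> j @ E (Suc j)) (E j @ a j)" for j
    proof (cases "j = 0")
      case True
      have c: "ehom (?U 0) v [] [l, (fst l, \<not> snd l)]"
        using U[of "[l, (fst l, \<not> snd l)]" 0] v l by (intro ehom_sym[OF ehom_cancel_letter]) auto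
      have "ehom (?U 0) (v \<otimes> val []) [p 0] [p 0]"
        using U[of "[p 0]" 0] v pw(2)[of 0] by (intro ehom_refl) auto
      from ehom_append[OF c this] show ?thesis using True by (simp add: E_def a_def)
    next
      case False
      have "ehom (?U j) (pos v ?\<gamma> j) [p j] [p j]" using U[of "[p j]" j] pc pw(2)[of j] by (intro ehom_refl) auto
      then show ?thesis using False by (simp add: E_def a_def)
    qed
    then have "ladder v [l] ?\<gamma> a ?U" unfolding ladder_def by (intro exI[of _ E]) (simp add: E_def)
    moreover have "a j \<in> words S0 \<and> length (a j) \<le> LM + 2" for j using True p by (simp add: a_def)
    ultimately show ?thesis by blast
  next
    case False
    then obtain b where b: "l = (t, b)" using l by (cases l) auto
    have "ladder v [(t, b)] ?\<gamma> (prow b ?\<gamma>) (\<lambda>j. slab (pos v ?\<gamma> j) ((LM + 1) * (1 + 1)) b)"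
      by (rule push_ladder[OF pw(1) _ v]) simp
    then have "ladder v [l] ?\<gamma> (prow b ?\<gamma>) ?U"
      unfolding b by (rule ladder_mono) (auto simp: slab_def numeral_2_eq_2)
    moreover have "prow b ?\<gamma> j \<in> words S0" "length (prow b ?\<gamma> j) \<le> LM * 1" for j
      using prow_words[of ?\<gamma>] prow_length[of ?\<gamma> 1] pw(1) by auto
    then have "prow b ?\<gamma> j \<in> words S0 \<and> length (prow b ?\<gamma> j) \<le> LM + 2" for j by (simp add: le_SucI)
    ultimately show ?thesis by blast
  qed
qed

text \<open>The ladder over an edge from \<open>v\<close> to \<open>g\<close> has three parts: the transported ray \<open>\<gamma>
  v\<close> at \<open>g\<close>, the quadrant from there to the line of powers of \<open>t\<close>, and the quadrant
  from this line to \<open>\<gamma> g\<close>. In each part a vertex \<open>x\<close> is within a distance of one of the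
  two avoiding rays that depends on \<open>\<bar>lev x\<bar>\<close> only, so that \<open>v\<close> or \<open>g\<close>
  lies in a ball that depends on \<open>x\<close> only.\<close>

theorem semistable_infinite:
  assumes inf: "infinite H" shows "semistable_space K"
proof -
  obtain f where "\<forall>v\<in>carrier G. \<exists>p. (\<forall>j. fst (p j) \<in> S0) \<and>
    (\<forall>x. finite {j. pos v (\<lambda>j. [p j]) j = x}) \<and> (\<forall>n. (\<exists>i. pos v (\<lambda>j. [p j]) i \<in> ball n) \<longrightarrow> v \<in> ball (f n))"
  proof (rule avoiding_rays[OF inf])
    fix f :: "nat \<Rightarrow> nat"
    assume "\<And>v. v \<in> carrier G \<Longrightarrow> \<exists>p. (\<forall>j. fst (p j) \<in> S0) \<and>
    (\<forall>x. finite {j. pos v (\<lambda>j. [p j]) j = x}) \<and> (\<forall>n. (\<exists>i. pos v (\<lambda>j. [p j]) i \<in> ball n) \<longrightarrow> v \<in> ball (f n))"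
    then show thesis by (intro that ballI)
  qed
  from bchoice[OF this] obtain p where p: "\<forall>v\<in>carrier G. (\<forall>j. fst (p v j) \<in> S0) \<and>
    (\<forall>x. finite {j. pos v (\<lambda>j. [p v j]) j = x}) \<and> (\<forall>n. (\<exists>i. pos v (\<lambda>j. [p v j]) i \<in> ball n) \<longrightarrow> v \<in> ball (f n))"
    by (rule exE)
  define \<gamma> where "\<gamma> v j = [p v j]" for v j
  have \<gamma>_eq: "\<gamma> v = (\<lambda>j. [p v j])" for v by (simp add: \<gamma>_def fun_eq_iff)
  have pS: "fst (p v j) \<in> S0" if "v \<in> carrier G" for v j using p that by blast
  have \<gamma>w: "\<gamma> v j \<in> words S0" "\<gamma> v j \<in> words S" if "v \<in> carrier G" for v j
    using pS[OF that] by (auto simp: \<gamma>_def)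
  have fib: "finite {j. pos v (\<gamma> v) j = x}" if "v \<in> carrier G" for v x using p that unfolding \<gamma>_eq by blast
  have avoid: "v \<in> ball (f n)" if "v \<in> carrier G" "pos v (\<gamma> v) i \<in> ball n" for v n i
    using p that unfolding \<gamma>_eq by blast
  let ?B = "LM + 2" and ?M = "(LM + 1) * 2"
  define C where "C k = ?M + push_radius ?B k" for k
  define nn where "nn x = (SOME n. x \<in> ball n)" for x
  have nn: "x \<in> ball (nn x)" if "x \<in> carrier G" for x unfolding nn_def by (rule someI_ex[OF every_ball[OF that]])
  define N where "N x = ball (f (nn x + C (nat \<bar>lev x\<bar>)))" for x
  have hit: "v \<in> N x" if v: "v \<in> carrier G" and c: "close m (pos v (\<gamma> v) i) x" "m \<le> C (nat \<bar>lev x\<bar>)" for v m i x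
  proof -
    have x: "x \<in> carrier G" using c by (simp add: close_def)
    show ?thesis unfolding N_def by (rule avoid[OF v close_ball[OF close_sym[OF close_mono[OF c]] nn[OF x]]])
  qed
  have nil: "proper_ladder N v [] (\<gamma> v) (\<gamma> v)" if v: "v \<in> carrier G" for v
  proof -
    let ?U = "\<lambda>j. pverts (pos v (\<gamma> v) j) (\<gamma> v j)"
    have c: "close 1 (pos v (\<gamma> v) j) x" if "x \<in> ?U j" for x j
      by (rule close_path_verts[OF pos_closed[OF v \<gamma>w(2)[OF v]] \<gamma>w(2)[OF v] that]) (simp add: \<gamma>_def)
    have L: "ladder v [] (\<gamma> v) (\<gamma> v) ?U" by (rule ladder_nil[OF v \<gamma>w(2)[OF v]])
    have fin: "finite {j. x \<in> ?U j}" for x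
      by (rule finite_subset[OF _ finite_close_pos[OF fib[OF v], of 1 x]]) (use c in blast)
    have "pverts v [] \<inter> N x \<noteq> {}" if "x \<in> ?U j" for x j
      using hit[OF v c[OF that]] by (simp add: C_def)
    then show ?thesis unfolding proper_ladder_def by (intro exI[of _ ?U] conjI allI ballI L fin) blast
  qed
  have letter: "proper_ladder N v [l] (\<gamma> v) (\<gamma> (v \<otimes> lval l))" if v: "v \<in> carrier G" and l: "fst l \<in> S" for v l
  proof -
    let ?g = "v \<otimes> lval l"
    have g: "?g \<in> carrier G" using v l S_carrier by simp
    have vl: "v \<otimes> val [l] = ?g" using l S_sub by (auto simp: letter_val_def)
    obtain a where a: "ladder v [l] (\<gamma> v) a (\<lambda>j. {x. close ?M (pos v (\<gamma> v) j) x})"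
      "\<And>j. a j \<in> words S0" "\<And>j. length (a j) \<le> ?B"
      using transport[of v l "p v", OF v l pS[OF v]] unfolding \<gamma>_eq by blast
    let ?U1 = "\<lambda>j. {x. close ?M (pos v (\<gamma> v) j) x}"
    have ca: "close ?M (pos v (\<gamma> v) j) (pos ?g a j)" for j using ladder_pos_in[OF a(1), of j] unfolding vl by simp
    have fa: "finite {j. pos ?g a j = x}" for x
      by (rule finite_subset[OF _ finite_close_pos[OF fib[OF v], of ?M x]]) (use ca in blast)
    \<comment> \<open>Both rays at \<open>?g\<close> are pushed in the same direction, away from level \<open>0\<close>.\<close>
    define b where "b = (0 \<le> lev ?g)"
    have sgn: "0 \<le> lev ?g * lev (tau b)" by (simp add: b_def lev_tau)
    obtain U2 where U2: "ladder ?g [] a (\<lambda>_. [(t, b)]) U2" "\<And>x. finite {j. x \<in> U2 j}"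
      "\<And>j x. x \<in> U2 j \<Longrightarrow> \<exists>i. close (push_radius ?B (nat \<bar>lev x\<bar>)) (pos ?g a i) x"
      using far_ladder[of ?g a ?B b, OF g a(2,3) fa sgn] by blast
    have len: "length (\<gamma> ?g j) \<le> ?B" for j by (simp add: \<gamma>_def)
    obtain U3 where U3: "ladder ?g [] (\<gamma> ?g) (\<lambda>_. [(t, b)]) U3" "\<And>x. finite {j. x \<in> U3 j}"
      "\<And>j x. x \<in> U3 j \<Longrightarrow> \<exists>i. close (push_radius ?B (nat \<bar>lev x\<bar>)) (pos ?g (\<gamma> ?g) i) x"
      using far_ladder[of ?g "\<gamma> ?g" ?B b, OF g \<gamma>w(1)[OF g] len fib[OF g] sgn] by blast
    have "ladder ?g [] (\<lambda>_. [(t, b)]) (\<gamma> ?g) U3" using ladder_sym[OF U3(1)] g by simp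
    then have "ladder ?g ([] @ []) a (\<gamma> ?g) (\<lambda>j. U2 j \<union> U3 j)" by (intro ladder_trans[OF U2(1)]) (simp add: g)
    then have "ladder v ([l] @ []) (\<gamma> v) (\<gamma> ?g) (\<lambda>j. ?U1 j \<union> (U2 j \<union> U3 j))"
      by (intro ladder_trans[OF a(1)]) (simp only: vl append_Nil)
    then have L: "ladder v [l] (\<gamma> v) (\<gamma> ?g) (\<lambda>j. ?U1 j \<union> (U2 j \<union> U3 j))" by simp
    have fin: "finite {j. x \<in> ?U1 j \<union> (U2 j \<union> U3 j)}" for x
      using finite_close_pos[OF fib[OF v], of ?M x] U2(2)[of x] U3(2)[of x] by (simp add: Collect_disj_eq)
    have vN: "v \<in> N x \<or> ?g \<in> N x" if "x \<in> ?U1 j \<union> (U2 j \<union> U3 j)" for x j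
    proof -
      from that consider "close ?M (pos v (\<gamma> v) j) x" | "x \<in> U2 j" | "x \<in> U3 j" by blast
      then show ?thesis
      proof cases
        case 1
        then show ?thesis using hit[OF v 1] by (simp add: C_def)
      next
        case 2
        then obtain i where "close (push_radius ?B (nat \<bar>lev x\<bar>)) (pos ?g a i) x" using U2(3) by blast
        from hit[OF v close_trans[OF ca this]] show ?thesis by (simp add: C_def)
      next
        case 3
        then obtain i where "close (push_radius ?B (nat \<bar>lev x\<bar>)) (pos ?g (\<gamma> ?g) i) x" using U3(3) by blast
        from hit[OF g this] show ?thesis by (simp add: C_def)
      qed
    qed
    have "pverts v [l] \<inter> N x \<noteq> {}" if "x \<in> ?U1 j \<union> (U2 j \<union> U3 j)" for x j
    proof -
      have "pverts v [l] = {v, ?g}" by (simp add: insert_commute)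
      then show ?thesis using vN[OF that] by blast
    qed
    then show ?thesis unfolding proper_ladder_def
      by (intro exI[of _ "\<lambda>j. ?U1 j \<union> (U2 j \<union> U3 j)"] conjI allI ballI L fin) blast
  qed
  have lad: "proper_ladder N v w (\<gamma> v) (\<gamma> (v \<otimes> val w))" if "w \<in> words S" "pverts v w \<subseteq> carrier G" for v w
    by (rule proper_ladder_word[OF subset_refl nil letter that])
  have fN: "finite (N x)" for x unfolding N_def by (rule finite_ball)
  have main: "properly_homotopic K r (column \<one> (\<gamma> \<one>))" if r: "is_ray K r" for r
  proof -
    have "continuous_map (top_of_set {0..}) K r" using r by (simp add: is_ray_iff[OF Hausdorff_K])
    then have pts: "r x \<in> cayley_points G S P" if "x \<ge> 0" for x
      using that by (auto simp: continuous_map_def Pi_iff topspace_K)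
    obtain w0 where w0: "w0 \<in> words S" "val w0 = base (r 0)" using every_word[OF base_carrier[OF pts[of 0]]] by auto
    show ?thesis
    proof (rule ray_homotopic_column[of "carrier G" \<gamma> N r w0 \<one>])
      show "cell_verts (r x) \<subseteq> carrier G" if "x \<ge> 0" for x by (rule cell_verts_carrier[OF pts[OF that]])
      show "pverts \<one> w0 \<subseteq> carrier G" by (rule path_verts_carrier[OF one_closed w0(1)])
      show "\<one> \<otimes> val w0 = base (r 0)" using w0 base_carrier[OF pts[of 0]] by simp
    qed (use \<gamma>w(2) fN lad r w0(1) in auto)
  qed
  show ?thesis unfolding semistable_space_def
    using properly_homotopic_trans[OF Hausdorff_K main properly_homotopic_sym[OF Hausdorff_K main]] by blast
qed

section \<open>Finite base group\<close>

lemma ball_level: assumes "x \<in> ball n" shows "\<bar>lev x\<bar> \<le> int n"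
proof -
  have "\<bar>lev (val w)\<bar> \<le> int (length w)" if "w \<in> words S" for w
    using that
  proof (induction w)
    case (Cons l w)
    have l: "fst l \<in> S" and w: "w \<in> words S" using Cons.prems by auto
    have "lev (lval l) = lev (fst l) \<or> lev (lval l) = - lev (fst l)"
      using lev_inv[of "fst l"] l S_sub by (auto simp: letter_val_def)
    then have "\<bar>lev (lval l)\<bar> \<le> 1" using l lev_S0 lev_t by auto
    moreover have "lev (val (l # w)) = lev (lval l) + lev (val w)" using l w S_sub by (simp add: lev_mult)
    ultimately show ?case using Cons.IH[OF w] by simp
  qed (simp add: lev_one)
  then show ?thesis using assms unfolding ball_def by fastforce
qed

lemma close_level: assumes "close n g h" shows "\<bar>lev g - lev h\<bar> \<le> int n"
proof -
  have "lev (inv g \<otimes> h) = lev h - lev g" using assms by (simp add: close_def lev_mult lev_inv)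
  then show ?thesis using ball_level[of "inv g \<otimes> h" n] assms by (simp add: close_def abs_minus_commute)
qed

lemma cell_level:
  assumes y: "y \<in> cayley_points G S P" and x: "x \<in> cell_verts y" "x' \<in> cell_verts y"
  shows "\<bar>lev x - lev x'\<bar> \<le> 2 * int LM"
proof -
  have "close LM (base y) x" if "x \<in> cell_verts y" for x
    using y
  proof (cases rule: point_cases)
    case (1 g)
    then show ?thesis using that close_mono[OF close_refl] by (fastforce simp: cell_verts_def close_def one_in_ball)
  next
    case (2 g s u)
    have "x \<in> pverts g [(s, True)]" using 2 that by (auto simp: cell_verts_def letter_val_def)
    then have "close LM g x" using 2 LM(1) by (intro close_path_verts[of g "[(s, True)]"]) auto
    then show ?thesis using 2 by simp
  next
    case (3 g w z)
    then have "w \<in> words S" using P_words by blast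
    then have "close LM g x" using 3 that LM(2) by (intro close_path_verts[of g w]) (auto simp: cell_verts_def)
    then show ?thesis using 3 by simp
  qed
  from close_level[OF this[OF x(1)]] close_level[OF this[OF x(2)]] show ?thesis by linarith
qed

definition signed_level :: "bool \<Rightarrow> 'a \<Rightarrow> real" where
  "signed_level b x = real_of_int (lev (tau b) * lev x)"

text \<open>A conjugation that maps the finite group \<open>H\<close> into itself maps it onto itself.\<close>

lemma conj_H:
  assumes fin: "finite H" and asc: "\<And>h. h \<in> H \<Longrightarrow> conj True h \<in> H" and h: "h \<in> H"
  shows "conj b h \<in> H"
proof (cases b)
  case True
  then show ?thesis using asc[OF h] by simp
next
  case False
  have c: "x \<in> carrier G" if "x \<in> H" for x using that H_carrier by blast
  have inv: "conj False (conj True x) = x" if "x \<in> carrier G" for x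
  proof -
    have "t \<otimes> (inv t \<otimes> x \<otimes> t) \<otimes> inv t = (t \<otimes> inv t) \<otimes> x \<otimes> (t \<otimes> inv t)"
      using that t_carrier by (simp only: m_assoc m_closed inv_closed)
    then show ?thesis using that t_carrier by (simp add: conj_def letter_val_def)
  qed
  have "inj_on (conj True) H" using inv c by (intro inj_on_inverseI[of _ "conj False"]) simp
  then have "conj True ` H = H" by (intro endo_inj_surj fin) (use asc in blast)+
  then obtain k where "k \<in> H" "h = conj True k" using h by blast
  then show ?thesis using inv[OF c] False by simp
qed

text \<open>If \<open>t\<close> normalises \<open>H\<close>, every element of \<open>G\<close> is \<open>h t\<^sup>k\<close> with
  \<open>k\<close> its level.\<close>

lemma finite_level_set:
  assumes fin: "finite H" and norm: "\<And>b h. h \<in> H \<Longrightarrow> conj b h \<in> H"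
  shows "finite {g \<in> carrier G. \<bar>lev g\<bar> \<le> c}"
proof (rule finite_subset)
  have tau: "tau b = t [^] lev (tau b)" for b
    unfolding lev_tau using t_carrier int_pow_neg[of t 1] by (simp add: letter_val_def)
  have "\<exists>h\<in>H. val w = h \<otimes> t [^] lev (val w)" if "w \<in> words S" for w
    using that
  proof (induction w)
    case Nil
    show ?case by (intro bexI[of _ \<one>]) (auto simp: lev_one generate.one)
  next
    case (Cons l w)
    have l: "fst l \<in> S" and w: "w \<in> words S" using Cons.prems by auto
    obtain h where h: "h \<in> H" "val w = h \<otimes> t [^] lev (val w)" using Cons.IH[OF w] by blast
    have hc: "h \<in> carrier G" using h H_carrier by blast
    have lc: "lval l \<in> carrier G" using l S_sub by (auto simp: letter_val_def)
    have lv: "lev (val (l # w)) = lev (lval l) + lev (val w)" using l w S_sub by (simp add: lev_mult lc)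
    show ?case
    proof (cases "fst l \<in> S0")
      case True
      have "val (l # w) = (lval l \<otimes> h) \<otimes> t [^] lev (val w)"
        using h(2) hc lc t_carrier by (simp add: m_assoc)
      moreover have "lev (lval l) = 0" by (rule lev_H[OF letter_H[OF True]])
      ultimately show ?thesis using H_mult[OF letter_H[OF True] h(1)] lv by (intro bexI[of _ "lval l \<otimes> h"]) auto
    next
      case False
      then obtain b where b: "l = (t, b)" using l by (cases l) auto
      have n: "inv (tau (\<not> b)) = tau b" using t_carrier by (simp add: letter_val_def)
      have cj: "conj (\<not> b) h \<in> H" by (rule norm[OF h(1)])
      have "conj (\<not> b) h \<otimes> tau b = tau b \<otimes> h \<otimes> (tau (\<not> b) \<otimes> tau b)"
        unfolding conj_def n using hc by (simp add: m_assoc)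
      also have "tau (\<not> b) \<otimes> tau b = \<one>" using n by (metis r_inv tau_closed)
      finally have e: "conj (\<not> b) h \<otimes> tau b = tau b \<otimes> h" using hc by simp
      have cc: "conj (\<not> b) h \<in> carrier G" using cj H_carrier by blast
      have "val (l # w) = tau b \<otimes> (h \<otimes> t [^] lev (val w))" using h(2) by (simp add: b)
      also have "\<dots> = conj (\<not> b) h \<otimes> tau b \<otimes> t [^] lev (val w)" using hc t_carrier by (simp add: e m_assoc)
      also have "\<dots> = conj (\<not> b) h \<otimes> (t [^] lev (tau b) \<otimes> t [^] lev (val w))"
        using cc t_carrier by (simp add: m_assoc flip: tau)
      also have "\<dots> = conj (\<not> b) h \<otimes> t [^] lev (val (l # w))" unfolding lv unfolding b using t_carrier by (simp add: int_pow_mult)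
      finally show ?thesis using cj by blast
    qed
  qed
  then have "\<exists>h\<in>H. g = h \<otimes> t [^] lev g" if "g \<in> carrier G" for g using every_word[OF that] by blast
  note factor = this
  show "{g \<in> carrier G. \<bar>lev g\<bar> \<le> c} \<subseteq> (\<lambda>(h, k). h \<otimes> t [^] k) ` (H \<times> {-c..c})"
  proof
    fix g assume g: "g \<in> {g \<in> carrier G. \<bar>lev g\<bar> \<le> c}"
    then obtain h where h: "h \<in> H" "g = h \<otimes> t [^] lev g" using factor by blast
    moreover have "lev g \<in> {-c..c}" using g by auto
    ultimately show "g \<in> (\<lambda>(h, k). h \<otimes> t [^] k) ` (H \<times> {-c..c})"
      by (intro image_eqI[of _ _ "(h, lev g)"]) auto
  qed
  show "finite ((\<lambda>(h, k). h \<otimes> t [^] k) ` (H \<times> {-c..c}))" using fin by simp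
qed

lemma pos_stable: "v \<in> carrier G \<Longrightarrow> pos v (\<lambda>_. [(t, b)]) j \<in> carrier G \<and> lev (pos v (\<lambda>_. [(t, b)]) j) = lev v + int j * lev (tau b)"
  by (induction j) (auto simp: lev_mult algebra_simps)

text \<open>The lines \<open>v t\<^sup>k\<close> at adjacent vertices. As \<open>t\<close> normalises \<open>H\<close>, the state
  stays \<open>\<one>\<close> and a rung is pushed from each level to the next; the \<open>j\<close>-th square is
  recognised by its level.\<close>

lemma stable_ladder:
  assumes norm: "\<And>b h. h \<in> H \<Longrightarrow> conj b h \<in> H" and v: "v \<in> carrier G" and w: "w = [] \<or> (\<exists>l. w = [l] \<and> fst l \<in> S)"
  shows "ladder v w (\<lambda>_. [(t, b)]) (\<lambda>_. [(t, b)])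
    (\<lambda>j. {x. lev (tau b) * lev v + int j - 1 \<le> lev (tau b) * lev x \<and> lev (tau b) * lev x \<le> lev (tau b) * lev v + int j + 2})"
    (is "ladder v w ?\<omega> ?\<omega> ?U")
proof -
  let ?q = "pos v ?\<omega>"
  have q: "?q j \<in> carrier G" "lev (?q j) = lev v + int j * lev (tau b)" for j using pos_stable[OF v] by auto
  have tb: "[(t, b)] \<in> words S" by simp
  have V: "g \<in> ?U j" if "lev g = lev (?q j) + k" "k \<in> {-1, 0, 1, 2 * lev (tau b)}" for g k j
    using that unfolding q by (auto simp: lev_tau algebra_simps)
  have lt: "lev (g \<otimes> tau b') = lev g + lev (tau b')" if "g \<in> carrier G" for g b' using that by (simp add: lev_mult)
  consider (nil) "w = []" | (base) l where "w = [l]" "fst l \<in> S0" | (stable) b' where "w = [(t, b')]"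
    using w by (metis insertE prod.collapse)
  then show ?thesis
  proof cases
    case nil
    have "pverts (?q j) [(t, b)] \<subseteq> ?U j" for j
    proof -
      have "?q j \<in> ?U j" by (rule V[of _ _ 0]) simp_all
      moreover have "?q j \<otimes> tau b \<in> ?U j" by (rule V[OF lt[OF q(1)]]) (simp add: lev_tau)
      ultimately show ?thesis by simp
    qed
    then show ?thesis unfolding nil using ladder_mono[OF ladder_nil[OF v tb]] by simp
  next
    case base
    have rep1: "rep b h = \<one>" if "h \<in> H" for h using norm[OF that] by (simp add: rep_def)
    have st1: "st b \<one> u = \<one>" if "u \<in> words S0" for u
      using that
    proof (induction u)
      case (Cons l u)
      then have "letter_val G l \<in> H" by (intro letter_H) simp
      then have "rep b (\<one> \<otimes> letter_val G l) = \<one>" using H_carrier rep1 by auto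
      then show ?case using Cons by simp
    qed simp
    define E where "E = rec_nat [l] (\<lambda>_. out b \<one>)"
    have E: "E 0 = [l]" "E (Suc j) = out b \<one> (E j)" for j by (simp_all add: E_def)
    have Ew: "E j \<in> words S0" for j
    proof (induction j)
      case (Suc j)
      then show ?case unfolding E by (rule out_words[OF T_one])
    qed (use base E in simp)
    have "ehom (?U j) (?q j) ([(t, b)] @ E (Suc j)) (E j @ [(t, b)])" for j
    proof (rule ehom_mono[OF ehom_sym])
      show "ehom (slab (?q j) ((LM + 1) * (length (E j) + 1)) b) (?q j) (E j @ [(t, b)]) ([(t, b)] @ E (Suc j))"
        using push_ehom[of "\<one>" b "E j" "?q j", OF T_one Ew q(1)] unfolding E(2) D_one st1[OF Ew] by (simp add: D_one)
      show "slab (?q j) ((LM + 1) * (length (E j) + 1)) b \<subseteq> ?U j"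
      proof
        fix x assume "x \<in> slab (?q j) ((LM + 1) * (length (E j) + 1)) b"
        then have "lev x = lev (?q j) + 0 \<or> lev x = lev (?q j) + lev (tau b)" by (auto simp: slab_def)
        then show "x \<in> ?U j" using V[of x j 0] V[of x j "lev (tau b)"] by (auto simp: lev_tau)
      qed
    qed
    then show ?thesis unfolding ladder_def base by (intro exI[of _ E]) (simp add: E)
  next
    case stable
    have vs: "pverts (?q j) [(t, c), (t, d)] \<subseteq> ?U j" if "c = b \<or> d = b" for c d j
    proof -
      have "?q j \<in> ?U j" by (rule V[of _ _ 0]) simp_all
      moreover have "?q j \<otimes> tau c \<in> ?U j" by (rule V[OF lt[OF q(1)]]) (simp add: lev_tau)
      moreover have "?q j \<otimes> tau c \<otimes> tau d \<in> ?U j"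
      proof (rule V)
        show "lev (?q j \<otimes> tau c \<otimes> tau d) = lev (?q j) + (lev (tau c) + lev (tau d))" using q(1) by (simp add: lt)
        show "lev (tau c) + lev (tau d) \<in> {-1, 0, 1, 2 * lev (tau b)}" using that by (auto simp: lev_tau)
      qed
      ultimately show ?thesis by simp
    qed
    have "ehom (?U j) (?q j) ([(t, b)] @ [(t, b')]) ([(t, b')] @ [(t, b)])" for j
    proof (cases "b' = b")
      case True
      show ?thesis unfolding True using vs[of b b j] q(1) by (intro ehom_refl) auto
    next
      case False
      then have b': "b' = (\<not> b)" by blast
      have 1: "ehom (?U j) (?q j) [(t, b), (t, b')] []"
        using ehom_cancel_letter[of "?q j" "(t, b)" "?U j", OF q(1)] vs[of b b' j] b' by simp
      have 2: "ehom (?U j) (?q j) [(t, b'), (t, b)] []"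
        using ehom_cancel_letter[of "?q j" "(t, b')" "?U j", OF q(1)] vs[of b' b j] b' by simp
      show ?thesis using ehom_trans[OF 1 ehom_sym[OF 2]] by simp
    qed
    then show ?thesis unfolding ladder_def stable by (intro exI[of _ "\<lambda>_. [(t, b')]"]) simp
  qed
qed

text \<open>Up to the sign of the level, the sweep takes place over the vertices of level at least \<open>- n\<close>. A square at
  the vertex \<open>x\<close> belongs to a ladder that starts between the levels \<open>- n\<close> and \<open>lev x +
  1\<close>, hence at one of finitely many vertices.\<close>

lemma ray_homotopic_stable_line:
  assumes fin: "finite H" and norm: "\<And>b h. h \<in> H \<Longrightarrow> conj b h \<in> H"
    and r: "is_ray K r" and M: "M \<ge> 0" "\<And>x. x \<ge> M \<Longrightarrow> 0 < level_fun (signed_level b) (r x)"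
  shows "properly_homotopic K r (column \<one> (\<lambda>_. [(t, b)]))"
proof -
  let ?\<omega> = "\<lambda>_::nat. [(t, b)]"
  have dl: "signed_level b x \<le> signed_level b x' + 2 * LM"
    if "y \<in> cayley_points G S P" "x \<in> cell_verts y" "x' \<in> cell_verts y" for y x x'
    using cell_level[OF that] by (auto simp: signed_level_def lev_tau abs_le_iff)
  obtain L where L: "\<And>x. x \<ge> 0 \<Longrightarrow> cell_verts (r x) \<subseteq> {v \<in> carrier G. - L \<le> signed_level b v}"
    by (rule ray_level_bounded_below[of "signed_level b" "2 * LM" r M]) (use dl r M in auto)
  have "continuous_map (top_of_set {0..}) K r" using r by (simp add: is_ray_iff[OF Hausdorff_K])
  then have pts: "r x \<in> cayley_points G S P" if "x \<ge> 0" for x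
    using that by (auto simp: continuous_map_def Pi_iff topspace_K)
  obtain w0 where w0: "w0 \<in> words S" "val w0 = base (r 0)" using every_word[OF base_carrier[OF pts[of 0]]] by auto
  have pf: "finite ((\<lambda>x. \<bar>lev x\<bar>) ` pverts \<one> w0)" by (rule finite_imageI[OF finite_path_verts])
  define n where "n = \<lceil>\<bar>L\<bar>\<rceil> + Max ((\<lambda>x. \<bar>lev x\<bar>) ` pverts \<one> w0)"
  have mx: "\<bar>lev x\<bar> \<le> Max ((\<lambda>x. \<bar>lev x\<bar>) ` pverts \<one> w0)" if "x \<in> pverts \<one> w0" for x
    by (rule Max_ge[OF pf]) (use that in blast)
  have m0: "0 \<le> Max ((\<lambda>x. \<bar>lev x\<bar>) ` pverts \<one> w0)" by (rule order_trans[OF abs_ge_zero mx[of \<one>]]) simp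
  have nL: "L \<le> n" using m0 unfolding n_def by linarith
  have nx: "\<bar>lev x\<bar> \<le> n" if "x \<in> pverts \<one> w0" for x using mx[OF that] unfolding n_def by linarith
  define Y where "Y = {v \<in> carrier G. - n \<le> lev (tau b) * lev v}"
  define N where "N x = {v \<in> carrier G. \<bar>lev v\<bar> \<le> \<bar>n\<bar> + \<bar>lev x\<bar> + 1}" for x
  have fN: "finite (N x)" for x unfolding N_def by (rule finite_level_set[OF fin norm])
  have step: "proper_ladder N v w ?\<omega> ?\<omega>" if v: "v \<in> Y" and w: "w = [] \<or> (\<exists>l. w = [l] \<and> fst l \<in> S)" for v w
  proof -
    let ?U = "\<lambda>j. {x. lev (tau b) * lev v + int j - 1 \<le> lev (tau b) * lev x \<and> lev (tau b) * lev x \<le> lev (tau b) * lev v + int j + 2}"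
    have vc: "v \<in> carrier G" using v by (simp add: Y_def)
    have lad: "ladder v w ?\<omega> ?\<omega> ?U" by (rule stable_ladder[OF norm vc w])
    have "{j. x \<in> ?U j} \<subseteq> {..nat (\<bar>lev x\<bar> + \<bar>lev v\<bar> + 1)}" for x by (auto simp: lev_tau split: if_splits)
    then have f: "finite {j. x \<in> ?U j}" for x by (rule finite_subset) simp
    have "v \<in> N x" if "x \<in> ?U j" for x j using that v by (auto simp: N_def Y_def lev_tau abs_le_iff split: if_splits)
    then have "pverts v w \<inter> N x \<noteq> {}" if "x \<in> ?U j" for x j using that start_in_path_verts[of v G w] by blast
    then show ?thesis unfolding proper_ladder_def using lad f by blast
  qed
  have lad: "proper_ladder N v w ?\<omega> ?\<omega>" if "w \<in> words S" "pverts v w \<subseteq> Y" for v w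
    by (rule proper_ladder_word[of Y N "\<lambda>_. ?\<omega>" w v]) (use step that in \<open>auto simp: Y_def\<close>)
  show ?thesis
  proof (rule ray_homotopic_column[of Y "\<lambda>_. ?\<omega>" N r w0 \<one>])
    show "cell_verts (r x) \<subseteq> Y" if "x \<ge> 0" for x
    proof
      fix v assume "v \<in> cell_verts (r x)"
      then have v: "v \<in> carrier G" "- L \<le> signed_level b v" using L[OF that] by auto
      then have "real_of_int (- n) \<le> real_of_int (lev (tau b) * lev v)" using nL by (simp add: signed_level_def)
      then show "v \<in> Y" using v by (simp only: Y_def of_int_le_iff mem_Collect_eq)
    qed
    show "pverts \<one> w0 \<subseteq> Y"
      using nx path_verts_carrier[OF one_closed w0(1)] by (fastforce simp: Y_def lev_tau abs_le_iff)
    show "\<one> \<otimes> val w0 = base (r 0)" using w0 base_carrier[OF pts[of 0]] by simp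
  qed (use fN lad r w0(1) in \<open>auto simp: Y_def\<close>)
qed

theorem semistable_finite:
  assumes fin: "finite H" and asc: "\<And>h. h \<in> H \<Longrightarrow> conj True h \<in> H" shows "semistable_space K"
  unfolding semistable_space_def
proof (intro allI impI, elim conjE)
  fix r s assume r: "is_ray K r" and s: "is_ray K s" and e: "converge_to_same_end K r s"
  have norm: "conj b h \<in> H" if "h \<in> H" for b h by (rule conj_H[OF fin asc that])
  have dl: "signed_level b x \<le> signed_level b x' + 2 * LM"
    if "y \<in> cayley_points G S P" "x \<in> cell_verts y" "x' \<in> cell_verts y" for b y x x'
    using cell_level[OF that] by (auto simp: signed_level_def lev_tau abs_le_iff)
  have "{g \<in> carrier G. \<bar>signed_level b g\<bar> \<le> 2 * LM} = {g \<in> carrier G. \<bar>lev g\<bar> \<le> 2 * int LM}" for b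
    by (auto simp: signed_level_def lev_tau)
  then have fl: "finite {g \<in> carrier G. \<bar>signed_level b g\<bar> \<le> 2 * LM}" for b
    using finite_level_set[OF fin norm] by simp
  have "signed_level False = (\<lambda>x. - signed_level True x)" by (simp add: fun_eq_iff signed_level_def lev_tau)
  then have neg: "level_fun (signed_level False) y = - level_fun (signed_level True) y" for y by (simp add: level_fun_minus)
  have sgn: "\<exists>b. \<exists>M\<ge>0. \<forall>x\<ge>M. 0 < level_fun (signed_level b) (q x) \<and> level_fun (signed_level (\<not> b)) (q x) < 0"
    if q: "is_ray K q" for q
  proof -
    obtain M where M: "M \<ge> 0" "(\<forall>x\<ge>M. 0 < level_fun (signed_level True) (q x)) \<or> (\<forall>x\<ge>M. level_fun (signed_level True) (q x) < 0)"
      by (rule ray_level_sign[of "signed_level True" "2 * LM" q, OF dl fl q])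
    from M(2) show ?thesis
    proof
      assume "\<forall>x\<ge>M. 0 < level_fun (signed_level True) (q x)"
      then show ?thesis using M(1) neg by (intro exI[of _ True] exI[of _ M]) auto
    next
      assume "\<forall>x\<ge>M. level_fun (signed_level True) (q x) < 0"
      then show ?thesis using M(1) neg by (intro exI[of _ False] exI[of _ M]) auto
    qed
  qed
  obtain b M where b: "M \<ge> 0" "\<And>x. x \<ge> M \<Longrightarrow> 0 < level_fun (signed_level b) (r x)" using sgn[OF r] by blast
  obtain b' M' where b': "M' \<ge> 0" "\<And>x. x \<ge> M' \<Longrightarrow> 0 < level_fun (signed_level b') (s x)"
    "\<And>x. x \<ge> M' \<Longrightarrow> level_fun (signed_level (\<not> b')) (s x) < 0" using sgn[OF s] by blast
  have "b' = b"
  proof (rule ccontr)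
    assume "b' \<noteq> b"
    then have "(\<not> b') = b" by blast
    with b'(3) have s_neg: "level_fun (signed_level b) (s x) < 0" if "x \<ge> M'" for x using that by simp
    show False
      by (rule level_separates_ends[of "signed_level b" "2 * LM" r s M M'])
        (rule dl, assumption+, rule fl, rule e, erule b(2), erule s_neg)
  qed
  have 1: "properly_homotopic K r (column \<one> (\<lambda>_. [(t, b)]))"
    by (rule ray_homotopic_stable_line[OF fin norm r b])
  have 2: "properly_homotopic K s (column \<one> (\<lambda>_. [(t, b)]))"
    by (rule ray_homotopic_stable_line[OF fin norm s b'(1)]) (assumption, erule b'(2)[unfolded \<open>b' = b\<close>])
  show "properly_homotopic K r s" by (rule properly_homotopic_trans[OF Hausdorff_K 1 properly_homotopic_sym[OF Hausdorff_K 2]])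
qed

end

section \<open>Ascending HNN extensions\<close>

lemma (in ascending) semistable:
  assumes "\<And>h. h \<in> H \<Longrightarrow> conj True h \<in> H" shows "semistable_group G"
proof -
  have "semistable_space K" using semistable_finite[OF _ assms] semistable_infinite by blast
  moreover have "generates G S" using gen S_sub by (simp add: generates_def)
  moreover have "P \<subseteq> {w \<in> words S. word_val G w = \<one>}" using P_words P_val by blast
  ultimately show ?thesis unfolding semistable_group_def using finite_S finite_P by blast
qed

fun stable_exponent :: "'a hnn_gen word \<Rightarrow> int" where
  "stable_exponent [] = 0"
| "stable_exponent ((Stable, b) # w) = (if b then 1 else -1) + stable_exponent w"
| "stable_exponent ((Base h, b) # w) = stable_exponent w"

lemma stable_exponent_append: "stable_exponent (u @ v) = stable_exponent u + stable_exponent v"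
  by (induction u rule: stable_exponent.induct) auto

text \<open>All defining relations have the same exponent sum of the stable letter on both sides.\<close>

lemma stable_exponent_invariant:
  assumes "pres_eq X (hnn_relations H \<phi>) u v" shows "stable_exponent u = stable_exponent v"
  using assms
proof induction
  case (pres_cancel x b)
  then show ?case by (cases x) auto
next
  case (pres_relation u v)
  then show ?case by (auto simp: hnn_relations_def)
qed (auto simp: stable_exponent_append)

locale hnn_data = group H for H :: "('a, 'b) monoid_scheme" +
  fixes \<phi> :: "'a \<Rightarrow> 'a"
  assumes \<phi>: "\<phi> \<in> hom H H" and index: "finite (rcosets\<^bsub>H\<^esub> (\<phi> ` carrier H))"
begin

abbreviation (input) X where "X \<equiv> insert Stable (Base ` carrier H)"
abbreviation (input) R where "R \<equiv> hnn_relations H \<phi>"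
abbreviation (input) E where "E \<equiv> ascending_HNN H \<phi>"

definition cls :: "'a hnn_gen word \<Rightarrow> 'a hnn_gen word set" where "cls u = pres_rel X R `` {u}"
definition emb :: "'a \<Rightarrow> 'a hnn_gen word set" where "emb h = cls [(Base h, True)]"
definition stab :: "'a hnn_gen word set" where "stab = cls [(Stable, True)]"
text \<open>The exponent sum is constant on each element of the group, so the choice of a word does not matter.\<close>

definition level :: "'a hnn_gen word set \<Rightarrow> int" where "level A = stable_exponent (SOME u. u \<in> A)"

lemma cls_eq: "pres_eq X R u v \<Longrightarrow> cls u = cls v"
  unfolding cls_def using pres_class_eq_iff pres_eq_words by blast

lemma cls_mult: "u \<in> words X \<Longrightarrow> v \<in> words X \<Longrightarrow> cls u \<otimes>\<^bsub>E\<^esub> cls v = cls (u @ v)"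
  unfolding cls_def ascending_HNN_def by (rule presented_group_mult)

lemma cls_closed: "u \<in> words X \<Longrightarrow> cls u \<in> carrier E"
  unfolding cls_def ascending_HNN_def presented_group_carrier_iff by blast

lemma cls_cases: assumes "A \<in> carrier E" obtains u where "u \<in> words X" "A = cls u"
  using assms unfolding cls_def ascending_HNN_def presented_group_carrier_iff by blast

lemma cls_one: "\<one>\<^bsub>E\<^esub> = cls []" by (simp add: ascending_HNN_def presented_group_one cls_def)

lemma level_cls: assumes "u \<in> words X" shows "level (cls u) = stable_exponent u"
proof -
  have "u \<in> cls u" using assms by (simp add: cls_def pres_rel_def pres_refl)
  then have "(SOME v. v \<in> cls u) \<in> cls u" by (rule someI)
  then have "pres_eq X R u (SOME v. v \<in> cls u)" by (simp add: cls_def pres_rel_def)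
  then show ?thesis unfolding level_def using stable_exponent_invariant by metis
qed

lemma emb_closed: "h \<in> carrier H \<Longrightarrow> emb h \<in> carrier E" unfolding emb_def by (intro cls_closed) simp
lemma stab_closed: "stab \<in> carrier E" unfolding stab_def by (intro cls_closed) simp

lemma emb_mult:
  assumes "h \<in> carrier H" "k \<in> carrier H" shows "emb (h \<otimes>\<^bsub>H\<^esub> k) = emb h \<otimes>\<^bsub>E\<^esub> emb k"
proof -
  have "pres_eq X R [(Base h, True), (Base k, True)] [(Base (h \<otimes>\<^bsub>H\<^esub> k), True)]"
    by (rule pres_relation) (use assms in \<open>auto simp: hnn_relations_def\<close>)
  from cls_eq[OF this] show ?thesis using assms cls_mult[of "[(Base h, True)]" "[(Base k, True)]"] by (simp add: emb_def)
qed

lemma cls_inv: assumes "x \<in> X" shows "inv\<^bsub>E\<^esub> (cls [(x, b)]) = cls [(x, \<not> b)]"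
proof -
  interpret E: group E by (rule group_ascending_HNN)
  have w: "[(x, b)] \<in> words X" "[(x, \<not> b)] \<in> words X" using assms by auto
  have "cls ([(x, \<not> b)] @ [(x, b)]) = cls []" using cls_eq[OF pres_cancel[OF assms, of R "\<not> b"]] by simp
  then have "cls [(x, \<not> b)] \<otimes>\<^bsub>E\<^esub> cls [(x, b)] = \<one>\<^bsub>E\<^esub>" by (simp only: cls_mult[OF w(2,1)] cls_one)
  then show ?thesis using E.inv_equality cls_closed[OF w(1)] cls_closed[OF w(2)] by blast
qed

lemma stab_conj:
  assumes "h \<in> carrier H" shows "inv\<^bsub>E\<^esub> stab \<otimes>\<^bsub>E\<^esub> emb h \<otimes>\<^bsub>E\<^esub> stab = emb (\<phi> h)"
proof -
  have ph: "\<phi> h \<in> carrier H" using \<phi> assms by (auto simp: hom_def)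
  have "pres_eq X R [(Stable, False), (Base h, True), (Stable, True)] [(Base (\<phi> h), True)]"
    by (rule pres_relation) (use assms ph in \<open>auto simp: hnn_relations_def\<close>)
  then have e: "cls ([(Stable, False)] @ [(Base h, True)] @ [(Stable, True)]) = emb (\<phi> h)" using cls_eq by (simp add: emb_def)
  have "inv\<^bsub>E\<^esub> stab = cls [(Stable, False)]" unfolding stab_def using cls_inv[of Stable True] by simp
  then show ?thesis unfolding e[symmetric] using assms by (simp add: stab_def emb_def cls_mult)
qed

lemma emb_hom: "emb \<in> hom H E" using emb_closed emb_mult by (intro homI) auto

text \<open>For \<open>t\<close> no correction is needed, as it conjugates \<open>H\<close> into itself. For the inverse of
  \<open>t\<close>, which undoes \<open>\<phi>\<close>, representatives \<open>c\<close> of the cosets \<open>\<phi>(H)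
  h\<close> serve: \<open>h c\<^sup>-\<^sup>1\<close> is in \<open>\<phi>(H)\<close>.\<close>

lemma semistable_HNN:
  assumes fg: "finitely_generated H" shows "semistable_group E"
proof -
  interpret E: group E by (rule group_ascending_HNN)
  interpret emb: group_hom H E emb using emb_hom by unfold_locales
  obtain A where A: "finite A" "A \<subseteq> carrier H" "generate H A = carrier H"
    using fg unfolding finitely_generated_def generates_def by blast
  define S0 where "S0 = emb ` A - {\<one>\<^bsub>E\<^esub>}"
  have S0: "S0 \<subseteq> carrier E" using A(2) emb_closed by (auto simp: S0_def)
  have gS0: "generate E S0 = emb ` carrier H"
  proof
    have "generate E S0 \<subseteq> generate E (emb ` A)" by (rule E.mono_generate) (auto simp: S0_def)
    moreover have "generate E (emb ` A) = emb ` carrier H" using emb.generate_img[OF A(2)] A(3) by simp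
    ultimately show "generate E S0 \<subseteq> emb ` carrier H" by simp
    have "emb ` A \<subseteq> generate E S0"
    proof
      fix x assume "x \<in> emb ` A"
      then have "x = \<one>\<^bsub>E\<^esub> \<or> x \<in> S0" by (simp add: S0_def)
      then show "x \<in> generate E S0" using generate.incl[of x S0 E] generate.one[of E S0] by blast
    qed
    then have "generate E (emb ` A) \<subseteq> generate E S0"
      by (rule E.generate_subgroup_incl[OF _ E.generate_is_subgroup[OF S0]])
    then show "emb ` carrier H \<subseteq> generate E S0" using emb.generate_img[OF A(2)] A(3) by simp
  qed
  have sub: "subgroup (\<phi> ` carrier H) H"
  proof -
    interpret p: group_hom H H \<phi> using \<phi> by unfold_locales
    show ?thesis by (rule p.img_is_subgroup)
  qed
  define c where "c M = (SOME x. x \<in> M \<and> x \<in> carrier H)" for M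
  define T where "T b = (if b then {\<one>\<^bsub>E\<^esub>} else insert \<one>\<^bsub>E\<^esub> (emb ` c ` (rcosets\<^bsub>H\<^esub> (\<phi> ` carrier H))))" for b
  have c: "c (\<phi> ` carrier H #>\<^bsub>H\<^esub> h) \<in> carrier H \<and> h \<otimes>\<^bsub>H\<^esub> inv\<^bsub>H\<^esub> (c (\<phi> ` carrier H #>\<^bsub>H\<^esub> h)) \<in> \<phi> ` carrier H" if h: "h \<in> carrier H" for h
  proof -
    let ?M = "\<phi> ` carrier H #>\<^bsub>H\<^esub> h"
    have "h \<in> ?M \<and> h \<in> carrier H" using rcos_self[OF h sub] h by simp
    then have cM: "c ?M \<in> ?M \<and> c ?M \<in> carrier H" unfolding c_def by (rule someI)
    then obtain y where y: "y \<in> \<phi> ` carrier H" "c ?M = y \<otimes>\<^bsub>H\<^esub> h" unfolding r_coset_def by blast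
    have yc: "y \<in> carrier H" using y(1) subgroup.subset[OF sub] by blast
    have "h \<otimes>\<^bsub>H\<^esub> inv\<^bsub>H\<^esub> (c ?M) = inv\<^bsub>H\<^esub> y" using h yc by (simp add: y(2) inv_mult_group m_assoc[symmetric])
    then show ?thesis using cM subgroup.m_inv_closed[OF sub y(1)] by simp
  qed
  have lv: "letter_val E (stab, b) = (if b then stab else inv\<^bsub>E\<^esub> stab)" for b by (simp add: letter_val_def)
  have pc: "\<phi> h \<in> carrier H" if "h \<in> carrier H" for h using \<phi> that by (auto simp: hom_def)
  have desc: "stab \<otimes>\<^bsub>E\<^esub> emb (\<phi> h) \<otimes>\<^bsub>E\<^esub> inv\<^bsub>E\<^esub> stab = emb h" if h: "h \<in> carrier H" for h
  proof -
    have "stab \<otimes>\<^bsub>E\<^esub> (inv\<^bsub>E\<^esub> stab \<otimes>\<^bsub>E\<^esub> emb h \<otimes>\<^bsub>E\<^esub> stab) \<otimes>\<^bsub>E\<^esub> inv\<^bsub>E\<^esub> stab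
        = (stab \<otimes>\<^bsub>E\<^esub> inv\<^bsub>E\<^esub> stab) \<otimes>\<^bsub>E\<^esub> emb h \<otimes>\<^bsub>E\<^esub> (stab \<otimes>\<^bsub>E\<^esub> inv\<^bsub>E\<^esub> stab)"
      using stab_closed emb_closed[OF h] by (simp only: E.m_assoc E.m_closed E.inv_closed)
    then show ?thesis using stab_conj[OF h] stab_closed emb_closed[OF h] by simp
  qed
  interpret ascending E S0 stab level T
  proof unfold_locales
    show "finite S0" "S0 \<subseteq> carrier E" "\<one>\<^bsub>E\<^esub> \<notin> S0" "stab \<in> carrier E"
      using A(1) S0 stab_closed by (auto simp: S0_def)
    show "level (x \<otimes>\<^bsub>E\<^esub> y) = level x + level y" if "x \<in> carrier E" "y \<in> carrier E" for x y
      using that by (elim cls_cases) (simp add: cls_mult level_cls stable_exponent_append)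
    show "level s = 0" if "s \<in> S0" for s using that A(2) by (auto simp: S0_def emb_def level_cls)
    show "level stab = 1" by (simp add: stab_def level_cls)
    show "finite (T b)" for b using index by (simp add: T_def)
    show "\<one>\<^bsub>E\<^esub> \<in> T b" for b by (simp add: T_def)
    show "T b \<subseteq> generate E S0" for b
    proof
      fix x assume "x \<in> T b"
      then have "x = \<one>\<^bsub>E\<^esub> \<or> x \<in> emb ` c ` (rcosets\<^bsub>H\<^esub> (\<phi> ` carrier H))" by (auto simp: T_def split: if_splits)
      then show "x \<in> generate E S0"
      proof
        assume "x = \<one>\<^bsub>E\<^esub>"
        then show ?thesis by (simp add: generate.one)
      next
        assume "x \<in> emb ` c ` (rcosets\<^bsub>H\<^esub> (\<phi> ` carrier H))"
        then obtain h where h: "h \<in> carrier H" "x = emb (c (\<phi> ` carrier H #>\<^bsub>H\<^esub> h))" unfolding RCOSETS_def by blast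
        show ?thesis unfolding gS0 h(2) using c[OF h(1)] by blast
      qed
    qed
    show "\<exists>x\<in>T b. inv\<^bsub>E\<^esub> (letter_val E (stab, b)) \<otimes>\<^bsub>E\<^esub> (h \<otimes>\<^bsub>E\<^esub> inv\<^bsub>E\<^esub> x) \<otimes>\<^bsub>E\<^esub> letter_val E (stab, b) \<in> generate E S0"
      if "h \<in> generate E S0" for b h
    proof -
      have "h \<in> emb ` carrier H" using that by (simp only: gS0)
      then obtain k where k: "k \<in> carrier H" "h = emb k" by (elim imageE) simp
      show ?thesis
      proof (cases b)
        case True
        have "h \<in> carrier E" using k emb_closed by simp
        then have "h \<otimes>\<^bsub>E\<^esub> inv\<^bsub>E\<^esub> \<one>\<^bsub>E\<^esub> = h" by simp
        then have "inv\<^bsub>E\<^esub> (letter_val E (stab, b)) \<otimes>\<^bsub>E\<^esub> (h \<otimes>\<^bsub>E\<^esub> inv\<^bsub>E\<^esub> \<one>\<^bsub>E\<^esub>) \<otimes>\<^bsub>E\<^esub> letter_val E (stab, b) = emb (\<phi> k)"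
          unfolding lv if_P[OF True] using stab_conj[OF k(1)] k(2) by argo
        moreover have "emb (\<phi> k) \<in> generate E S0" unfolding gS0 by (rule imageI[OF pc[OF k(1)]])
        moreover have "\<one>\<^bsub>E\<^esub> \<in> T b" by (simp add: T_def)
        ultimately show ?thesis by (intro bexI[of _ "\<one>\<^bsub>E\<^esub>"]) argo+
      next
        case False
        let ?c = "c (\<phi> ` carrier H #>\<^bsub>H\<^esub> k)"
        have cc: "?c \<in> carrier H" by (rule c[OF k(1), THEN conjunct1])
        obtain y where y: "y \<in> carrier H" "k \<otimes>\<^bsub>H\<^esub> inv\<^bsub>H\<^esub> ?c = \<phi> y"
          using c[OF k(1), THEN conjunct2] by (rule imageE) (rule that, assumption+)
        have "h \<otimes>\<^bsub>E\<^esub> inv\<^bsub>E\<^esub> (emb ?c) = emb (k \<otimes>\<^bsub>H\<^esub> inv\<^bsub>H\<^esub> ?c)"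
          unfolding k(2) using emb.hom_inv[OF cc] emb_mult[OF k(1) inv_closed[OF cc]] by argo
        then have e: "h \<otimes>\<^bsub>E\<^esub> inv\<^bsub>E\<^esub> (emb ?c) = emb (\<phi> y)" unfolding y(2) .
        have "inv\<^bsub>E\<^esub> (inv\<^bsub>E\<^esub> stab) = stab" by (rule E.inv_inv[OF stab_closed])
        then have "inv\<^bsub>E\<^esub> (letter_val E (stab, b)) \<otimes>\<^bsub>E\<^esub> (h \<otimes>\<^bsub>E\<^esub> inv\<^bsub>E\<^esub> (emb ?c)) \<otimes>\<^bsub>E\<^esub> letter_val E (stab, b) = emb y"
          unfolding e lv if_not_P[OF False] using desc[OF y(1)] by argo
        moreover have "emb y \<in> generate E S0" unfolding gS0 by (rule imageI[OF y(1)])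
        moreover have "\<phi> ` carrier H #>\<^bsub>H\<^esub> k \<in> rcosets\<^bsub>H\<^esub> (\<phi> ` carrier H)" using k(1) by (auto simp: RCOSETS_def)
        then have "emb ?c \<in> T b" unfolding T_def if_not_P[OF False] by (intro insertI2 imageI)
        ultimately show ?thesis by (intro bexI[of _ "emb ?c"]) argo+
      qed
    qed
    show "generate E (insert stab S0) = carrier E"
    proof
      show "generate E (insert stab S0) \<subseteq> carrier E" by (rule E.generate_incl) (use S0 stab_closed in blast)
      have sg: "subgroup (generate E (insert stab S0)) E" by (rule E.generate_is_subgroup) (use S0 stab_closed in blast)
      have "generate E S0 \<subseteq> generate E (insert stab S0)" by (rule E.mono_generate) blast
      then have emb_in: "emb h \<in> generate E (insert stab S0)" if "h \<in> carrier H" for h using that unfolding gS0 by blast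
      have stab_in: "stab \<in> generate E (insert stab S0)" by (rule generate.incl) simp
      have "cls u \<in> generate E (insert stab S0)" if "u \<in> words X" for u
        using that
      proof (induction u)
        case Nil
        show ?case using generate.one[of E "insert stab S0"] by (simp add: cls_one)
      next
        case (Cons l u)
        obtain x b where l: "l = (x, b)" by (cases l)
        have x: "x \<in> X" and u: "u \<in> words X" using Cons.prems l by auto
        have "cls [(x, True)] \<in> generate E (insert stab S0)" using x emb_in stab_in by (auto simp: emb_def stab_def)
        moreover have "cls [(x, False)] = inv\<^bsub>E\<^esub> (cls [(x, True)])" using cls_inv[OF x, of True] by simp
        ultimately have "cls [l] \<in> generate E (insert stab S0)"
          unfolding l using subgroup.m_inv_closed[OF sg] by (cases b) auto
        then have "cls [l] \<otimes>\<^bsub>E\<^esub> cls u \<in> generate E (insert stab S0)" using Cons.IH[OF u] by (rule generate.eng)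
        then show ?case using cls_mult[of "[l]" u] x u l by simp
      qed
      then show "carrier E \<subseteq> generate E (insert stab S0)"
      proof (intro subsetI)
        fix A assume "A \<in> carrier E"
        then obtain u where "u \<in> words X" "A = cls u" by (rule cls_cases)
        then show "A \<in> generate E (insert stab S0)" using \<open>\<And>u. u \<in> words X \<Longrightarrow> cls u \<in> generate E (insert stab S0)\<close> by simp
      qed
    qed
  qed
  show ?thesis
  proof (rule semistable)
    fix h assume "h \<in> generate E S0"
    then obtain k where k: "k \<in> carrier H" "h = emb k" unfolding gS0 by blast
    then show "conj True h \<in> generate E S0" unfolding conj_def lv gS0 using stab_conj[OF k(1)] pc by simp
  qed
qed

end

theorem corollary1:
  fixes H :: "('a, 'b) monoid_scheme" and \<phi> :: "'a \<Rightarrow> 'a"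
  assumes "group H"
    and "finitely_generated H"
    and "\<phi> \<in> mon H H"
    and "finite (rcosets\<^bsub>H\<^esub> (\<phi> ` carrier H))"
  shows "semistable_group (ascending_HNN H \<phi>)"
proof -
  interpret hnn_data H \<phi>
    using assms by (intro hnn_data.intro hnn_data_axioms.intro) (auto simp: mon_def)
  show ?thesis by (rule semistable_HNN[OF assms(2)])
qed

end
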